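(* Consider the quasilinear wave equation $$\partial_t^2u=\partial_x^2u-u+\kappa a(u)\partial_x^2u+\kappa g(u,\partial_xu),\quad x\in\mathbb{T},\ t\in[0,T],\qquad u(\cdot,0)=u_0,\ \ \partial_tu(\cdot,0)=\dot u_0,$$ with smooth real-valued functions $a,g$ satisfying $a(0)=0$, $g(0,0)=0$. Let TI2 be the trigonometric integrator (context) with $$\bar b_1(V)=\tfrac12\,\mathrm{sinc}(h\Omega)\,\mathrm{sinc}(\tfrac12h\Omega),\qquad b_1(V)=\mathrm{sinc}(h\Omega)\cos(\tfrac12h\Omega),$$ which does not satisfy the requirement that $|\xi\,\mathrm{sinc}(\xi)^{-1}b_1(\xi^2)|\le c$ for all $\xi\ge0$ with some constant $c$. Assume that for a fixed $s\ge0$ the exact solution satisfies $(u(\cdot,t),\partial_tu(\cdot,t))\in H^{5+s}\times H^{4+s}$ with $|||(u(\cdot,t),\partial_tu(\cdot,t))|||_{4+s}\le M$ for $0\le t\le T$, where $M>0$, and that there are $0<\delta<1$ and $A_0\ge0$ such that $1+\kappa a(u(\cdot,t))\ge\delta>0$ and $\kappa a(u(\cdot,t))\le A_0$ for $0\le t\le T$. Then there is $h_0>0$ such that for $0<\kappa\ll1$ and for all $h$ with $\kappa\lesssim h<h_0$: (i) (with $s=0$) the time-discrete TI2 solution satisfies $$|||(u_n,\dot u_n)-(u(\cdot,t_n),\partial_tu(\cdot,t_n))|||_1\le Ch^2\qquad\text{for }0\le t_n=nh\le T;$$ (ii) the fully discrete TI2 solution satisfies $$|||(u^K_n,\dot u^K_n)-(u(\cdot,t_n),\partial_tu(\cdot,t_n))|||_1\le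 Ch^2+CK^{-s-2}\qquad\text{for }0\le t_n=nh\le T.$$ Here the constant $C$ depends on $a$, $g$ and $M$ (for the fixed $s$), but is independent of the time step-size $h$, the final time $T$ and (in (ii)) $K$.
   Context: $\mathbb{T}=\mathbb{R}/(2\pi\mathbb{Z})$; solutions are real-valued. For $v(x)=\sum_{j\in\mathbb{Z}}\hat v_je^{\mathrm{i}jx}$ put $\langle j\rangle=\sqrt{j^2+1}$ and $\|v\|_s^2=\sum_j\langle j\rangle^{2s}|\hat v_j|^2$, the norm of $H^s=H^s(\mathbb{T})$; $|||(u,\dot u)|||_s=(\|u\|_{s+1}^2+\|\dot u\|_s^2)^{1/2}$ is the norm of $H^{s+1}\times H^s$. $0<\kappa\ll1$ means that $\kappa>0$ is small; $\kappa\lesssim h$ means $\kappa\le\mathrm{const}\cdot h$. $\Omega=\sqrt{-\partial_x^2+1}$; functions of $h\Omega$ act as Fourier multipliers ($\Omega e^{\mathrm{i}jx}=\langle j\rangle e^{\mathrm{i}jx}$); $V=h^2\Omega^2$; $\mathrm{sinc}(\xi)=\sin(\xi)/\xi$; $f(u)=a(u)\partial_x^2u+g(u,\partial_xu)$. Time-discrete trigonometric integrator with coefficients $b_1,\bar b_1$ and step size $h$, started from $(u_0,\dot u_0)$: $u_{n+1/2}=\cos(\tfrac12h\Omega)u_n+\tfrac12h\,\mathrm{sinc}(\tfrac12h\Omega)\dot u_n$, $u_{n+1}=\cos(h\Omega)u_n+h\,\mathrm{sinc}(h\Omega)\dot u_n+\kappa h^2\bar b_1(V)f(u_{n+1/2})$,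 $\dot u_{n+1}=-\Omega\sin(h\Omega)u_n+\cos(h\Omega)\dot u_n+\kappa h\,b_1(V)f(u_{n+1/2})$. $\mathcal{V}^K=\{\sum_{j=-K}^K\hat v_je^{\mathrm{i}jx}:\hat v_j\in\mathbb{C}\}$; $\mathcal{P}^K$ is the $L^2$-orthogonal projection onto $\mathcal{V}^K$; $\mathcal{I}^K$ is trigonometric interpolation in $\mathcal{V}^K$; $f^K(u)=\mathcal{I}^K(a(u))\,\partial_x^2u+\mathcal{I}^K(g(u,\partial_xu))$, $\hat f^K(u)=\mathcal{P}^K(f^K(u))$. The fully discrete integrator is obtained from the time-discrete one by replacing $f$ by $\hat f^K$ and $(u_n,\dot u_n)$ by $(u^K_n,\dot u^K_n)\in\mathcal{V}^K\times\mathcal{V}^K$, with initial values $(\mathcal{P}^K(u_0),\mathcal{P}^K(\dot u_0))$. *)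

theory Defs
  imports "HOL-Probability.Sinc_Integral"
begin

section \<open>Smooth coefficient functions\<close>

primrec higher_differentiable :: "nat \<Rightarrow> ('a::real_normed_vector \<Rightarrow> real) \<Rightarrow> bool" where
  "higher_differentiable 0 f \<longleftrightarrow> continuous_on UNIV f"
| "higher_differentiable (Suc k) f \<longleftrightarrow>
     (\<forall>x. f differentiable (at x)) \<and>
     (\<forall>v. higher_differentiable k (\<lambda>x. frechet_derivative f (at x) v))"

definition smooth :: "('a::real_normed_vector \<Rightarrow> real) \<Rightarrow> bool" where
  "smooth f \<longleftrightarrow> (\<forall>k. higher_differentiable k f)"


section \<open>Sobolev spaces on the torus\<close>

text \<open>Functions on the torus are represented by \<open>2 * pi\<close>-periodic functions on the real line.\<close>

definition periodic :: "(real \<Rightarrow> real) \<Rightarrow> bool" where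
  "periodic v \<longleftrightarrow> (\<forall>x. v (x + 2 * pi) = v x)"

definition fourier_coeff :: "(real \<Rightarrow> real) \<Rightarrow> int \<Rightarrow> complex" where
  "fourier_coeff v j =
     (LINT x:{0..2 * pi}|lborel. complex_of_real (v x) * cis (- (real_of_int j * x))) / (2 * pi)"

definition japanese_bracket :: "int \<Rightarrow> real" where
  "japanese_bracket j = sqrt ((real_of_int j)\<^sup>2 + 1)"

text \<open>Only used for \<open>s \<ge> 0\<close>. Sums over a family that is not summable are \<open>0\<close> by convention, so
  \<open>sobolev_norm s v\<close> is meaningful only together with \<open>v \<in> sobolev s\<close>.\<close>

definition sobolev :: "real \<Rightarrow> (real \<Rightarrow> real) set" where
  "sobolev s = {v. periodic v \<and> v \<in> borel_measurable lborel \<and>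
     set_integrable lborel {0..2 * pi} (\<lambda>x. (v x)\<^sup>2) \<and>
     (\<lambda>j. japanese_bracket j powr (2 * s) * (cmod (fourier_coeff v j))\<^sup>2) summable_on UNIV}"

definition sobolev_norm :: "real \<Rightarrow> (real \<Rightarrow> real) \<Rightarrow> real" where
  "sobolev_norm s v =
     sqrt (\<Sum>\<^sub>\<infinity>j. japanese_bracket j powr (2 * s) * (cmod (fourier_coeff v j))\<^sup>2)"

definition energy_space :: "real \<Rightarrow> ((real \<Rightarrow> real) \<times> (real \<Rightarrow> real)) set" where
  "energy_space s = sobolev (s + 1) \<times> sobolev s"

definition energy_norm :: "real \<Rightarrow> (real \<Rightarrow> real) \<times> (real \<Rightarrow> real) \<Rightarrow> real" where
  "energy_norm s p = sqrt ((sobolev_norm (s + 1) (fst p))\<^sup>2 + (sobolev_norm s (snd p))\<^sup>2)"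


section \<open>The quasilinear wave equation\<close>

definition nonlinearity ::
  "(real \<Rightarrow> real) \<Rightarrow> (real \<times> real \<Rightarrow> real) \<Rightarrow> (real \<Rightarrow> real) \<Rightarrow> real \<Rightarrow> real" where
  "nonlinearity a g u = (\<lambda>x. a (u x) * deriv (deriv u) x + g (u x, deriv u x))"

text \<open>\<open>u t\<close> and \<open>ut t\<close> are the functions \<open>u(\<cdot>,t)\<close> and \<open>\<partial>\<^sub>tu(\<cdot>,t)\<close>. The time derivatives at the
  end points of the time interval are one-sided.\<close>

definition wave_solution ::
  "(real \<Rightarrow> real) \<Rightarrow> (real \<times> real \<Rightarrow> real) \<Rightarrow> real \<Rightarrow> real \<Rightarrow> (real \<Rightarrow> real) \<Rightarrow> (real \<Rightarrow> real) \<Rightarrow>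
   (real \<Rightarrow> real \<Rightarrow> real) \<Rightarrow> (real \<Rightarrow> real \<Rightarrow> real) \<Rightarrow> bool" where
  "wave_solution a g \<kappa> T u0 v0 u ut \<longleftrightarrow>
     u 0 = u0 \<and> ut 0 = v0 \<and>
     (\<forall>t\<in>{0..T}. periodic (u t) \<and>
       (\<forall>x. u t differentiable (at x) \<and> deriv (u t) differentiable (at x) \<and>
          ((\<lambda>\<tau>. u \<tau> x) has_real_derivative ut t x) (at t within {0..T}) \<and>
          ((\<lambda>\<tau>. ut \<tau> x) has_real_derivative
             deriv (deriv (u t)) x - u t x + \<kappa> * (a (u t x) * deriv (deriv (u t)) x)
               + \<kappa> * g (u t x, deriv (u t) x)) (at t within {0..T})))"


section \<open>Trigonometric integrators\<close>

text \<open>\<open>fourier_multiplier \<phi>\<close> is the operator \<open>\<phi>(\<Omega>)\<close>, which multiplies the \<open>j\<close>-th Fourier coefficient by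
  \<open>\<phi> \<langle>j\<rangle>\<close>. For real-valued \<open>v\<close> the series is invariant under complex conjugation,
  so that taking the real part only changes the type.\<close>

definition fourier_multiplier :: "(real \<Rightarrow> real) \<Rightarrow> (real \<Rightarrow> real) \<Rightarrow> real \<Rightarrow> real" where
  "fourier_multiplier \<phi> v = (\<lambda>x. Re (\<Sum>\<^sub>\<infinity>j.
     complex_of_real (\<phi> (japanese_bracket j)) * fourier_coeff v j * cis (real_of_int j * x)))"

text \<open>The coefficients \<open>b1\<close>, \<open>bb1\<close> of the integrator are functions of \<open>V = h\<^sup>2 \<Omega>\<^sup>2\<close>.\<close>

definition ti_step ::
  "(real \<Rightarrow> real) \<Rightarrow> (real \<Rightarrow> real) \<Rightarrow> ((real \<Rightarrow> real) \<Rightarrow> real \<Rightarrow> real) \<Rightarrow> real \<Rightarrow> real \<Rightarrow>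
   (real \<Rightarrow> real) \<times> (real \<Rightarrow> real) \<Rightarrow> (real \<Rightarrow> real) \<times> (real \<Rightarrow> real)" where
  "ti_step b1 bb1 F \<kappa> h p =
    (let u = fst p; v = snd p;
         uh = (\<lambda>x. fourier_multiplier (\<lambda>\<omega>. cos (h / 2 * \<omega>)) u x
                   + h / 2 * fourier_multiplier (\<lambda>\<omega>. sinc (h / 2 * \<omega>)) v x)
     in (\<lambda>x. fourier_multiplier (\<lambda>\<omega>. cos (h * \<omega>)) u x
             + h * fourier_multiplier (\<lambda>\<omega>. sinc (h * \<omega>)) v x
             + \<kappa> * h\<^sup>2 * fourier_multiplier (\<lambda>\<omega>. bb1 (h\<^sup>2 * \<omega>\<^sup>2)) (F uh) x,
         \<lambda>x. - fourier_multiplier (\<lambda>\<omega>. \<omega> * sin (h * \<omega>)) u x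
             + fourier_multiplier (\<lambda>\<omega>. cos (h * \<omega>)) v x
             + \<kappa> * h * fourier_multiplier (\<lambda>\<omega>. b1 (h\<^sup>2 * \<omega>\<^sup>2)) (F uh) x))"

primrec trig_integrator ::
  "(real \<Rightarrow> real) \<Rightarrow> (real \<Rightarrow> real) \<Rightarrow> ((real \<Rightarrow> real) \<Rightarrow> real \<Rightarrow> real) \<Rightarrow> real \<Rightarrow> real \<Rightarrow>
   (real \<Rightarrow> real) \<times> (real \<Rightarrow> real) \<Rightarrow> nat \<Rightarrow> (real \<Rightarrow> real) \<times> (real \<Rightarrow> real)" where
  "trig_integrator b1 bb1 F \<kappa> h p 0 = p"
| "trig_integrator b1 bb1 F \<kappa> h p (Suc n) =
     ti_step b1 bb1 F \<kappa> h (trig_integrator b1 bb1 F \<kappa> h p n)"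

text \<open>TI2, with \<open>sqrt \<zeta>\<close> standing for \<open>h \<Omega>\<close>.\<close>

definition TI2_b1 :: "real \<Rightarrow> real" where
  "TI2_b1 \<zeta> = sinc (sqrt \<zeta>) * cos (1 / 2 * sqrt \<zeta>)"

definition TI2_bb1 :: "real \<Rightarrow> real" where
  "TI2_bb1 \<zeta> = 1 / 2 * sinc (sqrt \<zeta>) * sinc (1 / 2 * sqrt \<zeta>)"

definition TI2_time_discrete ::
  "(real \<Rightarrow> real) \<Rightarrow> (real \<times> real \<Rightarrow> real) \<Rightarrow> real \<Rightarrow> real \<Rightarrow> (real \<Rightarrow> real) \<Rightarrow> (real \<Rightarrow> real) \<Rightarrow>
   nat \<Rightarrow> (real \<Rightarrow> real) \<times> (real \<Rightarrow> real)" where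
  "TI2_time_discrete a g \<kappa> h u0 v0 n =
     trig_integrator TI2_b1 TI2_bb1 (nonlinearity a g) \<kappa> h (u0, v0) n"


section \<open>Spatial discretization\<close>

text \<open>The real-valued elements of the space \<open>\<V>\<^sup>K\<close> of trigonometric polynomials of degree at
  most \<open>K\<close>.\<close>

definition trig_polys :: "nat \<Rightarrow> (real \<Rightarrow> real) set" where
  "trig_polys K = {v. \<exists>c::int \<Rightarrow> complex. \<forall>x. complex_of_real (v x) =
     (\<Sum>j = - int K..int K. c j * cis (real_of_int j * x))}"

definition is_trig_projection :: "nat \<Rightarrow> (real \<Rightarrow> real) \<Rightarrow> (real \<Rightarrow> real) \<Rightarrow> bool" where
  "is_trig_projection K v p \<longleftrightarrow> p \<in> trig_polys K \<and>
     (\<forall>q\<in>trig_polys K. (LINT x:{0..2 * pi}|lborel. (v x - p x) * q x) = 0)"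

definition trig_projection :: "nat \<Rightarrow> (real \<Rightarrow> real) \<Rightarrow> real \<Rightarrow> real" where
  "trig_projection K v = (THE p. is_trig_projection K v p)"

definition grid_point :: "nat \<Rightarrow> nat \<Rightarrow> real" where
  "grid_point K k = 2 * pi * real k / real (2 * K + 1)"

definition is_trig_interpolant :: "nat \<Rightarrow> (real \<Rightarrow> real) \<Rightarrow> (real \<Rightarrow> real) \<Rightarrow> bool" where
  "is_trig_interpolant K v p \<longleftrightarrow> p \<in> trig_polys K \<and>
     (\<forall>k<2 * K + 1. p (grid_point K k) = v (grid_point K k))"

definition trig_interpolation :: "nat \<Rightarrow> (real \<Rightarrow> real) \<Rightarrow> real \<Rightarrow> real" where
  "trig_interpolation K v = (THE p. is_trig_interpolant K v p)"

text \<open>The projection and the interpolant exist and are unique.\<close>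

lemma integral_cis:
  "(LINT x:{0..2 * pi}|lborel. cis (real_of_int m * x)) = (if m = 0 then 2 * pi else 0)"
proof (cases "m = 0")
  case True
  then show ?thesis
    by (simp add: set_integral_mult_right set_lebesgue_integral_def measure_def scaleR_conv_of_real)
next
  case False
  define F where "F x = cis (real_of_int m * x) / (\<i> * of_int m)" for x
  have "(F has_vector_derivative cis (real_of_int m * x)) (at x within {0..2*pi})" for x
  proof -
    have "F = (\<lambda>x. exp (\<i> * of_int m * of_real x) / (\<i> * of_int m))"
      by (auto simp: F_def cis_conv_exp fun_eq_iff mult_ac)
    moreover have "((\<lambda>x. exp (\<i> * of_int m * of_real x) / (\<i> * of_int m)) has_vector_derivative
        exp (\<i> * of_int m * of_real x)) (at x within {0..2*pi})"
    proof -
      have "((\<lambda>z. exp (\<i> * of_int m * z) / (\<i> * of_int m)) has_field_derivative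
          exp (\<i> * of_int m * of_real x)) (at (of_real x))"
        using False by (auto intro!: derivative_eq_intros)
      from has_vector_derivative_real_field[OF this] show ?thesis by simp
    qed
    ultimately show ?thesis by (simp add: cis_conv_exp mult_ac)
  qed
  then have "(LINT x:{0..2*pi}|lborel. cis (real_of_int m * x)) = F (2*pi) - F 0"
    unfolding set_lebesgue_integral_def
    by (intro integral_FTC_Icc) (auto intro!: continuous_intros continuous_on_cis)
  also have "F (2*pi) = F 0"
    using cis_multiple_2pi[of "of_int m"] by (simp add: F_def mult.assoc mult.commute)
  finally show ?thesis using False by simp
qed

lemma grid_point_swap: "real i * grid_point K l = real l * grid_point K i"
  by (simp add: grid_point_def)

lemma sum_cis_grid:
  assumes "\<bar>m\<bar> \<le> 2 * int K"
  shows "(\<Sum>k<2 * K + 1. cis (real_of_int m * grid_point K k)) = (if m = 0 then of_nat (2 * K + 1) else 0)"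
proof (cases "m = 0")
  case False
  define N where "N = 2 * K + 1"
  define z where "z = cis (2 * pi * real_of_int m / real N)"
  have Npos: "real N > 0" by (simp add: N_def)
  have pw: "cis (real_of_int m * grid_point K k) = z ^ k" for k
    by (simp add: z_def Complex.DeMoivre grid_point_def N_def mult_ac)
  have zN: "z ^ N = 1"
  proof -
    have "z ^ N = cis (2 * pi * real_of_int m)"
      using Npos by (simp add: z_def Complex.DeMoivre)
    then show ?thesis using cis_multiple_2pi[of "of_int m"] by simp
  qed
  have "z \<noteq> 1"
  proof
    assume "z = 1"
    then have "cos (2 * pi * real_of_int m / real N) = 1"
      by (simp add: z_def complex_eq_iff)
    then obtain n where n: "2 * pi * real_of_int m / real N = of_int n * 2 * pi"
      by (auto simp: cos_one_2pi_int)
    then have "real_of_int m = real_of_int n * real N"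
      using Npos by (simp add: field_simps)
    then have "m = n * int N" by (metis of_int_eq_iff of_int_mult of_int_of_nat_eq)
    then have "\<bar>m\<bar> = \<bar>n\<bar> * int N" by (simp add: abs_mult)
    moreover have "\<bar>n\<bar> \<ge> 1" using False \<open>m = n * int N\<close> by auto
    ultimately have "\<bar>m\<bar> \<ge> 1 * int N" by (metis mult_right_mono of_nat_0_le_iff)
    then show False using assms by (simp add: N_def)
  qed
  then have "(\<Sum>k<N. z ^ k) = 0" using geometric_sum[of z N] zN by simp
  then show ?thesis using False pw by (simp add: N_def)
qed simp

lemma trig_polysI:
  assumes "\<And>j. c (- j) = cnj (c j)"
  shows "(\<lambda>x. Re (\<Sum>j = - int K..int K. c j * cis (real_of_int j * x))) \<in> trig_polys K"
    and "complex_of_real (Re (\<Sum>j = - int K..int K. c j * cis (real_of_int j * x)))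
         = (\<Sum>j = - int K..int K. c j * cis (real_of_int j * x))"
proof -
  have *: "complex_of_real (Re (\<Sum>j = - int K..int K. c j * cis (real_of_int j * x)))
         = (\<Sum>j = - int K..int K. c j * cis (real_of_int j * x))" for x
  proof -
    let ?S = "\<Sum>j = - int K..int K. c j * cis (real_of_int j * x)"
    have "cnj ?S = (\<Sum>j = - int K..int K. c (- j) * cis (real_of_int (- j) * x))"
      by (simp add: assms cis_cnj)
    also have "\<dots> = ?S"
      by (rule sum.reindex_bij_witness[of _ uminus uminus]) auto
    finally show ?thesis by (metis Reals_cnj_iff of_real_Re)
  qed
  then show "complex_of_real (Re (\<Sum>j = - int K..int K. c j * cis (real_of_int j * x)))
         = (\<Sum>j = - int K..int K. c j * cis (real_of_int j * x))" .
  from * show "(\<lambda>x. Re (\<Sum>j = - int K..int K. c j * cis (real_of_int j * x))) \<in> trig_polys K"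
    unfolding trig_polys_def by (intro CollectI exI[of _ c] allI)
qed

lemma trig_interpolant_eq:
  assumes "is_trig_interpolant K v p"
  shows "p = (\<lambda>x. Re (\<Sum>j = - int K..int K. ((\<Sum>k<2 * K + 1. of_real (v (grid_point K k))
           * cis (- (real_of_int j * grid_point K k))) / of_nat (2 * K + 1)) * cis (real_of_int j * x)))"
proof -
  from assms obtain c where c: "\<And>x. complex_of_real (p x) = (\<Sum>j = - int K..int K. c j * cis (real_of_int j * x))"
    and v: "\<And>k. k < 2 * K + 1 \<Longrightarrow> p (grid_point K k) = v (grid_point K k)"
    by (auto simp: is_trig_interpolant_def trig_polys_def)
  have coeff: "(\<Sum>k<2 * K + 1. of_real (v (grid_point K k)) * cis (- (real_of_int l * grid_point K k)))
        / of_nat (2 * K + 1) = c l" if l: "l \<in> {- int K..int K}" for l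
  proof -
    have "(\<Sum>k<2 * K + 1. of_real (v (grid_point K k)) * cis (- (real_of_int l * grid_point K k)))
        = (\<Sum>k<2 * K + 1. \<Sum>j = - int K..int K. c j * cis (real_of_int (j - l) * grid_point K k))"
      using v by (intro sum.cong refl)
        (simp add: v[symmetric] c sum_distrib_right mult.assoc cis_mult left_diff_distrib)
    also have "\<dots> = (\<Sum>j = - int K..int K. c j * (\<Sum>k<2 * K + 1. cis (real_of_int (j - l) * grid_point K k)))"
      unfolding sum_distrib_left by (rule sum.swap)
    also have "\<dots> = (\<Sum>j = - int K..int K. c j * (if j - l = 0 then of_nat (2 * K + 1) else 0))"
      using l by (intro sum.cong refl arg_cong2[where f = "(*)"] sum_cis_grid) auto
    also have "\<dots> = (\<Sum>j = - int K..int K. if j = l then c l * of_nat (2 * K + 1) else 0)"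
      by (intro sum.cong) auto
    also have "\<dots> = c l * of_nat (2 * K + 1)"
      using l by (subst sum.delta) auto
    finally show ?thesis by (simp del: of_nat_add of_nat_mult of_nat_Suc)
  qed
  show ?thesis
  proof
    fix x
    have "p x = Re (\<Sum>j = - int K..int K. c j * cis (real_of_int j * x))"
      by (simp flip: c)
    also have "\<dots> = Re (\<Sum>j = - int K..int K. ((\<Sum>k<2 * K + 1. of_real (v (grid_point K k))
           * cis (- (real_of_int j * grid_point K k))) / of_nat (2 * K + 1)) * cis (real_of_int j * x))"
      by (intro arg_cong[where f = Re] sum.cong refl arg_cong2[where f = "(*)"] coeff[symmetric]) auto
    finally show "p x = \<dots>" .
  qed
qed

lemma trig_interpolant_exists:
  "is_trig_interpolant K v (\<lambda>x. Re (\<Sum>j = - int K..int K. ((\<Sum>k<2 * K + 1. of_real (v (grid_point K k))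
           * cis (- (real_of_int j * grid_point K k))) / of_nat (2 * K + 1)) * cis (real_of_int j * x)))"
proof -
  define c where "c j = (\<Sum>k<2 * K + 1. complex_of_real (v (grid_point K k))
           * cis (- (real_of_int j * grid_point K k))) / of_nat (2 * K + 1)" for j
  have cnj: "c (- j) = cnj (c j)" for j by (simp add: c_def cis_cnj)
  have "(\<Sum>j = - int K..int K. c j * cis (real_of_int j * grid_point K l)) = of_real (v (grid_point K l))"
    if l: "l < 2 * K + 1" for l
  proof -
    have swap: "(\<Sum>j = - int K..int K. cis (real_of_int j * (grid_point K l - grid_point K k)))
        = (if k = l then of_nat (2 * K + 1) else 0)" if k: "k < 2 * K + 1" for k
    proof -
      have "(\<Sum>j = - int K..int K. cis (real_of_int j * (grid_point K l - grid_point K k)))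
          = (\<Sum>i<2 * K + 1. cis ((real i - real K) * (grid_point K l - grid_point K k)))"
        by (rule sum.reindex_bij_witness[of _ "\<lambda>i. int i - int K" "\<lambda>j. nat (j + int K)"]) auto
      also have "\<dots> = cis (- (real K * (grid_point K l - grid_point K k))) *
           (\<Sum>i<2 * K + 1. cis (real_of_int (int l - int k) * grid_point K i))"
        unfolding sum_distrib_left cis_mult
        by (intro sum.cong refl arg_cong[where f = cis])
          (simp add: left_diff_distrib right_diff_distrib grid_point_swap[of _ K l] grid_point_swap[of _ K k])
      also have "(\<Sum>i<2 * K + 1. cis (real_of_int (int l - int k) * grid_point K i))
          = (if int l - int k = 0 then of_nat (2 * K + 1) else 0)"
        using k l by (intro sum_cis_grid) auto
      finally show ?thesis by (auto split: if_splits)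
    qed
    have "(\<Sum>j = - int K..int K. c j * cis (real_of_int j * grid_point K l))
        = (\<Sum>j = - int K..int K. \<Sum>k<2 * K + 1. of_real (v (grid_point K k)) / of_nat (2 * K + 1)
             * cis (real_of_int j * (grid_point K l - grid_point K k)))"
      unfolding c_def sum_distrib_right sum_divide_distrib
      by (intro sum.cong refl) (simp add: mult.assoc cis_mult algebra_simps)
    also have "\<dots> = (\<Sum>k<2 * K + 1. of_real (v (grid_point K k)) / of_nat (2 * K + 1)
             * (\<Sum>j = - int K..int K. cis (real_of_int j * (grid_point K l - grid_point K k))))"
      unfolding sum_distrib_left by (rule sum.swap)
    also have "\<dots> = (\<Sum>k<2 * K + 1. of_real (v (grid_point K k)) / of_nat (2 * K + 1)
             * (if k = l then of_nat (2 * K + 1) else 0))"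
      by (intro sum.cong refl arg_cong2[where f = "(*)"] swap) auto
    also have "\<dots> = (\<Sum>k<2 * K + 1. if k = l then of_real (v (grid_point K l)) else 0)"
      by (intro sum.cong) (auto simp del: of_nat_add of_nat_mult of_nat_Suc)
    also have "\<dots> = of_real (v (grid_point K l))"
      using l by (subst sum.delta) auto
    finally show ?thesis .
  qed
  then show ?thesis
    using trig_polysI(1)[of c K, OF cnj] unfolding is_trig_interpolant_def c_def by simp
qed

lemma trig_interpolant_unique: "\<exists>!p. is_trig_interpolant K v p"
  using trig_interpolant_exists trig_interpolant_eq by blast


lemma fourier_coeff_uminus: "fourier_coeff v (- j) = cnj (fourier_coeff v j)"
proof -
  have "cnj (LINT x:{0..2 * pi}|lborel. complex_of_real (v x) * cis (- (real_of_int j * x)))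
      = (LINT x:{0..2 * pi}|lborel. complex_of_real (v x) * cis (real_of_int j * x))"
    unfolding set_lebesgue_integral_def
    by (subst Bochner_Integration.integral_cnj[symmetric]) (simp add: cis_cnj)
  then show ?thesis by (simp add: fourier_coeff_def)
qed

lemma set_integrable_mult_cis:
  assumes "set_integrable lborel {0..2 * pi} v"
  shows "set_integrable lborel {0..2 * pi} (\<lambda>x. complex_of_real (v x) * cis (r * x))"
proof -
  have "integrable lborel (\<lambda>x. complex_of_real (indicator {0..2 * pi} x * v x))"
    using assms unfolding set_integrable_def by (intro integrable_of_real) simp
  moreover have "continuous_on UNIV (\<lambda>x. cis (r * x))"
    by (intro continuous_intros continuous_on_cis)
  then have "(\<lambda>x. cis (r * x)) \<in> borel_measurable lborel"
    by (simp add: borel_measurable_continuous_onI)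
  ultimately have "integrable lborel (\<lambda>x. complex_of_real (indicator {0..2 * pi} x * v x) * cis (r * x))"
    (is "integrable lborel ?g")
  proof -
    assume f: "integrable lborel (\<lambda>x. complex_of_real (indicator {0..2 * pi} x * v x))"
      and c: "(\<lambda>x. cis (r * x)) \<in> borel_measurable lborel"
    have "?g \<in> borel_measurable lborel"
      by (rule borel_measurable_times[OF borel_measurable_integrable[OF f] c])
    moreover have "AE x in lborel. norm (?g x) \<le> norm (complex_of_real (indicator {0..2 * pi} x * v x))"
      by (intro AE_I2) (simp only: norm_mult norm_cis mult_1_right order_refl)
    ultimately show ?thesis by (rule Bochner_Integration.integrable_bound[OF f])
  qed
  then show ?thesis
    unfolding set_integrable_def by (simp add: scaleR_conv_of_real mult.assoc)
qed

lemma set_integral_sum':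
  fixes f :: "'i \<Rightarrow> real \<Rightarrow> complex"
  assumes "\<And>i. i \<in> I \<Longrightarrow> set_integrable lborel A (f i)"
  shows "(LINT x:A|lborel. \<Sum>i\<in>I. f i x) = (\<Sum>i\<in>I. LINT x:A|lborel. f i x)"
  using assms unfolding set_lebesgue_integral_def set_integrable_def
  by (simp add: scaleR_sum_right Bochner_Integration.integral_sum)

lemma integral_mult_trig_poly:
  assumes v: "set_integrable lborel {0..2 * pi} v"
    and q: "\<And>x. complex_of_real (q x) = (\<Sum>j = - int K..int K. d j * cis (real_of_int j * x))"
  shows "complex_of_real (LINT x:{0..2 * pi}|lborel. v x * q x)
    = 2 * pi * (\<Sum>j = - int K..int K. d j * fourier_coeff v (- j))"
proof -
  have "complex_of_real (LINT x:{0..2 * pi}|lborel. v x * q x)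
      = (LINT x:{0..2 * pi}|lborel. complex_of_real (v x * q x))"
    by (rule set_integral_complex_of_real[symmetric])
  also have "\<dots> = (LINT x:{0..2 * pi}|lborel.
      \<Sum>j = - int K..int K. d j * (complex_of_real (v x) * cis (real_of_int j * x)))"
    by (simp add: q sum_distrib_left mult_ac)
  also have "\<dots> = (\<Sum>j = - int K..int K.
      (LINT x:{0..2 * pi}|lborel. d j * (complex_of_real (v x) * cis (real_of_int j * x))))"
    using set_integrable_mult_cis[OF v] by (intro set_integral_sum') auto
  also have "\<dots> = 2 * pi * (\<Sum>j = - int K..int K. d j * fourier_coeff v (- j))"
    by (simp add: fourier_coeff_def sum_distrib_left mult_ac)
  finally show ?thesis .
qed

lemma trig_poly_integrable:
  assumes q: "\<And>x. complex_of_real (q x) = (\<Sum>j = - int K..int K. d j * cis (real_of_int j * x))"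
  shows "set_integrable lborel {0..2 * pi} q"
proof -
  have "q = (\<lambda>x. Re (\<Sum>j = - int K..int K. d j * cis (real_of_int j * x)))"
    by (simp flip: q)
  moreover have "continuous_on {0..2 * pi} (\<lambda>x. Re (\<Sum>j = - int K..int K. d j * cis (real_of_int j * x)))"
    by (intro continuous_intros continuous_on_cis)
  ultimately show ?thesis
    by (simp add: borel_integrable_atLeastAtMost')
qed

lemma fourier_coeff_trig_poly:
  assumes q: "\<And>x. complex_of_real (q x) = (\<Sum>j = - int K..int K. d j * cis (real_of_int j * x))"
    and l: "l \<in> {- int K..int K}"
  shows "fourier_coeff q l = d l"
proof -
  have int: "set_integrable lborel {0..2 * pi} (\<lambda>x. cis (r * x))" for r
    by (intro borel_integrable_atLeastAtMost' continuous_intros continuous_on_cis)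
  have "(LINT x:{0..2 * pi}|lborel. complex_of_real (q x) * cis (- (real_of_int l * x)))
      = (LINT x:{0..2 * pi}|lborel. \<Sum>j = - int K..int K. d j * cis (real_of_int (j - l) * x))"
    by (simp add: q sum_distrib_right mult.assoc cis_mult left_diff_distrib)
  also have "\<dots> = (\<Sum>j = - int K..int K. (LINT x:{0..2 * pi}|lborel. d j * cis (real_of_int (j - l) * x)))"
    using int by (intro set_integral_sum' set_integrable_mult_right) auto
  also have "\<dots> = (\<Sum>j = - int K..int K. if j = l then d l * (2 * pi) else 0)"
    unfolding set_integral_mult_right integral_cis by (intro sum.cong) auto
  also have "\<dots> = d l * (2 * pi)"
    using l by (subst sum.delta) auto
  finally show ?thesis by (simp add: fourier_coeff_def)
qed

lemma fourier_coeff_diff: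
  assumes "set_integrable lborel {0..2 * pi} v" "set_integrable lborel {0..2 * pi} w"
  shows "fourier_coeff (\<lambda>x. v x - w x) j = fourier_coeff v j - fourier_coeff w j"
  using set_integral_diff(2)[OF assms[THEN set_integrable_mult_cis[of _ "- real_of_int j"]]]
  by (simp add: fourier_coeff_def left_diff_distrib diff_divide_distrib)

lemma trig_projection_exists:
  assumes v: "set_integrable lborel {0..2 * pi} v"
  shows "is_trig_projection K v
    (\<lambda>x. Re (\<Sum>j = - int K..int K. fourier_coeff v j * cis (real_of_int j * x)))" (is "is_trig_projection K v ?p")
proof -
  note p = trig_polysI[where c = "fourier_coeff v" and K = K, OF fourier_coeff_uminus]
  have ip: "set_integrable lborel {0..2 * pi} ?p"
    by (rule trig_poly_integrable[where d = "fourier_coeff v" and K = K]) (rule p(2))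
  have "(LINT x:{0..2 * pi}|lborel. (v x - ?p x) * q x) = 0" if "q \<in> trig_polys K" for q
  proof -
    from that obtain d where d: "\<And>x. complex_of_real (q x) = (\<Sum>j = - int K..int K. d j * cis (real_of_int j * x))"
      by (auto simp: trig_polys_def)
    have "complex_of_real (LINT x:{0..2 * pi}|lborel. (v x - ?p x) * q x)
        = 2 * pi * (\<Sum>j = - int K..int K. d j * fourier_coeff (\<lambda>x. v x - ?p x) (- j))"
      by (intro integral_mult_trig_poly set_integral_diff(1) v ip d)
    also have "(\<Sum>j = - int K..int K. d j * fourier_coeff (\<lambda>x. v x - ?p x) (- j)) = 0"
    proof (intro sum.neutral ballI)
      fix j assume "j \<in> {- int K..int K}"
      then have "fourier_coeff ?p (- j) = fourier_coeff v (- j)"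
        by (intro fourier_coeff_trig_poly[where K = K] p(2)) auto
      then show "d j * fourier_coeff (\<lambda>x. v x - ?p x) (- j) = 0"
        by (simp only: fourier_coeff_diff[OF v ip] diff_self mult_zero_right)
    qed
    finally show ?thesis by (simp only: mult_zero_right of_real_eq_0_iff)
  qed
  with p(1) show ?thesis by (simp add: is_trig_projection_def)
qed

lemma trig_projection_eq:
  assumes v: "set_integrable lborel {0..2 * pi} v" and p: "is_trig_projection K v p"
  shows "p = (\<lambda>x. Re (\<Sum>j = - int K..int K. fourier_coeff v j * cis (real_of_int j * x)))"
proof -
  from p obtain c where c: "\<And>x. complex_of_real (p x) = (\<Sum>j = - int K..int K. c j * cis (real_of_int j * x))"
    and orth: "\<And>q. q \<in> trig_polys K \<Longrightarrow> (LINT x:{0..2 * pi}|lborel. (v x - p x) * q x) = 0"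
    by (auto simp: is_trig_projection_def trig_polys_def)
  have ip: "set_integrable lborel {0..2 * pi} p" by (rule trig_poly_integrable[OF c])
  define d where "d j = fourier_coeff (\<lambda>x. v x - p x) j" for j
  note q = trig_polysI[where c = d and K = K]
  have dc: "d (- j) = cnj (d j)" for j by (simp add: d_def fourier_coeff_uminus)
  let ?q = "\<lambda>x. Re (\<Sum>j = - int K..int K. d j * cis (real_of_int j * x))"
  have "0 = complex_of_real (LINT x:{0..2 * pi}|lborel. (v x - p x) * ?q x)"
    using orth[OF q(1)[OF dc]] by simp
  also have "\<dots> = 2 * pi * (\<Sum>j = - int K..int K. d j * fourier_coeff (\<lambda>x. v x - p x) (- j))"
    by (rule integral_mult_trig_poly[OF set_integral_diff(1)[OF v ip]], rule q(2), rule dc)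
  also have "\<dots> = complex_of_real (2 * pi * (\<Sum>j = - int K..int K. (cmod (d j))\<^sup>2))"
    by (simp add: dc flip: d_def complex_norm_square)
  finally have "(\<Sum>j = - int K..int K. (cmod (d j))\<^sup>2) = 0"
    by (simp only: of_real_eq_0_iff eq_commute[of "0::complex"]) simp
  then have "\<forall>j\<in>{- int K..int K}. d j = 0"
    by (subst (asm) sum_nonneg_eq_0_iff) auto
  then have "fourier_coeff v j = c j" if "j \<in> {- int K..int K}" for j
    using that fourier_coeff_trig_poly[OF c that] by (simp add: d_def fourier_coeff_diff[OF v ip])
  then have "(\<Sum>j = - int K..int K. fourier_coeff v j * cis (real_of_int j * x)) = of_real (p x)" for x
    unfolding c by (intro sum.cong) auto
  then show ?thesis by simp
qed

lemma trig_projection_unique: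
  assumes "set_integrable lborel {0..2 * pi} v"
  shows "\<exists>!p. is_trig_projection K v p"
  using trig_projection_exists[OF assms] trig_projection_eq[OF assms] by blast

definition discrete_nonlinearity ::
  "(real \<Rightarrow> real) \<Rightarrow> (real \<times> real \<Rightarrow> real) \<Rightarrow> nat \<Rightarrow> (real \<Rightarrow> real) \<Rightarrow> real \<Rightarrow> real" where
  "discrete_nonlinearity a g K u = trig_projection K (\<lambda>x.
     trig_interpolation K (\<lambda>y. a (u y)) x * deriv (deriv u) x
     + trig_interpolation K (\<lambda>y. g (u y, deriv u y)) x)"

definition TI2_fully_discrete ::
  "(real \<Rightarrow> real) \<Rightarrow> (real \<times> real \<Rightarrow> real) \<Rightarrow> nat \<Rightarrow> real \<Rightarrow> real \<Rightarrow> (real \<Rightarrow> real) \<Rightarrow> (real \<Rightarrow> real) \<Rightarrow>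
   nat \<Rightarrow> (real \<Rightarrow> real) \<times> (real \<Rightarrow> real)" where
  "TI2_fully_discrete a g K \<kappa> h u0 v0 n =
     trig_integrator TI2_b1 TI2_bb1 (discrete_nonlinearity a g K) \<kappa> h
       (trig_projection K u0, trig_projection K v0) n"

end

theory Submission
  imports Defs
begin

text \<open>
  In the variable \<open>p = v + \<i> \<Omega> u\<close> one step of TI2 is a half rotation by \<open>cis (h \<Omega> / 2)\<close>, the kick
  \<open>p \<mapsto> p + \<kappa> h sinc (h \<Omega>) f(u)\<close> and another half rotation. Since \<open>h \<Omega> sinc (h \<Omega>)\<close> is
  bounded, the kick maps an \<open>L\<^sup>2\<close> error of \<open>f\<close> to an \<open>H\<^sup>1\<close> error of size \<open>\<kappa>\<close>, without a factor \<open>h\<close>.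
  As \<open>\<kappa> \<le> c h\<close>, over \<open>T / h\<close> steps this costs only a factor \<open>exp (c L T)\<close>, and the sum of the local errors
  carries a factor \<open>\<kappa> T\<close>. The thresholds for \<open>h\<close> and \<open>\<kappa>\<close> may depend on \<open>c\<close> and \<open>T\<close> and absorb these
  factors as soon as the local error is \<open>\<kappa> h\<close> times \<open>o(h)\<close> plus the spatial error: because of \<open>\<kappa> \<le> c h\<close>
  the global error is then \<open>h o(h)\<close>. The midpoint rule yields \<open>h\<close> to the power \<open>4/3\<close>, by interpolation between the
  \<open>H\<^sup>3\<close> bound of \<open>f(u)\<close> and the pointwise bound \<open>O(h\<^sup>2)\<close> of its second time difference. The latter uses
  only the mean value theorem for \<open>u\<close> and Taylor expansion of \<open>a\<close> and \<open>g\<close>.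

  For the fully discrete method, \<open>a\<close> and \<open>g\<close> are composed with the projected solution. The
  derivatives of such compositions grow with \<open>K\<close> at a known rate, which gives the interpolation error
  for every real \<open>s\<close>.
\<close>

section \<open>Weighted sequence spaces\<close>

text \<open>The obstacle is that \<open>f\<close> loses two derivatives: an \<open>H^2\<close> error
  of the position is only an \<open>L^2\<close> error of \<open>f\<close>, and the filter returns
  exactly one order in \<open>diag\<close>, that is, \<open>H^2\<close> for the position and
  \<open>H^1\<close> for the velocity. Uniform bounds in higher norms are available for the exact
  solution only. Differences of nonlinear terms are therefore arranged so that excess derivatives
  fall on the exact solution. The higher regularity of the numerical solution is carried along as
  the mere existence of some bound and never enters a constant. One induction covers both methods:
  \<open>S\<close> is the set of retained modes, either all of them or those of degree at most
  \<open>K\<close>. The numerical solution is compared with the exact one truncated to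
  \<open>S\<close>, and the discarded tail is added at the very end. In the fully discrete case
  interpolation errors are estimated along the truncated exact solution, whose derivatives are
  controlled to the required order; the deviation of the numerical solution from it is interpolated
  using only its values at the grid points.\<close>

abbreviation jb :: "int \<Rightarrow> real" where "jb \<equiv> japanese_bracket"

lemma jb_ge_1: "1 \<le> jb j"
  by (simp add: japanese_bracket_def)

lemma jb_pos [simp]: "0 < jb j"
  using jb_ge_1[of j] by linarith

lemma jb_nonneg [simp]: "0 \<le> jb j"
  by (simp add: less_imp_le)

lemma jb_nonzero [simp]: "jb j \<noteq> 0"
  by (simp add: order_less_imp_not_eq2)

lemma jb_uminus [simp]: "jb (- j) = jb j"
  by (simp add: japanese_bracket_def)

lemma jb_square: "(jb j)\<^sup>2 = (real_of_int j)\<^sup>2 + 1"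
  unfolding japanese_bracket_def by (rule real_sqrt_pow2) simp

lemma abs_le_jb: "\<bar>real_of_int j\<bar> \<le> jb j"
  unfolding japanese_bracket_def by (rule real_le_rsqrt) simp

lemma jb_le_1_abs: "jb j \<le> 1 + \<bar>real_of_int j\<bar>"
  unfolding japanese_bracket_def by (rule real_le_lsqrt) (auto simp: power2_eq_square algebra_simps abs_if)

lemma jb_mono: "\<bar>j\<bar> \<le> \<bar>k\<bar> \<Longrightarrow> jb j \<le> jb k"
  unfolding japanese_bracket_def
  by (simp add: abs_le_square_iff[symmetric] flip: of_int_abs)

lemma jb_powr_ge_1: "0 \<le> r \<Longrightarrow> 1 \<le> jb j powr r"
  using jb_ge_1 by (rule ge_one_powr_ge_zero)

lemma jb_powr_pos [simp]: "0 < jb j powr r"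
  by simp

text \<open>\<open>hbound r B x\<close> says that the \<open>H\<^sup>r\<close> norm of the sequence of Fourier coefficients \<open>x\<close> is at most \<open>B\<close>,
  \<open>wbound\<close> is the same for the weighted Wiener algebra; both include convergence.\<close>

definition hbound :: "real \<Rightarrow> real \<Rightarrow> (int \<Rightarrow> complex) \<Rightarrow> bool" where
  "hbound r B x \<longleftrightarrow> (\<forall>J. finite J \<longrightarrow> L2_set (\<lambda>j. jb j powr r * cmod (x j)) J \<le> B)"

definition wbound :: "real \<Rightarrow> real \<Rightarrow> (int \<Rightarrow> complex) \<Rightarrow> bool" where
  "wbound r A x \<longleftrightarrow> (\<forall>J. finite J \<longrightarrow> (\<Sum>j\<in>J. jb j powr r * cmod (x j)) \<le> A)"

lemma hbound_nonneg: "hbound r B x \<Longrightarrow> 0 \<le> B"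
  unfolding hbound_def by (metis L2_set_empty finite.emptyI)

lemma wbound_nonneg: "wbound r B x \<Longrightarrow> 0 \<le> B"
  unfolding wbound_def by (metis sum.empty finite.emptyI)

text \<open>Fourier multipliers, truncations and changes of weight are estimated through this
  pointwise comparison, so that neither operator norms nor questions of convergence arise.\<close>

lemma hbound_dominated:
  assumes "hbound r B x" "0 \<le> c" "\<And>j. jb j powr r' * cmod (y j) \<le> c * (jb j powr r * cmod (x j))"
  shows "hbound r' (c * B) y"
  unfolding hbound_def
proof safe
  fix J :: "int set" assume "finite J"
  have "L2_set (\<lambda>j. jb j powr r' * cmod (y j)) J \<le> L2_set (\<lambda>j. c * (jb j powr r * cmod (x j))) J"
    by (rule L2_set_mono) (auto intro: assms(3))
  also have "\<dots> = c * L2_set (\<lambda>j. jb j powr r * cmod (x j)) J"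
    using assms(2) by (rule L2_set_right_distrib[symmetric])
  also have "\<dots> \<le> c * B"
    using assms(1,2) \<open>finite J\<close> unfolding hbound_def by (simp add: mult_left_mono)
  finally show "L2_set (\<lambda>j. jb j powr r' * cmod (y j)) J \<le> c * B" .
qed

lemma wbound_dominated:
  assumes "wbound r B x" "0 \<le> c" "\<And>j. jb j powr r' * cmod (y j) \<le> c * (jb j powr r * cmod (x j))"
  shows "wbound r' (c * B) y"
  unfolding wbound_def
proof safe
  fix J :: "int set" assume "finite J"
  have "(\<Sum>j\<in>J. jb j powr r' * cmod (y j)) \<le> (\<Sum>j\<in>J. c * (jb j powr r * cmod (x j)))"
    by (rule sum_mono) (auto intro: assms(3))
  also have "\<dots> \<le> c * B"
    using assms(1,2) \<open>finite J\<close> unfolding wbound_def by (simp add: mult_left_mono flip: sum_distrib_left)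
  finally show "(\<Sum>j\<in>J. jb j powr r' * cmod (y j)) \<le> c * B" .
qed

lemma hbound_mono: "hbound r B x \<Longrightarrow> B \<le> B' \<Longrightarrow> hbound r B' x"
  unfolding hbound_def by (meson order_trans)

lemma wbound_mono: "wbound r B x \<Longrightarrow> B \<le> B' \<Longrightarrow> wbound r B' x"
  unfolding wbound_def by (meson order_trans)

lemma hbound_le:
  assumes "hbound r B x" "\<And>j. jb j powr r' * cmod (y j) \<le> jb j powr r * cmod (x j)"
  shows "hbound r' B y"
  using hbound_dominated[OF assms(1), of 1 r' y] assms(2) by simp

lemma wbound_le:
  assumes "wbound r B x" "\<And>j. jb j powr r' * cmod (y j) \<le> jb j powr r * cmod (x j)"
  shows "wbound r' B y"
  using wbound_dominated[OF assms(1), of 1 r' y] assms(2) by simp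

lemma hbound_norm_le: "hbound r B x \<Longrightarrow> (\<And>j. cmod (y j) \<le> cmod (x j)) \<Longrightarrow> hbound r B y"
  by (erule hbound_le) (simp add: mult_left_mono)

lemma wbound_norm_le: "wbound r B x \<Longrightarrow> (\<And>j. cmod (y j) \<le> cmod (x j)) \<Longrightarrow> wbound r B y"
  by (erule wbound_le) (simp add: mult_left_mono)

lemma hbound_weaken: "hbound r B x \<Longrightarrow> r' \<le> r \<Longrightarrow> hbound r' B x"
  by (erule hbound_le) (simp add: mult_right_mono powr_mono jb_ge_1)

lemma wbound_weaken: "wbound r B x \<Longrightarrow> r' \<le> r \<Longrightarrow> wbound r' B x"
  by (erule wbound_le) (simp add: mult_right_mono powr_mono jb_ge_1)

lemma hbound_add:
  assumes "hbound r A x" "hbound r B y"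
  shows "hbound r (A + B) (\<lambda>j. x j + y j)"
  unfolding hbound_def
proof safe
  fix J :: "int set" assume "finite J"
  have "L2_set (\<lambda>j. jb j powr r * cmod (x j + y j)) J
      \<le> L2_set (\<lambda>j. jb j powr r * cmod (x j) + jb j powr r * cmod (y j)) J"
    by (rule L2_set_mono) (auto simp: norm_triangle_ineq mult_left_mono simp flip: distrib_left)
  also have "\<dots> \<le> L2_set (\<lambda>j. jb j powr r * cmod (x j)) J + L2_set (\<lambda>j. jb j powr r * cmod (y j)) J"
    by (rule L2_set_triangle_ineq)
  also have "\<dots> \<le> A + B" using assms \<open>finite J\<close> unfolding hbound_def by (intro add_mono) auto
  finally show "L2_set (\<lambda>j. jb j powr r * cmod (x j + y j)) J \<le> A + B" .
qed

lemma wbound_add: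
  assumes "wbound r A x" "wbound r B y"
  shows "wbound r (A + B) (\<lambda>j. x j + y j)"
  unfolding wbound_def
proof safe
  fix J :: "int set" assume "finite J"
  have "(\<Sum>j\<in>J. jb j powr r * cmod (x j + y j))
      \<le> (\<Sum>j\<in>J. jb j powr r * cmod (x j) + jb j powr r * cmod (y j))"
    by (rule sum_mono) (auto simp: norm_triangle_ineq mult_left_mono simp flip: distrib_left)
  also have "\<dots> \<le> A + B" using assms \<open>finite J\<close> unfolding wbound_def sum.distrib by (intro add_mono) auto
  finally show "(\<Sum>j\<in>J. jb j powr r * cmod (x j + y j)) \<le> A + B" .
qed

lemma hbound_diff: "hbound r A x \<Longrightarrow> hbound r B y \<Longrightarrow> hbound r (A + B) (\<lambda>j. x j - y j)"
  using hbound_add[of r A x B "\<lambda>j. - y j"] hbound_norm_le[of r B y "\<lambda>j. - y j"] by simp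

lemma wbound_diff: "wbound r A x \<Longrightarrow> wbound r B y \<Longrightarrow> wbound r (A + B) (\<lambda>j. x j - y j)"
  using wbound_add[of r A x B "\<lambda>j. - y j"] wbound_norm_le[of r B y "\<lambda>j. - y j"] by simp

lemma hbound_cmult: "hbound r B x \<Longrightarrow> cmod c \<le> c' \<Longrightarrow> hbound r (c' * B) (\<lambda>j. c * x j)"
  by (erule hbound_dominated)
    (auto simp: norm_mult mult_ac mult_left_mono mult_right_mono intro: order_trans[OF norm_ge_zero])

lemma hbound_reflect:
  assumes "hbound r B x"
  shows "hbound r B (\<lambda>j. x (- j))"
  unfolding hbound_def
proof safe
  fix J :: "int set" assume "finite J"
  have "L2_set (\<lambda>j. jb j powr r * cmod (x (- j))) J = L2_set (\<lambda>j. jb j powr r * cmod (x j)) (uminus ` J)"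
    unfolding L2_set_def by (subst sum.reindex) auto
  also have "\<dots> \<le> B" using assms \<open>finite J\<close> unfolding hbound_def by blast
  finally show "L2_set (\<lambda>j. jb j powr r * cmod (x (- j))) J \<le> B" .
qed

lemma hbound_pow_mult:
  "hbound (r + real k) B x \<Longrightarrow> hbound r B (\<lambda>j. (\<i> * of_int j) ^ k * x j)"
  by (erule hbound_le)
    (simp add: norm_mult norm_power powr_add mult.assoc[symmetric] powr_realpow mult_right_mono mult_left_mono
      power_mono abs_le_jb)

lemma wbound_pow_mult:
  "wbound (r + real k) B x \<Longrightarrow> wbound r B (\<lambda>j. (\<i> * of_int j) ^ k * x j)"
  by (erule wbound_le)
    (simp add: norm_mult norm_power powr_add mult.assoc[symmetric] powr_realpow mult_right_mono mult_left_mono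
      power_mono abs_le_jb)

text \<open>The zero mode contributes 1 and each sign at most 2, because
  \<open>1 / (n + 1)^2 <= 1 / n - 1 / (n + 1)\<close> makes the one-sided sums telescope.\<close>

lemma sum_inverse_jb_squares:
  fixes J :: "int set"
  assumes "finite J"
  shows "(\<Sum>j\<in>J. jb j powr -2) \<le> 5"
proof -
  have S: "(\<Sum>i=1..n. 1 / (real i)\<^sup>2) \<le> 2 - 1 / real n" if "1 \<le> n" for n
    using that
  proof (induction n rule: dec_induct)
    case (step n)
    have "1 / (real (Suc n))\<^sup>2 \<le> 1 / (real n * real (Suc n))"
      using step.hyps by (intro divide_left_mono) (auto simp: power2_eq_square)
    also have "\<dots> = 1 / real n - 1 / real (Suc n)"
      using step.hyps by (simp add: field_simps)
    finally show ?case using step.IH by simp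
  qed simp
  obtain n :: nat where n: "\<And>j. j \<in> J \<Longrightarrow> \<bar>j\<bar> \<le> int n"
  proof -
    have "\<bar>j\<bar> \<le> int (nat (\<Sum>i\<in>J. \<bar>i\<bar>))" if "j \<in> J" for j
      using member_le_sum[of j J abs] that assms by (simp add: sum_nonneg)
    then show ?thesis using that by blast
  qed
  have le: "jb j powr -2 \<le> 1 / (real (nat \<bar>j\<bar>))\<^sup>2" if "j \<noteq> 0" for j
  proof -
    have "jb j powr -2 = 1 / (jb j)\<^sup>2"
      by (simp add: powr_minus divide_inverse)
    also have "\<dots> \<le> 1 / (real (nat \<bar>j\<bar>))\<^sup>2"
      unfolding jb_square using that
      by (intro divide_left_mono mult_pos_pos) (auto simp: zero_less_power2 add_nonneg_pos)
    finally show ?thesis .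
  qed
  have "J \<subseteq> insert 0 (int ` {1..n} \<union> (\<lambda>i. - int i) ` {1..n})"
  proof
    fix x assume "x \<in> J"
    from n[OF this] have "x = 0 \<or> x = int (nat x) \<and> 1 \<le> nat x \<and> nat x \<le> n
        \<or> x = - int (nat (- x)) \<and> 1 \<le> nat (- x) \<and> nat (- x) \<le> n"
      by arith
    then consider "x = 0" | "x = int (nat x)" "nat x \<in> {1..n}" | "x = - int (nat (- x))" "nat (- x) \<in> {1..n}"
      by (auto simp del: int_nat_eq)
    then show "x \<in> insert 0 (int ` {1..n} \<union> (\<lambda>i. - int i) ` {1..n})" by cases blast+
  qed
  then have "(\<Sum>j\<in>J. jb j powr -2) \<le> (\<Sum>j\<in>insert 0 (int ` {1..n} \<union> (\<lambda>i. - int i) ` {1..n}). jb j powr -2)"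
    by (intro sum_mono2) auto
  also have "(\<Sum>j\<in>insert 0 (int ` {1..n} \<union> (\<lambda>i. - int i) ` {1..n}). jb j powr -2)
     = 1 + ((\<Sum>j\<in>int ` {1..n}. jb j powr -2) + (\<Sum>j\<in>(\<lambda>i. - int i) ` {1..n}. jb j powr -2))"
    by (subst sum.insert, force, force, subst sum.union_disjoint) (auto simp: japanese_bracket_def)
  also have "(\<Sum>j\<in>int ` {1..n}. jb j powr -2) = (\<Sum>i=1..n. jb (int i) powr -2)"
    by (subst sum.reindex) (auto simp: inj_on_def)
  also have "(\<Sum>j\<in>(\<lambda>i. - int i) ` {1..n}. jb j powr -2) = (\<Sum>i=1..n. jb (int i) powr -2)"
    by (subst sum.reindex) (auto simp: inj_on_def)
  also have "(\<Sum>i=1..n. jb (int i) powr -2) \<le> (\<Sum>i=1..n. 1 / (real i)\<^sup>2)"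
    by (rule sum_mono) (use le[of "int _"] in auto)
  also have "\<dots> \<le> 2"
  proof (cases "1 \<le> n")
    case True
    then show ?thesis using S[of n] by (smt (verit) divide_nonneg_nonneg of_nat_0_le_iff)
  qed simp
  finally show ?thesis by simp
qed

text \<open>Sobolev embedding by Cauchy--Schwarz against the weight \<open>jb j powr -1\<close>; the
  factor 3 bounds the square root of the sum of its squares. The price is one whole derivative,
  which keeps integer orders integer.\<close>

lemma hbound_imp_wbound:
  assumes "hbound (r + 1) B x"
  shows "wbound r (3 * B) x"
  unfolding wbound_def
proof safe
  fix J :: "int set" assume J: "finite J"
  have "(\<Sum>j\<in>J. jb j powr r * cmod (x j)) = (\<Sum>j\<in>J. \<bar>jb j powr -1\<bar> * \<bar>jb j powr (r + 1) * cmod (x j)\<bar>)"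
    by (intro sum.cong refl) (simp add: powr_add powr_minus abs_mult field_simps)
  also have "\<dots> \<le> L2_set (\<lambda>j. jb j powr -1) J * L2_set (\<lambda>j. jb j powr (r + 1) * cmod (x j)) J"
    by (rule L2_set_mult_ineq)
  also have "\<dots> \<le> 3 * B"
  proof (rule mult_mono)
    have "(jb j powr -1)\<^sup>2 = jb j powr -2" for j
      by (simp add: powr_minus power2_eq_square divide_inverse)
    then have "L2_set (\<lambda>j. jb j powr -1) J = sqrt (\<Sum>j\<in>J. jb j powr -2)"
      unfolding L2_set_def by (simp only:)
    also have "\<dots> \<le> sqrt 9" using sum_inverse_jb_squares[OF J] by (intro real_sqrt_le_mono) linarith
    finally show "L2_set (\<lambda>j. jb j powr -1) J \<le> 3" by simp
    show "L2_set (\<lambda>j. jb j powr (r + 1) * cmod (x j)) J \<le> B" using assms J unfolding hbound_def by blast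
  qed (auto simp: L2_set_nonneg)
  finally show "(\<Sum>j\<in>J. jb j powr r * cmod (x j)) \<le> 3 * B" .
qed

text \<open>Interpolation between Sobolev norms with an explicit splitting frequency: modes up to
  \<open>R\<close> are measured by the weak norm, those above by the strong one. \<open>R\<close>
  stays free so that the two contributions can be balanced where the sizes of \<open>A\<close> and
  \<open>B\<close> are known.\<close>

lemma hbound_split_low_high:
  assumes "hbound s A x" "hbound r B x" "0 < R" "s \<le> q" "q \<le> r"
  shows "hbound q (R powr (q - s) * A + R powr (q - r) * B) x"
proof -
  define lo where "lo j = (if jb j \<le> R then x j else 0)" for j
  define hi where "hi j = (if jb j \<le> R then 0 else x j)" for j
  have "hbound q (R powr (q - s) * A) lo"
  proof (rule hbound_dominated[OF assms(1)])
    fix j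
    have "jb j powr q = jb j powr (q - s) * jb j powr s" by (simp flip: powr_add)
    also have "\<dots> \<le> R powr (q - s) * jb j powr s" if "jb j \<le> R"
      using that assms by (intro mult_right_mono powr_mono2) (auto simp: less_imp_le)
    finally show "jb j powr q * cmod (lo j) \<le> R powr (q - s) * (jb j powr s * cmod (x j))"
      by (auto simp: lo_def mult.assoc[symmetric] mult_right_mono)
  qed simp
  moreover have "hbound q (R powr (q - r) * B) hi"
  proof (rule hbound_dominated[OF assms(2)])
    fix j
    have "jb j powr q = jb j powr (q - r) * jb j powr r" by (simp flip: powr_add)
    also have "\<dots> \<le> R powr (q - r) * jb j powr r" if "\<not> jb j \<le> R"
      using that assms by (intro mult_right_mono powr_mono2') auto
    finally show "jb j powr q * cmod (hi j) \<le> R powr (q - r) * (jb j powr r * cmod (x j))"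
      by (auto simp: hi_def mult.assoc[symmetric] mult_right_mono)
  qed simp
  ultimately have "hbound q (R powr (q - s) * A + R powr (q - r) * B) (\<lambda>j. lo j + hi j)" by (rule hbound_add)
  also have "(\<lambda>j. lo j + hi j) = x" by (auto simp: lo_def hi_def)
  finally show ?thesis .
qed

text \<open>Testing against the increment itself reduces the vector-valued mean value inequality to the
  real mean value theorem.\<close>

lemma hbound_mean_value:
  assumes ab: "a \<le> b"
    and der: "\<And>j \<tau>. a \<le> \<tau> \<Longrightarrow> \<tau> \<le> b \<Longrightarrow> ((\<lambda>\<tau>. y \<tau> j) has_vector_derivative y' \<tau> j) (at \<tau> within {a..b})"
    and bd: "\<And>\<tau>. a \<le> \<tau> \<Longrightarrow> \<tau> \<le> b \<Longrightarrow> hbound r B (y' \<tau>)"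
  shows "hbound r (B * (b - a)) (\<lambda>j. y b j - y a j)"
  unfolding hbound_def
proof safe
  fix J :: "int set" assume J: "finite J"
  define d where "d j = y b j - y a j" for j
  define N where "N = L2_set (\<lambda>j. jb j powr r * cmod (d j)) J"
  have B: "0 \<le> B" using bd[of a] ab hbound_nonneg by auto
  define \<psi> where "\<psi> \<tau> = (\<Sum>j\<in>J. (jb j powr r)\<^sup>2 * (d j \<bullet> y \<tau> j))" for \<tau>
  define \<psi>' where "\<psi>' \<tau> = (\<Sum>j\<in>J. (jb j powr r)\<^sup>2 * (d j \<bullet> y' \<tau> j))" for \<tau>
  have N2: "N\<^sup>2 = \<psi> b - \<psi> a"
  proof -
    have "N\<^sup>2 = (\<Sum>j\<in>J. (jb j powr r * cmod (d j))\<^sup>2)"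
      unfolding N_def L2_set_def by (rule real_sqrt_pow2) (simp add: sum_nonneg)
    also have "\<dots> = \<psi> b - \<psi> a"
      unfolding \<psi>_def sum_subtractf[symmetric]
      by (intro sum.cong refl)
        (simp add: power_mult_distrib power2_norm_eq_inner d_def flip: right_diff_distrib inner_diff_right)
    finally show ?thesis .
  qed
  have "norm (\<psi> b - \<psi> a) \<le> N * B * norm (b - a)"
  proof (rule differentiable_bound[where S = "{a..b}" and f' = "\<lambda>\<tau> h. h * \<psi>' \<tau>"])
    fix \<tau> assume \<tau>: "\<tau> \<in> {a..b}"
    have "((\<lambda>\<tau>. \<psi> \<tau>) has_derivative (\<lambda>h. \<Sum>j\<in>J. (jb j powr r)\<^sup>2 * (d j \<bullet> (h *\<^sub>R y' \<tau> j)))) (at \<tau> within {a..b})"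
      unfolding \<psi>_def
      by (intro has_derivative_sum has_derivative_mult_right has_derivative_inner_right)
        (use der \<tau> in \<open>auto simp: has_vector_derivative_def\<close>)
    then show "(\<psi> has_derivative (\<lambda>h. h * \<psi>' \<tau>)) (at \<tau> within {a..b})"
      by (simp add: \<psi>'_def sum_distrib_left mult_ac)
    have "\<bar>\<psi>' \<tau>\<bar> \<le> (\<Sum>j\<in>J. \<bar>jb j powr r * cmod (d j)\<bar> * \<bar>jb j powr r * cmod (y' \<tau> j)\<bar>)"
      unfolding \<psi>'_def
    proof (rule order_trans[OF sum_abs sum_mono])
      fix j
      have "\<bar>(jb j powr r)\<^sup>2 * (d j \<bullet> y' \<tau> j)\<bar> \<le> (jb j powr r)\<^sup>2 * (cmod (d j) * cmod (y' \<tau> j))"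
        by (simp add: abs_mult mult_left_mono Cauchy_Schwarz_ineq2)
      then show "\<bar>(jb j powr r)\<^sup>2 * (d j \<bullet> y' \<tau> j)\<bar> \<le> \<bar>jb j powr r * cmod (d j)\<bar> * \<bar>jb j powr r * cmod (y' \<tau> j)\<bar>"
        by (simp add: power2_eq_square abs_mult mult_ac)
    qed
    also have "\<dots> \<le> N * L2_set (\<lambda>j. jb j powr r * cmod (y' \<tau> j)) J"
      unfolding N_def by (rule L2_set_mult_ineq)
    also have "\<dots> \<le> N * B"
      using bd[of \<tau>] \<tau> J unfolding hbound_def N_def by (intro mult_left_mono) (auto simp: L2_set_nonneg)
    finally show "onorm (\<lambda>h. h * \<psi>' \<tau>) \<le> N * B"
      by (intro onorm_bound) (auto simp: abs_mult mult_left_mono mult.commute N_def L2_set_nonneg B)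
  qed (use ab in auto)
  then have "N * N \<le> N * (B * (b - a))"
    using ab N2 by (simp add: power2_eq_square mult_ac)
  moreover have "0 \<le> N" unfolding N_def by (rule L2_set_nonneg)
  ultimately have "N \<le> B * (b - a)"
    using B ab by (cases "N = 0") auto
  then show "L2_set (\<lambda>j. jb j powr r * cmod (y b j - y a j)) J \<le> B * (b - a)"
    by (simp add: N_def d_def)
qed

section \<open>Fourier series\<close>

abbreviation fc :: "(real \<Rightarrow> real) \<Rightarrow> int \<Rightarrow> complex" where "fc \<equiv> fourier_coeff"

text \<open>The symmetry of the coefficients of real functions. It makes the real part in
  \<open>synth\<close> lossless, so that \<open>fc\<close> recovers the coefficients of a convergent
  series.\<close>

definition herm :: "(int \<Rightarrow> complex) \<Rightarrow> bool" where
  "herm x \<longleftrightarrow> (\<forall>j. x (- j) = cnj (x j))"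

lemma herm_fc [simp]: "herm (fc v)"
  by (simp add: herm_def fourier_coeff_uminus)

definition synth :: "(int \<Rightarrow> complex) \<Rightarrow> real \<Rightarrow> real" where
  "synth x t = Re (\<Sum>\<^sub>\<infinity>j. x j * cis (real_of_int j * t))"

definition synth_upto :: "nat \<Rightarrow> (int \<Rightarrow> complex) \<Rightarrow> real \<Rightarrow> real" where
  "synth_upto K x t = Re (\<Sum>j=-int K..int K. x j * cis (real_of_int j * t))"

lemma fourier_multiplier_synth:
  "fourier_multiplier \<phi> v = synth (\<lambda>j. complex_of_real (\<phi> (jb j)) * fc v j)"
  by (simp add: fourier_multiplier_def synth_def fun_eq_iff)

lemma wbound_summable:
  assumes "wbound 0 A x"
  shows "(\<lambda>j. cmod (x j)) summable_on UNIV" "(\<Sum>\<^sub>\<infinity>j. cmod (x j)) \<le> A"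
proof -
  have *: "(\<Sum>j\<in>J. cmod (x j)) \<le> A" if "finite J" for J
    using assms that by (simp add: wbound_def)
  then show s: "(\<lambda>j. cmod (x j)) summable_on UNIV"
    by (intro nonneg_bdd_above_summable_on bdd_aboveI2[where M = A]) auto
  show "(\<Sum>\<^sub>\<infinity>j. cmod (x j)) \<le> A"
    by (rule infsum_le_finite_sums[OF s]) (use * in auto)
qed

lemma wbound_abs_summable:
  assumes "wbound 0 A x"
  shows "(\<lambda>j. cmod (x j * cis (real_of_int j * t))) summable_on B"
  using summable_on_subset_banach[OF wbound_summable(1)[OF assms], of B] by (simp add: norm_mult)

lemma synth_bound:
  assumes "wbound 0 A x"
  shows "\<bar>synth x t\<bar> \<le> A"
proof -
  have "\<bar>synth x t\<bar> \<le> cmod (\<Sum>\<^sub>\<infinity>j. x j * cis (real_of_int j * t))"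
    unfolding synth_def by (rule abs_Re_le_cmod)
  also have "\<dots> \<le> (\<Sum>\<^sub>\<infinity>j. cmod (x j * cis (real_of_int j * t)))"
    by (rule norm_infsum_bound[OF wbound_abs_summable[OF assms]])
  also have "\<dots> \<le> A" using wbound_summable[OF assms] by (simp add: norm_mult)
  finally show ?thesis .
qed

text \<open>The remainder of the convergent series of moduli dominates the truncation error
  uniformly in \<open>t\<close>. This one null sequence later justifies continuity, termwise
  differentiation and the exchange of limits with integrals.\<close>

lemma synth_tail:
  assumes "wbound 0 A x"
  obtains r where "r \<longlonglongrightarrow> 0" "\<And>K t. \<bar>synth x t - synth_upto K x t\<bar> \<le> r K"
proof -
  define L where "L = (\<Sum>\<^sub>\<infinity>j. cmod (x j))"
  define r where "r K = L - (\<Sum>j=-int K..int K. cmod (x j))" for K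
  note s = wbound_summable(1)[OF assms]
  have hs: "((\<lambda>j. cmod (x j)) has_sum L) UNIV" using s unfolding L_def by (rule has_sum_infsum)
  have "r \<longlonglongrightarrow> 0"
  proof (rule LIMSEQ_I)
    fix e :: real assume "0 < e"
    obtain F where F: "finite F" "\<And>G. finite G \<Longrightarrow> F \<subseteq> G \<Longrightarrow> dist (sum (\<lambda>j. cmod (x j)) G) L < e"
      using tendstoD[OF hs[unfolded has_sum_def] \<open>0 < e\<close>]
      unfolding eventually_finite_subsets_at_top by auto
    define K0 where "K0 = nat (\<Sum>i\<in>F. \<bar>i\<bar>)"
    have "norm (r K - 0) < e" if "K \<ge> K0" for K
    proof -
      have "\<bar>j\<bar> \<le> int K" if "j \<in> F" for j
        using member_le_sum[of j F abs] that F(1) \<open>K \<ge> K0\<close> by (simp add: sum_nonneg K0_def)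
      then have "F \<subseteq> {-int K..int K}" by force
      from F(2)[OF _ this] show ?thesis by (simp add: r_def dist_real_def abs_minus_commute)
    qed
    then show "\<exists>no. \<forall>n\<ge>no. norm (r n - 0) < e" by blast
  qed
  moreover have "\<bar>synth x t - synth_upto K x t\<bar> \<le> r K" for K t
  proof -
    let ?F = "{-int K..int K}" and ?g = "\<lambda>j. x j * cis (real_of_int j * t)"
    have "infsum ?g UNIV = infsum ?g ?F + infsum ?g (-?F)"
      using infsum_Un_disjoint[of ?g ?F "-?F"] abs_summable_summable[OF wbound_abs_summable[OF assms]]
      by (simp del: infsum_finite)
    then have "\<bar>synth x t - synth_upto K x t\<bar> = \<bar>Re (infsum ?g (-?F))\<bar>"
      by (simp add: synth_def synth_upto_def)
    also have "\<dots> \<le> (\<Sum>\<^sub>\<infinity>j\<in>-?F. cmod (?g j))"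
      by (rule order_trans[OF abs_Re_le_cmod norm_infsum_bound[OF wbound_abs_summable[OF assms]]])
    also have "\<dots> = (\<Sum>\<^sub>\<infinity>j\<in>-?F. cmod (x j))" by (simp add: norm_mult)
    also have "\<dots> = r K"
    proof -
      have "L = infsum (\<lambda>j. cmod (x j)) ?F + infsum (\<lambda>j. cmod (x j)) (-?F)"
        unfolding L_def using infsum_Un_disjoint[of "\<lambda>j. cmod (x j)" ?F "-?F"] summable_on_subset_banach[OF s]
        by (simp del: infsum_finite)
      then show ?thesis by (simp add: r_def)
    qed
    finally show ?thesis .
  qed
  ultimately show ?thesis using that by blast
qed

lemma synth_upto_tendsto:
  assumes "wbound 0 A x"
  shows "(\<lambda>K. synth_upto K x t) \<longlonglongrightarrow> synth x t"
proof -
  obtain r where r: "r \<longlonglongrightarrow> 0" "\<And>K t. \<bar>synth x t - synth_upto K x t\<bar> \<le> r K"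
    using synth_tail[OF assms] by blast
  show ?thesis
    by (rule LIM_zero_cancel, rule Lim_null_comparison[OF _ r(1)])
      (use r(2) in \<open>auto simp: abs_minus_commute\<close>)
qed

lemma continuous_synth_upto [continuous_intros]: "continuous_on S (synth_upto K x)"
  unfolding synth_upto_def by (intro continuous_intros continuous_on_cis)

lemma continuous_synth:
  assumes "wbound 0 A x"
  shows "continuous_on S (synth x)"
proof -
  obtain r where r: "r \<longlonglongrightarrow> 0" "\<And>K t. \<bar>synth x t - synth_upto K x t\<bar> \<le> r K"
    using synth_tail[OF assms] by blast
  have "uniform_limit S (\<lambda>K. synth_upto K x) (synth x) sequentially"
    unfolding uniform_limit_iff
  proof safe
    fix e :: real assume "0 < e"
    with r(1) have "\<forall>\<^sub>F K in sequentially. r K < e" by (rule order_tendstoD)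
    then show "\<forall>\<^sub>F K in sequentially. \<forall>t\<in>S. dist (synth_upto K x t) (synth x t) < e"
    proof eventually_elim
      case (elim K)
      then show ?case using le_less_trans[OF r(2) elim] by (simp add: dist_real_def abs_minus_commute)
    qed
  qed
  then show ?thesis
    by (rule uniform_limit_theorem[rotated]) (auto intro!: always_eventually continuous_synth_upto)
qed

lemma cis_periodic: "cis (real_of_int j * (t + 2 * pi)) = cis (real_of_int j * t)"
  using cis_multiple_2pi[of "of_int j"] by (simp add: distrib_left mult_ac flip: cis_mult)

lemma periodic_synth [simp]: "periodic (synth x)"
  unfolding periodic_def synth_def by (simp only: cis_periodic) simp

text \<open>Termwise differentiation of the partial sums: the differentiated series converges
  uniformly, by \<open>synth_tail\<close> for the coefficients \<open>d\<close>.\<close>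

lemma synth_DERIV:
  assumes "wbound 1 A x"
  shows "(synth x has_real_derivative synth (\<lambda>j. \<i> * of_int j * x j) t) (at t)"
proof -
  define d where "d j = \<i> * of_int j * x j" for j
  have w: "wbound 0 A x" using wbound_weaken[OF assms] by simp
  have wd: "wbound 0 A d" using wbound_pow_mult[of 0 1 A x] assms by (simp add: d_def[abs_def])
  obtain r where r: "r \<longlonglongrightarrow> 0" "\<And>K t. \<bar>synth d t - synth_upto K d t\<bar> \<le> r K"
    using synth_tail[OF wd] by blast
  have "\<exists>g. \<forall>t\<in>UNIV. (\<lambda>K. synth_upto K x t) \<longlonglongrightarrow> g t \<and> (g has_derivative (\<lambda>h. h * synth d t)) (at t within UNIV)"
  proof (rule has_derivative_sequence[where f' = "\<lambda>K t h. h * synth_upto K d t" and ?x0.0 = 0 and l = "synth x 0"])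
    fix K t
    have "((\<lambda>t. x j * cis (real_of_int j * t)) has_vector_derivative d j * cis (real_of_int j * t)) (at t)" for j
    proof -
      have "((\<lambda>z. x j * exp (\<i> * of_int j * z)) has_field_derivative d j * exp (\<i> * of_int j * of_real t)) (at (of_real t))"
        by (auto intro!: derivative_eq_intros simp: d_def)
      from has_vector_derivative_real_field[OF this] show ?thesis by (simp add: cis_conv_exp mult_ac)
    qed
    then have "((\<lambda>t. \<Sum>j=-int K..int K. x j * cis (real_of_int j * t)) has_vector_derivative
        (\<Sum>j=-int K..int K. d j * cis (real_of_int j * t))) (at t)"
      by (intro has_vector_derivative_sum)
    from bounded_linear.has_vector_derivative[OF bounded_linear_Re this]
    show "(synth_upto K x has_derivative (\<lambda>h. h * synth_upto K d t)) (at t within UNIV)"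
      by (simp add: synth_upto_def[abs_def] has_vector_derivative_def)
  next
    fix e :: real assume "0 < e"
    with r(1) have "\<forall>\<^sub>F K in sequentially. r K < e" by (rule order_tendstoD)
    then show "\<forall>\<^sub>F K in sequentially. \<forall>t\<in>UNIV. \<forall>h. norm (h * synth_upto K d t - h * synth d t) \<le> e * norm h"
    proof eventually_elim
      case (elim K)
      have "\<bar>synth_upto K d t - synth d t\<bar> \<le> e" for t
        using r(2)[of t K] elim by (simp add: abs_minus_commute)
      then show ?case by (auto simp: abs_mult mult.commute[of e] mult_left_mono simp flip: right_diff_distrib)
    qed
  qed (auto intro: synth_upto_tendsto[OF w])
  then obtain g where g: "\<And>t. (\<lambda>K. synth_upto K x t) \<longlonglongrightarrow> g t" "\<And>t. (g has_derivative (\<lambda>h. h * synth d t)) (at t)"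
    by auto
  then have "g = synth x" using LIMSEQ_unique[OF g(1) synth_upto_tendsto[OF w]] by auto
  with g(2)[of t] show ?thesis by (simp add: has_field_derivative_def d_def[abs_def] mult_commute_abs)
qed

lemma synth_add:
  assumes "wbound 0 A x" "wbound 0 B y"
  shows "synth (\<lambda>j. x j + y j) t = synth x t + synth y t"
  using abs_summable_summable[OF wbound_abs_summable[OF assms(1), of t UNIV]]
    abs_summable_summable[OF wbound_abs_summable[OF assms(2), of t UNIV]]
  by (simp add: synth_def distrib_right infsum_add)

lemma synth_cmult: "synth (\<lambda>j. complex_of_real c * x j) t = c * synth x t"
  by (simp add: synth_def mult.assoc infsum_cmult_right')

lemma synth_diff:
  assumes "wbound 0 A x" "wbound 0 B y"
  shows "synth (\<lambda>j. x j - y j) t = synth x t - synth y t"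
  using synth_add[OF assms(1) wbound_norm_le[OF assms(2), of "\<lambda>j. complex_of_real (-1) * y j"]]
    synth_cmult[of "-1" y t] by simp

lemma synth_finite_support:
  assumes "\<And>j. j \<notin> {-int K..int K} \<Longrightarrow> x j = 0"
  shows "synth x = synth_upto K x"
  unfolding synth_def synth_upto_def
  by (rule ext, rule arg_cong[where f = Re], subst infsum_finite[symmetric], simp,
      rule infsum_cong_neutral) (use assms in auto)

section \<open>Fourier coefficients\<close>

lemma set_integrable_continuous: "continuous_on UNIV w \<Longrightarrow> set_integrable lborel {0..2*pi} w"
  for w :: "real \<Rightarrow> 'a::euclidean_space"
  by (rule borel_integrable_atLeastAtMost', rule continuous_on_subset[of UNIV]) auto

lemma fc_diff:
  "continuous_on UNIV v \<Longrightarrow> continuous_on UNIV w \<Longrightarrow> fc (\<lambda>x. v x - w x) j = fc v j - fc w j"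
  by (rule fourier_coeff_diff; rule set_integrable_continuous)

lemma fc_cmult: "fc (\<lambda>x. c * v x) j = complex_of_real c * fc v j"
  by (simp add: fourier_coeff_def mult.assoc)

lemma fc_add':
  assumes "set_integrable lborel {0..2 * pi} v" "set_integrable lborel {0..2 * pi} w"
  shows "fc (\<lambda>x. v x + w x) j = fc v j + fc w j"
proof -
  have "set_integrable lborel {0..2 * pi} (\<lambda>x. (-1) * w x)"
    by (rule set_integrable_mult_right) (rule assms(2))
  from fourier_coeff_diff[OF assms(1) this] show ?thesis by (simp only: fc_cmult) simp
qed

lemma fc_add:
  "continuous_on UNIV v \<Longrightarrow> continuous_on UNIV w \<Longrightarrow> fc (\<lambda>x. v x + w x) j = fc v j + fc w j"
  by (intro fc_add' set_integrable_continuous)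

lemma fc_norm_le:
  assumes "continuous_on UNIV w" "\<And>x. \<bar>w x\<bar> \<le> B"
  shows "cmod (fc w j) \<le> B"
proof -
  let ?f = "\<lambda>x. complex_of_real (w x) * cis (- (real_of_int j * x))"
  have c: "continuous_on UNIV ?f" using assms(1) by (intro continuous_intros continuous_on_cis)
  have "cmod (LINT x:{0..2*pi}|lborel. ?f x) \<le> (LINT x:{0..2*pi}|lborel. cmod (?f x))"
    by (rule set_integral_norm_bound[OF set_integrable_continuous[OF c]])
  also have "\<dots> \<le> (LINT x:{0..2*pi}|lborel. B)"
    by (rule set_integral_mono) (use assms in \<open>auto simp: norm_mult intro!: set_integrable_continuous continuous_intros\<close>)
  also have "\<dots> = 2 * pi * B" by (simp add: set_lebesgue_integral_def)
  finally show ?thesis by (simp add: fourier_coeff_def norm_divide field_simps)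
qed

lemma synth_upto_of_real:
  assumes "herm x"
  shows "complex_of_real (synth_upto K x t) = (\<Sum>j=-int K..int K. x j * cis (real_of_int j * t))"
  unfolding synth_upto_def by (rule trig_polysI(2)) (use assms in \<open>simp add: herm_def\<close>)

lemma fc_synth_upto:
  assumes "herm x" "l \<in> {-int K..int K}"
  shows "fc (synth_upto K x) l = x l"
  by (rule fourier_coeff_trig_poly[OF synth_upto_of_real[OF assms(1)] assms(2)])

text \<open>Exact for partial sums containing the mode \<open>l\<close>; the uniform truncation
  error bounds the error of the coefficient and tends to zero.\<close>

lemma fc_synth:
  assumes "herm x" "wbound 0 A x"
  shows "fc (synth x) l = x l"
proof -
  obtain r where r: "r \<longlonglongrightarrow> 0" "\<And>K t. \<bar>synth x t - synth_upto K x t\<bar> \<le> r K"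
    using synth_tail[OF assms(2)] by blast
  have "cmod (fc (synth x) l - x l) \<le> r K" if "K \<ge> nat \<bar>l\<bar>" for K
  proof -
    have "fc (\<lambda>t. synth x t - synth_upto K x t) l = fc (synth x) l - x l"
      using fc_diff[OF continuous_synth[OF assms(2)] continuous_synth_upto] fc_synth_upto[OF assms(1), of l K] that
      by (simp add: abs_le_iff nat_le_iff)
    moreover have "cmod (fc (\<lambda>t. synth x t - synth_upto K x t) l) \<le> r K"
      by (intro fc_norm_le continuous_intros continuous_synth[OF assms(2)] r(2))
    ultimately show ?thesis by simp
  qed
  then have "cmod (fc (synth x) l - x l) \<le> 0"
    by (intro tendsto_lowerbound[OF r(1)]) (auto simp: eventually_sequentially)
  then show ?thesis by simp
qed

text \<open>The \<open>L^2\<close> norm for the normalized measure \<open>dx / (2 pi)\<close>, so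
  that it corresponds to \<open>hbound 0\<close> without constants. Continuity is built in to settle
  integrability once and for all.\<close>

definition l2bound :: "real \<Rightarrow> (real \<Rightarrow> real) \<Rightarrow> bool" where
  "l2bound B w \<longleftrightarrow> 0 \<le> B \<and> continuous_on UNIV w \<and> (LINT x:{0..2*pi}|lborel. (w x)\<^sup>2) \<le> 2 * pi * B\<^sup>2"

lemma l2bound_sup:
  assumes "continuous_on UNIV w" "\<And>x. \<bar>w x\<bar> \<le> B"
  shows "l2bound B w"
proof -
  have "(LINT x:{0..2*pi}|lborel. (w x)\<^sup>2) \<le> (LINT x:{0..2*pi}|lborel. B\<^sup>2)"
    by (rule set_integral_mono) (use assms in \<open>auto intro!: set_integrable_continuous continuous_intros abs_le_square_iff[THEN iffD1] intro: order_trans[OF assms(2) abs_ge_self]\<close>)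
  also have "\<dots> = 2 * pi * B\<^sup>2" by (simp add: set_lebesgue_integral_def)
  finally show ?thesis using assms(1) assms(2)[of 0] by (simp add: l2bound_def)
qed

lemma l2bound_mult:
  assumes "continuous_on UNIV b" "\<And>x. \<bar>b x\<bar> \<le> C" "l2bound B w"
  shows "l2bound (C * B) (\<lambda>x. b x * w x)"
proof -
  have w: "continuous_on UNIV w" and C: "0 \<le> C" and B: "0 \<le> B"
    using assms(3) assms(2)[of 0] by (auto simp: l2bound_def)
  have "(LINT x:{0..2*pi}|lborel. (b x * w x)\<^sup>2) \<le> (LINT x:{0..2*pi}|lborel. C\<^sup>2 * (w x)\<^sup>2)"
  proof (rule set_integral_mono)
    fix x
    show "(b x * w x)\<^sup>2 \<le> C\<^sup>2 * (w x)\<^sup>2"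
      using abs_le_square_iff[of "b x" C] assms(2)[of x] C by (simp add: power_mult_distrib mult_right_mono)
  qed (use assms(1) w in \<open>auto intro!: set_integrable_continuous continuous_intros\<close>)
  also have "\<dots> = C\<^sup>2 * (LINT x:{0..2*pi}|lborel. (w x)\<^sup>2)" by simp
  also have "\<dots> \<le> C\<^sup>2 * (2 * pi * B\<^sup>2)"
    using assms(3) by (intro mult_left_mono) (auto simp: l2bound_def)
  finally show ?thesis using assms(1) w B C by (auto simp: l2bound_def power_mult_distrib mult_ac intro: continuous_intros)
qed

lemma integral_synth_upto_square:
  assumes "herm x"
  shows "(LINT t:{0..2*pi}|lborel. (synth_upto K x t)\<^sup>2) = 2 * pi * (\<Sum>j=-int K..int K. (cmod (x j))\<^sup>2)"
proof -
  have "complex_of_real (LINT t:{0..2*pi}|lborel. synth_upto K x t * synth_upto K x t)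
      = 2 * pi * (\<Sum>j=-int K..int K. x j * fc (synth_upto K x) (- j))"
    by (intro integral_mult_trig_poly synth_upto_of_real assms set_integrable_continuous continuous_synth_upto)
  also have "(\<Sum>j=-int K..int K. x j * fc (synth_upto K x) (- j)) = (\<Sum>j=-int K..int K. complex_of_real ((cmod (x j))\<^sup>2))"
  proof (intro sum.cong refl)
    fix j assume "j \<in> {-int K..int K}"
    then have "fc (synth_upto K x) (- j) = x (- j)" by (intro fc_synth_upto assms) auto
    then show "x j * fc (synth_upto K x) (- j) = complex_of_real ((cmod (x j))\<^sup>2)"
      using assms by (simp only: herm_def complex_norm_square)
  qed
  also have "complex_of_real (2 * pi) * (\<Sum>j=-int K..int K. complex_of_real ((cmod (x j))\<^sup>2))
     = complex_of_real (2 * pi * (\<Sum>j=-int K..int K. (cmod (x j))\<^sup>2))" by simp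
  finally show ?thesis by (simp only: of_real_eq_iff power2_eq_square)
qed

lemma finite_int_subset_symmetric:
  assumes "finite (J :: int set)"
  obtains K where "J \<subseteq> {-int K..int K}"
proof -
  have "J \<subseteq> {-int (nat (\<Sum>i\<in>J. \<bar>i\<bar>))..int (nat (\<Sum>i\<in>J. \<bar>i\<bar>))}"
  proof
    fix j assume "j \<in> J"
    then have "\<bar>j\<bar> \<le> (\<Sum>i\<in>J. \<bar>i\<bar>)" using member_le_sum[of j J abs] assms by simp
    then show "j \<in> {-int (nat (\<Sum>i\<in>J. \<bar>i\<bar>))..int (nat (\<Sum>i\<in>J. \<bar>i\<bar>))}" by auto
  qed
  then show ?thesis using that by blast
qed

text \<open>The trigonometric projection \<open>p\<close> is orthogonal to \<open>w - p\<close>,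
  hence its norm is at most that of \<open>w\<close>. Any finite set of modes lies in a symmetric
  interval, where the norm of \<open>p\<close> is the sum of the squared coefficients.\<close>

lemma bessel:
  assumes "l2bound B w"
  shows "hbound 0 B (fc w)"
  unfolding hbound_def
proof safe
  fix J :: "int set" assume "finite J"
  then obtain K where K: "J \<subseteq> {-int K..int K}" by (rule finite_int_subset_symmetric)
  have w: "continuous_on UNIV w" and B: "0 \<le> B" using assms by (auto simp: l2bound_def)
  define p where "p = synth_upto K (fc w)"
  have p: "continuous_on UNIV p" unfolding p_def by (rule continuous_synth_upto)
  have "is_trig_projection K w p"
    using trig_projection_exists[OF set_integrable_continuous[OF w], of K] by (simp add: p_def synth_upto_def[abs_def])
  then have orth: "(LINT x:{0..2 * pi}|lborel. (w x - p x) * p x) = 0"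
    unfolding is_trig_projection_def by blast
  have "0 \<le> (LINT x:{0..2 * pi}|lborel. (w x - p x)\<^sup>2)"
    unfolding set_lebesgue_integral_def by (intro Bochner_Integration.integral_nonneg) simp
  also have "\<dots> = (LINT x:{0..2 * pi}|lborel. (w x)\<^sup>2 - ((p x)\<^sup>2 + 2 * ((w x - p x) * p x)))"
    by (simp add: power2_eq_square algebra_simps)
  also have "\<dots> = (LINT x:{0..2 * pi}|lborel. (w x)\<^sup>2) - ((LINT x:{0..2 * pi}|lborel. (p x)\<^sup>2)
      + 2 * (LINT x:{0..2 * pi}|lborel. (w x - p x) * p x))"
    using w p by (subst set_integral_diff(2) set_integral_add(2) set_integral_mult_right, (intro set_integrable_continuous continuous_intros; simp)+)+ simp
  finally have "(LINT x:{0..2 * pi}|lborel. (p x)\<^sup>2) \<le> 2 * pi * B\<^sup>2"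
    using orth assms by (simp add: l2bound_def)
  then have "(\<Sum>j=-int K..int K. (cmod (fc w j))\<^sup>2) \<le> B\<^sup>2"
    unfolding p_def by (subst (asm) integral_synth_upto_square) auto
  moreover have "(\<Sum>j\<in>J. (cmod (fc w j))\<^sup>2) \<le> (\<Sum>j=-int K..int K. (cmod (fc w j))\<^sup>2)"
    by (rule sum_mono2) (use K in auto)
  ultimately show "L2_set (\<lambda>j. jb j powr 0 * cmod (fc w j)) J \<le> B"
    unfolding L2_set_def using B by (intro real_le_lsqrt) (auto simp: sum_nonneg)
qed

lemma bessel_sup: "continuous_on UNIV w \<Longrightarrow> (\<And>x. \<bar>w x\<bar> \<le> B) \<Longrightarrow> hbound 0 B (fc w)"
  by (intro bessel l2bound_sup)

lemma hbound_0_sum: "hbound 0 B x \<Longrightarrow> finite J \<Longrightarrow> (\<Sum>j\<in>J. (cmod (x j))\<^sup>2) \<le> B\<^sup>2"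
  unfolding hbound_def L2_set_def by (drule spec, drule mp, assumption) (auto dest: sqrt_le_D)

text \<open>The identity holds for partial sums. The squares of the series and of its partial sum
  differ by the product of their difference and their sum, at most \<open>r K * (2 * A)\<close>,
  which vanishes in the limit.\<close>

lemma parseval:
  assumes "herm x" "wbound 0 A x" "hbound 0 B x"
  shows "l2bound B (synth x)"
proof -
  obtain r where r: "r \<longlonglongrightarrow> 0" "\<And>K t. \<bar>synth x t - synth_upto K x t\<bar> \<le> r K"
    using synth_tail[OF assms(2)] by blast
  let ?I = "\<lambda>f. LINT t:{0..2*pi}|lborel. (f t :: real)"
  have c: "continuous_on UNIV (synth x)" by (rule continuous_synth[OF assms(2)])
  have "?I (\<lambda>t. (synth x t)\<^sup>2) \<le> 2 * pi * B\<^sup>2 + r K * (2 * A) * (2 * pi)" for K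
  proof -
    have "?I (\<lambda>t. (synth x t)\<^sup>2) \<le> ?I (\<lambda>t. (synth_upto K x t)\<^sup>2 + r K * (2 * A))"
    proof (rule set_integral_mono)
      fix t
      have "wbound 0 A (\<lambda>j. if j \<in> {-int K..int K} then x j else 0)" by (rule wbound_norm_le[OF assms(2)]) auto
      from synth_bound[OF this, of t] have "\<bar>synth_upto K x t\<bar> \<le> A"
        by (subst (asm) synth_finite_support[of K]) (auto simp: synth_upto_def)
      then have "\<bar>synth x t + synth_upto K x t\<bar> \<le> 2 * A" using synth_bound[OF assms(2), of t] by linarith
      then have "\<bar>(synth x t - synth_upto K x t) * (synth x t + synth_upto K x t)\<bar> \<le> r K * (2 * A)"
        unfolding abs_mult using r(2)[of t K] by (intro mult_mono) auto
      then show "(synth x t)\<^sup>2 \<le> (synth_upto K x t)\<^sup>2 + r K * (2 * A)"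
        by (simp add: power2_eq_square algebra_simps abs_le_iff)
    qed (auto intro!: set_integrable_continuous continuous_intros c)
    also have "\<dots> = ?I (\<lambda>t. (synth_upto K x t)\<^sup>2) + ?I (\<lambda>t. r K * (2 * A))"
      by (rule set_integral_add) (auto intro!: set_integrable_continuous continuous_intros)
    also have "?I (\<lambda>t. r K * (2 * A)) = r K * (2 * A) * (2 * pi)" by (simp add: set_lebesgue_integral_def)
    also have "?I (\<lambda>t. (synth_upto K x t)\<^sup>2) \<le> 2 * pi * B\<^sup>2"
      unfolding integral_synth_upto_square[OF assms(1)] using hbound_0_sum[OF assms(3)] by simp
    finally show ?thesis by simp
  qed
  moreover have "(\<lambda>K. 2 * pi * B\<^sup>2 + r K * (2 * A) * (2 * pi)) \<longlonglongrightarrow> 2 * pi * B\<^sup>2 + 0 * (2 * A) * (2 * pi)"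
    by (intro tendsto_intros r(1))
  ultimately have "?I (\<lambda>t. (synth x t)\<^sup>2) \<le> 2 * pi * B\<^sup>2"
    by (intro tendsto_lowerbound[where F = sequentially]) auto
  then show ?thesis using c hbound_nonneg[OF assms(3)] by (simp add: l2bound_def)
qed

section \<open>Uniqueness of Fourier coefficients of continuous periodic functions\<close>

lemma periodic_int:
  assumes "periodic w"
  shows "w (x + 2 * pi * of_int n) = w x"
proof -
  have nat: "w (x + 2 * pi * real n) = w x" for x n
  proof (induction n)
    case (Suc n)
    have "w (x + 2 * pi * real (Suc n)) = w ((x + 2 * pi * real n) + 2 * pi)" by (simp add: algebra_simps)
    then show ?case using Suc assms by (simp add: periodic_def)
  qed simp
  show ?thesis
  proof (cases "0 \<le> n")
    case True
    then show ?thesis using nat[of x "nat n"] by simp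
  next
    case False
    then show ?thesis using nat[of "x + 2 * pi * of_int n" "nat (- n)"] by (simp add: algebra_simps)
  qed
qed

text \<open>Each branch of the argument has a cut: \<open>Arg\<close> along the negative axis,
  \<open>Arg2pi\<close> along the positive one. No point of the circle lies on both, and periodicity
  makes the two branches give the same value of \<open>w\<close>.\<close>

lemma continuous_on_circle_lift:
  assumes "periodic w" "continuous_on UNIV w"
  obtains W :: "complex \<Rightarrow> real" where "continuous_on (sphere 0 1) W" "\<And>x. W (cis x) = w x"
proof -
  define W where "W z = w (Arg z)" for z
  have eq: "w x = w y" if "cis x = cis y" for x y
  proof -
    have "sin x = sin y \<and> cos x = cos y" using that by (simp add: complex_eq_iff)
    then obtain n :: int where "x = y + 2 * pi * n" by (auto simp: sin_cos_eq_iff)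
    then show ?thesis using periodic_int[OF assms(1)] by simp
  qed
  have wc: "isCont w x" for x using assms(2) by (simp add: continuous_on_eq_continuous_at)
  have "continuous (at z within sphere 0 1) W" if z: "z \<in> sphere 0 1" for z
  proof (cases "z \<in> \<real>\<^sub>\<le>\<^sub>0")
    case False
    then have "isCont (\<lambda>z. w (Arg z)) z"
      by (intro isCont_o2[OF continuous_at_Arg wc]) auto
    then show ?thesis unfolding W_def by (rule continuous_at_imp_continuous_within)
  next
    case True
    then have "z \<notin> \<real>\<^sub>\<ge>\<^sub>0" using z by (auto simp: complex_nonpos_Reals_iff complex_nonneg_Reals_iff cmod_def)
    then have "isCont (\<lambda>z. w (Arg2pi z)) z"
      by (intro isCont_o2[OF continuous_at_Arg2pi wc])
    then have c: "continuous (at z within sphere 0 1) (\<lambda>z. w (Arg2pi z))" by (rule continuous_at_imp_continuous_within)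
    have "w (Arg2pi y) = W y" if "y \<in> sphere 0 1" for y
      unfolding W_def
    proof (rule eq)
      have "cmod y = 1" using that by simp
      then have "cis (Arg y) = y" using cis_Arg[of y] by (cases "y = 0") (auto simp: sgn_div_norm)
      moreover have "cis (Arg2pi y) = y" using Arg2pi_eq[of y] \<open>cmod y = 1\<close> by (simp add: cis_conv_exp)
      ultimately show "cis (Arg2pi y) = cis (Arg y)" by simp
    qed
    then show ?thesis by (rule continuous_transform_within[OF c zero_less_one z])
  qed
  moreover have "W (cis x) = w x" for x
  proof -
    have "cis (Arg (cis x)) = cis x" using cis_Arg[of "cis x"] by (auto simp: sgn_div_norm)
    then show ?thesis unfolding W_def by (rule eq)
  qed
  ultimately show ?thesis by (intro that[of W]) (simp_all add: continuous_on_eq_continuous_within)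
qed

text \<open>By Stone--Weierstrass on the unit circle. The functions orthogonal to everything are
  closed under multiplication by \<open>cos\<close> and \<open>sin\<close>, hence by polynomials in them.\<close>

lemma fourier_unique:
  assumes per: "periodic w" and w: "continuous_on UNIV w" and zero: "\<And>j. fc w j = 0"
  shows "w x = 0"
proof -
  define I where "I f = (LINT x:{0..2*pi}|lborel. (f x :: complex))" for f
  \<comment> \<open>\<open>N\<close> collects the \<open>q\<close> for which all Fourier
    coefficients of \<open>w * q\<close> vanish, \<open>M\<close> the multipliers that map
    \<open>N\<close> to itself. Closure under products is immediate for \<open>M\<close>, though not
    for \<open>N\<close>; since the constant 1 is in \<open>N\<close>, \<open>M\<close> is contained
    in \<open>N\<close>.\<close>
  define N where "N = {q. continuous_on UNIV q \<and> (\<forall>j::int. I (\<lambda>x. complex_of_real (w x * q x) * cis (real_of_int j * x)) = 0)}"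
  define M where "M = {q. continuous_on UNIV q \<and> (\<forall>r\<in>N. (\<lambda>x. q x * r x) \<in> N)}"
  have one: "(\<lambda>x. 1) \<in> N"
  proof -
    have "I (\<lambda>x. complex_of_real (w x) * cis (real_of_int j * x)) = 0" for j
      using zero[of "- j"] by (simp add: fourier_coeff_def I_def)
    then show ?thesis by (simp add: N_def)
  qed
  have Icont: "set_integrable lborel {0..2*pi} f" if "continuous_on UNIV f" for f :: "real \<Rightarrow> complex"
    by (rule set_integrable_continuous[OF that])
  have Nadd: "(\<lambda>x. a * q x + b * r x) \<in> N" if "q \<in> N" "r \<in> N" for q r a b
  proof -
    have c: "continuous_on UNIV q" "continuous_on UNIV r" using that by (auto simp: N_def)
    have "I (\<lambda>x. complex_of_real (w x * (a * q x + b * r x)) * cis (real_of_int j * x)) = 0" for j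
    proof -
      have "I (\<lambda>x. complex_of_real (w x * (a * q x + b * r x)) * cis (real_of_int j * x))
          = I (\<lambda>x. complex_of_real a * (complex_of_real (w x * q x) * cis (real_of_int j * x))
               + complex_of_real b * (complex_of_real (w x * r x) * cis (real_of_int j * x)))"
        by (simp add: algebra_simps)
      also have "\<dots> = complex_of_real a * I (\<lambda>x. complex_of_real (w x * q x) * cis (real_of_int j * x))
               + complex_of_real b * I (\<lambda>x. complex_of_real (w x * r x) * cis (real_of_int j * x))"
        unfolding I_def
        by (subst set_integral_add(2)) (use c w in \<open>auto intro!: set_integrable_mult_right Icont continuous_intros continuous_on_cis\<close>)
      also have "\<dots> = 0" using that by (simp add: N_def)
      finally show ?thesis .
    qed
    then show ?thesis using c by (auto simp: N_def intro!: continuous_intros)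
  qed
  have trig: "(\<lambda>x. cos x) \<in> M" "(\<lambda>x. sin x) \<in> M"
  proof -
    have "I (\<lambda>x. complex_of_real (w x * (t x * r x)) * cis (real_of_int j * x)) = 0"
      if r: "r \<in> N" and t: "t = cos \<or> t = sin" for r j t
    proof -
      have c: "continuous_on UNIV r" using r by (auto simp: N_def)
      \<comment> \<open>The coefficients in Euler's formulas for \<open>cos\<close> and
        \<open>sin\<close>. Multiplication by these functions thus only shifts the mode
        \<open>j\<close> by one in both directions.\<close>
      define b :: complex where "b = (if t = cos then 1 / 2 else - \<i> / 2)"
      define b' :: complex where "b' = (if t = cos then 1 / 2 else \<i> / 2)"
      have tb: "complex_of_real (t x) * cis (real_of_int j * x)
          = b * cis (real_of_int (j + 1) * x) + b' * cis (real_of_int (j - 1) * x)" for x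
      proof -
        have "complex_of_real (t x) = b * cis x + b' * cis (- x)"
        proof (cases "t = cos")
          case False
          then have "t = sin" using t by simp
          then show ?thesis using False by (auto simp: b_def b'_def complex_eq_iff)
        qed (auto simp: b_def b'_def complex_eq_iff)
        then show ?thesis by (simp add: distrib_right mult.assoc cis_mult) (simp add: algebra_simps)
      qed
      have "I (\<lambda>x. complex_of_real (w x * (t x * r x)) * cis (real_of_int j * x))
          = I (\<lambda>x. b * (complex_of_real (w x * r x) * cis (real_of_int (j + 1) * x))
               + b' * (complex_of_real (w x * r x) * cis (real_of_int (j - 1) * x)))"
      proof (rule arg_cong[of _ _ I], rule ext)
        fix x
        have "complex_of_real (w x * (t x * r x)) * cis (real_of_int j * x)
            = complex_of_real (w x * r x) * (complex_of_real (t x) * cis (real_of_int j * x))"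
          by (simp add: mult_ac)
        then show "complex_of_real (w x * (t x * r x)) * cis (real_of_int j * x)
            = b * (complex_of_real (w x * r x) * cis (real_of_int (j + 1) * x))
               + b' * (complex_of_real (w x * r x) * cis (real_of_int (j - 1) * x))"
          unfolding tb by (simp add: algebra_simps)
      qed
      also have "\<dots> = b * I (\<lambda>x. complex_of_real (w x * r x) * cis (real_of_int (j + 1) * x))
               + b' * I (\<lambda>x. complex_of_real (w x * r x) * cis (real_of_int (j - 1) * x))"
        unfolding I_def
        by (subst set_integral_add(2)) (use c w in \<open>auto intro!: set_integrable_mult_right Icont continuous_intros continuous_on_cis simp del: of_int_add of_int_diff\<close>)
      also have "\<dots> = 0"
      proof -
        have "I (\<lambda>x. complex_of_real (w x * r x) * cis (real_of_int i * x)) = 0" for i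
          using r unfolding N_def by blast
        then show ?thesis by (simp only: mult_zero_right add_0_left)
      qed
      finally show ?thesis .
    qed
    then show "(\<lambda>x. cos x) \<in> M" "(\<lambda>x. sin x) \<in> M"
      unfolding M_def N_def by (auto intro!: continuous_intros)
  qed
  have Mlin: "(\<lambda>x. a * q x + b * r x) \<in> M" if "q \<in> M" "r \<in> M" for q r a b
  proof -
    have "(\<lambda>x. (a * q x + b * r x) * s x) \<in> N" if s: "s \<in> N" for s
      using Nadd[of "\<lambda>x. q x * s x" "\<lambda>x. r x * s x" a b] \<open>q \<in> M\<close> \<open>r \<in> M\<close> s
      by (simp add: M_def distrib_right mult.assoc)
    then show ?thesis using that by (auto simp: M_def intro!: continuous_intros)
  qed
  have poly: "(\<lambda>x. p (cis x)) \<in> M" if "real_polynomial_function p" for p :: "complex \<Rightarrow> real"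
    using that
  proof induction
    case (linear f)
    then interpret bounded_linear f .
    have "f (cis x) = f 1 * cos x + f \<i> * sin x" for x
    proof -
      have "cis x = cos x *\<^sub>R 1 + sin x *\<^sub>R \<i>" by (simp add: complex_eq_iff)
      then show ?thesis by (simp only: add scaleR) simp
    qed
    then show ?case using Mlin[OF trig, of "f 1" "f \<i>"] by simp
  next
    case (const c)
    have "(\<lambda>x. c * r x) \<in> N" if "r \<in> N" for r using Nadd[OF that that, of c 0] by simp
    then show ?case by (simp add: M_def)
  next
    case (add f g)
    then show ?case using Mlin[of "\<lambda>x. f (cis x)" "\<lambda>x. g (cis x)" 1 1] by simp
  next
    case (mult f g)
    then show ?case by (auto simp: M_def mult.assoc intro!: continuous_intros)
  qed
  obtain W where W: "continuous_on (sphere 0 1) W" "\<And>x. W (cis x) = w x"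
    using continuous_on_circle_lift[OF per w] by blast
  define A where "A = (LINT x:{0..2*pi}|lborel. \<bar>w x\<bar>)"
  \<comment> \<open>A polynomial \<open>q\<close> in \<open>cos\<close> and \<open>sin\<close> that
    is uniformly \<open>e\<close>-close to \<open>w\<close> is orthogonal to \<open>w\<close>, so
    the integral of \<open>w^2\<close> equals that of \<open>w * (w - q)\<close>.\<close>
  have small: "(LINT x:{0..2*pi}|lborel. (w x)\<^sup>2) \<le> e * A" if "0 < e" for e
  proof -
    obtain p where p: "real_polynomial_function p" "\<And>z. z \<in> sphere 0 1 \<Longrightarrow> \<bar>W z - p z\<bar> < e"
      using Stone_Weierstrass_real_polynomial_function[OF compact_sphere W(1) \<open>0 < e\<close>] by blast
    define q where "q x = p (cis x)" for x
    have q: "q \<in> M" unfolding q_def by (rule poly[OF p(1)])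
    then have "q \<in> N" and qc: "continuous_on UNIV q" using one by (force simp: M_def)+
    then have "I (\<lambda>x. complex_of_real (w x * q x) * cis (real_of_int 0 * x)) = 0" unfolding N_def by blast
    then have "complex_of_real (LINT x:{0..2*pi}|lborel. w x * q x) = 0"
      by (simp add: I_def flip: set_integral_complex_of_real)
    then have 0: "(LINT x:{0..2*pi}|lborel. w x * q x) = 0" by simp
    have wq: "\<bar>w x - q x\<bar> \<le> e" for x using p(2)[of "cis x"] W(2)[of x] by (simp add: q_def less_imp_le)
    have "(LINT x:{0..2*pi}|lborel. (w x)\<^sup>2) \<le> (LINT x:{0..2*pi}|lborel. w x * q x + e * \<bar>w x\<bar>)"
    proof (rule set_integral_mono)
      fix x
      have "w x * (w x - q x) \<le> \<bar>w x\<bar> * \<bar>w x - q x\<bar>" by (simp flip: abs_mult)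
      also have "\<dots> \<le> \<bar>w x\<bar> * e" by (rule mult_left_mono[OF wq]) simp
      finally show "(w x)\<^sup>2 \<le> w x * q x + e * \<bar>w x\<bar>" by (simp add: power2_eq_square algebra_simps)
    qed (auto intro!: set_integrable_continuous continuous_intros w qc)
    also have "\<dots> = e * A"
      unfolding A_def
      by (subst set_integral_add(2)) (auto intro!: set_integrable_continuous continuous_intros w qc simp: 0)
    finally show ?thesis .
  qed
  have "A \<ge> 0" unfolding A_def set_lebesgue_integral_def by (intro Bochner_Integration.integral_nonneg) simp
  have "(LINT x:{0..2*pi}|lborel. (w x)\<^sup>2) \<le> 0"
  proof (rule field_le_epsilon)
    fix e :: real assume "0 < e"
    then have "(LINT x:{0..2*pi}|lborel. (w x)\<^sup>2) \<le> e / (A + 1) * A"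
      using small[of "e / (A + 1)"] \<open>A \<ge> 0\<close> by simp
    also have "\<dots> \<le> e" using \<open>A \<ge> 0\<close> \<open>0 < e\<close> by (simp add: field_simps)
    finally show "(LINT x:{0..2*pi}|lborel. (w x)\<^sup>2) \<le> 0 + e" by simp
  qed
  moreover have "0 \<le> (LINT x:{0..2*pi}|lborel. (w x)\<^sup>2)"
    unfolding set_lebesgue_integral_def by (intro Bochner_Integration.integral_nonneg) simp
  ultimately have I0: "(LINT x:{0..2*pi}|lborel. (w x)\<^sup>2) = 0" by simp
  have si: "set_integrable lborel {0..2*pi} (\<lambda>x. (w x)\<^sup>2)" by (auto intro!: set_integrable_continuous continuous_intros w)
  have "((\<lambda>x. (w x)\<^sup>2) has_integral 0) (cbox 0 (2*pi))"
    using has_integral_set_lebesgue[of "{0..2*pi}" "\<lambda>x. (w x)\<^sup>2"] set_borel_integral_eq_integral[OF si] I0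
    by (simp add: has_integral_iff)
  then have z: "w y = 0" if "y \<in> {0..2*pi}" for y
  proof -
    have "continuous_on {0..2*pi} (\<lambda>x. (w x)\<^sup>2)"
      by (intro continuous_intros continuous_on_subset[OF w]) auto
    then show ?thesis
      using has_integral_0_cbox_imp_0[of 0 "2*pi" "\<lambda>x. (w x)\<^sup>2" y] that \<open>((\<lambda>x. (w x)\<^sup>2) has_integral 0) (cbox 0 (2*pi))\<close>
      by (auto simp: box_ne_empty not_le)
  qed
  define n where "n = \<lfloor>x / (2 * pi)\<rfloor>"
  have "of_int n \<le> x / (2 * pi)" "x / (2 * pi) < of_int n + 1" unfolding n_def by linarith+
  then have "x + 2 * pi * of_int (- n) \<in> {0..2*pi}" by (simp add: field_simps)
  from z[OF this] show ?thesis using periodic_int[OF per, of x "- n"] by simp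
qed

text \<open>Inversion: the series and \<open>w\<close> are continuous with the same coefficients, so
  uniqueness applies to their difference.\<close>

lemma synth_fc:
  assumes "periodic w" "continuous_on UNIV w" "wbound 0 A (fc w)"
  shows "synth (fc w) = w"
proof
  fix x
  have "(\<lambda>x. synth (fc w) x - w x) x = 0"
    by (rule fourier_unique)
      (use assms periodic_synth[of "fc w"] in \<open>auto simp: periodic_def fc_diff continuous_synth fc_synth intro!: continuous_intros continuous_synth\<close>)
  then show "synth (fc w) x = w x" by simp
qed

section \<open>Functions with bounded derivatives\<close>

text \<open>Bounds \<open>\<phi> i\<close> that grow with the order \<open>i\<close> of the derivative are needed for trigonometric
  polynomials whose degree tends to infinity.\<close>

primrec ck_bound :: "nat \<Rightarrow> (nat \<Rightarrow> real) \<Rightarrow> (real \<Rightarrow> real) \<Rightarrow> bool" where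
  "ck_bound 0 \<phi> w \<longleftrightarrow> periodic w \<and> continuous_on UNIV w \<and> (\<forall>x. \<bar>w x\<bar> \<le> \<phi> 0)"
| "ck_bound (Suc k) \<phi> w \<longleftrightarrow> periodic w \<and> continuous_on UNIV w \<and> (\<forall>x. \<bar>w x\<bar> \<le> \<phi> 0) \<and>
     (\<exists>w'. (\<forall>x. (w has_real_derivative w' x) (at x)) \<and> ck_bound k (\<lambda>i. \<phi> (Suc i)) w')"

lemma ck_boundD:
  assumes "ck_bound k \<phi> w"
  shows "periodic w" "continuous_on UNIV w" "\<And>x. \<bar>w x\<bar> \<le> \<phi> 0"
  using assms by (cases k; simp)+

lemma ck_bound_SucI:
  assumes "periodic w" "\<And>x. \<bar>w x\<bar> \<le> \<phi> 0" "\<And>x. (w has_real_derivative w' x) (at x)" "ck_bound k (\<lambda>i. \<phi> (Suc i)) w'"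
  shows "ck_bound (Suc k) \<phi> w"
  using assms DERIV_continuous_on[of UNIV w w'] by auto

lemma ck_bound_SucE:
  assumes "ck_bound (Suc k) \<phi> w"
  obtains w' where "\<And>x. (w has_real_derivative w' x) (at x)" "ck_bound k (\<lambda>i. \<phi> (Suc i)) w'"
  using assms by auto

lemma ck_bound_mono: "ck_bound k \<phi> w \<Longrightarrow> (\<And>i. i \<le> k \<Longrightarrow> \<phi> i \<le> \<psi> i) \<Longrightarrow> ck_bound k \<psi> w"
proof (induction k arbitrary: \<phi> \<psi> w)
  case 0
  then show ?case by (auto intro: order_trans)
next
  case (Suc k)
  then obtain w' where w': "\<And>x. (w has_real_derivative w' x) (at x)" "ck_bound k (\<lambda>i. \<phi> (Suc i)) w'" by auto
  have "ck_bound k (\<lambda>i. \<psi> (Suc i)) w'" by (rule Suc.IH[OF w'(2)]) (use Suc.prems(2) in auto)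
  moreover have "\<bar>w x\<bar> \<le> \<psi> 0" for x using Suc.prems(1) Suc.prems(2)[of 0] by (force intro: order_trans)
  ultimately show ?case using ck_boundD(1)[OF Suc.prems(1)] w'(1) by (intro ck_bound_SucI)
qed

lemma ck_bound_Suc_imp: "ck_bound (Suc k) \<phi> w \<Longrightarrow> ck_bound k \<phi> w"
proof (induction k arbitrary: \<phi> w)
  case (Suc k)
  obtain w' where w': "\<And>x. (w has_real_derivative w' x) (at x)" "ck_bound (Suc k) (\<lambda>i. \<phi> (Suc i)) w'"
    using ck_bound_SucE[OF Suc.prems] by blast
  show ?case using ck_boundD[OF Suc.prems] by (intro ck_bound_SucI[OF _ _ w'(1) Suc.IH[OF w'(2)]])
qed auto

lemma ck_bound_le: "ck_bound k \<phi> w \<Longrightarrow> m \<le> k \<Longrightarrow> ck_bound m \<phi> w"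
  by (rotate_tac 1, induction k rule: dec_induct) (auto dest: ck_bound_Suc_imp simp del: ck_bound.simps)

lemma ck_bound_add: "ck_bound k \<phi> f \<Longrightarrow> ck_bound k \<psi> g \<Longrightarrow> ck_bound k (\<lambda>i. \<phi> i + \<psi> i) (\<lambda>x. f x + g x)"
proof (induction k arbitrary: \<phi> \<psi> f g)
  case 0
  then show ?case
    by (auto simp: periodic_def intro!: continuous_intros order_trans[OF abs_triangle_ineq] add_mono)
next
  case (Suc k)
  then obtain f' g' where
    f': "\<And>x. (f has_real_derivative f' x) (at x)" "ck_bound k (\<lambda>i. \<phi> (Suc i)) f'" and
    g': "\<And>x. (g has_real_derivative g' x) (at x)" "ck_bound k (\<lambda>i. \<psi> (Suc i)) g'" by auto
  have "((\<lambda>x. f x + g x) has_real_derivative f' x + g' x) (at x)" for x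
    by (intro derivative_intros f' g')
  then show ?case using ck_boundD[OF Suc.prems(1)] ck_boundD[OF Suc.prems(2)]
    by (intro ck_bound_SucI[OF _ _ _ Suc.IH[OF f'(2) g'(2)]])
      (auto simp: periodic_def intro!: order_trans[OF abs_triangle_ineq] add_mono)
qed

text \<open>Leibniz rule: every differentiation doubles the number of terms, hence
  \<open>2 ^ i\<close>. The majorant \<rho> of the products depends only on the total order, which
  is what makes bounds growing with the order manageable.\<close>

lemma ck_bound_mult:
  "ck_bound k \<phi> f \<Longrightarrow> ck_bound k \<psi> g \<Longrightarrow> (\<And>l m. l + m \<le> k \<Longrightarrow> \<phi> l * \<psi> m \<le> \<rho> (l + m)) \<Longrightarrow>
   ck_bound k (\<lambda>i. 2 ^ i * \<rho> i) (\<lambda>x. f x * g x)"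
proof (induction k arbitrary: \<phi> \<psi> \<rho> f g)
  case 0
  have "\<bar>f x * g x\<bar> \<le> \<phi> 0 * \<psi> 0" for x
    unfolding abs_mult using ck_boundD(3)[OF 0(1), of x] ck_boundD(3)[OF 0(2), of x] by (intro mult_mono) auto
  then show ?case using 0 by (force simp: periodic_def intro!: continuous_intros intro: order_trans)
next
  case (Suc k)
  then obtain f' g' where
    f': "\<And>x. (f has_real_derivative f' x) (at x)" "ck_bound k (\<lambda>i. \<phi> (Suc i)) f'" and
    g': "\<And>x. (g has_real_derivative g' x) (at x)" "ck_bound k (\<lambda>i. \<psi> (Suc i)) g'" by auto
  have f: "ck_bound k \<phi> f" and g: "ck_bound k \<psi> g" using Suc.prems(1,2) by (auto intro: ck_bound_Suc_imp simp del: ck_bound.simps)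
  have 1: "ck_bound k (\<lambda>i. 2 ^ i * \<rho> (Suc i)) (\<lambda>x. f' x * g x)"
    by (rule Suc.IH[OF f'(2) g]) (use Suc.prems(3)[of "Suc _"] in simp)
  have 2: "ck_bound k (\<lambda>i. 2 ^ i * \<rho> (Suc i)) (\<lambda>x. f x * g' x)"
    by (rule Suc.IH[OF f g'(2)]) (use Suc.prems(3)[of _ "Suc _"] in simp)
  have "ck_bound k (\<lambda>i. 2 ^ Suc i * \<rho> (Suc i)) (\<lambda>x. f' x * g x + f x * g' x)"
    by (rule ck_bound_mono[OF ck_bound_add[OF 1 2]]) simp
  moreover have "((\<lambda>x. f x * g x) has_real_derivative f' x * g x + f x * g' x) (at x)" for x
    using DERIV_mult[OF f'(1) g'(1)] by (simp add: add.commute mult.commute)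
  moreover have "\<bar>f x * g x\<bar> \<le> \<rho> 0" for x
  proof -
    have "\<bar>f x * g x\<bar> \<le> \<phi> 0 * \<psi> 0"
      unfolding abs_mult using ck_boundD(3)[OF f, of x] ck_boundD(3)[OF g, of x] by (intro mult_mono) auto
    also have "\<dots> \<le> \<rho> 0" using Suc.prems(3)[of 0 0] by simp
    finally show ?thesis .
  qed
  ultimately show ?case
    using ck_boundD(1)[OF f] ck_boundD(1)[OF g] by (intro ck_bound_SucI) (auto simp: periodic_def)
qed

lemma ck_bound_synth:
  assumes "\<And>i. i \<le> k \<Longrightarrow> wbound (real i) (\<phi> i) x"
  shows "ck_bound k \<phi> (synth x)"
  using assms
proof (induction k arbitrary: \<phi> x)
  case 0
  then have w: "wbound 0 (\<phi> 0) x" by force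
  show ?case using continuous_synth[OF w] synth_bound[OF w] by simp
next
  case (Suc k)
  have w: "wbound 0 (\<phi> 0) x" using Suc.prems[of 0] by simp
  have w1: "wbound 1 (\<phi> 1) x" using Suc.prems[of 1] by simp
  have "ck_bound k (\<lambda>i. \<phi> (Suc i)) (synth (\<lambda>j. \<i> * of_int j * x j))"
  proof (rule Suc.IH)
    fix i assume "i \<le> k"
    then have "wbound (real i + real 1) (\<phi> (Suc i)) x" using Suc.prems[of "Suc i"] by (simp add: add.commute)
    from wbound_pow_mult[OF this] show "wbound (real i) (\<phi> (Suc i)) (\<lambda>j. \<i> * of_int j * x j)" by simp
  qed
  then show ?case using continuous_synth[OF w] synth_bound[OF w] synth_DERIV[OF w1] by auto
qed

text \<open>Integration by parts; the boundary terms cancel by periodicity of \<open>w\<close> and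
  of the exponential.\<close>

lemma fc_deriv:
  assumes "periodic w" "\<And>x. (w has_real_derivative w' x) (at x)" "continuous_on UNIV w'"
  shows "fc w' j = \<i> * of_int j * fc w j"
proof -
  let ?e = "\<lambda>x. cis (- (real_of_int j * x))"
  define F where "F x = complex_of_real (w x) * ?e x" for x
  define f where "f x = complex_of_real (w' x) * ?e x - \<i> * of_int j * (complex_of_real (w x) * ?e x)" for x
  have w: "continuous_on UNIV w"
    using assms(2) by (intro DERIV_continuous_on[of UNIV w w']) auto
  have "(F has_vector_derivative f x) (at x within {0..2*pi})" for x
  proof -
    have "((\<lambda>z. exp (- \<i> * of_int j * z)) has_field_derivative (- \<i> * of_int j) * exp (- \<i> * of_int j * of_real x)) (at (of_real x))"
      by (auto intro!: derivative_eq_intros)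
    from has_vector_derivative_real_field[OF this]
    have "(?e has_vector_derivative - \<i> * of_int j * ?e x) (at x)" by (simp add: cis_conv_exp mult_ac)
    moreover have "((\<lambda>x. complex_of_real (w x)) has_vector_derivative complex_of_real (w' x)) (at x)"
      using assms(2)[of x] by (intro has_vector_derivative_of_real) (simp add: has_real_derivative_iff_has_vector_derivative)
    ultimately have "(F has_vector_derivative complex_of_real (w x) * (- \<i> * of_int j * ?e x) + complex_of_real (w' x) * ?e x) (at x)"
      unfolding F_def by (rule has_vector_derivative_mult[rotated])
    then have "(F has_vector_derivative f x) (at x)" by (simp add: f_def algebra_simps)
    then show ?thesis by (rule has_vector_derivative_at_within)
  qed
  moreover have fc: "continuous_on UNIV f"
    unfolding f_def by (intro continuous_intros continuous_on_cis w assms(3))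
  ultimately have "(LINT x:{0..2*pi}|lborel. f x) = F (2*pi) - F 0"
    unfolding set_lebesgue_integral_def
    by (intro integral_FTC_Icc) (auto intro: continuous_on_subset)
  also have "F (2*pi) = F 0"
    using cis_multiple_2pi[of "- of_int j"] assms(1)[unfolded periodic_def, rule_format, of 0]
    by (simp add: F_def mult.assoc mult.commute)
  also have "(LINT x:{0..2*pi}|lborel. f x) = (LINT x:{0..2*pi}|lborel. complex_of_real (w' x) * ?e x)
      - \<i> * of_int j * (LINT x:{0..2*pi}|lborel. complex_of_real (w x) * ?e x)"
    unfolding f_def
    by (subst set_integral_diff(2))
      (auto intro!: set_integrable_mult_right set_integrable_continuous continuous_intros continuous_on_cis w assms(3))
  finally show ?thesis by (simp add: fourier_coeff_def)
qed

lemma ck_bound_fc: "ck_bound k \<phi> w \<Longrightarrow> i \<le> k \<Longrightarrow> hbound 0 (\<phi> i) (\<lambda>j. (\<i> * of_int j) ^ i * fc w j)"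
proof (induction i arbitrary: k \<phi> w)
  case 0
  then show ?case using bessel_sup[OF ck_boundD(2,3)[OF 0(1)]] by simp
next
  case (Suc i)
  then obtain k' where k: "k = Suc k'" by (cases k) auto
  with Suc.prems obtain w' where w': "\<And>x. (w has_real_derivative w' x) (at x)" "ck_bound k' (\<lambda>i. \<phi> (Suc i)) w'" by auto
  have "fc w' j = \<i> * of_int j * fc w j" for j
    by (rule fc_deriv[OF ck_boundD(1)[OF Suc.prems(1)] w'(1) ck_boundD(2)[OF w'(2)]])
  then show ?case using Suc.IH[OF w'(2)] Suc.prems(2) k by (simp add: mult_ac)
qed

text \<open>Since \<open>jb j\<close> is at most twice the maximum of 1 and |j|, the weight of order
  \<open>k\<close> is controlled by the derivatives of orders 0 and \<open>k\<close> alone.\<close>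

lemma hbound_from_0:
  assumes "hbound 0 A x" "hbound 0 B (\<lambda>j. (\<i> * of_int j) ^ k * x j)"
  shows "hbound (real k) (2 ^ k * (A + B)) x"
proof -
  \<comment> \<open>Passing to moduli before adding excludes cancellation between a coefficient and
    its multiple by the power of \<open>i j\<close>.\<close>
  have "hbound 0 A (\<lambda>j. complex_of_real (cmod (x j)))" by (rule hbound_norm_le[OF assms(1)]) simp
  moreover have "hbound 0 B (\<lambda>j. complex_of_real (\<bar>real_of_int j\<bar> ^ k * cmod (x j)))"
    by (rule hbound_norm_le[OF assms(2)]) (simp add: norm_mult norm_power)
  ultimately have s: "hbound 0 (A + B) (\<lambda>j. complex_of_real (cmod (x j)) + complex_of_real (\<bar>real_of_int j\<bar> ^ k * cmod (x j)))"
    by (rule hbound_add)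
  show ?thesis
  proof (rule hbound_dominated[OF s])
    fix j
    have "jb j ^ k \<le> (2 * max 1 \<bar>real_of_int j\<bar>) ^ k"
      using jb_le_1_abs[of j] by (intro power_mono) auto
    also have "\<dots> = 2 ^ k * (max 1 \<bar>real_of_int j\<bar>) ^ k" by (simp add: power_mult_distrib)
    also have "\<dots> \<le> 2 ^ k * (1 + \<bar>real_of_int j\<bar> ^ k)"
      by (intro mult_left_mono) (auto simp: max_def)
    finally have "jb j ^ k * cmod (x j) \<le> 2 ^ k * (1 + \<bar>real_of_int j\<bar> ^ k) * cmod (x j)"
      by (rule mult_right_mono) simp
    also have "\<dots> = 2 ^ k * cmod (complex_of_real (cmod (x j)) + complex_of_real (\<bar>real_of_int j\<bar> ^ k * cmod (x j)))"
      unfolding of_real_add[symmetric] norm_of_real by (simp add: distrib_right)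
    finally show "jb j powr real k * cmod (x j) \<le> 2 ^ k * (jb j powr 0 *
        cmod (complex_of_real (cmod (x j)) + complex_of_real (\<bar>real_of_int j\<bar> ^ k * cmod (x j))))"
      by (simp add: powr_realpow)
  qed simp
qed

lemma ck_bound_imp_hbound: "ck_bound k \<phi> w \<Longrightarrow> hbound (real k) (2 ^ k * (\<phi> 0 + \<phi> k)) (fc w)"
  using hbound_from_0[of "\<phi> 0" "fc w" "\<phi> k" k] ck_bound_fc[of k \<phi> w 0] ck_bound_fc[of k \<phi> w k] by simp

text \<open>Modes are selected by a predicate so that the same arguments run with the constant
  \<open>True\<close>, where nothing is truncated, and with \<open>low K\<close>.\<close>

definition supp :: "(int \<Rightarrow> bool) \<Rightarrow> (int \<Rightarrow> complex) \<Rightarrow> bool" where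
  "supp S x \<longleftrightarrow> (\<forall>j. \<not> S j \<longrightarrow> x j = 0)"

definition low :: "nat \<Rightarrow> int \<Rightarrow> bool" where
  "low K j \<longleftrightarrow> j \<in> {-int K..int K}"

lemma low_uminus [simp]: "low K (- j) = low K j"
  by (auto simp: low_def)

text \<open>Supplies convergence only: \<open>A\<close> depends on \<open>K\<close>, so a bound
  obtained here must not enter a final constant.\<close>

lemma finite_support_bounds:
  assumes "supp (low K) x"
  obtains A where "wbound r A x" "hbound r A x"
proof -
  define A where "A = (\<Sum>j=-int K..int K. jb j powr r * cmod (x j))"
  have 1: "(\<Sum>j\<in>J. jb j powr r * cmod (x j)) \<le> A" if "finite J" for J
  proof -
    have "(\<Sum>j\<in>J. jb j powr r * cmod (x j)) = (\<Sum>j\<in>J \<inter> {-int K..int K}. jb j powr r * cmod (x j))"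
      by (rule sum.mono_neutral_right) (use that assms in \<open>auto simp: supp_def low_def\<close>)
    also have "\<dots> \<le> A" unfolding A_def by (rule sum_mono2) auto
    finally show ?thesis .
  qed
  moreover have "L2_set (\<lambda>j. jb j powr r * cmod (x j)) J \<le> A" if "finite J" for J
    using L2_set_le_sum[of J "\<lambda>j. jb j powr r * cmod (x j)"] 1[OF that] by simp
  ultimately show ?thesis using that[of A] by (simp add: wbound_def hbound_def)
qed

text \<open>The \<open>k\<close>-th derivative of the product need not exist pointwise, so trigonometric
  polynomials are treated first.\<close>

lemma hbound_fc_mult_upto:
  assumes "ck_bound k (\<lambda>_. B) b" "herm x" "hbound (real k) M x" "supp (low K) x"
  shows "hbound (real k) (3 ^ k * (B * M)) (fc (\<lambda>t. b t * synth x t))"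
  using assms
proof (induction k arbitrary: b x)
  case 0
  obtain A where "wbound 0 A x" using finite_support_bounds[OF 0(4)] by blast
  then have "l2bound M (synth x)" using parseval 0 by auto
  then show ?case using bessel[OF l2bound_mult[OF ck_boundD(2,3)[OF 0(1)]]] by simp
next
  case (Suc k)
  obtain A where wf: "wbound 1 A x" using finite_support_bounds[OF Suc.prems(4)] by blast
  define d where "d j = \<i> * of_int j * x j" for j
  obtain b' where b': "\<And>t. (b has_real_derivative b' t) (at t)" "ck_bound k (\<lambda>_. B) b'" using Suc.prems(1) by auto
  have b: "ck_bound k (\<lambda>_. B) b" using Suc.prems(1) by (rule ck_bound_Suc_imp)
  have xk: "hbound (real k) M x" using Suc.prems(3) by (rule hbound_weaken) simp
  have dk: "hbound (real k) M d"
    using hbound_pow_mult[of "real k" 1 M x] Suc.prems(3) by (simp add: d_def[abs_def] add.commute)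
  have hd: "herm d" using Suc.prems(2) by (simp add: herm_def d_def)
  have d0: "supp (low K) d" using Suc.prems(4) by (simp add: supp_def d_def)
  have wd: "wbound 0 A d"
    using wbound_pow_mult[of 0 1 A x] wf by (simp add: d_def[abs_def])
  have 1: "hbound (real k) (3 ^ k * (B * M)) (fc (\<lambda>t. b t * synth x t))"
    by (rule Suc.IH[OF b Suc.prems(2) xk Suc.prems(4)])
  have 2: "hbound (real k) (3 ^ k * (B * M)) (fc (\<lambda>t. b' t * synth x t))"
    by (rule Suc.IH[OF b'(2) Suc.prems(2) xk Suc.prems(4)])
  have 3: "hbound (real k) (3 ^ k * (B * M)) (fc (\<lambda>t. b t * synth d t))"
    by (rule Suc.IH[OF b hd dk d0])
  note cx = continuous_synth[OF wbound_weaken[OF wf zero_le_one]] and cd = continuous_synth[OF wd]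
  have "fc (\<lambda>t. b' t * synth x t + b t * synth d t) j = \<i> * of_int j * fc (\<lambda>t. b t * synth x t) j" for j
  proof (rule fc_deriv)
    show "periodic (\<lambda>t. b t * synth x t)"
      using ck_boundD(1)[OF b] periodic_synth[of x] by (simp add: periodic_def)
    show "((\<lambda>t. b t * synth x t) has_real_derivative b' t * synth x t + b t * synth d t) (at t)" for t
      using DERIV_mult[OF b'(1) synth_DERIV[OF wf]] by (simp add: d_def[abs_def] add.commute mult.commute)
  qed (intro continuous_intros ck_boundD(2)[OF b] ck_boundD(2)[OF b'(2)] cx cd)
  moreover have "fc (\<lambda>t. b' t * synth x t + b t * synth d t) j = fc (\<lambda>t. b' t * synth x t) j + fc (\<lambda>t. b t * synth d t) j" for j
    by (intro fc_add continuous_intros ck_boundD(2)[OF b] ck_boundD(2)[OF b'(2)] cx cd)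
  ultimately have 4: "hbound (real k) (3 ^ k * (B * M) + 3 ^ k * (B * M)) (\<lambda>j. \<i> * of_int j * fc (\<lambda>t. b t * synth x t) j)"
    using hbound_add[OF 2 3] by simp
  let ?f = "fc (\<lambda>t. b t * synth x t)"
  have "hbound (real k) (3 ^ k * (B * M)) (\<lambda>j. complex_of_real (cmod (?f j)))" by (rule hbound_norm_le[OF 1]) simp
  moreover have "hbound (real k) (3 ^ k * (B * M) + 3 ^ k * (B * M)) (\<lambda>j. complex_of_real (\<bar>real_of_int j\<bar> * cmod (?f j)))"
    by (rule hbound_norm_le[OF 4]) (simp add: norm_mult)
  \<comment> \<open>The base 3 counts one copy of the bound for the product itself and two for the
    terms of the Leibniz rule.\<close>
  ultimately have 5: "hbound (real k) (3 ^ Suc k * (B * M)) (\<lambda>j. complex_of_real (cmod (?f j)) + complex_of_real (\<bar>real_of_int j\<bar> * cmod (?f j)))"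
    by (rule hbound_mono[OF hbound_add]) simp
  show ?case
  proof (rule hbound_le[OF 5])
    fix j
    have "jb j powr real (Suc k) * cmod (?f j) = jb j powr real k * (jb j * cmod (?f j))"
      by (simp add: powr_add add.commute)
    also have "\<dots> \<le> jb j powr real k * ((1 + \<bar>real_of_int j\<bar>) * cmod (?f j))"
      by (intro mult_left_mono mult_right_mono jb_le_1_abs) auto
    also have "(1 + \<bar>real_of_int j\<bar>) * cmod (?f j) = cmod (complex_of_real (cmod (?f j)) + complex_of_real (\<bar>real_of_int j\<bar> * cmod (?f j)))"
      unfolding of_real_add[symmetric] norm_of_real by (simp add: distrib_right)
    finally show "jb j powr real (Suc k) * cmod (?f j) \<le> jb j powr real k *
       cmod (complex_of_real (cmod (?f j)) + complex_of_real (\<bar>real_of_int j\<bar> * cmod (?f j)))" .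
  qed
qed

text \<open>The bound for truncations of \<open>x\<close> is uniform in the degree, and each
  coefficient of the product converges because the truncation error is uniform. A finite partial sum
  of the norm therefore passes to the limit.\<close>

lemma hbound_fc_mult:
  assumes b: "ck_bound k (\<lambda>_. B) b" and x: "herm x" "hbound (real k) M x" "wbound 0 A x"
  shows "hbound (real k) (3 ^ k * (B * M)) (fc (\<lambda>t. b t * synth x t))"
  unfolding hbound_def
proof safe
  fix J :: "int set" assume J: "finite J"
  define xK where "xK K j = (if j \<in> {-int K..int K} then x j else 0)" for K j
  obtain r where r: "r \<longlonglongrightarrow> 0" "\<And>K t. \<bar>synth x t - synth_upto K x t\<bar> \<le> r K"
    using synth_tail[OF x(3)] by blast
  have xK: "synth (xK K) = synth_upto K x" for K
    by (subst synth_finite_support[of K]) (auto simp: xK_def synth_upto_def)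
  have B: "0 \<le> B" using ck_boundD(3)[OF b, of 0] by linarith
  have lim: "(\<lambda>K. fc (\<lambda>t. b t * synth (xK K) t) j) \<longlonglongrightarrow> fc (\<lambda>t. b t * synth x t) j" for j
  proof (rule LIM_zero_cancel, rule Lim_null_comparison)
    show "(\<lambda>K. B * r K) \<longlonglongrightarrow> 0" using tendsto_mult_right_zero[OF r(1)] by blast
    show "\<forall>\<^sub>F K in sequentially. norm (fc (\<lambda>t. b t * synth (xK K) t) j - fc (\<lambda>t. b t * synth x t) j) \<le> B * r K"
    proof (rule always_eventually, rule allI)
      fix K
      have "fc (\<lambda>t. b t * synth (xK K) t - b t * synth x t) j = fc (\<lambda>t. b t * synth (xK K) t) j - fc (\<lambda>t. b t * synth x t) j"
        unfolding xK by (intro fc_diff continuous_intros ck_boundD(2)[OF b] continuous_synth[OF x(3)])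
      moreover have "cmod (fc (\<lambda>t. b t * synth (xK K) t - b t * synth x t) j) \<le> B * r K"
        unfolding xK
      proof (rule fc_norm_le)
        fix t
        show "\<bar>b t * synth_upto K x t - b t * synth x t\<bar> \<le> B * r K"
          unfolding right_diff_distrib[symmetric] abs_mult
          using ck_boundD(3)[OF b, of t] r(2)[of t K] B by (intro mult_mono) (auto simp: abs_minus_commute)
      qed (intro continuous_intros ck_boundD(2)[OF b] continuous_synth[OF x(3)])
      ultimately show "norm (fc (\<lambda>t. b t * synth (xK K) t) j - fc (\<lambda>t. b t * synth x t) j) \<le> B * r K" by simp
    qed
  qed
  have "(\<lambda>K. L2_set (\<lambda>j. jb j powr real k * cmod (fc (\<lambda>t. b t * synth (xK K) t) j)) J)
     \<longlonglongrightarrow> L2_set (\<lambda>j. jb j powr real k * cmod (fc (\<lambda>t. b t * synth x t) j)) J"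
    unfolding L2_set_def by (intro tendsto_intros lim)
  moreover have "L2_set (\<lambda>j. jb j powr real k * cmod (fc (\<lambda>t. b t * synth (xK K) t) j)) J \<le> 3 ^ k * (B * M)" for K
  proof -
    have "hbound (real k) (3 ^ k * (B * M)) (fc (\<lambda>t. b t * synth (xK K) t))"
    proof (rule hbound_fc_mult_upto[OF b])
      show "herm (xK K)" using x(1) by (auto simp: herm_def xK_def)
      show "hbound (real k) M (xK K)" by (rule hbound_norm_le[OF x(2)]) (auto simp: xK_def)
      show "supp (low K) (xK K)" by (auto simp: supp_def low_def xK_def)
    qed
    then show ?thesis using J unfolding hbound_def by blast
  qed
  ultimately show "L2_set (\<lambda>j. jb j powr real k * cmod (fc (\<lambda>t. b t * synth x t) j)) J \<le> 3 ^ k * (B * M)"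
    by (intro tendsto_upperbound[where F = sequentially]) auto
qed

section \<open>Composition with smooth functions\<close>

definition fst_deriv :: "(real \<times> real \<Rightarrow> real) \<Rightarrow> real \<times> real \<Rightarrow> real" where
  "fst_deriv G p = frechet_derivative G (at p) (1, 0)"

definition snd_deriv :: "(real \<times> real \<Rightarrow> real) \<Rightarrow> real \<times> real \<Rightarrow> real" where
  "snd_deriv G p = frechet_derivative G (at p) (0, 1)"

lemma smooth_frechet: "smooth G \<Longrightarrow> smooth (\<lambda>p. frechet_derivative G (at p) v)"
  unfolding smooth_def by (metis higher_differentiable.simps(2))

lemma smooth_partial: "smooth G \<Longrightarrow> smooth (fst_deriv G)" "smooth G \<Longrightarrow> smooth (snd_deriv G)"
  using smooth_frechet[of G "(1, 0)"] smooth_frechet[of G "(0, 1)"]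
  by (simp_all add: fst_deriv_def[abs_def] snd_deriv_def[abs_def])

lemma smooth_continuous: "smooth G \<Longrightarrow> continuous_on UNIV G"
  unfolding smooth_def by (metis higher_differentiable.simps(1))

lemma smooth_differentiable: "smooth G \<Longrightarrow> G differentiable (at p)"
  unfolding smooth_def by (metis higher_differentiable.simps(2))

text \<open>Lets \<open>a\<close> be treated as a function of two variables, so that one set of
  composition estimates serves \<open>a\<close> and \<open>g\<close>.\<close>

lemma smooth_comp_fst:
  assumes "smooth (a :: real \<Rightarrow> real)"
  shows "smooth (\<lambda>p :: real \<times> real. a (fst p))"
proof -
  have "higher_differentiable k a \<Longrightarrow> higher_differentiable k (\<lambda>p :: real \<times> real. a (fst p))" for k
  proof (induction k arbitrary: a)
    case 0
    then show ?case by (auto intro!: continuous_intros intro: continuous_on_compose2)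
  next
    case (Suc k)
    have d: "((\<lambda>p :: real \<times> real. a (fst p)) has_derivative (\<lambda>h. frechet_derivative a (at (fst p)) (fst h))) (at p)" for p
    proof -
      have "(a has_derivative frechet_derivative a (at (fst p))) (at (fst p))"
        using Suc.prems by (simp flip: frechet_derivative_works)
      from has_derivative_compose[OF has_derivative_fst[OF has_derivative_ident] this] show ?thesis .
    qed
    have "frechet_derivative (\<lambda>p :: real \<times> real. a (fst p)) (at p) = (\<lambda>h. frechet_derivative a (at (fst p)) (fst h))" for p
      using frechet_derivative_at[OF d] by simp
    moreover have "higher_differentiable k (\<lambda>p :: real \<times> real. frechet_derivative a (at (fst p)) v)" for v
      using Suc.IH[of "\<lambda>x. frechet_derivative a (at x) v"] Suc.prems by simp
    moreover have "(\<lambda>p :: real \<times> real. a (fst p)) differentiable (at p)" for p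
      unfolding differentiable_def using d[of p] by blast
    ultimately show ?case by simp
  qed
  then show ?thesis using assms by (simp add: smooth_def)
qed

lemma smooth_chain:
  assumes G: "smooth G" and "(u has_real_derivative u') (at x)" "(v has_real_derivative v') (at x)"
  shows "((\<lambda>x. G (u x, v x)) has_real_derivative fst_deriv G (u x, v x) * u' + snd_deriv G (u x, v x) * v') (at x)"
proof -
  let ?D = "frechet_derivative G (at (u x, v x))"
  have D: "(G has_derivative ?D) (at (u x, v x))"
    using smooth_differentiable[OF G] by (simp flip: frechet_derivative_works)
  interpret D: bounded_linear ?D by (rule has_derivative_bounded_linear[OF D])
  have "((\<lambda>x. (u x, v x)) has_derivative (\<lambda>h. (u' * h, v' * h))) (at x)"
    using assms(2,3) by (intro has_derivative_Pair) (auto simp: has_field_derivative_def)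
  from has_derivative_compose[OF this D]
  have "((\<lambda>x. G (u x, v x)) has_derivative (\<lambda>h. ?D (u' * h, v' * h))) (at x)" .
  moreover have "?D (u' * h, v' * h) = (fst_deriv G (u x, v x) * u' + snd_deriv G (u x, v x) * v') * h" for h
  proof -
    have "(u' * h, v' * h) = (u' * h) *\<^sub>R (1, 0) + (v' * h) *\<^sub>R (0, 1)" by simp
    then show ?thesis by (simp only: D.add D.scaleR) (simp add: fst_deriv_def snd_deriv_def algebra_simps)
  qed
  ultimately show ?thesis by (simp add: has_field_derivative_def)
qed

lemma smooth_bounded:
  assumes "smooth (G :: real \<times> real \<Rightarrow> real)"
  obtains C where "0 \<le> C" "\<And>x y. \<bar>x\<bar> \<le> B \<Longrightarrow> \<bar>y\<bar> \<le> B \<Longrightarrow> \<bar>G (x, y)\<bar> \<le> C"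
proof -
  have "compact (G ` ({-B..B} \<times> {-B..B}))"
    by (intro compact_continuous_image continuous_on_subset[OF smooth_continuous[OF assms]] compact_Times) auto
  then obtain C where "\<And>y. y \<in> G ` ({-B..B} \<times> {-B..B}) \<Longrightarrow> norm y \<le> C"
    using compact_imp_bounded bounded_iff by metis
  then have "\<bar>G (x, y)\<bar> \<le> \<bar>C\<bar>" if "\<bar>x\<bar> \<le> B" "\<bar>y\<bar> \<le> B" for x y
  proof -
    have "G (x, y) \<in> G ` ({-B..B} \<times> {-B..B})" using that by (auto simp: abs_le_iff)
    then have "norm (G (x, y)) \<le> C" by (rule \<open>\<And>y. y \<in> G ` ({-B..B} \<times> {-B..B}) \<Longrightarrow> norm y \<le> C\<close>)
    then show ?thesis by simp
  qed
  then show ?thesis using that[of "\<bar>C\<bar>"] by simp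
qed

section \<open>Lipschitz, Taylor and second-difference estimates for smooth functions of two
  variables\<close>

lemma smooth_mean_value:
  assumes "smooth G"
  obtains \<theta> where "0 < \<theta>" "\<theta> < 1" "G (x + d, y + e) - G (x, y) =
    fst_deriv G (x + \<theta> * d, y + \<theta> * e) * d + snd_deriv G (x + \<theta> * d, y + \<theta> * e) * e"
proof -
  have "((\<lambda>\<theta>. G (x + \<theta> * d, y + \<theta> * e)) has_real_derivative
     fst_deriv G (x + \<theta> * d, y + \<theta> * e) * d + snd_deriv G (x + \<theta> * d, y + \<theta> * e) * e) (at \<theta>)" for \<theta>
    by (rule smooth_chain[OF assms]) (auto intro!: derivative_eq_intros)
  from MVT2[OF zero_less_one this] show ?thesis using that by force
qed

lemma abs_convex_le:
  assumes "\<bar>x\<bar> \<le> B" "\<bar>x + d\<bar> \<le> B" "0 \<le> \<theta>" "\<theta> \<le> (1::real)"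
  shows "\<bar>x + \<theta> * d\<bar> \<le> B"
proof -
  have "x + \<theta> * d = (1 - \<theta>) * x + \<theta> * (x + d)" by (simp add: algebra_simps)
  also have "\<bar>\<dots>\<bar> \<le> (1 - \<theta>) * \<bar>x\<bar> + \<theta> * \<bar>x + d\<bar>"
    using assms by (intro order_trans[OF abs_triangle_ineq]) (simp add: abs_mult)
  also have "\<dots> \<le> (1 - \<theta>) * B + \<theta> * B" using assms by (intro add_mono mult_left_mono) auto
  finally show ?thesis by (simp add: algebra_simps)
qed

lemma smooth_lipschitz:
  assumes "smooth G"
  obtains L where "0 \<le> L" "\<And>x y x' y'. \<bar>x\<bar> \<le> B \<Longrightarrow> \<bar>y\<bar> \<le> B \<Longrightarrow> \<bar>x'\<bar> \<le> B \<Longrightarrow> \<bar>y'\<bar> \<le> B \<Longrightarrow>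
     \<bar>G (x', y') - G (x, y)\<bar> \<le> L * (\<bar>x' - x\<bar> + \<bar>y' - y\<bar>)"
proof -
  obtain C1 where C1: "0 \<le> C1" "\<And>x y. \<bar>x\<bar> \<le> B \<Longrightarrow> \<bar>y\<bar> \<le> B \<Longrightarrow> \<bar>fst_deriv G (x, y)\<bar> \<le> C1"
    using smooth_bounded[OF smooth_partial(1)[OF assms]] by blast
  obtain C2 where C2: "0 \<le> C2" "\<And>x y. \<bar>x\<bar> \<le> B \<Longrightarrow> \<bar>y\<bar> \<le> B \<Longrightarrow> \<bar>snd_deriv G (x, y)\<bar> \<le> C2"
    using smooth_bounded[OF smooth_partial(2)[OF assms]] by blast
  show ?thesis
  proof (rule that[of "C1 + C2"])
    fix x y x' y' assume B: "\<bar>x\<bar> \<le> B" "\<bar>y\<bar> \<le> B" "\<bar>x'\<bar> \<le> B" "\<bar>y'\<bar> \<le> B"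
    obtain \<theta> where \<theta>: "0 < \<theta>" "\<theta> < 1" "G (x + (x' - x), y + (y' - y)) - G (x, y) =
      fst_deriv G (x + \<theta> * (x' - x), y + \<theta> * (y' - y)) * (x' - x) + snd_deriv G (x + \<theta> * (x' - x), y + \<theta> * (y' - y)) * (y' - y)"
      using smooth_mean_value[OF assms] by blast
    have b: "\<bar>x + \<theta> * (x' - x)\<bar> \<le> B" "\<bar>y + \<theta> * (y' - y)\<bar> \<le> B"
      using B \<theta> by (auto intro!: abs_convex_le)
    have "\<bar>G (x', y') - G (x, y)\<bar> \<le> C1 * \<bar>x' - x\<bar> + C2 * \<bar>y' - y\<bar>"
      using \<theta>(3) C1(2)[OF b] C2(2)[OF b]
      by (auto simp: abs_mult intro!: order_trans[OF abs_triangle_ineq] add_mono mult_right_mono)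
    also have "\<dots> \<le> (C1 + C2) * \<bar>x' - x\<bar> + (C1 + C2) * \<bar>y' - y\<bar>"
      using C1 C2 by (intro add_mono mult_right_mono) auto
    finally show "\<bar>G (x', y') - G (x, y)\<bar> \<le> (C1 + C2) * (\<bar>x' - x\<bar> + \<bar>y' - y\<bar>)" by (simp add: distrib_left)
  qed (use C1 C2 in simp)
qed

text \<open>The mean value theorem along the segment, followed by the Lipschitz bound of the two
  partial derivatives, produces the quadratic remainder without naming second derivatives.\<close>

lemma smooth_taylor:
  assumes "smooth G"
  obtains L where "0 \<le> L" "\<And>x y d e. \<bar>x\<bar> \<le> B \<Longrightarrow> \<bar>y\<bar> \<le> B \<Longrightarrow> \<bar>x + d\<bar> \<le> B \<Longrightarrow> \<bar>y + e\<bar> \<le> B \<Longrightarrow>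
     \<bar>G (x + d, y + e) - G (x, y) - (fst_deriv G (x, y) * d + snd_deriv G (x, y) * e)\<bar> \<le> L * (\<bar>d\<bar> + \<bar>e\<bar>)\<^sup>2"
proof -
  obtain L1 where L1: "0 \<le> L1" "\<And>x y x' y'. \<bar>x\<bar> \<le> B \<Longrightarrow> \<bar>y\<bar> \<le> B \<Longrightarrow> \<bar>x'\<bar> \<le> B \<Longrightarrow> \<bar>y'\<bar> \<le> B \<Longrightarrow>
     \<bar>fst_deriv G (x', y') - fst_deriv G (x, y)\<bar> \<le> L1 * (\<bar>x' - x\<bar> + \<bar>y' - y\<bar>)"
    using smooth_lipschitz[OF smooth_partial(1)[OF assms]] by blast
  obtain L2 where L2: "0 \<le> L2" "\<And>x y x' y'. \<bar>x\<bar> \<le> B \<Longrightarrow> \<bar>y\<bar> \<le> B \<Longrightarrow> \<bar>x'\<bar> \<le> B \<Longrightarrow> \<bar>y'\<bar> \<le> B \<Longrightarrow>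
     \<bar>snd_deriv G (x', y') - snd_deriv G (x, y)\<bar> \<le> L2 * (\<bar>x' - x\<bar> + \<bar>y' - y\<bar>)"
    using smooth_lipschitz[OF smooth_partial(2)[OF assms]] by blast
  show ?thesis
  proof (rule that[of "L1 + L2"])
    fix x y d e assume B: "\<bar>x\<bar> \<le> B" "\<bar>y\<bar> \<le> B" "\<bar>x + d\<bar> \<le> B" "\<bar>y + e\<bar> \<le> B"
    obtain \<theta> where \<theta>: "0 < \<theta>" "\<theta> < 1" "G (x + d, y + e) - G (x, y) =
      fst_deriv G (x + \<theta> * d, y + \<theta> * e) * d + snd_deriv G (x + \<theta> * d, y + \<theta> * e) * e"
      using smooth_mean_value[OF assms] by blast
    have b: "\<bar>x + \<theta> * d\<bar> \<le> B" "\<bar>y + \<theta> * e\<bar> \<le> B" using B \<theta> by (auto intro!: abs_convex_le)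
    let ?s = "\<bar>d\<bar> + \<bar>e\<bar>"
    have s: "\<bar>x + \<theta> * d - x\<bar> + \<bar>y + \<theta> * e - y\<bar> \<le> ?s"
      using \<theta> by (simp add: abs_mult mult_left_le_one_le add_mono)
    have 1: "\<bar>fst_deriv G (x + \<theta> * d, y + \<theta> * e) - fst_deriv G (x, y)\<bar> \<le> L1 * ?s"
      by (rule order_trans[OF L1(2)[OF B(1,2) b] mult_left_mono[OF s L1(1)]])
    have 2: "\<bar>snd_deriv G (x + \<theta> * d, y + \<theta> * e) - snd_deriv G (x, y)\<bar> \<le> L2 * ?s"
      by (rule order_trans[OF L2(2)[OF B(1,2) b] mult_left_mono[OF s L2(1)]])
    have "G (x + d, y + e) - G (x, y) - (fst_deriv G (x, y) * d + snd_deriv G (x, y) * e)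
       = (fst_deriv G (x + \<theta> * d, y + \<theta> * e) - fst_deriv G (x, y)) * d
         + (snd_deriv G (x + \<theta> * d, y + \<theta> * e) - snd_deriv G (x, y)) * e"
      using \<theta>(3) by (simp add: algebra_simps)
    also have "\<bar>\<dots>\<bar> \<le> L1 * ?s * ?s + L2 * ?s * ?s"
      using 1 2 L1(1) L2(1)
      by (intro order_trans[OF abs_triangle_ineq]) (auto simp: abs_mult intro!: add_mono mult_mono)
    finally show "\<bar>G (x + d, y + e) - G (x, y) - (fst_deriv G (x, y) * d + snd_deriv G (x, y) * e)\<bar> \<le> (L1 + L2) * ?s\<^sup>2"
      by (simp add: power2_eq_square algebra_simps)
  qed (use L1 L2 in simp)
qed

text \<open>In the sum of two expansions about \<open>(x, y)\<close> the linear terms combine to the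
  second differences of the arguments, of size \<open>d^2\<close>. The two remainders are at most
  \<open>L * (2 * d)^2\<close> each, whence the 8.\<close>

lemma smooth_second_difference:
  assumes "smooth G"
  obtains L where "0 \<le> L" "\<And>x y x1 y1 x2 y2 d. \<bar>x\<bar> \<le> B \<Longrightarrow> \<bar>y\<bar> \<le> B \<Longrightarrow> \<bar>x1\<bar> \<le> B \<Longrightarrow> \<bar>y1\<bar> \<le> B \<Longrightarrow> \<bar>x2\<bar> \<le> B \<Longrightarrow> \<bar>y2\<bar> \<le> B \<Longrightarrow>
     \<bar>x1 - x\<bar> \<le> d \<Longrightarrow> \<bar>y1 - y\<bar> \<le> d \<Longrightarrow> \<bar>x2 - x\<bar> \<le> d \<Longrightarrow> \<bar>y2 - y\<bar> \<le> d \<Longrightarrow>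
     \<bar>x1 + x2 - 2 * x\<bar> \<le> d\<^sup>2 \<Longrightarrow> \<bar>y1 + y2 - 2 * y\<bar> \<le> d\<^sup>2 \<Longrightarrow>
     \<bar>G (x1, y1) + G (x2, y2) - 2 * G (x, y)\<bar> \<le> L * d\<^sup>2"
proof -
  obtain L where L: "0 \<le> L" "\<And>x y d e. \<bar>x\<bar> \<le> B \<Longrightarrow> \<bar>y\<bar> \<le> B \<Longrightarrow> \<bar>x + d\<bar> \<le> B \<Longrightarrow> \<bar>y + e\<bar> \<le> B \<Longrightarrow>
     \<bar>G (x + d, y + e) - G (x, y) - (fst_deriv G (x, y) * d + snd_deriv G (x, y) * e)\<bar> \<le> L * (\<bar>d\<bar> + \<bar>e\<bar>)\<^sup>2"
    using smooth_taylor[OF assms] by blast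
  obtain C1 where C1: "0 \<le> C1" "\<And>x y. \<bar>x\<bar> \<le> B \<Longrightarrow> \<bar>y\<bar> \<le> B \<Longrightarrow> \<bar>fst_deriv G (x, y)\<bar> \<le> C1"
    using smooth_bounded[OF smooth_partial(1)[OF assms]] by blast
  obtain C2 where C2: "0 \<le> C2" "\<And>x y. \<bar>x\<bar> \<le> B \<Longrightarrow> \<bar>y\<bar> \<le> B \<Longrightarrow> \<bar>snd_deriv G (x, y)\<bar> \<le> C2"
    using smooth_bounded[OF smooth_partial(2)[OF assms]] by blast
  show ?thesis
  proof (rule that[of "8 * L + C1 + C2"])
    fix x y x1 y1 x2 y2 d
    assume B: "\<bar>x\<bar> \<le> B" "\<bar>y\<bar> \<le> B" "\<bar>x1\<bar> \<le> B" "\<bar>y1\<bar> \<le> B" "\<bar>x2\<bar> \<le> B" "\<bar>y2\<bar> \<le> B"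
      and d: "\<bar>x1 - x\<bar> \<le> d" "\<bar>y1 - y\<bar> \<le> d" "\<bar>x2 - x\<bar> \<le> d" "\<bar>y2 - y\<bar> \<le> d"
      and d2: "\<bar>x1 + x2 - 2 * x\<bar> \<le> d\<^sup>2" "\<bar>y1 + y2 - 2 * y\<bar> \<le> d\<^sup>2"
    let ?T = "\<lambda>x1 y1. G (x1, y1) - G (x, y) - (fst_deriv G (x, y) * (x1 - x) + snd_deriv G (x, y) * (y1 - y))"
    have t: "\<bar>?T x1 y1\<bar> \<le> L * (2 * d)\<^sup>2" if "\<bar>x1\<bar> \<le> B" "\<bar>y1\<bar> \<le> B" "\<bar>x1 - x\<bar> \<le> d" "\<bar>y1 - y\<bar> \<le> d" for x1 y1
    proof -
      have "\<bar>?T x1 y1\<bar> \<le> L * (\<bar>x1 - x\<bar> + \<bar>y1 - y\<bar>)\<^sup>2"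
        using L(2)[of x y "x1 - x" "y1 - y"] B that by simp
      also have "\<dots> \<le> L * (2 * d)\<^sup>2" using that L(1) by (intro mult_left_mono power_mono) auto
      finally show ?thesis .
    qed
    have "G (x1, y1) + G (x2, y2) - 2 * G (x, y) = ?T x1 y1 + ?T x2 y2
      + (fst_deriv G (x, y) * (x1 + x2 - 2 * x) + snd_deriv G (x, y) * (y1 + y2 - 2 * y))"
      by (simp add: algebra_simps)
    also have "\<bar>\<dots>\<bar> \<le> L * (2 * d)\<^sup>2 + L * (2 * d)\<^sup>2 + (C1 * d\<^sup>2 + C2 * d\<^sup>2)"
    proof -
      have "\<bar>fst_deriv G (x, y) * (x1 + x2 - 2 * x)\<bar> \<le> C1 * d\<^sup>2" "\<bar>snd_deriv G (x, y) * (y1 + y2 - 2 * y)\<bar> \<le> C2 * d\<^sup>2"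
        unfolding abs_mult using d2 C1(2)[OF B(1,2)] C2(2)[OF B(1,2)] C1(1) C2(1) by (auto intro!: mult_mono)
      then show ?thesis using t[OF B(3,4) d(1,2)] t[OF B(5,6) d(3,4)] by linarith
    qed
    finally show "\<bar>G (x1, y1) + G (x2, y2) - 2 * G (x, y)\<bar> \<le> (8 * L + C1 + C2) * d\<^sup>2"
      by (simp add: algebra_simps)
  qed (use L C1 C2 in simp)
qed

text \<open>Induction on the order replaces the formula for higher derivatives of a composition: the
  derivative is a sum of products of partial derivatives of \<open>G\<close>, composed with
  \<open>u\<close> and \<open>v\<close>, with \<open>u'\<close> or \<open>v'\<close>. The inequality
  \<open>\<Phi> l * \<Phi> m \<le> \<Phi> (l + m)\<close> is what such products demand, and
  \<open>\<Phi> 0 = 1\<close> keeps the values in a fixed square. The point is that \<open>C\<close>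
  is chosen before \<Phi>: the weights will depend on \<open>K\<close>, the constant will
  not.\<close>

lemma ck_bound_compose:
  assumes "smooth G" "0 \<le> B"
  shows "\<exists>C\<ge>0. \<forall>\<Phi> u v. \<Phi> 0 = 1 \<and> (\<forall>i. 1 \<le> \<Phi> i) \<and> (\<forall>l m. \<Phi> l * \<Phi> m \<le> \<Phi> (l + m)) \<and>
     ck_bound k (\<lambda>i. B * \<Phi> i) u \<and> ck_bound k (\<lambda>i. B * \<Phi> i) v \<longrightarrow> ck_bound k (\<lambda>i. C * \<Phi> i) (\<lambda>x. G (u x, v x))"
  using assms(1)
proof (induction k arbitrary: G)
  case 0
  obtain C where C: "0 \<le> C" "\<And>x y. \<bar>x\<bar> \<le> B \<Longrightarrow> \<bar>y\<bar> \<le> B \<Longrightarrow> \<bar>G (x, y)\<bar> \<le> C"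
    using smooth_bounded[OF 0] by blast
  then show ?case
    by (intro exI[of _ C])
      (auto simp: periodic_def intro!: continuous_on_compose2[OF smooth_continuous[OF 0]] continuous_intros)
next
  case (Suc k)
  obtain C0 where C0: "0 \<le> C0" "\<And>x y. \<bar>x\<bar> \<le> B \<Longrightarrow> \<bar>y\<bar> \<le> B \<Longrightarrow> \<bar>G (x, y)\<bar> \<le> C0"
    using smooth_bounded[OF Suc.prems] by blast
  obtain C1 where C1: "0 \<le> C1" "\<forall>\<Phi> u v. \<Phi> 0 = 1 \<and> (\<forall>i. 1 \<le> \<Phi> i) \<and> (\<forall>l m. \<Phi> l * \<Phi> m \<le> \<Phi> (l + m)) \<and>
     ck_bound k (\<lambda>i. B * \<Phi> i) u \<and> ck_bound k (\<lambda>i. B * \<Phi> i) v \<longrightarrow> ck_bound k (\<lambda>i. C1 * \<Phi> i) (\<lambda>x. fst_deriv G (u x, v x))"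
    using Suc.IH[OF smooth_partial(1)[OF Suc.prems]] by (elim exE conjE) (rule that)
  obtain C2 where C2: "0 \<le> C2" "\<forall>\<Phi> u v. \<Phi> 0 = 1 \<and> (\<forall>i. 1 \<le> \<Phi> i) \<and> (\<forall>l m. \<Phi> l * \<Phi> m \<le> \<Phi> (l + m)) \<and>
     ck_bound k (\<lambda>i. B * \<Phi> i) u \<and> ck_bound k (\<lambda>i. B * \<Phi> i) v \<longrightarrow> ck_bound k (\<lambda>i. C2 * \<Phi> i) (\<lambda>x. snd_deriv G (u x, v x))"
    using Suc.IH[OF smooth_partial(2)[OF Suc.prems]] by (elim exE conjE) (rule that)
  define C where "C = C0 + 2 ^ k * ((C1 + C2) * B)"
  have "ck_bound (Suc k) (\<lambda>i. C * \<Phi> i) (\<lambda>x. G (u x, v x))"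
    if \<Phi>: "\<Phi> 0 = 1" "\<forall>i. 1 \<le> \<Phi> i" "\<forall>l m. \<Phi> l * \<Phi> m \<le> \<Phi> (l + m)"
      and u: "ck_bound (Suc k) (\<lambda>i. B * \<Phi> i) u" and v: "ck_bound (Suc k) (\<lambda>i. B * \<Phi> i) v" for \<Phi> u v
  proof -
    obtain u' where u': "\<And>x. (u has_real_derivative u' x) (at x)" "ck_bound k (\<lambda>i. B * \<Phi> (Suc i)) u'"
      using ck_bound_SucE[OF u] by blast
    obtain v' where v': "\<And>x. (v has_real_derivative v' x) (at x)" "ck_bound k (\<lambda>i. B * \<Phi> (Suc i)) v'"
      using ck_bound_SucE[OF v] by blast
    note hyp = conjI[OF \<Phi>(1) conjI[OF \<Phi>(2) conjI[OF \<Phi>(3) conjI[OF ck_bound_Suc_imp[OF u] ck_bound_Suc_imp[OF v]]]]]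
    have prod: "c * \<Phi> l * (B * \<Phi> (Suc m)) \<le> c * B * \<Phi> (Suc (l + m))" if "0 \<le> c" for c l m
    proof -
      have "(c * B) * (\<Phi> l * \<Phi> (Suc m)) \<le> (c * B) * \<Phi> (Suc (l + m))"
        using \<Phi>(3)[rule_format, of l "Suc m"] that assms(2) by (intro mult_left_mono) auto
      then show ?thesis by (simp add: mult_ac)
    qed
    have 1: "ck_bound k (\<lambda>i. 2 ^ i * (C1 * B * \<Phi> (Suc i))) (\<lambda>x. fst_deriv G (u x, v x) * u' x)"
      by (rule ck_bound_mult[OF C1(2)[THEN spec, THEN spec, THEN spec, THEN mp, OF hyp] u'(2)]) (rule prod[OF C1(1)])
    have 2: "ck_bound k (\<lambda>i. 2 ^ i * (C2 * B * \<Phi> (Suc i))) (\<lambda>x. snd_deriv G (u x, v x) * v' x)"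
      by (rule ck_bound_mult[OF C2(2)[THEN spec, THEN spec, THEN spec, THEN mp, OF hyp] v'(2)]) (rule prod[OF C2(1)])
    show ?thesis
    proof (rule ck_bound_SucI[OF _ _ smooth_chain[OF Suc.prems u'(1) v'(1)]])
      show "periodic (\<lambda>x. G (u x, v x))" using ck_boundD(1)[OF u] ck_boundD(1)[OF v] by (simp add: periodic_def)
      show "\<bar>G (u x, v x)\<bar> \<le> C * \<Phi> 0" for x
      proof -
        have "\<bar>G (u x, v x)\<bar> \<le> C0" using ck_boundD(3)[OF u, of x] ck_boundD(3)[OF v, of x] \<Phi>(1) by (intro C0(2)) auto
        also have "\<dots> \<le> C" using C1(1) C2(1) assms(2) by (simp add: C_def)
        finally show ?thesis using \<Phi>(1) by simp
      qed
      show "ck_bound k (\<lambda>i. C * \<Phi> (Suc i)) (\<lambda>x. fst_deriv G (u x, v x) * u' x + snd_deriv G (u x, v x) * v' x)"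
      proof (rule ck_bound_mono[OF ck_bound_add[OF 1 2]])
        fix i assume "i \<le> k"
        have p: "0 \<le> (C1 + C2) * B" using C1(1) C2(1) assms(2) by simp
        have "2 ^ i * (C1 * B * \<Phi> (Suc i)) + 2 ^ i * (C2 * B * \<Phi> (Suc i)) = 2 ^ i * ((C1 + C2) * B) * \<Phi> (Suc i)"
          by (simp add: algebra_simps)
        also have "\<dots> \<le> C * \<Phi> (Suc i)"
        proof (rule mult_right_mono)
          have "2 ^ i * ((C1 + C2) * B) \<le> 2 ^ k * ((C1 + C2) * B)"
            by (rule mult_right_mono[OF power_increasing[OF \<open>i \<le> k\<close>] p]) simp
          then show "2 ^ i * ((C1 + C2) * B) \<le> C" using C0(1) by (simp add: C_def)
          show "0 \<le> \<Phi> (Suc i)" using \<Phi>(2)[rule_format, of "Suc i"] by simp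
        qed
        finally show "2 ^ i * (C1 * B * \<Phi> (Suc i)) + 2 ^ i * (C2 * B * \<Phi> (Suc i)) \<le> C * \<Phi> (Suc i)" .
      qed
    qed
  qed
  moreover have "0 \<le> C" using C0(1) C1(1) C2(1) assms(2) by (simp add: C_def)
  ultimately show ?case by blast
qed

lemma ck_bound_compose_const:
  assumes "smooth G" "0 \<le> B"
  obtains C where "0 \<le> C" "\<And>u v. ck_bound k (\<lambda>_. B) u \<Longrightarrow> ck_bound k (\<lambda>_. B) v \<Longrightarrow> ck_bound k (\<lambda>_. C) (\<lambda>x. G (u x, v x))"
proof -
  obtain C where C: "0 \<le> C" "\<forall>\<Phi> u v. \<Phi> 0 = 1 \<and> (\<forall>i. 1 \<le> \<Phi> i) \<and> (\<forall>l m. \<Phi> l * \<Phi> m \<le> \<Phi> (l + m)) \<and>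
     ck_bound k (\<lambda>i. B * \<Phi> i) u \<and> ck_bound k (\<lambda>i. B * \<Phi> i) v \<longrightarrow> ck_bound k (\<lambda>i. C * \<Phi> i) (\<lambda>x. G (u x, v x))"
    using ck_bound_compose[OF assms, of k] by (elim exE conjE) (rule that)
  show ?thesis using that[OF C(1)] C(2)[THEN spec[of _ "\<lambda>_. 1"]] by simp
qed

section \<open>The nonlinearity\<close>

definition dcoeff :: "(int \<Rightarrow> complex) \<Rightarrow> int \<Rightarrow> complex" where
  "dcoeff x j = \<i> * of_int j * x j"

lemma herm_dcoeff: "herm x \<Longrightarrow> herm (dcoeff x)"
  by (simp add: herm_def dcoeff_def)

lemma hbound_dcoeff: "hbound (r + 1) B x \<Longrightarrow> hbound r B (dcoeff x)"
  using hbound_pow_mult[of r 1 B x] by (simp add: dcoeff_def[abs_def])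

lemma wbound_dcoeff: "wbound (r + 1) B x \<Longrightarrow> wbound r B (dcoeff x)"
  using wbound_pow_mult[of r 1 B x] by (simp add: dcoeff_def[abs_def])

lemma hbound_dcoeff2: "hbound (r + 2) B x \<Longrightarrow> hbound r B (dcoeff (dcoeff x))"
  by (intro hbound_dcoeff) (simp add: add.assoc)

lemma wbound_dcoeff2: "wbound (r + 2) B x \<Longrightarrow> wbound r B (dcoeff (dcoeff x))"
  by (intro wbound_dcoeff) (simp add: add.assoc)

lemma deriv_synth: "wbound 1 A x \<Longrightarrow> deriv (synth x) = synth (dcoeff x)"
  using DERIV_imp_deriv[OF synth_DERIV] by (auto simp: dcoeff_def[abs_def])

lemma deriv2_synth:
  assumes "wbound 2 A x"
  shows "deriv (deriv (synth x)) = synth (dcoeff (dcoeff x))"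
  using deriv_synth[OF wbound_weaken[OF assms, of 1]] deriv_synth[OF wbound_dcoeff[of 1 A x]] assms by simp

lemma nonlinearity_synth:
  assumes "wbound 2 A x"
  shows "nonlinearity a g (synth x) t =
    a (synth x t) * synth (dcoeff (dcoeff x)) t + g (synth x t, synth (dcoeff x) t)"
  unfolding nonlinearity_def using deriv2_synth[OF assms] deriv_synth[OF wbound_weaken[OF assms, of 1]] by simp

lemma synth_continuous_bounds:
  assumes "wbound 2 A x"
  shows "continuous_on S (synth x)" "continuous_on S (synth (dcoeff x))" "continuous_on S (synth (dcoeff (dcoeff x)))"
    "\<bar>synth x t\<bar> \<le> A" "\<bar>synth (dcoeff x) t\<bar> \<le> A" "\<bar>synth (dcoeff (dcoeff x)) t\<bar> \<le> A"
proof -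
  have w: "wbound 0 A x" "wbound 0 A (dcoeff x)" "wbound 0 A (dcoeff (dcoeff x))"
    using wbound_weaken[OF assms, of 0] wbound_dcoeff[of 0 A x] wbound_weaken[OF assms, of 1] wbound_dcoeff2[of 0 A x] assms by auto
  show "continuous_on S (synth x)" "continuous_on S (synth (dcoeff x))" "continuous_on S (synth (dcoeff (dcoeff x)))"
    "\<bar>synth x t\<bar> \<le> A" "\<bar>synth (dcoeff x) t\<bar> \<le> A" "\<bar>synth (dcoeff (dcoeff x)) t\<bar> \<le> A"
    using continuous_synth[OF w(1)] continuous_synth[OF w(2)] continuous_synth[OF w(3)]
      synth_bound[OF w(1)] synth_bound[OF w(2)] synth_bound[OF w(3)] by blast+
qed

lemma smooth_comp_continuous:
  "smooth G \<Longrightarrow> continuous_on S u \<Longrightarrow> continuous_on S v \<Longrightarrow> continuous_on S (\<lambda>x. G (u x, v x))"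
  by (rule continuous_on_compose2[OF smooth_continuous]) (auto intro!: continuous_intros)

lemma smooth_comp_continuous1:
  "smooth a \<Longrightarrow> continuous_on S u \<Longrightarrow> continuous_on S (\<lambda>x. a (u x))"
  by (rule continuous_on_compose2[OF smooth_continuous]) auto

lemma continuous_nonlinearity:
  assumes "smooth a" "smooth g" "wbound 2 A x"
  shows "continuous_on S (nonlinearity a g (synth x))"
  unfolding nonlinearity_synth[OF assms(3), abs_def]
  by (intro continuous_intros smooth_comp_continuous1[OF assms(1)] smooth_comp_continuous[OF assms(2)]
      synth_continuous_bounds[OF assms(3)])

abbreviation nlcoeff :: "(real \<Rightarrow> real) \<Rightarrow> (real \<times> real \<Rightarrow> real) \<Rightarrow> (int \<Rightarrow> complex) \<Rightarrow> int \<Rightarrow> complex" where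
  "nlcoeff a g x \<equiv> fc (nonlinearity a g (synth x))"

text \<open>\<open>H^5\<close> gives four bounded derivatives of \<open>u\<close>, hence three of
  \<open>a(u)\<close> and of \<open>g(u, u_x)\<close>, while \<open>u_xx\<close> itself lies in
  \<open>H^3\<close>. The constants 27 and 8 are those of the product and of the passage from sup
  bounds to \<open>H^3\<close>.\<close>

lemma nonlinearity_regular:
  assumes a: "smooth a" and g: "smooth g" and B: "0 \<le> B"
  obtains C where "0 \<le> C" "\<And>x. herm x \<Longrightarrow> hbound 5 B x \<Longrightarrow> hbound 3 C (nlcoeff a g x)"
proof -
  obtain Ca where Ca: "0 \<le> Ca" "\<And>u v. ck_bound 3 (\<lambda>i. 3 * B) u \<Longrightarrow> ck_bound 3 (\<lambda>i. 3 * B) v \<Longrightarrow> ck_bound 3 (\<lambda>i. Ca) (\<lambda>x. a (u x))"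
    using ck_bound_compose_const[OF smooth_comp_fst[OF a], of "3 * B" 3] B by auto
  obtain Cg where Cg: "0 \<le> Cg" "\<And>u v. ck_bound 3 (\<lambda>i. 3 * B) u \<Longrightarrow> ck_bound 3 (\<lambda>i. 3 * B) v \<Longrightarrow> ck_bound 3 (\<lambda>i. Cg) (\<lambda>x. g (u x, v x))"
    using ck_bound_compose_const[OF g, of "3 * B" 3] B by auto
  show ?thesis
  proof (rule that[of "27 * (Ca * B) + 8 * (Cg + Cg)"])
    fix x assume x: "herm x" "hbound 5 B x"
    have w4: "wbound 4 (3 * B) x" using x(2) by (intro hbound_imp_wbound) simp
    have w2: "wbound 2 (3 * B) x" by (rule wbound_weaken[OF w4]) simp
    have u: "ck_bound 3 (\<lambda>i. 3 * B) (synth x)"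
      by (rule ck_bound_synth) (rule wbound_weaken[OF w4], simp)
    have v: "ck_bound 3 (\<lambda>i. 3 * B) (synth (dcoeff x))"
      by (rule ck_bound_synth, rule wbound_dcoeff) (rule wbound_weaken[OF w4], simp)
    have w: "hbound (real 3) B (dcoeff (dcoeff x))" using x(2) by (intro hbound_dcoeff2) simp
    have w0: "wbound 0 (3 * B) (dcoeff (dcoeff x))" using w2 by (intro wbound_dcoeff2) simp
    have "hbound (real 3) (3 ^ 3 * (Ca * B)) (fc (\<lambda>t. a (synth x t) * synth (dcoeff (dcoeff x)) t))"
      by (rule hbound_fc_mult[OF Ca(2)[OF u v] _ w w0]) (intro herm_dcoeff x(1))
    moreover have "hbound (real 3) (2 ^ 3 * (Cg + Cg)) (fc (\<lambda>t. g (synth x t, synth (dcoeff x) t)))"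
      by (rule ck_bound_imp_hbound[OF Cg(2)[OF u v]])
    ultimately have "hbound 3 (27 * (Ca * B) + 8 * (Cg + Cg))
        (\<lambda>j. fc (\<lambda>t. a (synth x t) * synth (dcoeff (dcoeff x)) t) j + fc (\<lambda>t. g (synth x t, synth (dcoeff x) t)) j)"
      by (intro hbound_add) simp_all
    moreover have "nlcoeff a g x j =
      fc (\<lambda>t. a (synth x t) * synth (dcoeff (dcoeff x)) t) j + fc (\<lambda>t. g (synth x t, synth (dcoeff x) t)) j" for j
      unfolding nonlinearity_synth[OF w2, abs_def]
      by (intro fc_add continuous_intros smooth_comp_continuous1[OF a] smooth_comp_continuous[OF g]
          synth_continuous_bounds[OF w2])
    ultimately show "hbound 3 (27 * (Ca * B) + 8 * (Cg + Cg)) (nlcoeff a g x)" by presburger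
  qed (use Ca Cg B in simp)
qed

text \<open>The splitting \<open>a(x) (x'' - y'') + (a(x) - a(y)) y''\<close> puts the pointwise
  bound of a second derivative on \<open>y\<close>, which will be the exact solution. For
  \<open>x\<close> an \<open>H^2\<close> bound suffices; \<open>A\<close> only guarantees
  convergence and does not enter \<open>L\<close>.\<close>

lemma nonlinearity_lipschitz:
  assumes a: "smooth a" and g: "smooth g" and B: "0 \<le> B"
  obtains L where "0 \<le> L" "\<And>x y e A. herm x \<Longrightarrow> herm y \<Longrightarrow> hbound 2 B x \<Longrightarrow> wbound 2 A x \<Longrightarrow> hbound 3 B y \<Longrightarrow>
    hbound 2 e (\<lambda>j. x j - y j) \<Longrightarrow>
    hbound 0 (L * e) (\<lambda>j. nlcoeff a g x j - nlcoeff a g y j)"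
proof -
  note a' = smooth_comp_fst[OF a]
  obtain Ca where Ca: "0 \<le> Ca" "\<And>x y. \<bar>x\<bar> \<le> 3 * B \<Longrightarrow> \<bar>y\<bar> \<le> 3 * B \<Longrightarrow> \<bar>a (fst (x, y))\<bar> \<le> Ca"
    using smooth_bounded[OF a'] by blast
  obtain La where La: "0 \<le> La" "\<And>x y x' y'. \<bar>x\<bar> \<le> 3 * B \<Longrightarrow> \<bar>y\<bar> \<le> 3 * B \<Longrightarrow> \<bar>x'\<bar> \<le> 3 * B \<Longrightarrow> \<bar>y'\<bar> \<le> 3 * B \<Longrightarrow>
     \<bar>a (fst (x', y')) - a (fst (x, y))\<bar> \<le> La * (\<bar>x' - x\<bar> + \<bar>y' - y\<bar>)"
    using smooth_lipschitz[OF a'] by blast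
  obtain Lg where Lg: "0 \<le> Lg" "\<And>x y x' y'. \<bar>x\<bar> \<le> 3 * B \<Longrightarrow> \<bar>y\<bar> \<le> 3 * B \<Longrightarrow> \<bar>x'\<bar> \<le> 3 * B \<Longrightarrow> \<bar>y'\<bar> \<le> 3 * B \<Longrightarrow>
     \<bar>g (x', y') - g (x, y)\<bar> \<le> Lg * (\<bar>x' - x\<bar> + \<bar>y' - y\<bar>)"
    using smooth_lipschitz[OF g] by blast
  show ?thesis
  proof (rule that[of "Ca + (La * 3 * (3 * B) + Lg * 6)"])
    fix x y e A
    assume x: "herm x" "hbound 2 B x" "wbound 2 A x" and y: "herm y" "hbound 3 B y" and e: "hbound 2 e (\<lambda>j. x j - y j)"
    define z where "z j = x j - y j" for j
    have e0: "0 \<le> e" by (rule hbound_nonneg[OF e])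
    have wy: "wbound 2 (3 * B) y" using y(2) by (intro hbound_imp_wbound) simp
    have wx1: "wbound 1 (3 * B) x" using x(2) by (intro hbound_imp_wbound) simp
    have wz1: "wbound 1 (3 * e) z" unfolding z_def using e by (intro hbound_imp_wbound) simp
    have wz2: "wbound 2 (A + 3 * B) z" unfolding z_def by (rule wbound_diff[OF x(3) wy])
    have hz: "herm z" using x(1) y(1) by (simp add: herm_def z_def)
    let ?X = "synth x" and ?X1 = "synth (dcoeff x)" and ?X2 = "synth (dcoeff (dcoeff x))"
    let ?Y = "synth y" and ?Y1 = "synth (dcoeff y)" and ?Y2 = "synth (dcoeff (dcoeff y))"
    have w0: "wbound 0 A x" "wbound 0 (3 * B) y" using wbound_weaken[OF x(3)] wbound_weaken[OF wy] by auto
    have w1: "wbound 0 A (dcoeff x)" "wbound 0 (3 * B) (dcoeff y)"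
      using wbound_weaken[OF x(3), of 1] wbound_weaken[OF wy, of 1] by (auto intro!: wbound_dcoeff)
    have w2: "wbound 0 A (dcoeff (dcoeff x))" "wbound 0 (3 * B) (dcoeff (dcoeff y))"
      using x(3) wy by (auto intro!: wbound_dcoeff2)
    have dz: "dcoeff z = (\<lambda>j. dcoeff x j - dcoeff y j)"
      and ddz: "dcoeff (dcoeff z) = (\<lambda>j. dcoeff (dcoeff x) j - dcoeff (dcoeff y) j)"
      by (auto simp: dcoeff_def z_def algebra_simps)
    have Z: "synth z t = ?X t - ?Y t" for t unfolding z_def by (rule synth_diff[OF w0])
    have Z1: "synth (dcoeff z) t = ?X1 t - ?Y1 t" for t unfolding dz by (rule synth_diff[OF w1])
    have Z2: "synth (dcoeff (dcoeff z)) t = ?X2 t - ?Y2 t" for t unfolding ddz by (rule synth_diff[OF w2])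
    have Zb: "\<bar>?X t - ?Y t\<bar> \<le> 3 * e" "\<bar>?X1 t - ?Y1 t\<bar> \<le> 3 * e" for t
      using synth_bound[OF wbound_weaken[OF wz1], of t] synth_bound[OF wbound_dcoeff[of 0 "3 * e" z], of t] wz1
      by (simp_all add: Z Z1)
    have Xb: "\<bar>?X t\<bar> \<le> 3 * B" "\<bar>?X1 t\<bar> \<le> 3 * B" for t
      using synth_bound[OF wbound_weaken[OF wx1], of t] synth_bound[OF wbound_dcoeff[of 0 "3 * B" x], of t] wx1 by simp_all
    note Yb = synth_continuous_bounds(4-6)[OF wy]
    note cont = synth_continuous_bounds(1-3)[OF x(3)] synth_continuous_bounds(1-3)[OF wy]
      smooth_comp_continuous1[OF a] smooth_comp_continuous[OF g]
    define F1 where "F1 t = a (?X t) * synth (dcoeff (dcoeff z)) t" for t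
    define F2 where "F2 t = (a (?X t) - a (?Y t)) * ?Y2 t + (g (?X t, ?X1 t) - g (?Y t, ?Y1 t))" for t
    have "l2bound e (synth (dcoeff (dcoeff z)))"
    proof (rule parseval)
      show "wbound 0 (A + 3 * B) (dcoeff (dcoeff z))" using wz2 by (intro wbound_dcoeff2) simp
      show "hbound 0 e (dcoeff (dcoeff z))" using e by (intro hbound_dcoeff2) (simp add: z_def[abs_def])
    qed (intro herm_dcoeff hz)
    then have "l2bound (Ca * e) F1"
      unfolding F1_def
      by (intro l2bound_mult cont(7) cont(1)) (use Ca(2)[of "?X _" 0] Xb B in auto)
    then have 1: "hbound 0 (Ca * e) (fc F1)" by (rule bessel)
    have F2c: "continuous_on UNIV F2" unfolding F2_def by (intro continuous_intros cont)
    have F1c: "continuous_on UNIV F1" unfolding F1_def Z2 by (intro continuous_intros cont)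
    have 2: "hbound 0 ((La * 3 * (3 * B) + Lg * 6) * e) (fc F2)"
    proof (rule bessel_sup[OF F2c])
      fix t
      have "\<bar>a (?X t) - a (?Y t)\<bar> \<le> La * (3 * e)"
        using La(2)[of "?Y t" 0 "?X t" 0] Xb(1)[of t] Yb(1)[of t] B Zb(1)[of t] La(1)
        by (auto intro: order_trans mult_left_mono)
      then have "\<bar>(a (?X t) - a (?Y t)) * ?Y2 t\<bar> \<le> La * (3 * e) * (3 * B)"
        unfolding abs_mult by (rule mult_mono) (use Yb La e0 in auto)
      moreover have "\<bar>g (?X t, ?X1 t) - g (?Y t, ?Y1 t)\<bar> \<le> Lg * (3 * e + 3 * e)"
        by (rule order_trans[OF Lg(2) mult_left_mono[OF add_mono]]) (use Xb Yb Zb Lg in auto)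
      ultimately have "\<bar>F2 t\<bar> \<le> La * (3 * e) * (3 * B) + Lg * (3 * e + 3 * e)"
        unfolding F2_def by linarith
      then show "\<bar>F2 t\<bar> \<le> (La * 3 * (3 * B) + Lg * 6) * e" by (simp add: algebra_simps)
    qed
    have eq: "nonlinearity a g ?X t - nonlinearity a g ?Y t = F1 t + F2 t" for t
      unfolding nonlinearity_synth[OF x(3)] nonlinearity_synth[OF wy] F1_def F2_def Z2 by (simp add: algebra_simps)
    have "fc (nonlinearity a g ?X) j - fc (nonlinearity a g ?Y) j = fc F1 j + fc F2 j" for j
      using fc_diff[OF continuous_nonlinearity[OF a g x(3)] continuous_nonlinearity[OF a g wy], of j]
        fc_add[OF F1c F2c, of j] by (simp add: eq)
    with hbound_add[OF 1 2]
    show "hbound 0 ((Ca + (La * 3 * (3 * B) + Lg * 6)) * e)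
        (\<lambda>j. fc (nonlinearity a g ?X) j - fc (nonlinearity a g ?Y) j)"
      by (simp add: distrib_right)
  qed (use Ca La Lg B in simp)
qed

text \<open>Here \<open>y\<close> is the centre and \<open>x\<close>, \<open>z\<close> are its
  neighbours in time. The discrete product rule leaves second differences of one factor times a
  value of the other and two products of first differences, all of order \<open>d^2\<close>
  pointwise; Bessel's inequality then passes to coefficients.\<close>

lemma nonlinearity_second_difference:
  assumes a: "smooth a" and g: "smooth g" and B: "0 \<le> B"
  obtains L where "0 \<le> L"
    "\<And>x y z d. wbound 2 B x \<Longrightarrow> wbound 2 B y \<Longrightarrow> wbound 2 B z \<Longrightarrow> wbound 2 d (\<lambda>j. x j - y j) \<Longrightarrow>
      wbound 2 d (\<lambda>j. z j - y j) \<Longrightarrow> wbound 2 (d\<^sup>2) (\<lambda>j. x j + z j - 2 * y j) \<Longrightarrow>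
      hbound 0 (L * d\<^sup>2) (\<lambda>j. nlcoeff a g x j + nlcoeff a g z j
        - 2 * nlcoeff a g y j)"
proof -
  note a' = smooth_comp_fst[OF a]
  obtain Ca where Ca: "0 \<le> Ca" "\<And>x y. \<bar>x\<bar> \<le> B \<Longrightarrow> \<bar>y\<bar> \<le> B \<Longrightarrow> \<bar>a (fst (x, y))\<bar> \<le> Ca"
    using smooth_bounded[OF a'] by blast
  obtain La where La: "0 \<le> La" "\<And>x y x' y'. \<bar>x\<bar> \<le> B \<Longrightarrow> \<bar>y\<bar> \<le> B \<Longrightarrow> \<bar>x'\<bar> \<le> B \<Longrightarrow> \<bar>y'\<bar> \<le> B \<Longrightarrow>
     \<bar>a (fst (x', y')) - a (fst (x, y))\<bar> \<le> La * (\<bar>x' - x\<bar> + \<bar>y' - y\<bar>)"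
    using smooth_lipschitz[OF a'] by blast
  obtain Sa where Sa: "0 \<le> Sa" "\<And>x y x1 y1 x2 y2 d. \<bar>x\<bar> \<le> B \<Longrightarrow> \<bar>y\<bar> \<le> B \<Longrightarrow> \<bar>x1\<bar> \<le> B \<Longrightarrow> \<bar>y1\<bar> \<le> B \<Longrightarrow> \<bar>x2\<bar> \<le> B \<Longrightarrow> \<bar>y2\<bar> \<le> B \<Longrightarrow>
     \<bar>x1 - x\<bar> \<le> d \<Longrightarrow> \<bar>y1 - y\<bar> \<le> d \<Longrightarrow> \<bar>x2 - x\<bar> \<le> d \<Longrightarrow> \<bar>y2 - y\<bar> \<le> d \<Longrightarrow>
     \<bar>x1 + x2 - 2 * x\<bar> \<le> d\<^sup>2 \<Longrightarrow> \<bar>y1 + y2 - 2 * y\<bar> \<le> d\<^sup>2 \<Longrightarrow>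
     \<bar>a (fst (x1, y1)) + a (fst (x2, y2)) - 2 * a (fst (x, y))\<bar> \<le> Sa * d\<^sup>2"
    using smooth_second_difference[OF a', of B] by blast
  obtain Sg where Sg: "0 \<le> Sg" "\<And>x y x1 y1 x2 y2 d. \<bar>x\<bar> \<le> B \<Longrightarrow> \<bar>y\<bar> \<le> B \<Longrightarrow> \<bar>x1\<bar> \<le> B \<Longrightarrow> \<bar>y1\<bar> \<le> B \<Longrightarrow> \<bar>x2\<bar> \<le> B \<Longrightarrow> \<bar>y2\<bar> \<le> B \<Longrightarrow>
     \<bar>x1 - x\<bar> \<le> d \<Longrightarrow> \<bar>y1 - y\<bar> \<le> d \<Longrightarrow> \<bar>x2 - x\<bar> \<le> d \<Longrightarrow> \<bar>y2 - y\<bar> \<le> d \<Longrightarrow>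
     \<bar>x1 + x2 - 2 * x\<bar> \<le> d\<^sup>2 \<Longrightarrow> \<bar>y1 + y2 - 2 * y\<bar> \<le> d\<^sup>2 \<Longrightarrow>
     \<bar>g (x1, y1) + g (x2, y2) - 2 * g (x, y)\<bar> \<le> Sg * d\<^sup>2"
    using smooth_second_difference[OF g, of B] by blast
  define L where "L = Sa * B + 2 * La + Ca + Sg"
  have L: "0 \<le> L" using Ca La Sa Sg B by (auto simp: L_def)
  have diff: "\<bar>synth x t - synth y t\<bar> \<le> d" "\<bar>synth (dcoeff x) t - synth (dcoeff y) t\<bar> \<le> d"
      "\<bar>synth (dcoeff (dcoeff x)) t - synth (dcoeff (dcoeff y)) t\<bar> \<le> d"
    if w: "wbound 2 C x" "wbound 2 C' y" "wbound 2 d (\<lambda>j. x j - y j)" for x y d t C C'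
  proof -
    have w0: "wbound 0 C x" "wbound 0 C' y" using wbound_weaken[OF w(1)] wbound_weaken[OF w(2)] by auto
    have w1: "wbound 0 C (dcoeff x)" "wbound 0 C' (dcoeff y)"
      using wbound_weaken[OF w(1), of 1] wbound_weaken[OF w(2), of 1] by (auto intro!: wbound_dcoeff)
    have w2: "wbound 0 C (dcoeff (dcoeff x))" "wbound 0 C' (dcoeff (dcoeff y))"
      using w(1,2) by (auto intro!: wbound_dcoeff2)
    have dz: "dcoeff (\<lambda>j. x j - y j) = (\<lambda>j. dcoeff x j - dcoeff y j)"
      and ddz: "dcoeff (\<lambda>j. dcoeff x j - dcoeff y j) = (\<lambda>j. dcoeff (dcoeff x) j - dcoeff (dcoeff y) j)"
      by (auto simp: dcoeff_def algebra_simps)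
    show "\<bar>synth x t - synth y t\<bar> \<le> d" "\<bar>synth (dcoeff x) t - synth (dcoeff y) t\<bar> \<le> d"
      "\<bar>synth (dcoeff (dcoeff x)) t - synth (dcoeff (dcoeff y)) t\<bar> \<le> d"
      using synth_continuous_bounds(4-6)[OF w(3), of t]
      unfolding dz ddz synth_diff[OF w0] synth_diff[OF w1] synth_diff[OF w2] .
  qed
  show ?thesis
  proof (rule that[OF L])
    fix x y z d assume x: "wbound 2 B x" and y: "wbound 2 B y" and z: "wbound 2 B z"
      and d: "wbound 2 d (\<lambda>j. x j - y j)" "wbound 2 d (\<lambda>j. z j - y j)" and dd: "wbound 2 (d\<^sup>2) (\<lambda>j. x j + z j - 2 * y j)"
    note X = synth_continuous_bounds(4-6)[OF x] and Y = synth_continuous_bounds(4-6)[OF y] and Z = synth_continuous_bounds(4-6)[OF z]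
    note D1 = diff[OF x y d(1)] and D2 = diff[OF z y d(2)]
    have d0: "0 \<le> d" by (rule wbound_nonneg[OF d(1)])
    have DD: "\<bar>synth x t + synth z t - 2 * synth y t\<bar> \<le> d\<^sup>2"
      "\<bar>synth (dcoeff x) t + synth (dcoeff z) t - 2 * synth (dcoeff y) t\<bar> \<le> d\<^sup>2"
      "\<bar>synth (dcoeff (dcoeff x)) t + synth (dcoeff (dcoeff z)) t - 2 * synth (dcoeff (dcoeff y)) t\<bar> \<le> d\<^sup>2" for t
    proof -
      have s: "wbound 2 (B + B) (\<lambda>j. x j + z j)" by (rule wbound_add[OF x z])
      have y2: "wbound 2 (2 * B) (\<lambda>j. 2 * y j)" by (rule wbound_dominated[OF y]) (simp_all add: norm_mult)
      have w: "wbound 0 B x" "wbound 0 B z" "wbound 0 B (dcoeff x)" "wbound 0 B (dcoeff z)"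
         "wbound 0 B (dcoeff (dcoeff x))" "wbound 0 B (dcoeff (dcoeff z))"
        using wbound_weaken[OF x, of 0] wbound_weaken[OF z, of 0] wbound_weaken[OF x, of 1] wbound_weaken[OF z, of 1] x z
        by (auto intro!: wbound_dcoeff wbound_dcoeff2)
      have e: "dcoeff (\<lambda>j. x j + z j) = (\<lambda>j. dcoeff x j + dcoeff z j)" "dcoeff (\<lambda>j. dcoeff x j + dcoeff z j) = (\<lambda>j. dcoeff (dcoeff x) j + dcoeff (dcoeff z) j)"
        "dcoeff (\<lambda>j. 2 * y j) = (\<lambda>j. 2 * dcoeff y j)" "dcoeff (\<lambda>j. 2 * dcoeff y j) = (\<lambda>j. 2 * dcoeff (dcoeff y) j)"
        by (auto simp: dcoeff_def algebra_simps)
      have c2: "synth (\<lambda>j. 2 * q j) t = 2 * synth q t" for q using synth_cmult[of 2 q t] by simp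
      show "\<bar>synth x t + synth z t - 2 * synth y t\<bar> \<le> d\<^sup>2"
        "\<bar>synth (dcoeff x) t + synth (dcoeff z) t - 2 * synth (dcoeff y) t\<bar> \<le> d\<^sup>2"
        "\<bar>synth (dcoeff (dcoeff x)) t + synth (dcoeff (dcoeff z)) t - 2 * synth (dcoeff (dcoeff y)) t\<bar> \<le> d\<^sup>2"
        using diff[OF s y2 dd, of t] unfolding e c2 synth_add[OF w(1,2)] synth_add[OF w(3,4)] synth_add[OF w(5,6)] .
    qed
    note cx = continuous_nonlinearity[OF a g x] and cy = continuous_nonlinearity[OF a g y] and cz = continuous_nonlinearity[OF a g z]
    have "hbound 0 (L * d\<^sup>2) (fc (\<lambda>t. nonlinearity a g (synth x) t + nonlinearity a g (synth z) t - 2 * nonlinearity a g (synth y) t))"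
    proof (rule bessel_sup)
      fix t
      let ?X = "synth x t" and ?X1 = "synth (dcoeff x) t" and ?X2 = "synth (dcoeff (dcoeff x)) t"
      let ?Y = "synth y t" and ?Y1 = "synth (dcoeff y) t" and ?Y2 = "synth (dcoeff (dcoeff y)) t"
      let ?Z = "synth z t" and ?Z1 = "synth (dcoeff z) t" and ?Z2 = "synth (dcoeff (dcoeff z)) t"
      have lx: "\<bar>a ?X - a ?Y\<bar> \<le> La * d"
        using La(2)[of ?Y 0 ?X 0] X(1)[of t] Y(1)[of t] B D1(1)[of t] La(1) by (auto intro: order_trans mult_left_mono)
      have lz: "\<bar>a ?Z - a ?Y\<bar> \<le> La * d"
        using La(2)[of ?Y 0 ?Z 0] Z(1)[of t] Y(1)[of t] B D2(1)[of t] La(1) by (auto intro: order_trans mult_left_mono)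
      have s: "\<bar>a ?X + a ?Z - 2 * a ?Y\<bar> \<le> Sa * d\<^sup>2"
        using Sa(2)[of ?Y 0 ?X 0 ?Z 0 d] X(1)[of t] Y(1)[of t] Z(1)[of t] B D1(1)[of t] D2(1)[of t] DD(1)[of t] d0 by simp
      have 1: "\<bar>(a ?X + a ?Z - 2 * a ?Y) * ?Y2\<bar> \<le> Sa * d\<^sup>2 * B"
        unfolding abs_mult by (rule mult_mono[OF s]) (use Y Sa in auto)
      have 2: "\<bar>(a ?X - a ?Y) * (?X2 - ?Y2)\<bar> \<le> La * d * d" "\<bar>(a ?Z - a ?Y) * (?Z2 - ?Y2)\<bar> \<le> La * d * d"
        unfolding abs_mult by (rule mult_mono[OF lx], use D1 La d0 in auto, rule mult_mono[OF lz], use D2 La d0 in auto)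
      have 3: "\<bar>a ?Y * (?X2 + ?Z2 - 2 * ?Y2)\<bar> \<le> Ca * d\<^sup>2"
        unfolding abs_mult by (rule mult_mono) (use Ca Ca(2)[of ?Y 0] Y DD B in auto)
      have 4: "\<bar>g (?X, ?X1) + g (?Z, ?Z1) - 2 * g (?Y, ?Y1)\<bar> \<le> Sg * d\<^sup>2"
        by (rule Sg(2)) (use X Y Z D1 D2 DD in auto)
      have "nonlinearity a g (synth x) t + nonlinearity a g (synth z) t - 2 * nonlinearity a g (synth y) t
          = (a ?X + a ?Z - 2 * a ?Y) * ?Y2 + (a ?X - a ?Y) * (?X2 - ?Y2) + (a ?Z - a ?Y) * (?Z2 - ?Y2)
            + a ?Y * (?X2 + ?Z2 - 2 * ?Y2) + (g (?X, ?X1) + g (?Z, ?Z1) - 2 * g (?Y, ?Y1))"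
        unfolding nonlinearity_synth[OF x] nonlinearity_synth[OF y] nonlinearity_synth[OF z] by (simp add: algebra_simps)
      also have "\<bar>\<dots>\<bar> \<le> Sa * d\<^sup>2 * B + La * d * d + La * d * d + Ca * d\<^sup>2 + Sg * d\<^sup>2" using 1 2 3 4 by linarith
      also have "\<dots> = L * d\<^sup>2" unfolding L_def by (simp add: algebra_simps power2_eq_square)
      finally show "\<bar>nonlinearity a g (synth x) t + nonlinearity a g (synth z) t - 2 * nonlinearity a g (synth y) t\<bar> \<le> L * d\<^sup>2" .
    qed (intro continuous_intros cx cy cz)
    moreover have "fc (\<lambda>t. nonlinearity a g (synth x) t + nonlinearity a g (synth z) t - 2 * nonlinearity a g (synth y) t)
      = (\<lambda>j. nlcoeff a g x j + nlcoeff a g z j - 2 * nlcoeff a g y j)"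
      by (rule ext, subst fc_diff, (intro continuous_intros cx cy cz)+, subst fc_add, (intro cx cz)+, subst fc_cmult) simp
    ultimately show "hbound 0 (L * d\<^sup>2) (\<lambda>j. nlcoeff a g x j + nlcoeff a g z j
        - 2 * nlcoeff a g y j)" by (simp only:)
  qed
qed

section \<open>Fourier coefficients of the exact solution\<close>

lemma sobolev_hbound:
  assumes "v \<in> sobolev s" "sobolev_norm s v \<le> B"
  shows "hbound s B (fc v)"
  unfolding hbound_def
proof safe
  fix J :: "int set" assume J: "finite J"
  let ?f = "\<lambda>j. jb j powr (2 * s) * (cmod (fc v j))\<^sup>2"
  have "L2_set (\<lambda>j. jb j powr s * cmod (fc v j)) J = sqrt (\<Sum>j\<in>J. ?f j)"
    unfolding L2_set_def by (simp add: power_mult_distrib powr_power mult.commute)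
  also have "\<dots> \<le> sqrt (\<Sum>\<^sub>\<infinity>j. ?f j)"
    using assms(1) J by (intro real_sqrt_le_mono finite_sum_le_infsum) (auto simp: sobolev_def)
  also have "\<dots> \<le> B" using assms(2) by (simp add: sobolev_norm_def)
  finally show "L2_set (\<lambda>j. jb j powr s * cmod (fc v j)) J \<le> B" .
qed

lemma hbound_sobolev:
  assumes "hbound s B (fc v)"
  shows "(\<lambda>j. jb j powr (2 * s) * (cmod (fc v j))\<^sup>2) summable_on UNIV" "sobolev_norm s v \<le> B"
proof -
  let ?f = "\<lambda>j. jb j powr (2 * s) * (cmod (fc v j))\<^sup>2"
  have *: "sum ?f J \<le> B\<^sup>2" if "finite J" for J
  proof -
    have "sqrt (sum ?f J) = L2_set (\<lambda>j. jb j powr s * cmod (fc v j)) J"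
      unfolding L2_set_def by (simp add: power_mult_distrib powr_power mult.commute)
    also have "\<dots> \<le> B" using assms that unfolding hbound_def by blast
    finally show ?thesis by (rule sqrt_le_D)
  qed
  then show s: "?f summable_on UNIV"
    by (intro nonneg_bdd_above_summable_on bdd_aboveI2[where M = "B\<^sup>2"]) auto
  have "(\<Sum>\<^sub>\<infinity>j. ?f j) \<le> B\<^sup>2" by (rule infsum_le_finite_sums[OF s]) (use * in auto)
  then show "sobolev_norm s v \<le> B"
    unfolding sobolev_norm_def using hbound_nonneg[OF assms] by (intro real_le_lsqrt) (auto intro: infsum_nonneg)
qed

lemma energy_space_hbound:
  assumes "(v, w) \<in> energy_space r" "energy_norm r (v, w) \<le> M"
  shows "hbound (r + 1) M (fc v)" "hbound r M (fc w)"
proof -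
  have "sobolev_norm (r + 1) v \<le> energy_norm r (v, w)" "sobolev_norm r w \<le> energy_norm r (v, w)"
    unfolding energy_norm_def by (auto intro!: real_le_rsqrt)
  then show "hbound (r + 1) M (fc v)" "hbound r M (fc w)"
    using assms by (auto intro!: sobolev_hbound simp: energy_space_def)
qed

lemma set_integrable_square_imp:
  assumes "v \<in> borel_measurable lborel" "set_integrable lborel {0..2 * pi} (\<lambda>x. (v x)\<^sup>2)"
  shows "set_integrable lborel {0..2 * pi} (v :: real \<Rightarrow> real)"
proof (rule set_integrable_bound[of lborel "{0..2*pi}" "\<lambda>x. 1 + (v x)\<^sup>2"])
  show "set_integrable lborel {0..2*pi} (\<lambda>x. 1 + (v x)\<^sup>2)"
    by (rule set_integral_add(1)[OF _ assms(2)]) (auto intro!: set_integrable_continuous)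
  show "set_borel_measurable lborel {0..2*pi} v"
    using assms(1) unfolding set_borel_measurable_def by measurable
  have "\<bar>y\<bar> \<le> 1 + y\<^sup>2" for y :: real
  proof -
    have "0 \<le> (2 * \<bar>y\<bar> - 1)\<^sup>2" by simp
    also have "\<dots> = 4 * y\<^sup>2 - 4 * \<bar>y\<bar> + 1" by (simp add: power2_diff power_mult_distrib)
    finally show ?thesis by simp
  qed
  then show "AE x in lborel. x \<in> {0..2*pi} \<longrightarrow> norm (v x) \<le> norm (1 + (v x)\<^sup>2)"
    by (intro AE_I2) auto
qed

text \<open>Differentiation under the integral sign; the derivative need not be continuous.\<close>

lemma fc_has_vector_derivative:
  fixes w w' :: "real \<Rightarrow> real \<Rightarrow> real"
  assumes der: "\<And>t x. t \<in> {0..T} \<Longrightarrow> ((\<lambda>\<tau>. w \<tau> x) has_real_derivative w' t x) (at t within {0..T})"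
    and int: "\<And>t. t \<in> {0..T} \<Longrightarrow> set_integrable lborel {0..2 * pi} (w t)"
    and meas: "\<And>t. t \<in> {0..T} \<Longrightarrow> w t \<in> borel_measurable lborel" "\<And>t. t \<in> {0..T} \<Longrightarrow> w' t \<in> borel_measurable lborel"
    and bd: "\<And>t x. t \<in> {0..T} \<Longrightarrow> \<bar>w' t x\<bar> \<le> C" and t: "t \<in> {0..T}"
  shows "((\<lambda>\<tau>. fc (w \<tau>) j) has_vector_derivative fc (w' t) j) (at t within {0..T})"
proof -
  let ?q = "\<lambda>\<tau> x. (w \<tau> x - w t x) / (\<tau> - t)"
  let ?e = "\<lambda>x. cis (- (real_of_int j * x))"
  have lip: "\<bar>w \<tau> x - w t x\<bar> \<le> C * \<bar>\<tau> - t\<bar>" if "\<tau> \<in> {0..T}" for \<tau> x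
    using field_differentiable_bound[of "{0..T}" "\<lambda>\<tau>. w \<tau> x" "\<lambda>\<tau>. w' \<tau> x" C \<tau> t] der bd t that by auto
  have "((\<lambda>\<tau>. (1 / (\<tau> - t)) *\<^sub>R (fc (w \<tau>) j - fc (w t) j)) \<longlongrightarrow> fc (w' t) j) (at t within {0..T})"
    unfolding tendsto_at_iff_sequentially
  proof safe
    fix X :: "nat \<Rightarrow> real" assume X: "\<forall>i. X i \<in> {0..T} - {t}" "X \<longlonglongrightarrow> t"
    have eq: "(1 / (\<tau> - t)) *\<^sub>R (fc (w \<tau>) j - fc (w t) j) = fc (?q \<tau>) j" if "\<tau> \<in> {0..T}" for \<tau>
    proof -
      have "fc (\<lambda>x. (1 / (\<tau> - t)) * (w \<tau> x - w t x)) j = complex_of_real (1 / (\<tau> - t)) * (fc (w \<tau>) j - fc (w t) j)"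
        by (simp only: fc_cmult fourier_coeff_diff[OF int[OF that] int[OF t]])
      then show ?thesis by (simp add: scaleR_conv_of_real)
    qed
    have "(\<lambda>i. LINT x:{0..2*pi}|lborel. complex_of_real (?q (X i) x) * ?e x) \<longlonglongrightarrow>
        (LINT x:{0..2*pi}|lborel. complex_of_real (w' t x) * ?e x)"
      unfolding set_lebesgue_integral_def
    proof (rule integral_dominated_convergence[where w = "\<lambda>x. indicator {0..2*pi} x * C"])
      have em: "?e \<in> borel_measurable lborel"
        by (simp, intro borel_measurable_continuous_onI continuous_intros continuous_on_cis)
      have wm: "w (X i) \<in> borel_measurable lborel" for i using meas(1) X(1) by blast
      show "(\<lambda>x. indicator {0..2*pi} x *\<^sub>R (complex_of_real (w' t x) * ?e x)) \<in> borel_measurable lborel"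
        using meas(2)[OF t] em by measurable
      show "(\<lambda>x. indicator {0..2*pi} x *\<^sub>R (complex_of_real (?q (X i) x) * ?e x)) \<in> borel_measurable lborel" for i
        using wm[of i] meas(1)[OF t] em by measurable
      show "integrable lborel (\<lambda>x. indicator {0..2*pi} x * C)" by simp
      show "AE x in lborel. (\<lambda>i. indicator {0..2*pi} x *\<^sub>R (complex_of_real (?q (X i) x) * ?e x)) \<longlonglongrightarrow>
         indicator {0..2*pi} x *\<^sub>R (complex_of_real (w' t x) * ?e x)"
      proof (rule AE_I2)
        fix x
        have "((\<lambda>\<tau>. ?q \<tau> x) \<longlongrightarrow> w' t x) (at t within {0..T})"
          using der[OF t, of x] by (simp add: has_field_derivative_iff)
        then have "(\<lambda>i. ?q (X i) x) \<longlonglongrightarrow> w' t x"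
          unfolding tendsto_at_iff_sequentially using X by (auto simp: o_def)
        then show "(\<lambda>i. indicator {0..2*pi} x *\<^sub>R (complex_of_real (?q (X i) x) * ?e x)) \<longlonglongrightarrow>
         indicator {0..2*pi} x *\<^sub>R (complex_of_real (w' t x) * ?e x)" by (intro tendsto_intros)
      qed
      show "AE x in lborel. norm (indicator {0..2*pi} x *\<^sub>R (complex_of_real (?q (X i) x) * ?e x)) \<le> indicator {0..2*pi} x * C" for i
      proof (rule AE_I2)
        fix x
        have Xi: "X i \<in> {0..T}" "X i \<noteq> t" using X(1) by auto
        have "\<bar>?q (X i) x\<bar> \<le> C" using lip[OF Xi(1), of x] Xi(2) by (simp add: field_simps)
        then show "norm (indicator {0..2*pi} x *\<^sub>R (complex_of_real (?q (X i) x) * ?e x)) \<le> indicator {0..2*pi} x * C"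
          by (auto simp: norm_mult indicator_def simp flip: of_real_diff of_real_divide)
      qed
    qed
    then have "(\<lambda>i. fc (?q (X i)) j) \<longlonglongrightarrow> fc (w' t) j"
      unfolding fourier_coeff_def by (intro tendsto_intros) auto
    then show "((\<lambda>\<tau>. (1 / (\<tau> - t)) *\<^sub>R (fc (w \<tau>) j - fc (w t) j)) \<circ> X) \<longlonglongrightarrow> fc (w' t) j"
      using eq X(1) by (simp add: o_def)
  qed
  from tendsto_Re[OF this] tendsto_Im[OF this] show ?thesis
    by (simp add: has_vector_derivative_complex_iff has_field_derivative_iff)
qed

text \<open>Turns the pointwise equation into ordinary differential equations for the modes. The
  position is continuous and hence equals its Fourier series; the velocity enters only as a
  measurable function with known coefficients.\<close>

lemma wave_solution_coefficients:
  assumes a: "smooth a" and g: "smooth g" and T: "0 < T" and r: "4 \<le> r"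
    and sol: "wave_solution a g \<kappa> T u0 v0 u ut"
    and M: "\<And>t. t \<in> {0..T} \<Longrightarrow> (u t, ut t) \<in> energy_space r" "\<And>t. t \<in> {0..T} \<Longrightarrow> energy_norm r (u t, ut t) \<le> M"
    and t: "t \<in> {0..T}"
  shows "hbound (r + 1) M (fc (u t))" "hbound r M (fc (ut t))" "synth (fc (u t)) = u t"
    and "((\<lambda>\<tau>. fc (u \<tau>) j) has_vector_derivative fc (ut t) j) (at t within {0..T})"
    and "((\<lambda>\<tau>. fc (ut \<tau>) j) has_vector_derivative
        - of_real ((jb j)\<^sup>2) * fc (u t) j + of_real \<kappa> * fc (nonlinearity a g (u t)) j) (at t within {0..T})"
proof -
  define W where "W t x = deriv (deriv (u t)) x - u t x + \<kappa> * (a (u t x) * deriv (deriv (u t)) x) + \<kappa> * g (u t x, deriv (u t) x)" for t x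
  have per: "periodic (u t)" and du: "\<And>x. u t differentiable (at x)"
    and ut: "\<And>x. ((\<lambda>\<tau>. u \<tau> x) has_real_derivative ut t x) (at t within {0..T})"
    and utt: "\<And>x. ((\<lambda>\<tau>. ut \<tau> x) has_real_derivative W t x) (at t within {0..T})" if "t \<in> {0..T}" for t
    using sol that unfolding wave_solution_def W_def by blast+
  have hu: "hbound (r + 1) M (fc (u t))" and hut: "hbound r M (fc (ut t))" if "t \<in> {0..T}" for t
    using energy_space_hbound[OF M(1)[OF that] M(2)[OF that]] by auto
  then show "hbound (r + 1) M (fc (u t))" "hbound r M (fc (ut t))" using t by auto
  have w2: "wbound 2 (3 * M) (fc (u t))" if "t \<in> {0..T}" for t
    using wbound_weaken[OF hbound_imp_wbound[OF hu[OF that]], of 2] r by simp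
  have cu: "continuous_on UNIV (u t)" if "t \<in> {0..T}" for t
    using du[OF that] by (simp add: continuous_at_imp_continuous_on differentiable_imp_continuous_within)
  have su: "synth (fc (u t)) = u t" if "t \<in> {0..T}" for t
    by (rule synth_fc[OF per[OF that] cu[OF that] wbound_weaken[OF w2[OF that]]]) simp
  then show "synth (fc (u t)) = u t" using t by auto
  have M0: "0 \<le> M" using hbound_nonneg[OF hu[OF t]] .
  have W: "W t x = synth (dcoeff (dcoeff (fc (u t)))) x - synth (fc (u t)) x + \<kappa> * nonlinearity a g (u t) x" if "t \<in> {0..T}" for t x
    using deriv2_synth[OF w2[OF that]] su[OF that] by (simp add: W_def nonlinearity_def distrib_left)
  have cn: "continuous_on UNIV (nonlinearity a g (u t))" if "t \<in> {0..T}" for t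
    using continuous_nonlinearity[OF a g w2[OF that]] su[OF that] by simp
  obtain Ca where Ca: "0 \<le> Ca" "\<And>x y. \<bar>x\<bar> \<le> 3 * M \<Longrightarrow> \<bar>y\<bar> \<le> 3 * M \<Longrightarrow> \<bar>a (fst (x, y))\<bar> \<le> Ca"
    using smooth_bounded[OF smooth_comp_fst[OF a]] by blast
  obtain Cg where Cg: "0 \<le> Cg" "\<And>x y. \<bar>x\<bar> \<le> 3 * M \<Longrightarrow> \<bar>y\<bar> \<le> 3 * M \<Longrightarrow> \<bar>g (x, y)\<bar> \<le> Cg"
    using smooth_bounded[OF g] by blast
  define B where "B = 3 * M + 3 * M + \<bar>\<kappa>\<bar> * (Ca * (3 * M) + Cg)"
  have WB: "\<bar>W t x\<bar> \<le> B" if "t \<in> {0..T}" for t x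
  proof -
    note b = synth_continuous_bounds(4-6)[OF w2[OF that], of x]
    have "\<bar>nonlinearity a g (synth (fc (u t))) x\<bar> \<le> Ca * (3 * M) + Cg"
      unfolding nonlinearity_synth[OF w2[OF that]]
      using Ca(2)[OF b(1,1)] Cg(2)[OF b(1,2)] b(3) Ca(1)
      by (intro order_trans[OF abs_triangle_ineq] add_mono) (auto simp: abs_mult intro!: mult_mono)
    then have "\<bar>\<kappa> * nonlinearity a g (u t) x\<bar> \<le> \<bar>\<kappa>\<bar> * (Ca * (3 * M) + Cg)"
      by (simp add: abs_mult mult_left_mono su[OF that])
    then show ?thesis using b(1,3) unfolding W[OF that] B_def by linarith
  qed
  have cW: "continuous_on UNIV (W t)" if "t \<in> {0..T}" for t
    unfolding W[OF that, abs_def] by (intro continuous_intros cn[OF that] synth_continuous_bounds[OF w2[OF that]])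
  have ub: "\<bar>u t x\<bar> \<le> 3 * M" if "t \<in> {0..T}" for t x
    using synth_continuous_bounds(4)[OF w2[OF that], of x] su[OF that] by simp
  text \<open>For fixed \<open>t\<close> the function \<open>ut t\<close> is only determined up to a null set by its coefficients. Dominated
    convergence needs a bound at every point, which the equation provides; it may depend on \<open>T\<close>.\<close>
  define C where "C = 6 * M / T + B * T"
  have utB: "\<bar>ut t x\<bar> \<le> C" if "t \<in> {0..T}" for t x
  proof -
    \<comment> \<open>At some time \<xi>, depending on \<open>x\<close>, the velocity equals the
      mean slope of the position and is at most \<open>6 * M / T\<close>; from there the bounded
      acceleration changes it by at most \<open>B * T\<close>.\<close>
    have "\<exists>\<xi>\<in>{0<..<T}. u T x - u 0 x = (T - 0) * ut \<xi> x"
      using ut by (intro mvt_simple[OF T, where f' = "\<lambda>\<xi> h. h * ut \<xi> x"])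
        (auto simp: has_field_derivative_def mult_commute_abs)
    then obtain \<xi> where "\<xi> \<in> {0<..<T}" "u T x - u 0 x = (T - 0) * ut \<xi> x" by blast
    then have \<xi>: "\<xi> \<in> {0..T}" "u T x - u 0 x = T * ut \<xi> x" by auto
    have "\<bar>T * ut \<xi> x\<bar> \<le> 6 * M" using ub[of T x] ub[of 0 x] T unfolding \<xi>(2)[symmetric] by simp
    then have "\<bar>ut \<xi> x\<bar> \<le> 6 * M / T" using T by (simp add: abs_mult field_simps)
    moreover have "\<bar>ut t x - ut \<xi> x\<bar> \<le> B * \<bar>t - \<xi>\<bar>"
      using field_differentiable_bound[of "{0..T}" "\<lambda>\<tau>. ut \<tau> x" "\<lambda>\<tau>. W \<tau> x" B t \<xi>] utt WB \<xi>(1) that by auto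
    moreover have "B * \<bar>t - \<xi>\<bar> \<le> B * T" using \<xi>(1) that WB[OF that, of x] by (intro mult_left_mono) auto
    ultimately show ?thesis unfolding C_def by linarith
  qed
  have mut: "ut t \<in> borel_measurable lborel" "set_integrable lborel {0..2*pi} (ut t)" if "t \<in> {0..T}" for t
    using M(1)[OF that] by (auto simp: energy_space_def sobolev_def intro!: set_integrable_square_imp)
  show "((\<lambda>\<tau>. fc (u \<tau>) j) has_vector_derivative fc (ut t) j) (at t within {0..T})"
    by (rule fc_has_vector_derivative[where C = C])
      (use ut utB mut cu t in \<open>auto intro!: set_integrable_continuous borel_measurable_continuous_onI\<close>)
  have 1: "((\<lambda>\<tau>. fc (ut \<tau>) j) has_vector_derivative fc (W t) j) (at t within {0..T})"
    by (rule fc_has_vector_derivative[where C = B])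
      (use utt WB mut cW t in \<open>auto intro!: borel_measurable_continuous_onI\<close>)
  have "fc (W t) j = fc (\<lambda>x. synth (dcoeff (dcoeff (fc (u t)))) x - synth (fc (u t)) x) j + fc (\<lambda>x. \<kappa> * nonlinearity a g (u t) x) j"
    unfolding W[OF t, abs_def]
    by (intro fc_add continuous_intros cn[OF t] synth_continuous_bounds[OF w2[OF t]])
  also have "fc (\<lambda>x. synth (dcoeff (dcoeff (fc (u t)))) x - synth (fc (u t)) x) j
      = dcoeff (dcoeff (fc (u t))) j - fc (u t) j"
  proof -
    have "fc (synth (dcoeff (dcoeff (fc (u t))))) j = dcoeff (dcoeff (fc (u t))) j"
      by (rule fc_synth[of _ "3 * M"]) (use w2[OF t] in \<open>auto intro!: herm_dcoeff wbound_dcoeff2\<close>)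
    moreover have "fc (synth (fc (u t))) j = fc (u t) j" by (simp add: su[OF t])
    ultimately show ?thesis
      by (subst fc_diff) (auto intro!: synth_continuous_bounds[OF w2[OF t]])
  qed
  finally have "fc (W t) j = - of_real ((jb j)\<^sup>2) * fc (u t) j + of_real \<kappa> * fc (nonlinearity a g (u t)) j"
    unfolding jb_square fc_cmult dcoeff_def by (simp add: power2_eq_square algebra_simps)
  with 1 show "((\<lambda>\<tau>. fc (ut \<tau>) j) has_vector_derivative
        - of_real ((jb j)\<^sup>2) * fc (u t) j + of_real \<kappa> * fc (nonlinearity a g (u t)) j) (at t within {0..T})" by simp
qed

section \<open>Quadrature error\<close>

text \<open>The exact solution reduced to what the analysis in time uses: the equations of the modes
  and bounds in \<open>H^5\<close> and \<open>H^4\<close>. The further regularity measured by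
  \<open>s\<close> acts only through truncation and interpolation.\<close>

definition exact_coeffs :: "(real \<Rightarrow> real) \<Rightarrow> (real \<times> real \<Rightarrow> real) \<Rightarrow> real \<Rightarrow> real \<Rightarrow> real \<Rightarrow>
    (real \<Rightarrow> int \<Rightarrow> complex) \<Rightarrow> (real \<Rightarrow> int \<Rightarrow> complex) \<Rightarrow> bool" where
  "exact_coeffs a g \<kappa> T M U V \<longleftrightarrow> (\<forall>t\<in>{0..T}. herm (U t) \<and> hbound 5 M (U t) \<and> hbound 4 M (V t) \<and>
     (\<forall>j. ((\<lambda>\<tau>. U \<tau> j) has_vector_derivative V t j) (at t within {0..T}) \<and>
          ((\<lambda>\<tau>. V \<tau> j) has_vector_derivative - of_real ((jb j)\<^sup>2) * U t j
             + of_real \<kappa> * nlcoeff a g (U t) j) (at t within {0..T})))"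

definition diag :: "(int \<Rightarrow> complex) \<Rightarrow> (int \<Rightarrow> complex) \<Rightarrow> int \<Rightarrow> complex" where
  "diag x y j = y j + \<i> * of_real (jb j) * x j"

text \<open>In the variable \<open>diag U V\<close> the linear flow is the rotation by \<open>cis (jb j * t)\<close>;
  \<open>twisted\<close> undoes it, so that only the nonlinearity contributes to the time derivative.\<close>

definition twisted :: "(real \<Rightarrow> int \<Rightarrow> complex) \<Rightarrow> (real \<Rightarrow> int \<Rightarrow> complex) \<Rightarrow> real \<Rightarrow> int \<Rightarrow> complex" where
  "twisted U V t j = cis (- (jb j * t)) * diag (U t) (V t) j"

lemma exact_coeffsD:
  assumes "exact_coeffs a g \<kappa> T M U V" "t \<in> {0..T}"
  shows "herm (U t)" "hbound 5 M (U t)" "hbound 4 M (V t)"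
    "((\<lambda>\<tau>. U \<tau> j) has_vector_derivative V t j) (at t within {0..T})"
    "((\<lambda>\<tau>. V \<tau> j) has_vector_derivative - of_real ((jb j)\<^sup>2) * U t j
       + of_real \<kappa> * nlcoeff a g (U t) j) (at t within {0..T})"
  using assms unfolding exact_coeffs_def by blast+

lemma cis_has_vector_derivative:
  "((\<lambda>t. cis (c * t)) has_vector_derivative \<i> * of_real c * cis (c * t)) (at t within S)"
proof -
  have "((\<lambda>z. exp (\<i> * of_real c * z)) has_field_derivative (\<i> * of_real c) * exp (\<i> * of_real c * of_real t)) (at (of_real t))"
    by (auto intro!: derivative_eq_intros)
  from has_vector_derivative_at_within[OF has_vector_derivative_real_field[OF this]]
  show ?thesis by (simp add: cis_conv_exp mult_ac)
qed

lemma twisted_deriv: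
  assumes "exact_coeffs a g \<kappa> T M U V" "t \<in> {0..T}"
  shows "((\<lambda>\<tau>. twisted U V \<tau> j) has_vector_derivative
    of_real \<kappa> * cis (- (jb j * t)) * nlcoeff a g (U t) j) (at t within {0..T})"
proof -
  let ?\<omega> = "complex_of_real (jb j)" and ?N = "nlcoeff a g (U t) j"
  have "((\<lambda>\<tau>. diag (U \<tau>) (V \<tau>) j) has_vector_derivative
      (- of_real ((jb j)\<^sup>2) * U t j + of_real \<kappa> * ?N) + \<i> * ?\<omega> * V t j) (at t within {0..T})"
    unfolding diag_def
    by (intro has_vector_derivative_add has_vector_derivative_mult_right exact_coeffsD[OF assms])
  then have "((\<lambda>\<tau>. cis (- jb j * \<tau>) * diag (U \<tau>) (V \<tau>) j) has_vector_derivative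
      cis (- jb j * t) * ((- of_real ((jb j)\<^sup>2) * U t j + of_real \<kappa> * ?N) + \<i> * ?\<omega> * V t j)
      + \<i> * of_real (- jb j) * cis (- jb j * t) * diag (U t) (V t) j) (at t within {0..T})"
    by (rule has_vector_derivative_mult[OF cis_has_vector_derivative])
  then show ?thesis
    by (simp add: twisted_def diag_def algebra_simps power2_eq_square)
qed

text \<open>Applied with \<open>c = 1\<close> and \<open>c = -1\<close> to differentiate expressions
  that are symmetric about a midpoint \<open>m\<close>.\<close>

lemma shift_vector_derivative:
  fixes f :: "real \<Rightarrow> 'a::real_normed_vector"
  assumes "(f has_vector_derivative f') (at (m + c * \<sigma>) within {0..T})" "(\<lambda>\<sigma>. m + c * \<sigma>) ` S \<subseteq> {0..T}"
  shows "((\<lambda>\<sigma>. f (m + c * \<sigma>)) has_vector_derivative c *\<^sub>R f') (at \<sigma> within S)"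
proof -
  have "((\<lambda>\<sigma>. m + c * \<sigma>) has_vector_derivative c) (at \<sigma> within S)"
    by (auto intro!: derivative_eq_intros simp flip: has_real_derivative_iff_has_vector_derivative)
  from vector_diff_chain_within[OF this has_vector_derivative_within_subset[OF assms]]
  show ?thesis by (simp add: o_def)
qed

text \<open>A time derivative costs one order in space: \<open>V\<close> is bounded in
  \<open>H^4\<close>, and its derivative in \<open>H^3\<close> because of the two orders taken from
  \<open>U\<close>.\<close>

lemma exact_coeffs_increments:
  assumes ex: "exact_coeffs a g \<kappa> T M U V" and N: "\<And>t. t \<in> {0..T} \<Longrightarrow> hbound 3 C (nlcoeff a g (U t))"
    and \<kappa>: "0 \<le> \<kappa>" "\<kappa> \<le> 1" and st: "0 \<le> s" "s \<le> t" "t \<le> T"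
  shows "hbound 4 (M * (t - s)) (\<lambda>j. U t j - U s j)" "hbound 3 ((M + C) * (t - s)) (\<lambda>j. V t j - V s j)"
proof -
  note D = exact_coeffsD[OF ex]
  have sub: "{s..t} \<subseteq> {0..T}" using st by auto
  show "hbound 4 (M * (t - s)) (\<lambda>j. U t j - U s j)"
    by (rule hbound_mean_value[where y' = V])
      (use st sub in \<open>auto intro!: D(3) has_vector_derivative_within_subset[OF D(4)]\<close>)
  show "hbound 3 ((M + C) * (t - s)) (\<lambda>j. V t j - V s j)"
  proof (rule hbound_mean_value[where y' = "\<lambda>t j. - of_real ((jb j)\<^sup>2) * U t j + of_real \<kappa> * nlcoeff a g (U t) j"])
    fix \<tau> assume "s \<le> \<tau>" "\<tau> \<le> t"
    then have \<tau>: "\<tau> \<in> {0..T}" using st by auto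
    have "hbound 3 M (\<lambda>j. - of_real ((jb j)\<^sup>2) * U \<tau> j)"
    proof (rule hbound_le[OF D(2)[OF \<tau>]])
      fix j
      have "jb j powr 5 = jb j powr 3 * jb j powr 2" by (simp only: powr_add[symmetric]) simp
      then show "jb j powr 3 * cmod (- of_real ((jb j)\<^sup>2) * U \<tau> j) \<le> jb j powr 5 * cmod (U \<tau> j)"
        by (simp add: norm_mult norm_power)
    qed
    moreover have "hbound 3 (1 * C) (\<lambda>j. of_real \<kappa> * nlcoeff a g (U \<tau>) j)"
      by (rule hbound_cmult[OF N[OF \<tau>]]) (use \<kappa> in simp)
    ultimately show "hbound 3 (M + C) (\<lambda>j. - of_real ((jb j)\<^sup>2) * U \<tau> j + of_real \<kappa> * nlcoeff a g (U \<tau>) j)"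
      using hbound_add by fastforce
  next
    fix j \<tau> assume "s \<le> \<tau>" "\<tau> \<le> t"
    then have "\<tau> \<in> {0..T}" using st by auto
    from has_vector_derivative_within_subset[OF D(5)[OF this] sub]
    show "((\<lambda>\<tau>. V \<tau> j) has_vector_derivative - of_real ((jb j)\<^sup>2) * U \<tau> j
      + of_real \<kappa> * nlcoeff a g (U \<tau>) j) (at \<tau> within {s..t})" .
  qed (use st in simp)
qed

lemma abs_cos_minus_one_le: "\<bar>2 * cos x - 2\<bar> \<le> (x::real)\<^sup>2"
proof -
  have "2 * cos x - 2 = - (2 * sin (x / 2))\<^sup>2"
    using cos_double_sin[of "x / 2"] by (simp add: power2_eq_square)
  moreover have "(2 * sin (x / 2))\<^sup>2 \<le> x\<^sup>2"
    using abs_sin_le_one abs_sin_x_le_abs_x[of "x / 2"] by (intro abs_le_square_iff[THEN iffD1]) (simp add: abs_mult)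
  ultimately show ?thesis by simp
qed

text \<open>The midpoint rule for the integral of the rotated nonlinearity over an interval of
  length \<open>2 * \<eta>\<close>. The claimed rate \<open>\<eta> powr (4 / 3) * \<eta>\<close> is
  deliberately below the classical third order, since regularity is short; the factor \<kappa> is
  kept explicit because it pays for the summation over the steps.\<close>

definition midpoint_error where
  "midpoint_error a g \<kappa> T E U V \<longleftrightarrow> (\<forall>m \<eta>. 0 < \<eta> \<and> \<eta> \<le> 1 \<and> 0 \<le> m - \<eta> \<and> m + \<eta> \<le> T \<longrightarrow>
     hbound 1 (\<kappa> * E * \<eta> powr (4 / 3) * \<eta>)
       (\<lambda>j. twisted U V (m + \<eta>) j - twisted U V (m - \<eta>) j
         - of_real (2 * \<eta> * \<kappa>) * cis (- (jb j * m)) * nlcoeff a g (U m) j))"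

text \<open>Seen as a function of the half length \<sigma>, the quadrature error vanishes at 0, and
  its derivative is the second difference of the rotated nonlinearity about \<open>m\<close>. It is
  enough to bound this derivative in \<open>H^1\<close> by \<open>\<sigma> powr (4 / 3)\<close>; the
  mean value inequality supplies the remaining factor.\<close>

lemma exact_local_error:
  assumes a: "smooth a" and g: "smooth g" and M: "0 \<le> M"
  obtains C where "0 \<le> C" "\<And>\<kappa> T U V. exact_coeffs a g \<kappa> T M U V \<Longrightarrow> 0 \<le> \<kappa> \<Longrightarrow> \<kappa> \<le> 1 \<Longrightarrow>
     midpoint_error a g \<kappa> T C U V"
proof -
  obtain C where C: "0 \<le> C" "\<And>x. herm x \<Longrightarrow> hbound 5 M x \<Longrightarrow> hbound 3 C (nlcoeff a g x)"
    using nonlinearity_regular[OF a g M] by blast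
  obtain L1 where L1: "0 \<le> L1" "\<And>x y e A. herm x \<Longrightarrow> herm y \<Longrightarrow> hbound 2 M x \<Longrightarrow> wbound 2 A x \<Longrightarrow> hbound 3 M y \<Longrightarrow>
    hbound 2 e (\<lambda>j. x j - y j) \<Longrightarrow> hbound 0 (L1 * e) (\<lambda>j. nlcoeff a g x j - nlcoeff a g y j)"
    by (rule nonlinearity_lipschitz[OF a g M]) (rule that)
  have M3: "0 \<le> 3 * M" using M by simp
  obtain L2 where L2: "0 \<le> L2"
    "\<And>x y z d. wbound 2 (3 * M) x \<Longrightarrow> wbound 2 (3 * M) y \<Longrightarrow> wbound 2 (3 * M) z \<Longrightarrow> wbound 2 d (\<lambda>j. x j - y j) \<Longrightarrow>
      wbound 2 d (\<lambda>j. z j - y j) \<Longrightarrow> wbound 2 (d\<^sup>2) (\<lambda>j. x j + z j - 2 * y j) \<Longrightarrow>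
      hbound 0 (L2 * d\<^sup>2) (\<lambda>j. nlcoeff a g x j + nlcoeff a g z j - 2 * nlcoeff a g y j)"
    by (rule nonlinearity_second_difference[OF a g M3]) (rule that)
  \<comment> \<open>\<open>c * \<sigma>\<close> is to dominate first differences of \<open>U\<close>
    and its square the second ones. The terms contain the embedding constant 3 and the interval
    length \<open>2 * \<sigma>\<close>; the final 1 ensures that \<open>c\<close> is at most its own
    square.\<close>
  define c where "c = 6 * M + 6 * (M + C) + 1"
  define E where "E = C + (L2 * c\<^sup>2 + 4 * C) + (L1 * c + 2 * C)"
  have c1: "1 \<le> c" using M C by (simp add: c_def)
  have E0: "0 \<le> E" using L1 L2 C c1 by (simp add: E_def)
  show ?thesis
  proof (rule that[OF E0], unfold midpoint_error_def, intro allI impI, elim conjE)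
    fix \<kappa> T m \<eta> :: real and U V
    assume ex: "exact_coeffs a g \<kappa> T M U V" and \<kappa>: "0 \<le> \<kappa>" "\<kappa> \<le> 1"
      and \<eta>: "0 < \<eta>" "\<eta> \<le> 1" and m: "0 \<le> m - \<eta>" "m + \<eta> \<le> T"
    define N where "N t = nlcoeff a g (U t)" for t
    note D = exact_coeffsD[OF ex]
    have N3: "hbound 3 C (N t)" if "t \<in> {0..T}" for t
      unfolding N_def by (rule C(2)[OF D(1,2)[OF that]])
    have Uw: "wbound 2 (3 * M) (U t)" if "t \<in> {0..T}" for t
      using wbound_weaken[OF hbound_imp_wbound[of 4 M "U t"], of 2] D(2)[OF that] by simp
    have inc: "hbound 4 (M * (t - s)) (\<lambda>j. U t j - U s j)" "hbound 3 ((M + C) * (t - s)) (\<lambda>j. V t j - V s j)"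
      if "0 \<le> s" "s \<le> t" "t \<le> T" for s t
      by (rule exact_coeffs_increments[OF ex _ \<kappa> that], rule N3[unfolded N_def], assumption)+
    have incw: "wbound 2 (c * \<delta>) (\<lambda>j. U t j - U s j)"
      if "0 \<le> s" "s \<le> t" "t \<le> T" "t - s \<le> 2 * \<delta>" "0 \<le> \<delta>" for s t \<delta>
    proof -
      have "wbound 2 (3 * (M * (t - s))) (\<lambda>j. U t j - U s j)"
        using wbound_weaken[OF hbound_imp_wbound[of 3 _ "\<lambda>j. U t j - U s j"], of _ 2] inc(1)[OF that(1-3)] by simp
      moreover have "3 * (M * (t - s)) \<le> c * \<delta>"
      proof -
        have "3 * (M * (t - s)) \<le> 3 * (M * (2 * \<delta>))" using that M by (intro mult_left_mono) auto
        also have "\<dots> = (6 * M) * \<delta>" by simp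
        also have "\<dots> \<le> c * \<delta>" using M C that by (intro mult_right_mono) (auto simp: c_def)
        finally show ?thesis .
      qed
      ultimately show ?thesis by (rule wbound_mono)
    qed
    have neg: "wbound 2 d (\<lambda>j. x j - y j)" if "wbound 2 d (\<lambda>j. y j - x j)" for d x y
      by (rule wbound_norm_le[OF that]) (simp add: norm_minus_commute)
    define y where "y \<sigma> j = twisted U V (m + 1 * \<sigma>) j - twisted U V (m + (-1) * \<sigma>) j
         - \<sigma> *\<^sub>R (2 * of_real \<kappa> * cis (- (jb j * m)) * N m j)" for \<sigma> j
    define y' where "y' \<sigma> j = 1 *\<^sub>R (of_real \<kappa> * cis (- (jb j * (m + 1 * \<sigma>))) * N (m + 1 * \<sigma>) j)
         - (-1) *\<^sub>R (of_real \<kappa> * cis (- (jb j * (m + (-1) * \<sigma>))) * N (m + (-1) * \<sigma>) j)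
         - 1 *\<^sub>R (2 * of_real \<kappa> * cis (- (jb j * m)) * N m j)" for \<sigma> j
    have y'_bound: "hbound 1 (\<kappa> * (E * \<sigma> powr (4 / 3))) (y' \<sigma>)" if \<sigma>: "0 \<le> \<sigma>" "\<sigma> \<le> \<eta>" for \<sigma>
    proof (cases "\<sigma> = 0")
      case True
      have "y' 0 = (\<lambda>j. 0)" by (simp add: y'_def fun_eq_iff)
      then show ?thesis using True by (simp add: hbound_def L2_set_def)
    next
      case False
      then have s0: "0 < \<sigma>" using \<sigma> by simp
      have s1: "\<sigma> \<le> 1" using \<sigma> \<eta> by simp
      have in_T: "m + \<sigma> \<in> {0..T}" "m - \<sigma> \<in> {0..T}" "m \<in> {0..T}" using \<sigma> m \<eta> by auto
      define D2 where "D2 j = N (m + \<sigma>) j + N (m - \<sigma>) j - 2 * N m j" for j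
      define D1 where "D1 j = N (m + \<sigma>) j - N (m - \<sigma>) j" for j
      \<comment> \<open>The second difference of \<open>U\<close> has the \<rho>-derivative
        \<open>V (m + \<rho>) - V (m - \<rho>)\<close>, itself an increment of size O(\<sigma>) in
        \<open>H^3\<close>.\<close>
      have "hbound 3 ((M + C) * (2 * \<sigma>)) (\<lambda>j. V (m + \<rho>) j - V (m - \<rho>) j)" if "0 \<le> \<rho>" "\<rho> \<le> \<sigma>" for \<rho>
      proof (rule hbound_mono[OF inc(2)])
        show "(M + C) * (m + \<rho> - (m - \<rho>)) \<le> (M + C) * (2 * \<sigma>)" using that M C by (intro mult_left_mono) auto
      qed (use that \<sigma> m \<eta> in auto)
      then have "hbound 3 ((M + C) * (2 * \<sigma>) * (\<sigma> - 0))
          (\<lambda>j. (U (m + 1 * \<sigma>) j + U (m + (-1) * \<sigma>) j) - (U (m + 1 * 0) j + U (m + (-1) * 0) j))"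
      proof (intro hbound_mean_value[where y' = "\<lambda>\<rho> j. 1 *\<^sub>R V (m + 1 * \<rho>) j + (-1) *\<^sub>R V (m + (-1) * \<rho>) j"])
        fix j \<rho> assume \<rho>: "0 \<le> \<rho>" "\<rho> \<le> \<sigma>"
        show "((\<lambda>\<rho>. U (m + 1 * \<rho>) j + U (m + (-1) * \<rho>) j) has_vector_derivative
           1 *\<^sub>R V (m + 1 * \<rho>) j + (-1) *\<^sub>R V (m + (-1) * \<rho>) j) (at \<rho> within {0..\<sigma>})"
          by (intro has_vector_derivative_add shift_vector_derivative[where T = T] D(4))
            (use \<rho> \<sigma> m \<eta> in auto)
      qed (use s0 in auto)
      then have "hbound 3 (2 * (M + C) * \<sigma>\<^sup>2) (\<lambda>j. U (m + \<sigma>) j + U (m - \<sigma>) j - 2 * U m j)"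
        by (simp add: power2_eq_square mult_ac)
      then have "wbound 2 (3 * (2 * (M + C) * \<sigma>\<^sup>2)) (\<lambda>j. U (m + \<sigma>) j + U (m - \<sigma>) j - 2 * U m j)"
        by (intro hbound_imp_wbound) simp
      moreover have "3 * (2 * (M + C) * \<sigma>\<^sup>2) \<le> (c * \<sigma>)\<^sup>2"
      proof -
        have "6 * (M + C) \<le> c" using M by (simp add: c_def)
        also have "c \<le> c\<^sup>2" using c1 by (simp add: power2_eq_square)
        finally have "6 * (M + C) * \<sigma>\<^sup>2 \<le> c\<^sup>2 * \<sigma>\<^sup>2" by (rule mult_right_mono) simp
        moreover have "3 * (2 * (M + C) * \<sigma>\<^sup>2) = 6 * (M + C) * \<sigma>\<^sup>2" by simp
        ultimately show ?thesis unfolding power_mult_distrib by linarith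
      qed
      ultimately have "wbound 2 ((c * \<sigma>)\<^sup>2) (\<lambda>j. U (m + \<sigma>) j + U (m - \<sigma>) j - 2 * U m j)" by (rule wbound_mono)
      then have D2_0: "hbound 0 (L2 * (c * \<sigma>)\<^sup>2) D2"
        unfolding D2_def N_def
        by (intro L2(2) Uw in_T incw[of m "m + \<sigma>" \<sigma>] neg[OF incw[of "m - \<sigma>" m \<sigma>]])
          (use \<sigma> m \<eta> in auto)
      have D1_0: "hbound 0 (L1 * (c * \<sigma>)) D1"
        unfolding D1_def N_def
      proof (rule hbound_mono[OF L1(2)[OF D(1)[OF in_T(1)] D(1)[OF in_T(2)] _ Uw[OF in_T(1)]]])
        show "hbound 2 M (U (m + \<sigma>))" "hbound 3 M (U (m - \<sigma>))"
          using hbound_weaken[OF D(2)[OF in_T(1)], of 2] hbound_weaken[OF D(2)[OF in_T(2)], of 3] by simp_all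
        show "hbound 2 (M * (m + \<sigma> - (m - \<sigma>))) (\<lambda>j. U (m + \<sigma>) j - U (m - \<sigma>) j)"
          by (rule hbound_weaken[OF inc(1)]) (use \<sigma> m \<eta> in auto)
        have "2 * M * \<sigma> \<le> c * \<sigma>" using M C s0 by (intro mult_right_mono) (auto simp: c_def)
        then show "L1 * (M * (m + \<sigma> - (m - \<sigma>))) \<le> L1 * (c * \<sigma>)"
          using L1(1) by (intro mult_left_mono) (auto simp: mult_ac)
      qed
      have "hbound 3 (2 * C) (\<lambda>j. 2 * N m j)" by (rule hbound_cmult[OF N3[OF in_T(3)]]) simp
      from hbound_diff[OF hbound_add[OF N3[OF in_T(1)] N3[OF in_T(2)]] this]
      have D2_3: "hbound 3 (4 * C) D2" by (simp add: D2_def[abs_def])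
      have D1_3: "hbound 3 (2 * C) D1"
        using hbound_diff[OF N3[OF in_T(1)] N3[OF in_T(2)]] by (simp add: D1_def[abs_def])
      have pw: "\<sigma> powr p * \<sigma> = \<sigma> powr (p + 1)" "\<sigma> powr p * \<sigma>\<^sup>2 = \<sigma> powr (p + 2)" for p
        using s0 by (simp_all add: powr_add)
      \<comment> \<open>The splitting frequency \<open>R = \<sigma> powr (- 2 / 3)\<close> balances
        \<open>R * \<sigma>^2\<close> from the low modes against \<open>R^(-2)\<close> from the high
        ones. This is the origin of the exponent \<open>4 / 3\<close>.\<close>
      have D2_1: "hbound 1 ((L2 * c\<^sup>2 + 4 * C) * \<sigma> powr (4 / 3)) D2"
      proof (rule hbound_mono[OF hbound_split_low_high[OF D2_0 D2_3, of "\<sigma> powr (- 2 / 3)" 1]])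
        have "(\<sigma> powr (- 2 / 3)) powr (1 - 0) * (L2 * (c * \<sigma>)\<^sup>2) = (L2 * c\<^sup>2) * (\<sigma> powr (- 2 / 3) * \<sigma>\<^sup>2)"
          using s0 by (simp add: power_mult_distrib)
        also have "\<dots> = (L2 * c\<^sup>2) * \<sigma> powr (4 / 3)" unfolding pw by simp
        finally have e1: "(\<sigma> powr (- 2 / 3)) powr (1 - 0) * (L2 * (c * \<sigma>)\<^sup>2) = (L2 * c\<^sup>2) * \<sigma> powr (4 / 3)" .
        have e2: "(\<sigma> powr (- 2 / 3)) powr (1 - 3) * (4 * C) = 4 * C * \<sigma> powr (4 / 3)"
          by (simp add: powr_powr)
        show "(\<sigma> powr (- 2 / 3)) powr (1 - 0) * (L2 * (c * \<sigma>)\<^sup>2) + (\<sigma> powr (- 2 / 3)) powr (1 - 3) * (4 * C)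
          \<le> (L2 * c\<^sup>2 + 4 * C) * \<sigma> powr (4 / 3)"
          unfolding e1 e2 distrib_right by simp
      qed (use s0 in auto)
      \<comment> \<open>Now \<open>R^2 * \<sigma>\<close> is balanced against \<open>R^(-1)\<close>.
        The result in \<open>H^2\<close> is only \<open>\<sigma> powr (1 / 3)\<close>; the sine in
        front of this difference gives back a factor \<sigma> at the price of one order.\<close>
      have D1_2: "hbound 2 ((L1 * c + 2 * C) * \<sigma> powr (1 / 3)) D1"
      proof (rule hbound_mono[OF hbound_split_low_high[OF D1_0 D1_3, of "\<sigma> powr (- 1 / 3)" 2]])
        have "(\<sigma> powr (- 1 / 3)) powr (2 - 0) * (L1 * (c * \<sigma>)) = (L1 * c) * (\<sigma> powr (- 2 / 3) * \<sigma>)"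
          by (simp add: powr_powr mult_ac)
        also have "\<dots> = (L1 * c) * \<sigma> powr (1 / 3)" unfolding pw by simp
        finally have e1: "(\<sigma> powr (- 1 / 3)) powr (2 - 0) * (L1 * (c * \<sigma>)) = (L1 * c) * \<sigma> powr (1 / 3)" .
        have e2: "(\<sigma> powr (- 1 / 3)) powr (2 - 3) * (2 * C) = 2 * C * \<sigma> powr (1 / 3)"
          by (subst powr_powr) simp
        show "(\<sigma> powr (- 1 / 3)) powr (2 - 0) * (L1 * (c * \<sigma>)) + (\<sigma> powr (- 1 / 3)) powr (2 - 3) * (2 * C)
          \<le> (L1 * c + 2 * C) * \<sigma> powr (1 / 3)"
          unfolding e1 e2 distrib_right by simp
      qed (use s0 in auto)
      \<comment> \<open>Here the rotation itself is differenced twice: two orders of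
        \<open>N m\<close> are exchanged for \<open>\<sigma>^2\<close>, which leads exactly from
        \<open>H^3\<close> to \<open>H^1\<close>.\<close>
      have T0: "hbound 1 (C * \<sigma>\<^sup>2) (\<lambda>j. of_real (2 * cos (jb j * \<sigma>) - 2) * N m j)"
        unfolding mult.commute[of C]
      proof (rule hbound_dominated[OF N3[OF in_T(3)]])
        fix j
        have "jb j powr 1 * \<bar>2 * cos (jb j * \<sigma>) - 2\<bar> \<le> jb j powr 1 * (jb j * \<sigma>)\<^sup>2"
          by (intro mult_left_mono abs_cos_minus_one_le) simp
        also have "\<dots> = \<sigma>\<^sup>2 * jb j powr 3"
          by (simp add: power_mult_distrib power2_eq_square power3_eq_cube)
        finally show "jb j powr 1 * cmod (of_real (2 * cos (jb j * \<sigma>) - 2) * N m j) \<le> \<sigma>\<^sup>2 * (jb j powr 3 * cmod (N m j))"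
          unfolding norm_mult norm_of_real mult.assoc[symmetric] by (rule mult_right_mono) simp
      qed simp
      have T1: "hbound 1 ((L2 * c\<^sup>2 + 4 * C) * \<sigma> powr (4 / 3)) (\<lambda>j. of_real (cos (jb j * \<sigma>)) * D2 j)"
        by (rule hbound_norm_le[OF D2_1]) (simp add: norm_mult mult_left_le_one_le)
      have T2: "hbound 1 (\<sigma> * ((L1 * c + 2 * C) * \<sigma> powr (1 / 3))) (\<lambda>j. - \<i> * of_real (sin (jb j * \<sigma>)) * D1 j)"
      proof (rule hbound_dominated[OF D1_2])
        fix j
        have "jb j powr 1 * \<bar>sin (jb j * \<sigma>)\<bar> \<le> jb j powr 1 * \<bar>jb j * \<sigma>\<bar>"
          by (intro mult_left_mono abs_sin_x_le_abs_x) simp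
        also have "\<dots> = \<sigma> * jb j powr 2" using s0 by (simp add: abs_mult power2_eq_square)
        finally have "jb j powr 1 * \<bar>sin (jb j * \<sigma>)\<bar> * cmod (D1 j) \<le> \<sigma> * jb j powr 2 * cmod (D1 j)"
          by (rule mult_right_mono) simp
        then show "jb j powr 1 * cmod (- \<i> * of_real (sin (jb j * \<sigma>)) * D1 j) \<le> \<sigma> * (jb j powr 2 * cmod (D1 j))"
          by (simp add: norm_mult mult.assoc)
      qed (use s0 in simp)
      \<comment> \<open>Real and imaginary parts of the rotation separate the symmetric second
        difference, multiplied by a cosine, from the antisymmetric first difference, multiplied by a
        sine.\<close>
      have id: "cis (- (jb j * \<sigma>)) * n1 + cis (jb j * \<sigma>) * n2 - 2 * n0
        = (of_real (2 * cos (jb j * \<sigma>) - 2) * n0 + of_real (cos (jb j * \<sigma>)) * (n1 + n2 - 2 * n0))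
          + (- \<i> * of_real (sin (jb j * \<sigma>)) * (n1 - n2))" for j n0 n1 n2
        by (simp add: complex_eq_iff algebra_simps)
      have "\<sigma> powr 2 \<le> \<sigma> powr (4 / 3)" using s0 s1 by (intro powr_mono') auto
      then have "C * \<sigma>\<^sup>2 \<le> C * \<sigma> powr (4 / 3)" using C(1) s0 by (simp add: mult_left_mono)
      moreover have "\<sigma> * ((L1 * c + 2 * C) * \<sigma> powr (1 / 3)) = (L1 * c + 2 * C) * \<sigma> powr (4 / 3)"
        using pw(1)[of "1 / 3"] by (simp add: mult_ac)
      ultimately have sum_le: "C * \<sigma>\<^sup>2 + (L2 * c\<^sup>2 + 4 * C) * \<sigma> powr (4 / 3) + \<sigma> * ((L1 * c + 2 * C) * \<sigma> powr (1 / 3)) \<le> E * \<sigma> powr (4 / 3)"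
        by (simp add: E_def distrib_right)
      have "hbound 1 (E * \<sigma> powr (4 / 3)) (\<lambda>j. cis (- (jb j * \<sigma>)) * N (m + \<sigma>) j + cis (jb j * \<sigma>) * N (m - \<sigma>) j - 2 * N m j)"
        using hbound_mono[OF hbound_add[OF hbound_add[OF T0 T1] T2] sum_le]
        unfolding id D1_def D2_def .
      then have "hbound 1 (\<kappa> * (E * \<sigma> powr (4 / 3))) (\<lambda>j. of_real \<kappa> * (cis (- (jb j * \<sigma>)) * N (m + \<sigma>) j + cis (jb j * \<sigma>) * N (m - \<sigma>) j - 2 * N m j))"
        by (rule hbound_cmult) (use \<kappa> in simp)
      then show ?thesis
      proof (rule hbound_norm_le)
        fix j
        have "y' \<sigma> j = cis (- (jb j * m)) * (of_real \<kappa> * (cis (- (jb j * \<sigma>)) * N (m + \<sigma>) j + cis (jb j * \<sigma>) * N (m - \<sigma>) j - 2 * N m j))"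
        proof -
          have "cis (- (jb j * (m + 1 * \<sigma>))) = cis (- (jb j * m)) * cis (- (jb j * \<sigma>))"
            "cis (- (jb j * (m + (-1) * \<sigma>))) = cis (- (jb j * m)) * cis (jb j * \<sigma>)"
            by (simp_all add: cis_mult algebra_simps)
          then show ?thesis unfolding y'_def by (simp add: algebra_simps)
        qed
        then show "cmod (y' \<sigma> j) \<le> cmod (of_real \<kappa> * (cis (- (jb j * \<sigma>)) * N (m + \<sigma>) j + cis (jb j * \<sigma>) * N (m - \<sigma>) j - 2 * N m j))"
          by (simp add: norm_mult)
      qed
    qed
    have "hbound 1 (\<kappa> * (E * \<eta> powr (4 / 3)) * (\<eta> - 0)) (\<lambda>j. y \<eta> j - y 0 j)"
    proof (rule hbound_mean_value[where y' = y'])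
      fix j \<sigma> assume \<sigma>: "0 \<le> \<sigma>" "\<sigma> \<le> \<eta>"
      have sh: "((\<lambda>\<sigma>. twisted U V (m + d * \<sigma>) j) has_vector_derivative
          d *\<^sub>R (of_real \<kappa> * cis (- (jb j * (m + d * \<sigma>))) * fc (nonlinearity a g (synth (U (m + d * \<sigma>)))) j))
          (at \<sigma> within {0..\<eta>})" if "d = 1 \<or> d = -1" for d
        by (rule shift_vector_derivative[where T = T], rule twisted_deriv[OF ex])
          (use \<sigma> m \<eta> that in auto)
      show "((\<lambda>\<sigma>. y \<sigma> j) has_vector_derivative y' \<sigma> j) (at \<sigma> within {0..\<eta>})"
        unfolding y_def y'_def N_def
        by (intro has_vector_derivative_diff sh) (auto simp: has_vector_derivative_def intro!: derivative_eq_intros)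
    next
      fix \<sigma> assume \<sigma>: "0 \<le> \<sigma>" "\<sigma> \<le> \<eta>"
      show "hbound 1 (\<kappa> * (E * \<eta> powr (4 / 3))) (y' \<sigma>)"
      proof (rule hbound_mono[OF y'_bound[OF \<sigma>]])
        show "\<kappa> * (E * \<sigma> powr (4 / 3)) \<le> \<kappa> * (E * \<eta> powr (4 / 3))"
          using \<sigma> \<kappa> E0 by (intro mult_left_mono powr_mono2) auto
      qed
    qed (use \<eta> in simp)
    then show "hbound 1 (\<kappa> * E * \<eta> powr (4 / 3) * \<eta>)
       (\<lambda>j. twisted U V (m + \<eta>) j - twisted U V (m - \<eta>) j
         - of_real (2 * \<eta> * \<kappa>) * cis (- (jb j * m)) * nlcoeff a g (U m) j)"
      by (simp add: y_def N_def scaleR_conv_of_real mult_ac)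
  qed
qed

text \<open>Variation of constants: \<open>y \<tau>\<close> transports the exact solution at time
  \<tau> by the linear flow to the final time, so that only the nonlinearity survives in its
  derivative. There \<open>sin (jb j * \<theta>) / jb j\<close> is at most the remaining time
  \<theta>, which yields the second factor \<eta>.\<close>

lemma exact_half_step:
  assumes ex: "exact_coeffs a g \<kappa> T M U V" and N: "\<And>t. t \<in> {0..T} \<Longrightarrow> hbound 3 C (nlcoeff a g (U t))"
    and \<kappa>: "0 \<le> \<kappa>" and \<eta>: "0 \<le> \<eta>" "0 \<le> t" "t + \<eta> \<le> T"
  shows "hbound 2 (\<kappa> * C * \<eta>\<^sup>2) (\<lambda>j. U (t + \<eta>) j
     - (of_real (cos (\<eta> * jb j)) * U t j + of_real (sin (\<eta> * jb j) / jb j) * V t j))"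
proof -
  note D = exact_coeffsD[OF ex]
  define y where "y \<tau> j = cos (jb j * (t + \<eta> - \<tau>)) *\<^sub>R U \<tau> j + (sin (jb j * (t + \<eta> - \<tau>)) / jb j) *\<^sub>R V \<tau> j" for \<tau> j
  define y' where "y' \<tau> j = (\<kappa> * sin (jb j * (t + \<eta> - \<tau>)) / jb j) *\<^sub>R nlcoeff a g (U \<tau>) j" for \<tau> j
  have C: "0 \<le> C" using hbound_nonneg[OF N[of t]] \<eta> by auto
  have "hbound 2 (\<kappa> * \<eta> * C * (t + \<eta> - t)) (\<lambda>j. y (t + \<eta>) j - y t j)"
  proof (rule hbound_mean_value[where y' = y'])
    fix j \<tau> assume \<tau>: "t \<le> \<tau>" "\<tau> \<le> t + \<eta>"
    then have \<tau>T: "\<tau> \<in> {0..T}" and sub: "{t..t + \<eta>} \<subseteq> {0..T}" using \<eta> by auto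
    let ?W = "- of_real ((jb j)\<^sup>2) * U \<tau> j + of_real \<kappa> * nlcoeff a g (U \<tau>) j"
    have "((\<lambda>\<tau>. y \<tau> j) has_vector_derivative
       (cos (jb j * (t + \<eta> - \<tau>)) *\<^sub>R V \<tau> j + (jb j * sin (jb j * (t + \<eta> - \<tau>))) *\<^sub>R U \<tau> j)
       + ((sin (jb j * (t + \<eta> - \<tau>)) / jb j) *\<^sub>R ?W + (- cos (jb j * (t + \<eta> - \<tau>))) *\<^sub>R V \<tau> j)) (at \<tau> within {t..t + \<eta>})"
      unfolding y_def
      by (intro has_vector_derivative_add has_vector_derivative_scaleR
          has_vector_derivative_within_subset[OF D(4)[OF \<tau>T] sub] has_vector_derivative_within_subset[OF D(5)[OF \<tau>T] sub])
        (auto intro!: derivative_eq_intros)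
    also have "(cos (jb j * (t + \<eta> - \<tau>)) *\<^sub>R V \<tau> j + (jb j * sin (jb j * (t + \<eta> - \<tau>))) *\<^sub>R U \<tau> j)
       + ((sin (jb j * (t + \<eta> - \<tau>)) / jb j) *\<^sub>R ?W + (- cos (jb j * (t + \<eta> - \<tau>))) *\<^sub>R V \<tau> j) = y' \<tau> j"
      by (simp add: y'_def scaleR_conv_of_real algebra_simps power2_eq_square)
    finally show "((\<lambda>\<tau>. y \<tau> j) has_vector_derivative y' \<tau> j) (at \<tau> within {t..t + \<eta>})" .
  next
    fix \<tau> assume \<tau>: "t \<le> \<tau>" "\<tau> \<le> t + \<eta>"
    then have "\<tau> \<in> {0..T}" using \<eta> by auto
    from hbound_weaken[OF N[OF this], of 2]
    show "hbound 2 (\<kappa> * \<eta> * C) (y' \<tau>)"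
    proof (rule hbound_dominated)
      fix j
      have "\<bar>sin (jb j * (t + \<eta> - \<tau>))\<bar> \<le> jb j * \<bar>t + \<eta> - \<tau>\<bar>"
        using abs_sin_x_le_abs_x[of "jb j * (t + \<eta> - \<tau>)"] by (simp add: abs_mult)
      also have "\<dots> \<le> jb j * \<eta>" using \<tau> by (intro mult_left_mono) auto
      finally have "\<kappa> * \<bar>sin (jb j * (t + \<eta> - \<tau>))\<bar> / jb j \<le> \<kappa> * (jb j * \<eta>) / jb j"
        using \<kappa> by (intro divide_right_mono mult_left_mono) auto
      then have "\<bar>\<kappa> * sin (jb j * (t + \<eta> - \<tau>)) / jb j\<bar> \<le> \<kappa> * \<eta>"
        using \<kappa> by (simp add: abs_mult)
      then show "jb j powr 2 * cmod (y' \<tau> j) \<le> \<kappa> * \<eta> * (jb j powr 2 * cmod (nlcoeff a g (U \<tau>) j))"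
        unfolding y'_def norm_scaleR mult.left_commute[of "jb j powr 2"]
        by (intro mult_right_mono) auto
    qed (use \<kappa> \<eta> in auto)
  qed (use \<eta> in auto)
  then show ?thesis by (simp add: y_def scaleR_conv_of_real power2_eq_square mult_ac)
qed

section \<open>One step of the integrator\<close>

text \<open>For Hermitian sequences, replacing \<open>j\<close> by \<open>- j\<close> and
  conjugating changes only the sign of the position part of \<open>diag\<close>. Half the sum and
  half the difference of the two versions isolate velocity and position.\<close>

lemma diag_components:
  assumes "herm x" "herm y" "hbound r e (diag x y)"
  shows "hbound (r + 1) e x" "hbound r e y"
proof -
  have r: "hbound r e (\<lambda>j. cnj (diag x y (- j)))"
    by (rule hbound_norm_le[OF hbound_reflect[OF assms(3)]]) simp
  have c: "cnj (diag x y (- j)) = y j - \<i> * of_real (jb j) * x j" for j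
    using assms(1,2) by (simp add: diag_def herm_def)
  have "hbound r (1 / 2 * (e + e)) (\<lambda>j. (1 / 2) * (diag x y j - cnj (diag x y (- j))))"
    by (rule hbound_cmult[OF hbound_diff[OF assms(3) r]]) simp
  also have "(\<lambda>j. (1 / 2) * (diag x y j - cnj (diag x y (- j)))) = (\<lambda>j. \<i> * of_real (jb j) * x j)"
    by (rule ext) (simp only: c, simp add: diag_def)
  finally have h: "hbound r e (\<lambda>j. \<i> * of_real (jb j) * x j)" by simp
  show "hbound (r + 1) e x"
    by (rule hbound_le[OF h]) (simp add: norm_mult powr_add)
  have "hbound r (1 / 2 * (e + e)) (\<lambda>j. (1 / 2) * (diag x y j + cnj (diag x y (- j))))"
    by (rule hbound_cmult[OF hbound_add[OF assms(3) r]]) simp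
  also have "(\<lambda>j. (1 / 2) * (diag x y j + cnj (diag x y (- j)))) = y"
    by (rule ext) (simp only: c, simp add: diag_def)
  finally show "hbound r e y" by simp
qed

lemma hbound_diag:
  assumes "hbound (r + 1) A x" "hbound r B y"
  shows "hbound r (B + A) (diag x y)"
proof -
  have "hbound r A (\<lambda>j. \<i> * of_real (jb j) * x j)"
    by (rule hbound_le[OF assms(1)]) (simp add: norm_mult powr_add)
  from hbound_add[OF assms(2) this] show ?thesis by (simp add: diag_def[abs_def])
qed

text \<open>The position after half a step of the linear flow; \<open>halfd\<close> is the
  corresponding velocity. Their \<open>diag\<close> is rotated by half the angle, so the pair keeps
  its norm.\<close>

definition halfc :: "real \<Rightarrow> (int \<Rightarrow> complex) \<Rightarrow> (int \<Rightarrow> complex) \<Rightarrow> int \<Rightarrow> complex" where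
  "halfc h x y j = of_real (cos (h / 2 * jb j)) * x j + of_real (sin (h / 2 * jb j) / jb j) * y j"

definition halfd :: "real \<Rightarrow> (int \<Rightarrow> complex) \<Rightarrow> (int \<Rightarrow> complex) \<Rightarrow> int \<Rightarrow> complex" where
  "halfd h x y j = of_real (cos (h / 2 * jb j)) * y j - of_real (jb j * sin (h / 2 * jb j)) * x j"

lemma herm_half: "herm x \<Longrightarrow> herm y \<Longrightarrow> herm (halfc h x y)" "herm x \<Longrightarrow> herm y \<Longrightarrow> herm (halfd h x y)"
  by (simp_all add: herm_def halfc_def halfd_def)

lemma diag_half: "diag (halfc h x y) (halfd h x y) j = cis (h / 2 * jb j) * diag x y j"
  by (simp add: diag_def halfc_def halfd_def complex_eq_iff algebra_simps)

lemma hbound_halfc: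
  assumes "herm x" "herm y" "hbound r e (diag x y)"
  shows "hbound (r + 1) e (halfc h x y)"
proof -
  have "hbound r e (diag (halfc h x y) (halfd h x y))"
    by (rule hbound_norm_le[OF assms(3)]) (simp add: diag_half norm_mult)
  from diag_components(1)[OF herm_half[OF assms(1,2)] this] show ?thesis .
qed

text \<open>The step of TI2 on coefficients, with \<open>f\<close> standing for the nonlinearity at
  the half step. Since \<open>h * sinc (h * \<omega>) = sin (h * \<omega>) / \<omega>\<close>, the
  filters appear as explicit quotients by \<open>jb j\<close>, which display the smoothing.\<close>

definition next_pos :: "real \<Rightarrow> real \<Rightarrow> (int \<Rightarrow> complex) \<Rightarrow> (int \<Rightarrow> complex) \<Rightarrow> (int \<Rightarrow> complex) \<Rightarrow> int \<Rightarrow> complex" where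
  "next_pos \<kappa> h x y f j = of_real (cos (h * jb j)) * x j + of_real (sin (h * jb j) / jb j) * y j
     + of_real (\<kappa> * (sin (h * jb j) / jb j) * (sin (h / 2 * jb j) / jb j)) * f j"

definition next_vel :: "real \<Rightarrow> real \<Rightarrow> (int \<Rightarrow> complex) \<Rightarrow> (int \<Rightarrow> complex) \<Rightarrow> (int \<Rightarrow> complex) \<Rightarrow> int \<Rightarrow> complex" where
  "next_vel \<kappa> h x y f j = of_real (cos (h * jb j)) * y j - of_real (jb j * sin (h * jb j)) * x j
     + of_real (\<kappa> * (sin (h * jb j) / jb j) * cos (h / 2 * jb j)) * f j"

lemma herm_next: "herm x \<Longrightarrow> herm y \<Longrightarrow> herm f \<Longrightarrow> herm (next_pos \<kappa> h x y f)"
  "herm x \<Longrightarrow> herm y \<Longrightarrow> herm f \<Longrightarrow> herm (next_vel \<kappa> h x y f)"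
  by (simp_all add: herm_def next_pos_def next_vel_def)

text \<open>The two filters of TI2 share the factor \<open>sin (h * jb j) / jb j\<close>. What
  remains of them is the sine (divided by \<open>jb j\<close>) and the cosine of the half angle, and
  these combine to one \<open>cis\<close>: the kick acts at the midpoint between two half
  rotations.\<close>

lemma diag_next:
  "diag (next_pos \<kappa> h x y f) (next_vel \<kappa> h x y f) j = cis (h * jb j) * diag x y j
     + of_real (\<kappa> * (sin (h * jb j) / jb j)) * cis (h / 2 * jb j) * f j"
  by (simp add: diag_def next_pos_def next_vel_def complex_eq_iff algebra_simps add_divide_distrib diff_divide_distrib)

text \<open>Merging the three series of each component requires absolute convergence. The position
  needs one order more than the velocity because the velocity update multiplies it by
  \<open>\<Omega>\<close>.\<close>

lemma ti_step_synth:
  assumes h: "0 < h" and x: "wbound 1 A (fc u)" and y: "wbound 0 A (fc v)"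
    and f: "wbound 0 A' (fc (F (synth (halfc h (fc u) (fc v)))))"
  shows "ti_step TI2_b1 TI2_bb1 F \<kappa> h (u, v) =
    (synth (next_pos \<kappa> h (fc u) (fc v) (fc (F (synth (halfc h (fc u) (fc v)))))),
     synth (next_vel \<kappa> h (fc u) (fc v) (fc (F (synth (halfc h (fc u) (fc v)))))))"
proof -
  have x0: "wbound 0 A (fc u)" using x by (rule wbound_weaken) simp
  have m: "wbound 0 B (\<lambda>j. of_real (c j) * z j)" if "wbound 0 B z" "\<And>j. \<bar>c j\<bar> \<le> 1" for B c and z :: "int \<Rightarrow> complex"
    by (rule wbound_norm_le[OF that(1)]) (simp add: norm_mult mult_left_le_one_le that(2))
  have sinc1: "\<bar>sinc z\<bar> \<le> 1" for z
    using abs_sin_x_le_abs_x[of z] by (simp add: abs_divide)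
  have hs: "h / 2 * sinc (h / 2 * jb j) = sin (h / 2 * jb j) / jb j" "h * sinc (h * jb j) = sin (h * jb j) / jb j" for j
    using h by simp_all
  have sq: "sqrt (h\<^sup>2 * (jb j)\<^sup>2) = h * jb j" for j using h by (simp add: real_sqrt_mult)
  have cb1: "\<bar>TI2_b1 (h\<^sup>2 * (jb j)\<^sup>2)\<bar> \<le> 1" for j
    unfolding TI2_b1_def sq abs_mult by (intro mult_le_one sinc1 abs_cos_le_one abs_ge_zero)
  have cbb1: "\<bar>TI2_bb1 (h\<^sup>2 * (jb j)\<^sup>2)\<bar> \<le> 1" for j
    unfolding TI2_bb1_def sq abs_mult
    by (intro mult_le_one sinc1 abs_ge_zero mult_nonneg_nonneg) simp
  let ?F = "F (synth (halfc h (fc u) (fc v)))"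
  have eq1: "synth (\<lambda>j. of_real (\<alpha> j) * fc u j) t + c * synth (\<lambda>j. of_real (\<beta> j) * fc v j) t
      = synth (\<lambda>j. of_real (\<alpha> j) * fc u j + of_real (c * \<beta> j) * fc v j) t"
    if "wbound 0 A (\<lambda>j. of_real (\<alpha> j) * fc u j)" "wbound 0 A (\<lambda>j. of_real (\<beta> j) * fc v j)" for \<alpha> \<beta> c t
  proof -
    have "wbound 0 (\<bar>c\<bar> * A) (\<lambda>j. of_real c * (of_real (\<beta> j) * fc v j))"
      by (rule wbound_dominated[OF that(2)]) (simp_all add: norm_mult)
    from synth_add[OF that(1) this, of t] show ?thesis by (simp add: synth_cmult mult.assoc)
  qed
  have uh: "(\<lambda>t. fourier_multiplier (\<lambda>\<omega>. cos (h / 2 * \<omega>)) u t + h / 2 * fourier_multiplier (\<lambda>\<omega>. sinc (h / 2 * \<omega>)) v t)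
      = synth (halfc h (fc u) (fc v))"
    unfolding fourier_multiplier_synth halfc_def[abs_def] hs[symmetric]
    by (rule ext, rule eq1) (intro m x0 y abs_cos_le_one sinc1)+
  have w3: "wbound 0 (\<bar>c\<bar> * A') (\<lambda>j. of_real c * (of_real (\<beta> j) * fc ?F j))" if "\<And>j. \<bar>\<beta> j\<bar> \<le> 1" for c \<beta>
    by (rule wbound_dominated[OF m[of A' "fc ?F" \<beta>, OF f that]]) (simp_all add: norm_mult)
  have w12: "wbound 0 (A + \<bar>c\<bar> * A) (\<lambda>j. of_real (\<alpha> j) * fc u j + of_real (c * \<beta> j) * fc v j)"
    if "wbound 0 A (\<lambda>j. of_real (\<alpha> j) * fc u j)" "\<And>j. \<bar>\<beta> j\<bar> \<le> 1" for \<alpha> \<beta> c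
    by (rule wbound_add[OF that(1)], rule wbound_dominated[OF y])
      (auto simp: norm_mult abs_mult that(2) intro!: mult_right_mono mult_left_le)
  have 1: "fourier_multiplier (\<lambda>\<omega>. cos (h * \<omega>)) u t + h * fourier_multiplier (\<lambda>\<omega>. sinc (h * \<omega>)) v t
      + \<kappa> * h\<^sup>2 * fourier_multiplier (\<lambda>\<omega>. TI2_bb1 (h\<^sup>2 * \<omega>\<^sup>2)) ?F t = synth (next_pos \<kappa> h (fc u) (fc v) (fc ?F)) t" for t
  proof -
    have "\<kappa> * h\<^sup>2 * TI2_bb1 (h\<^sup>2 * (jb j)\<^sup>2) = \<kappa> * (h * sinc (h * jb j)) * (h / 2 * sinc (h / 2 * jb j))" for j
      unfolding TI2_bb1_def sq by (simp add: power2_eq_square)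
    then have "complex_of_real (\<kappa> * (h * sinc (h * jb j)) * (h / 2 * sinc (h / 2 * jb j))) * z
        = of_real (\<kappa> * h\<^sup>2) * (of_real (TI2_bb1 (h\<^sup>2 * (jb j)\<^sup>2)) * z)" for j z
      by (simp only: mult.assoc[of "complex_of_real _", symmetric] of_real_mult[symmetric])
    then have "next_pos \<kappa> h (fc u) (fc v) (fc ?F) = (\<lambda>j. (of_real (cos (h * jb j)) * fc u j + of_real (h * sinc (h * jb j)) * fc v j)
       + of_real (\<kappa> * h\<^sup>2) * (of_real (TI2_bb1 (h\<^sup>2 * (jb j)\<^sup>2)) * fc ?F j))"
      unfolding next_pos_def[abs_def] hs[symmetric] by (simp only:)
    moreover have "synth (\<lambda>j. (of_real (cos (h * jb j)) * fc u j + of_real (h * sinc (h * jb j)) * fc v j)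
       + of_real (\<kappa> * h\<^sup>2) * (of_real (TI2_bb1 (h\<^sup>2 * (jb j)\<^sup>2)) * fc ?F j)) t
      = (synth (\<lambda>j. of_real (cos (h * jb j)) * fc u j) t + h * synth (\<lambda>j. of_real (sinc (h * jb j)) * fc v j) t)
        + (\<kappa> * h\<^sup>2) * synth (\<lambda>j. of_real (TI2_bb1 (h\<^sup>2 * (jb j)\<^sup>2)) * fc ?F j) t"
    proof (subst synth_add[OF w12 w3])
      show "wbound 0 A (\<lambda>j. of_real (cos (h * jb j)) * fc u j)" by (intro m x0) simp
      show "synth (\<lambda>j. of_real (cos (h * jb j)) * fc u j + of_real (h * sinc (h * jb j)) * fc v j) t +
        synth (\<lambda>j. of_real (\<kappa> * h\<^sup>2) * (of_real (TI2_bb1 (h\<^sup>2 * (jb j)\<^sup>2)) * fc ?F j)) t =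
        synth (\<lambda>j. of_real (cos (h * jb j)) * fc u j) t + h * synth (\<lambda>j. of_real (sinc (h * jb j)) * fc v j) t +
        \<kappa> * h\<^sup>2 * synth (\<lambda>j. of_real (TI2_bb1 (h\<^sup>2 * (jb j)\<^sup>2)) * fc ?F j) t"
        by (subst eq1[symmetric], intro m x0, simp, intro m y sinc1, simp only: synth_cmult)
    qed (intro sinc1 cbb1)+
    ultimately show ?thesis unfolding fourier_multiplier_synth by simp
  qed
  have om: "wbound 0 A (\<lambda>j. of_real (jb j * s j) * fc u j)" if "\<And>j. \<bar>s j\<bar> \<le> 1" for s
    by (rule wbound_le[OF x]) (simp add: norm_mult abs_mult that mult_left_le_one_le)
  have 2: "- fourier_multiplier (\<lambda>\<omega>. \<omega> * sin (h * \<omega>)) u t + fourier_multiplier (\<lambda>\<omega>. cos (h * \<omega>)) v t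
      + \<kappa> * h * fourier_multiplier (\<lambda>\<omega>. TI2_b1 (h\<^sup>2 * \<omega>\<^sup>2)) ?F t = synth (next_vel \<kappa> h (fc u) (fc v) (fc ?F)) t" for t
  proof -
    have "\<kappa> * h * TI2_b1 (h\<^sup>2 * (jb j)\<^sup>2) = \<kappa> * (h * sinc (h * jb j)) * cos (h / 2 * jb j)" for j
      unfolding TI2_b1_def sq by simp
    then have "complex_of_real (\<kappa> * (h * sinc (h * jb j)) * cos (h / 2 * jb j)) * z
        = of_real (\<kappa> * h) * (of_real (TI2_b1 (h\<^sup>2 * (jb j)\<^sup>2)) * z)" for j z
      by (simp only: mult.assoc[of "complex_of_real _", symmetric] of_real_mult[symmetric])
    moreover have "complex_of_real (cos (h * jb j)) * y - of_real (jb j * sin (h * jb j)) * x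
        = of_real (jb j * (- sin (h * jb j))) * x + of_real (1 * cos (h * jb j)) * y" for j x y by simp
    ultimately have "next_vel \<kappa> h (fc u) (fc v) (fc ?F) = (\<lambda>j. (of_real (jb j * (- sin (h * jb j))) * fc u j + of_real (1 * cos (h * jb j)) * fc v j)
       + of_real (\<kappa> * h) * (of_real (TI2_b1 (h\<^sup>2 * (jb j)\<^sup>2)) * fc ?F j))"
      unfolding next_vel_def[abs_def] hs[symmetric] by (simp only:)
    moreover have "synth (\<lambda>j. (of_real (jb j * (- sin (h * jb j))) * fc u j + of_real (1 * cos (h * jb j)) * fc v j)
       + of_real (\<kappa> * h) * (of_real (TI2_b1 (h\<^sup>2 * (jb j)\<^sup>2)) * fc ?F j)) t
      = (synth (\<lambda>j. of_real (jb j * (- sin (h * jb j))) * fc u j) t + 1 * synth (\<lambda>j. of_real (cos (h * jb j)) * fc v j) t)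
        + (\<kappa> * h) * synth (\<lambda>j. of_real (TI2_b1 (h\<^sup>2 * (jb j)\<^sup>2)) * fc ?F j) t"
    proof (subst synth_add[OF w12 w3])
      show "wbound 0 A (\<lambda>j. of_real (jb j * (- sin (h * jb j))) * fc u j)" by (intro om) simp
      show "synth (\<lambda>j. of_real (jb j * (- sin (h * jb j))) * fc u j + of_real (1 * cos (h * jb j)) * fc v j) t +
        synth (\<lambda>j. of_real (\<kappa> * h) * (of_real (TI2_b1 (h\<^sup>2 * (jb j)\<^sup>2)) * fc ?F j)) t =
        synth (\<lambda>j. of_real (jb j * (- sin (h * jb j))) * fc u j) t + 1 * synth (\<lambda>j. of_real (cos (h * jb j)) * fc v j) t +
        \<kappa> * h * synth (\<lambda>j. of_real (TI2_b1 (h\<^sup>2 * (jb j)\<^sup>2)) * fc ?F j) t"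
        by (subst eq1[symmetric], intro om, simp, intro m y abs_cos_le_one, simp only: synth_cmult)
    qed (intro abs_cos_le_one cb1)+
    moreover have "synth (\<lambda>j. of_real (jb j * (- sin (h * jb j))) * fc u j) t = - synth (\<lambda>j. of_real (jb j * sin (h * jb j)) * fc u j) t"
      using synth_cmult[of "-1" "\<lambda>j. of_real (jb j * sin (h * jb j)) * fc u j" t] by simp
    ultimately show ?thesis unfolding fourier_multiplier_synth by simp
  qed
  show ?thesis unfolding ti_step_def Let_def fst_conv snd_conv uh 1 2 by (simp add: eta_contract_eq)
qed

text \<open>The quotients by \<open>jb j\<close> give the kick two orders in the position and one in
  the velocity. A nonlinearity in \<open>H^3\<close> therefore reproduces \<open>H^5\<close> and
  \<open>H^4\<close>, though with a bound that grows from step to step.\<close>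

lemma hbound_next:
  assumes x: "hbound (r + 2) B x" and y: "hbound (r + 1) B y" and f: "hbound r B' f" and r: "0 \<le> r"
  shows "hbound (r + 2) (B + B + \<bar>\<kappa>\<bar> * B') (next_pos \<kappa> h x y f)" "hbound (r + 1) (B + B + \<bar>\<kappa>\<bar> * B') (next_vel \<kappa> h x y f)"
proof -
  have p2: "jb j powr (r + 2) = jb j powr (r + 1) * jb j" "jb j powr (r + 1) = jb j powr r * jb j" for j
    by (simp_all add: powr_add power2_eq_square)
  have 1: "hbound (r + 2) B (\<lambda>j. of_real (cos (h * jb j)) * x j)"
    by (rule hbound_norm_le[OF x]) (simp add: norm_mult mult_left_le_one_le)
  have 2: "hbound (r + 2) B (\<lambda>j. of_real (sin (h * jb j) / jb j) * y j)"
    by (rule hbound_le[OF y]) (simp add: p2(1) norm_mult norm_divide mult_left_le_one_le mult_left_mono)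
  have 3: "hbound (r + 2) (\<bar>\<kappa>\<bar> * B') (\<lambda>j. of_real (\<kappa> * (sin (h * jb j) / jb j) * (sin (h / 2 * jb j) / jb j)) * f j)"
  proof (rule hbound_dominated[OF f])
    fix j
    have "\<bar>sin (h * jb j) * sin (h / 2 * jb j)\<bar> \<le> 1" unfolding abs_mult by (intro mult_le_one) auto
    then have "\<bar>\<kappa>\<bar> * \<bar>sin (h * jb j) * sin (h / 2 * jb j)\<bar> * (jb j powr r * cmod (f j)) \<le> \<bar>\<kappa>\<bar> * 1 * (jb j powr r * cmod (f j))"
      by (intro mult_right_mono mult_left_mono) auto
    moreover have "jb j powr (r + 2) * cmod (of_real (\<kappa> * (sin (h * jb j) / jb j) * (sin (h / 2 * jb j) / jb j)) * f j)
        = \<bar>\<kappa>\<bar> * \<bar>sin (h * jb j) * sin (h / 2 * jb j)\<bar> * (jb j powr r * cmod (f j))"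
      unfolding norm_mult[of _ "f j"] norm_of_real p2 by (simp add: abs_mult abs_divide)
    ultimately show "jb j powr (r + 2) * cmod (of_real (\<kappa> * (sin (h * jb j) / jb j) * (sin (h / 2 * jb j) / jb j)) * f j)
        \<le> \<bar>\<kappa>\<bar> * (jb j powr r * cmod (f j))" by simp
  qed simp
  show "hbound (r + 2) (B + B + \<bar>\<kappa>\<bar> * B') (next_pos \<kappa> h x y f)"
    unfolding next_pos_def[abs_def] by (intro hbound_add 1 2 3)
  have 4: "hbound (r + 1) B (\<lambda>j. of_real (cos (h * jb j)) * y j)"
    by (rule hbound_norm_le[OF y]) (simp add: norm_mult mult_left_le_one_le)
  have 5: "hbound (r + 1) B (\<lambda>j. of_real (jb j * sin (h * jb j)) * x j)"
    by (rule hbound_le[OF x]) (simp add: p2(1) norm_mult mult_left_le_one_le mult_left_mono mult.assoc)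
  have 6: "hbound (r + 1) (\<bar>\<kappa>\<bar> * B') (\<lambda>j. of_real (\<kappa> * (sin (h * jb j) / jb j) * cos (h / 2 * jb j)) * f j)"
  proof (rule hbound_dominated[OF f])
    fix j
    have "\<bar>sin (h * jb j) * cos (h / 2 * jb j)\<bar> \<le> 1" unfolding abs_mult by (intro mult_le_one) auto
    then have "\<bar>\<kappa>\<bar> * \<bar>sin (h * jb j) * cos (h / 2 * jb j)\<bar> * (jb j powr r * cmod (f j)) \<le> \<bar>\<kappa>\<bar> * 1 * (jb j powr r * cmod (f j))"
      by (intro mult_right_mono mult_left_mono) auto
    moreover have "jb j powr (r + 1) * cmod (of_real (\<kappa> * (sin (h * jb j) / jb j) * cos (h / 2 * jb j)) * f j)
        = \<bar>\<kappa>\<bar> * \<bar>sin (h * jb j) * cos (h / 2 * jb j)\<bar> * (jb j powr r * cmod (f j))"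
      unfolding norm_mult[of _ "f j"] norm_of_real p2 by (simp add: abs_mult abs_divide)
    ultimately show "jb j powr (r + 1) * cmod (of_real (\<kappa> * (sin (h * jb j) / jb j) * cos (h / 2 * jb j)) * f j)
        \<le> \<bar>\<kappa>\<bar> * (jb j powr r * cmod (f j))" by simp
  qed simp
  show "hbound (r + 1) (B + B + \<bar>\<kappa>\<bar> * B') (next_vel \<kappa> h x y f)"
    unfolding next_vel_def[abs_def] by (intro hbound_add hbound_diff 4 5 6)
qed

section \<open>Propagation of errors\<close>

definition cutoff :: "(int \<Rightarrow> bool) \<Rightarrow> (int \<Rightarrow> complex) \<Rightarrow> int \<Rightarrow> complex" where
  "cutoff S x j = (if S j then x j else 0)"

lemma supp_cutoff: "supp S (cutoff S x)"
  by (simp add: supp_def cutoff_def)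

lemma herm_cutoff: "(\<And>j. S (- j) = S j) \<Longrightarrow> herm x \<Longrightarrow> herm (cutoff S x)"
  by (simp add: herm_def cutoff_def)

lemma hbound_cutoff: "hbound r B x \<Longrightarrow> hbound r B (cutoff S x)"
  by (erule hbound_norm_le) (simp add: cutoff_def)

lemma abs_sin_minus_le: "\<bar>sin x - x\<bar> \<le> \<bar>x\<bar> * (x::real)\<^sup>2"
proof -
  have "norm ((sin x - x) - (sin 0 - 0)) \<le> x\<^sup>2 * norm (x - 0)"
  proof (rule field_differentiable_bound[where S = "{-\<bar>x\<bar>..\<bar>x\<bar>}" and f' = "\<lambda>y. cos y - 1"])
    fix y assume y: "y \<in> {-\<bar>x\<bar>..\<bar>x\<bar>}"
    show "((\<lambda>y. sin y - y) has_field_derivative cos y - 1) (at y within {-\<bar>x\<bar>..\<bar>x\<bar>})"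
      by (auto intro!: derivative_eq_intros)
    have "y\<^sup>2 \<le> x\<^sup>2" using y by (intro abs_le_square_iff[THEN iffD1]) auto
    then show "norm (cos y - 1) \<le> x\<^sup>2"
      using abs_cos_minus_one_le[of y] zero_le_power2[of x] unfolding real_norm_def by arith
  qed auto
  then show ?thesis by (simp add: mult.commute)
qed

text \<open>The hypothesis on \<open>F\<close> near the exact solution splits its defect in two:
  \<open>d1\<close> is proportional to the current error, measured in \<open>L^2\<close>, and costs
  a factor \<kappa>; \<open>d2\<close> is the spatial error, measured in \<open>H^1\<close>, and
  costs \<open>\<kappa> * h\<close>. The smallness condition closes a bootstrap: the error stays at
  most 1, in the region where the constant \<open>L\<close> is valid. In \<open>r\<close>, the four
  terms come from the half-step error of the linear flow fed through \<open>L\<close>, from the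
  quadrature, from the filter \<open>sinc\<close> being different from 1, and from space.\<close>

lemma error_propagation:
  fixes s :: "nat \<Rightarrow> (real \<Rightarrow> real) \<times> (real \<Rightarrow> real)"
  assumes ex: "exact_coeffs a g \<kappa> T M U V" and \<kappa>: "0 \<le> \<kappa>" "\<kappa> \<le> 1" and h: "0 < h" "h \<le> 1" "\<kappa> \<le> c * h"
    and N: "\<And>t. t \<in> {0..T} \<Longrightarrow> hbound 3 C (nlcoeff a g (U t))"
    and E: "0 \<le> E" "midpoint_error a g \<kappa> T E U V"
    and S: "\<And>j. S (- j) = S j"
    and F: "\<And>x. herm x \<Longrightarrow> supp S x \<Longrightarrow> (\<exists>B. hbound 5 B x) \<Longrightarrow> supp S (fc (F (synth x))) \<and> (\<exists>B. hbound 3 B (fc (F (synth x))))"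
    and A: "\<And>t x e. t \<in> {0..T} \<Longrightarrow> herm x \<Longrightarrow> supp S x \<Longrightarrow> (\<exists>B. hbound 5 B x) \<Longrightarrow>
        hbound 2 e (\<lambda>j. x j - cutoff S (U t) j) \<Longrightarrow> e \<le> 1 \<Longrightarrow>
        \<exists>d1 d2. (\<forall>j. fc (F (synth x)) j - cutoff S (nlcoeff a g (U t)) j = d1 j + d2 j)
          \<and> hbound 0 (L * e) d1 \<and> hbound 1 \<rho> d2"
    and L: "0 \<le> L" and \<rho>: "0 \<le> \<rho>" and C: "0 \<le> C"
    and r: "r = L * C * \<kappa> * h + E * h powr (4 / 3) + C * h\<^sup>2 + \<rho>"
    and small: "T * \<kappa> * r * exp (c * L * T) + \<kappa> * C * h\<^sup>2 \<le> 1"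
    and s0: "fc (fst (s 0)) = cutoff S (U 0)" "fc (snd (s 0)) = cutoff S (V 0)"
    and s: "\<And>n. s (Suc n) = ti_step TI2_b1 TI2_bb1 F \<kappa> h (s n)"
    and n: "real n * h \<le> T"
  shows "(\<exists>B. hbound 5 B (fc (fst (s n))) \<and> hbound 4 B (fc (snd (s n)))) \<and>
    supp S (fc (fst (s n))) \<and> supp S (fc (snd (s n))) \<and>
    (0 < n \<longrightarrow> (\<exists>X Y B. s n = (synth X, synth Y) \<and> wbound 0 B X \<and> wbound 0 B Y)) \<and>
    hbound 1 (T * \<kappa> * r * exp (c * L * T))
      (\<lambda>j. cis (- (jb j * (real n * h))) * diag (fc (fst (s n))) (fc (snd (s n))) j - cutoff S (twisted U V (real n * h)) j)"
proof -
  define q where "q n j = cis (- (jb j * (real n * h))) * diag (fc (fst (s n))) (fc (snd (s n))) j" for n j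
  \<comment> \<open>A convenient majorant of the recursion
    \<open>e (n + 1) = (1 + \<kappa> * L) * e n + \<kappa> * h * r\<close> with
    \<open>e 0 = 0\<close>: each of the \<open>n\<close> local errors is given the largest
    amplification.\<close>
  define e where "e n = real n * \<kappa> * h * r * (1 + \<kappa> * L) ^ n" for n
  note D = exact_coeffsD[OF ex]
  have r0: "0 \<le> r" unfolding r using L C \<kappa> h E \<rho> by (intro add_nonneg_nonneg mult_nonneg_nonneg) auto
  have T0: "0 \<le> T" by (rule order_trans[OF _ n]) (use h in simp)
  have e_le: "e n \<le> T * \<kappa> * r * exp (c * L * T)" if n: "real n * h \<le> T" for n
  proof -
    have "(1 + \<kappa> * L) ^ n \<le> exp (\<kappa> * L) ^ n" using \<kappa> L by (intro power_mono) (auto simp: exp_ge_add_one_self)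
    also have "\<dots> = exp (real n * (\<kappa> * L))" by (simp add: exp_of_nat_mult)
    also have "\<dots> \<le> exp (c * L * T)"
    proof -
      have "real n * (\<kappa> * L) \<le> real n * (c * h * L)" using h L by (intro mult_left_mono mult_right_mono) auto
      also have "\<dots> = c * L * (real n * h)" by simp
      also have "\<dots> \<le> c * L * T"
      proof -
        have "0 \<le> c" using h \<kappa> by (metis linorder_not_le mult_neg_pos order.trans order_less_irrefl order_le_less_trans)
        then show ?thesis using L n by (intro mult_left_mono) auto
      qed
      finally show ?thesis by simp
    qed
    finally have "(real n * h) * (\<kappa> * r) * (1 + \<kappa> * L) ^ n \<le> T * (\<kappa> * r) * exp (c * L * T)"
      using n h \<kappa> r0 L T0 by (intro mult_mono) auto
    then show ?thesis by (simp add: e_def mult_ac)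
  qed
  have main: "(\<exists>B. hbound 5 B (fc (fst (s n))) \<and> hbound 4 B (fc (snd (s n)))) \<and>
      supp S (fc (fst (s n))) \<and> supp S (fc (snd (s n))) \<and>
      (0 < n \<longrightarrow> (\<exists>X Y B. s n = (synth X, synth Y) \<and> wbound 0 B X \<and> wbound 0 B Y)) \<and>
      hbound 1 (e n) (\<lambda>j. q n j - cutoff S (twisted U V (real n * h)) j)"
    using n
  proof (induction n)
    case 0
    have T0: "0 \<in> {0..T}" using 0 by simp
    have "q 0 j - cutoff S (twisted U V (real 0 * h)) j = 0" for j
      by (simp add: q_def s0 twisted_def cutoff_def diag_def)
    then have "hbound 1 (e 0) (\<lambda>j. q 0 j - cutoff S (twisted U V (real 0 * h)) j)"
      by (simp add: e_def hbound_def L2_set_def)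
    then show ?case
      using hbound_cutoff[OF D(2)[OF T0]] hbound_cutoff[OF D(3)[OF T0]] supp_cutoff unfolding s0 by blast
  next
    case (Suc n)

    \<comment> \<open>One step on the level of coefficients\<close>
    define x where "x = fc (fst (s n))"
    define y where "y = fc (snd (s n))"
    define m where "m = real n * h + h / 2"
    define z where "z = halfc h x y"
    define f where "f = fc (F (synth z))"
    have Tn: "real n * h \<in> {0..T}" "m \<in> {0..T}" "real (Suc n) * h \<in> {0..T}" "real n * h + h \<le> T"
      using Suc.prems h by (auto simp: m_def distrib_right)
    have IH: "(\<exists>B. hbound 5 B x \<and> hbound 4 B y)" "supp S x" "supp S y"
      "hbound 1 (e n) (\<lambda>j. q n j - cutoff S (twisted U V (real n * h)) j)"
      using Suc.IH Tn(1) unfolding x_def y_def by auto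
    obtain B where B: "hbound 5 B x" "hbound 4 B y" using IH(1) by blast
    have hx: "herm x" "herm y" by (simp_all add: x_def y_def)
    have "hbound 4 (B + B) (diag x y)" by (rule hbound_diag) (use B in auto)
    from hbound_halfc[OF hx this, of h] have z5: "\<exists>B. hbound 5 B z" unfolding z_def by auto
    have hz: "herm z" unfolding z_def by (rule herm_half(1)[OF hx])
    have sz: "supp S z" using IH(2,3) by (simp add: supp_def z_def halfc_def)
    from F[OF hz sz z5] obtain B' where f: "supp S f" "hbound 3 B' f" by (auto simp: f_def)
    have step: "s (Suc n) = (synth (next_pos \<kappa> h x y f), synth (next_vel \<kappa> h x y f))"
    proof -
      have "wbound 1 (3 * B) x" using wbound_weaken[OF hbound_imp_wbound[of 4 B x], of 1] B by simp
      moreover have "wbound 0 (3 * B) y" using wbound_weaken[OF hbound_imp_wbound[of 3 B y], of 0] B by simp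
      moreover have "wbound 0 (3 * B') f" using wbound_weaken[OF hbound_imp_wbound[of 2 B' f], of 0] f by simp
      ultimately have "ti_step TI2_b1 TI2_bb1 F \<kappa> h (fst (s n), snd (s n)) = (synth (next_pos \<kappa> h x y f), synth (next_vel \<kappa> h x y f))"
        using h unfolding x_def y_def f_def z_def by (intro ti_step_synth)
      then show ?thesis by (simp add: s)
    qed
    have hf: "herm f" by (simp add: f_def)
    have X5: "hbound 5 (B + B + \<bar>\<kappa>\<bar> * B') (next_pos \<kappa> h x y f)" and Y4: "hbound 4 (B + B + \<bar>\<kappa>\<bar> * B') (next_vel \<kappa> h x y f)"
      using hbound_next[of 3 B x y B' f] B f(2) by auto
    have X0: "wbound 0 (3 * (B + B + \<bar>\<kappa>\<bar> * B')) (next_pos \<kappa> h x y f)"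
      by (rule wbound_weaken[OF hbound_imp_wbound[of 4]]) (use X5 in simp_all)
    have Y0: "wbound 0 (3 * (B + B + \<bar>\<kappa>\<bar> * B')) (next_vel \<kappa> h x y f)"
      by (rule wbound_weaken[OF hbound_imp_wbound[of 3]]) (use Y4 in simp_all)
    have fcs: "fc (fst (s (Suc n))) = next_pos \<kappa> h x y f" "fc (snd (s (Suc n))) = next_vel \<kappa> h x y f"
      using fc_synth[OF herm_next(1)[OF hx hf] X0] fc_synth[OF herm_next(2)[OF hx hf] Y0] by (auto simp: step)
    have supps: "supp S (next_pos \<kappa> h x y f)" "supp S (next_vel \<kappa> h x y f)"
      using IH(2,3) f(1) by (auto simp: supp_def next_pos_def next_vel_def)

    \<comment> \<open>Comparison with the exact solution at the midpoint\<close>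
    define Nm where "Nm = nlcoeff a g (U m)"
    let ?tn = "real n * h"
    have "hbound 1 (e n) (diag (\<lambda>j. x j - cutoff S (U ?tn) j) (\<lambda>j. y j - cutoff S (V ?tn) j))"
    proof (rule hbound_norm_le[OF IH(4)])
      fix j
      have "q n j - cutoff S (twisted U V ?tn) j = cis (- (jb j * ?tn)) * diag (\<lambda>j. x j - cutoff S (U ?tn) j) (\<lambda>j. y j - cutoff S (V ?tn) j) j"
        by (simp add: q_def x_def y_def twisted_def cutoff_def diag_def algebra_simps)
      then show "cmod (diag (\<lambda>j. x j - cutoff S (U ?tn) j) (\<lambda>j. y j - cutoff S (V ?tn) j) j) \<le> cmod (q n j - cutoff S (twisted U V ?tn) j)"
        by (simp add: norm_mult)
    qed
    moreover have "herm (\<lambda>j. x j - cutoff S (U ?tn) j)" "herm (\<lambda>j. y j - cutoff S (V ?tn) j)"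
    proof -
      show "herm (\<lambda>j. x j - cutoff S (U ?tn) j)" using hx(1) herm_cutoff[of S, OF S D(1)[OF Tn(1)]] by (simp add: herm_def)
      \<comment> \<open>The symmetry is part of the hypotheses for \<open>U\<close> only.
        \<open>V\<close> inherits it as time derivative, since derivatives within an interval of
        positive length are unique, also at its end points.\<close>
      have hV: "herm (V t)" if t: "t \<in> {0..T}" for t
        unfolding herm_def
      proof
        fix j
        have "((\<lambda>\<tau>. U \<tau> (- j)) has_vector_derivative cnj (V t j)) (at t within {0..T})"
        proof (rule has_vector_derivative_transform_within[OF _ zero_less_one t])
          show "((\<lambda>\<tau>. cnj (U \<tau> j)) has_vector_derivative cnj (V t j)) (at t within {0..T})"
            by (rule bounded_linear.has_vector_derivative[OF bounded_linear_cnj D(4)[OF t]])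
          show "cnj (U \<tau> j) = U \<tau> (- j)" if "\<tau> \<in> {0..T}" for \<tau> using D(1)[OF that] by (simp add: herm_def)
        qed
        moreover have "0 < T" using Suc.prems h by (smt (verit) mult_pos_pos of_nat_0_less_iff zero_less_Suc)
        ultimately show "V t (- j) = cnj (V t j)"
          using vector_derivative_unique_within_closed_interval[of 0 T t "\<lambda>\<tau>. U \<tau> (- j)" "V t (- j)" "cnj (V t j)"] D(4)[OF t] t by simp
      qed
      show "herm (\<lambda>j. y j - cutoff S (V ?tn) j)" using hx(2) herm_cutoff[of S, OF S hV[OF Tn(1)]] by (simp add: herm_def)
    qed
    \<comment> \<open>The half rotation preserves the \<open>H^1\<close> bound of
      \<open>diag\<close>, and this is an \<open>H^2\<close> bound of the position, as the
      nonlinearity requires.\<close>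
    ultimately have "hbound (1 + 1) (e n) (halfc h (\<lambda>j. x j - cutoff S (U ?tn) j) (\<lambda>j. y j - cutoff S (V ?tn) j))"
      by (intro hbound_halfc)
    then have z1: "hbound 2 (e n) (\<lambda>j. z j - cutoff S (halfc h (U ?tn) (V ?tn)) j)"
      by (rule hbound_le) (simp add: z_def halfc_def cutoff_def algebra_simps diff_divide_distrib)
    have "hbound 2 (\<kappa> * C * (h / 2)\<^sup>2) (\<lambda>j. U (?tn + h / 2) j
       - (of_real (cos (h / 2 * jb j)) * U ?tn j + of_real (sin (h / 2 * jb j) / jb j) * V ?tn j))"
      by (rule exact_half_step[OF ex N \<kappa>(1)]) (use Tn h in auto)
    then have z2: "hbound 2 (\<kappa> * C * h\<^sup>2) (\<lambda>j. cutoff S (U m) j - cutoff S (halfc h (U ?tn) (V ?tn)) j)"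
    proof (rule hbound_mono[OF hbound_norm_le])
      show "\<kappa> * C * (h / 2)\<^sup>2 \<le> \<kappa> * C * h\<^sup>2" using \<kappa> C by (intro mult_left_mono) (auto simp: power_divide)
    qed (simp add: cutoff_def m_def halfc_def)
    define \<epsilon> where "\<epsilon> = e n + \<kappa> * C * h\<^sup>2"
    have z3: "hbound 2 \<epsilon> (\<lambda>j. z j - cutoff S (U m) j)"
      using hbound_diff[OF z1 z2] by (simp add: \<epsilon>_def)
    \<comment> \<open>The bootstrap: the closed bound for \<open>e n\<close> and the smallness
      condition admit the Lipschitz estimate at this step.\<close>
    have "\<epsilon> \<le> 1" unfolding \<epsilon>_def using e_le[of n] Tn small by auto
    from A[OF Tn(2) hz sz z5 z3 this] obtain d1 d2 where
      d: "\<And>j. f j - cutoff S Nm j = d1 j + d2 j" and d1: "hbound 0 (L * \<epsilon>) d1" and d2: "hbound 1 \<rho> d2"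
      unfolding f_def Nm_def by blast
    \<comment> \<open>The filter factor is used in three ways: bounded by \<open>1 / jb j\<close> it
      turns \<open>L^2\<close> into \<open>H^1\<close> for \<open>d1\<close>; bounded by
      \<open>h\<close> it keeps \<open>H^1\<close> for \<open>d2\<close>; and its deviation from
      \<open>h\<close> takes two orders from the exact nonlinearity in exchange for
      \<open>h^2\<close>.\<close>
    let ?s = "\<lambda>j. sin (h * jb j) / jb j"
    have sin1: "\<bar>?s j\<bar> \<le> 1 / jb j" for j by (simp add: abs_divide divide_right_mono)
    have sin2: "\<bar>?s j\<bar> \<le> h" for j
      using abs_sin_x_le_abs_x[of "h * jb j"] h by (simp add: abs_mult field_simps)
    have sin3: "\<bar>?s j - h\<bar> \<le> h * (h * jb j)\<^sup>2" for j
    proof -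
      have "\<bar>?s j - h\<bar> = \<bar>sin (h * jb j) - h * jb j\<bar> / jb j" by (simp add: abs_divide field_simps)
      also have "\<dots> \<le> (\<bar>h * jb j\<bar> * (h * jb j)\<^sup>2) / jb j" by (intro divide_right_mono abs_sin_minus_le) simp
      also have "\<dots> = h * (h * jb j)\<^sup>2" using h by (simp add: abs_mult)
      finally show ?thesis .
    qed
    have K1: "hbound 1 (\<kappa> * (L * \<epsilon>)) (\<lambda>j. of_real (\<kappa> * ?s j) * cis (- (jb j * m)) * d1 j)"
    proof (rule hbound_dominated[OF d1 \<kappa>(1)])
      fix j
      have "jb j * \<bar>\<kappa> * ?s j\<bar> * cmod (d1 j) \<le> jb j * (\<kappa> * (1 / jb j)) * cmod (d1 j)"
        unfolding abs_mult using sin1[of j] \<kappa> by (intro mult_right_mono mult_left_mono mult_mono) auto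
      then show "jb j powr 1 * cmod (of_real (\<kappa> * ?s j) * cis (- (jb j * m)) * d1 j) \<le> \<kappa> * (jb j powr 0 * cmod (d1 j))"
        by (simp only: norm_mult norm_of_real norm_cis) (simp add: mult_ac)
    qed
    have K2: "hbound 1 (\<kappa> * h * \<rho>) (\<lambda>j. of_real (\<kappa> * ?s j) * cis (- (jb j * m)) * d2 j)"
    proof (rule hbound_dominated[OF d2])
      fix j
      have "\<bar>\<kappa> * ?s j\<bar> * (jb j powr 1 * cmod (d2 j)) \<le> \<kappa> * h * (jb j powr 1 * cmod (d2 j))"
        unfolding abs_mult using sin2[of j] \<kappa> by (intro mult_right_mono mult_mono) auto
      then show "jb j powr 1 * cmod (of_real (\<kappa> * ?s j) * cis (- (jb j * m)) * d2 j) \<le> \<kappa> * h * (jb j powr 1 * cmod (d2 j))"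
        by (simp only: norm_mult norm_of_real norm_cis) (simp add: mult_ac)
    qed (use \<kappa> h in simp)
    have Nm3: "hbound 3 C Nm" unfolding Nm_def by (rule N[OF Tn(2)])
    have K3: "hbound 1 (\<kappa> * h * h\<^sup>2 * C) (\<lambda>j. cutoff S (\<lambda>j. of_real (\<kappa> * (?s j - h)) * cis (- (jb j * m)) * Nm j) j)"
    proof (rule hbound_dominated[OF Nm3])
      fix j
      have "jb j powr 1 * \<bar>\<kappa> * (?s j - h)\<bar> * cmod (Nm j) \<le> jb j powr 1 * (\<kappa> * (h * (h * jb j)\<^sup>2)) * cmod (Nm j)"
        unfolding abs_mult using sin3[of j] \<kappa> by (intro mult_right_mono mult_left_mono mult_mono) auto
      also have "\<dots> = \<kappa> * h * h\<^sup>2 * (jb j powr 3 * cmod (Nm j))"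
        by (simp add: power2_eq_square power3_eq_cube)
      finally have "jb j powr 1 * \<bar>\<kappa> * (?s j - h)\<bar> * cmod (Nm j) \<le> \<kappa> * h * h\<^sup>2 * (jb j powr 3 * cmod (Nm j))" .
      then show "jb j powr 1 * cmod (cutoff S (\<lambda>j. of_real (\<kappa> * (?s j - h)) * cis (- (jb j * m)) * Nm j) j) \<le> \<kappa> * h * h\<^sup>2 * (jb j powr 3 * cmod (Nm j))"
        using \<kappa> h unfolding cutoff_def by (cases "S j") (simp_all only: norm_mult norm_of_real norm_cis if_True if_False norm_zero, simp_all add: mult_ac)
    qed (use \<kappa> h in simp)
    define l where "l j = twisted U V (m + h / 2) j - twisted U V (m - h / 2) j - of_real (2 * (h / 2) * \<kappa>) * cis (- (jb j * m)) * Nm j" for j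
    have "hbound 1 (\<kappa> * E * (h / 2) powr (4 / 3) * (h / 2)) l"
      unfolding l_def Nm_def by (rule E(2)[unfolded midpoint_error_def, rule_format]) (use h Tn in \<open>auto simp: m_def\<close>)
    moreover have "\<kappa> * E * (h / 2) powr (4 / 3) * (h / 2) \<le> \<kappa> * E * h powr (4 / 3) * h"
      using \<kappa> E h by (intro mult_mono mult_left_mono powr_mono2) auto
    ultimately have "hbound 1 (\<kappa> * E * h powr (4 / 3) * h) l" by (rule hbound_mono)
    then have K4: "hbound 1 (\<kappa> * E * h powr (4 / 3) * h) (cutoff S l)" by (rule hbound_cutoff)
    \<comment> \<open>The new error is the old one plus the kicks by \<open>d1\<close> and
      \<open>d2\<close>, plus the effect of the filter on the exact nonlinearity, minus the midpoint
      error. Undoing the rotation leaves the old error without any factor.\<close>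
    have id: "q (Suc n) j - cutoff S (twisted U V (real (Suc n) * h)) j =
       (((q n j - cutoff S (twisted U V ?tn) j) + of_real (\<kappa> * ?s j) * cis (- (jb j * m)) * d1 j)
        + of_real (\<kappa> * ?s j) * cis (- (jb j * m)) * d2 j)
        + cutoff S (\<lambda>j. of_real (\<kappa> * (?s j - h)) * cis (- (jb j * m)) * Nm j) j - cutoff S l j" for j
    proof -
      have c1: "cis (- (jb j * (real (Suc n) * h))) * cis (h * jb j) = cis (- (jb j * ?tn))"
        unfolding cis_mult by (rule arg_cong[of _ _ cis]) (simp add: algebra_simps)
      have c2: "cis (- (jb j * (real (Suc n) * h))) * cis (h / 2 * jb j) = cis (- (jb j * m))"
        unfolding cis_mult by (rule arg_cong[of _ _ cis]) (simp add: m_def algebra_simps)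
      have q1: "q (Suc n) j = q n j + of_real (\<kappa> * ?s j) * cis (- (jb j * m)) * f j"
        unfolding q_def fcs diag_next c1[symmetric] c2[symmetric] by (simp add: x_def y_def algebra_simps)
      have f: "f j = cutoff S Nm j + d1 j + d2 j" using d[of j] by (simp add: algebra_simps)
      have t: "m + h / 2 = real (Suc n) * h" "m - h / 2 = ?tn" by (simp_all add: m_def algebra_simps)
      show ?thesis
      proof (cases "S j")
        case True
        then show ?thesis unfolding q1 f l_def t cutoff_def
          by (simp add: algebra_simps add_divide_distrib diff_divide_distrib)
      next
        case False
        then show ?thesis unfolding q1 f cutoff_def
          by (simp add: algebra_simps add_divide_distrib diff_divide_distrib)
      qed
    qed
    \<comment> \<open>The part \<open>\<kappa> * C * h^2\<close> of \<epsilon> reappears as the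
      summand \<open>L * C * \<kappa> * h\<close> of \<open>r\<close>, after one factor
      \<open>\<kappa> * h\<close> is taken out.\<close>
    have "e n + \<kappa> * (L * \<epsilon>) + \<kappa> * h * \<rho> + \<kappa> * h * h\<^sup>2 * C + \<kappa> * E * h powr (4 / 3) * h = (1 + \<kappa> * L) * e n + \<kappa> * h * r"
      unfolding \<epsilon>_def r by (simp add: algebra_simps power2_eq_square)
    also have "\<dots> \<le> e (Suc n)"
    proof -
      have "\<kappa> * h * r * 1 \<le> \<kappa> * h * r * (1 + \<kappa> * L) ^ Suc n"
        using \<kappa> h r0 L by (intro mult_left_mono one_le_power) auto
      then show ?thesis by (simp add: e_def algebra_simps)
    qed
    finally have "hbound 1 (e (Suc n)) (\<lambda>j. q (Suc n) j - cutoff S (twisted U V (real (Suc n) * h)) j)"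
      unfolding id by (rule hbound_mono[OF hbound_diff[OF hbound_add[OF hbound_add[OF hbound_add[OF IH(4) K1] K2] K3] K4]])
    moreover have "\<exists>X Y B. s (Suc n) = (synth X, synth Y) \<and> wbound 0 B X \<and> wbound 0 B Y" using step X0 Y0 by blast
    ultimately show ?case using X5 Y4 supps unfolding fcs by blast
  qed
  then show ?thesis using hbound_mono[OF _ e_le[OF n]] unfolding q_def by blast
qed

section \<open>Trigonometric interpolation\<close>

text \<open>The discrete Fourier transform of the grid values, extended by zero, so that
  interpolants become series with finitely many modes.\<close>

definition interp_coeff :: "nat \<Rightarrow> (real \<Rightarrow> real) \<Rightarrow> int \<Rightarrow> complex" where
  "interp_coeff K w = cutoff (low K) (\<lambda>j. (\<Sum>k<2 * K + 1. of_real (w (grid_point K k))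
     * cis (- (real_of_int j * grid_point K k))) / of_nat (2 * K + 1))"

lemma supp_interp_coeff [simp]: "supp (low K) (interp_coeff K w)"
  unfolding interp_coeff_def by (rule supp_cutoff)

lemma herm_interp_coeff [simp]: "herm (interp_coeff K w)"
  unfolding interp_coeff_def by (rule herm_cutoff) (simp_all add: herm_def cis_cnj)

lemma synth_low: "supp (low K) x \<Longrightarrow> synth x = synth_upto K x"
  by (rule synth_finite_support) (auto simp: supp_def low_def)

lemma synth_interp_coeff: "synth (interp_coeff K w) = (\<lambda>x. Re (\<Sum>j = - int K..int K. ((\<Sum>k<2 * K + 1. of_real (w (grid_point K k))
   * cis (- (real_of_int j * grid_point K k))) / of_nat (2 * K + 1)) * cis (real_of_int j * x)))"
  unfolding synth_low[OF supp_interp_coeff] synth_upto_def[abs_def]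
  by (rule ext, rule arg_cong[where f = Re], rule sum.cong) (auto simp: interp_coeff_def cutoff_def low_def)

lemma interpolant_synth_interp_coeff: "is_trig_interpolant K w (synth (interp_coeff K w))"
  unfolding synth_interp_coeff by (rule trig_interpolant_exists)

lemma trig_interpolation_synth: "trig_interpolation K w = synth (interp_coeff K w)"
  unfolding trig_interpolation_def
  using theI'[OF trig_interpolant_unique[of K w]] interpolant_synth_interp_coeff[of K w] trig_interpolant_unique[of K w] by blast

lemma synth_interp_coeff_grid: "k < 2 * K + 1 \<Longrightarrow> synth (interp_coeff K w) (grid_point K k) = w (grid_point K k)"
  using interpolant_synth_interp_coeff[of K w] unfolding is_trig_interpolant_def by blast

lemma fc_low: "herm x \<Longrightarrow> supp (low K) x \<Longrightarrow> fc (synth x) j = x j"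
  by (metis finite_support_bounds fc_synth)

lemma interp_coeff_trig_poly:
  assumes "herm x" "supp (low K) x"
  shows "interp_coeff K (synth x) = x"
proof -
  have "is_trig_interpolant K (synth x) (synth x)"
    unfolding is_trig_interpolant_def synth_low[OF assms(2)] trig_polys_def
    using synth_upto_of_real[OF assms(1)] by auto
  then have "synth (interp_coeff K (synth x)) = synth x"
    using trig_interpolant_unique interpolant_synth_interp_coeff by blast
  then show ?thesis using fc_low[OF assms] fc_low[OF herm_interp_coeff supp_interp_coeff] by (metis ext)
qed

lemma interp_coeff_diff: "interp_coeff K (\<lambda>x. v x - w x) j = interp_coeff K v j - interp_coeff K w j"
  by (simp add: interp_coeff_def cutoff_def left_diff_distrib sum_subtractf diff_divide_distrib)

text \<open>Inserting the discrete transform for one of the two factors in the squared modulus and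
  exchanging the sums turns the other factor into the interpolant at the nodes, which equals
  \<open>w\<close> there. The sum of squares is thus the mean of the squared grid values.\<close>

lemma discrete_bessel:
  assumes "(\<Sum>k<2 * K + 1. (w (grid_point K k))\<^sup>2) \<le> real (2 * K + 1) * B\<^sup>2" "0 \<le> B"
  shows "hbound 0 B (interp_coeff K w)"
  unfolding hbound_def
proof safe
  fix J :: "int set" assume J: "finite J"
  define N where "N = 2 * K + 1"
  have N0: "0 < N" by (simp add: N_def)
  let ?x = "grid_point K"
  have c: "interp_coeff K w j = (\<Sum>k<N. of_real (w (?x k)) * cis (- (real_of_int j * ?x k))) / of_nat N" if "j \<in> {-int K..int K}" for j
    using that by (simp only: interp_coeff_def cutoff_def low_def if_True N_def)
  have "complex_of_real (\<Sum>j=-int K..int K. (cmod (interp_coeff K w j))\<^sup>2) = (\<Sum>j=-int K..int K. cnj (interp_coeff K w j) * interp_coeff K w j)"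
    by (simp only: of_real_sum complex_norm_square mult.commute)
  also have "\<dots> = (\<Sum>j=-int K..int K. cnj (interp_coeff K w j) * ((\<Sum>k<N. of_real (w (?x k)) * cis (- (real_of_int j * ?x k))) / of_nat N))"
    by (intro sum.cong refl) (simp only: c)
  also have "\<dots> = (\<Sum>j=-int K..int K. \<Sum>k<N. of_real (w (?x k)) * cnj (interp_coeff K w j * cis (real_of_int j * ?x k))) / of_nat N"
    unfolding sum_divide_distrib by (intro sum.cong refl) (simp add: sum_distrib_left cis_cnj mult_ac)
  also have "(\<Sum>j=-int K..int K. \<Sum>k<N. of_real (w (?x k)) * cnj (interp_coeff K w j * cis (real_of_int j * ?x k)))
     = (\<Sum>k<N. of_real (w (?x k)) * cnj (\<Sum>j=-int K..int K. interp_coeff K w j * cis (real_of_int j * ?x k)))"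
    unfolding cnj_sum sum_distrib_left by (rule sum.swap)
  also have "\<dots> = (\<Sum>k<N. complex_of_real ((w (?x k))\<^sup>2))"
  proof (intro sum.cong refl)
    fix k assume "k \<in> {..<N}"
    then have "synth_upto K (interp_coeff K w) (?x k) = w (?x k)"
      using synth_interp_coeff_grid[of k K w] by (simp add: synth_low[OF supp_interp_coeff] N_def)
    then have "(\<Sum>j=-int K..int K. interp_coeff K w j * cis (real_of_int j * ?x k)) = of_real (w (?x k))"
      using synth_upto_of_real[OF herm_interp_coeff, of K K w "?x k"] by simp
    then show "of_real (w (?x k)) * cnj (\<Sum>j=-int K..int K. interp_coeff K w j * cis (real_of_int j * ?x k)) = complex_of_real ((w (?x k))\<^sup>2)"
      by (simp add: power2_eq_square)
  qed
  also have "\<dots> / of_nat N = complex_of_real ((\<Sum>k<N. (w (?x k))\<^sup>2) / real N)" by simp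
  finally have "(\<Sum>j=-int K..int K. (cmod (interp_coeff K w j))\<^sup>2) = (\<Sum>k<N. (w (?x k))\<^sup>2) / real N"
    by (simp only: of_real_eq_iff)
  also have "\<dots> \<le> B\<^sup>2" using assms(1) N0 unfolding N_def[symmetric] by (simp add: divide_le_eq mult.commute)
  finally have s: "(\<Sum>j=-int K..int K. (cmod (interp_coeff K w j))\<^sup>2) \<le> B\<^sup>2" .
  have "(\<Sum>j\<in>J. (cmod (interp_coeff K w j))\<^sup>2) = (\<Sum>j\<in>J \<inter> {-int K..int K}. (cmod (interp_coeff K w j))\<^sup>2)"
    by (rule sum.mono_neutral_right) (use J in \<open>auto simp: interp_coeff_def cutoff_def low_def\<close>)
  also have "\<dots> \<le> (\<Sum>j=-int K..int K. (cmod (interp_coeff K w j))\<^sup>2)" by (rule sum_mono2) auto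
  finally show "L2_set (\<lambda>j. jb j powr 0 * cmod (interp_coeff K w j)) J \<le> B"
    unfolding L2_set_def using s assms(2) by (intro real_le_lsqrt) (auto simp: sum_nonneg)
qed

lemma discrete_bessel_sup:
  assumes "\<And>x. \<bar>w x\<bar> \<le> B"
  shows "hbound 0 B (interp_coeff K w)"
proof (rule discrete_bessel)
  have "(w x)\<^sup>2 \<le> B\<^sup>2" for x using assms[of x] by (intro abs_le_square_iff[THEN iffD1]) auto
  then have "(\<Sum>k<2 * K + 1. (w (grid_point K k))\<^sup>2) \<le> (\<Sum>k<2 * K + 1. B\<^sup>2)" by (intro sum_mono)
  then show "(\<Sum>k<2 * K + 1. (w (grid_point K k))\<^sup>2) \<le> real (2 * K + 1) * B\<^sup>2" by simp
  show "0 \<le> B" using assms[of 0] by simp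
qed

text \<open>By the fundamental theorem for \<open>v^2\<close> and
  \<open>2 |v v'| <= v^2 / \<delta> + \<delta> v'^2\<close>, the value at \<open>x\<close> is
  controlled by the value at any \<open>y\<close> of the interval; averaging over \<open>y\<close>
  removes the latter.\<close>

lemma point_value_le_integrals:
  fixes v v' :: "real \<Rightarrow> real"
  assumes \<delta>: "0 < \<delta>" and der: "\<And>x. (v has_real_derivative v' x) (at x)" and c: "continuous_on UNIV v'"
  shows "\<delta> * (v x)\<^sup>2 \<le> 2 * integral {x..x + \<delta>} (\<lambda>y. (v y)\<^sup>2) + \<delta>\<^sup>2 * integral {x..x + \<delta>} (\<lambda>y. (v' y)\<^sup>2)"
proof -
  define P where "P = integral {x..x + \<delta>} (\<lambda>y. (v y)\<^sup>2)"
  define Q where "Q = integral {x..x + \<delta>} (\<lambda>y. (v' y)\<^sup>2)"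
  have vc: "continuous_on S v" for S
    using DERIV_continuous_on[of UNIV v v'] der continuous_on_subset by blast
  have v'c: "continuous_on S v'" for S using c continuous_on_subset by blast
  have ci: "f integrable_on {a..b}" if "continuous_on UNIV f" for f :: "real \<Rightarrow> real" and a b
    by (rule integrable_continuous_real[OF continuous_on_subset[OF that]]) simp
  let ?g = "\<lambda>y. (v y)\<^sup>2 / \<delta> + \<delta> * (v' y)\<^sup>2"
  have gc: "continuous_on UNIV ?g" using \<delta> by (intro continuous_intros vc v'c) simp
  have point: "(v x)\<^sup>2 \<le> (v y)\<^sup>2 + P / \<delta> + \<delta> * Q" if y: "y \<in> {x..x + \<delta>}" for y
  proof -
    have "((\<lambda>z. 2 * v z * v' z) has_integral (v y)\<^sup>2 - (v x)\<^sup>2) {x..y}"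
    proof (rule fundamental_theorem_of_calculus)
      show "x \<le> y" using y by simp
      fix z
      have "((\<lambda>z. (v z)\<^sup>2) has_real_derivative 2 * v z * v' z) (at z within {x..y})"
        by (rule DERIV_subset) (auto intro!: derivative_eq_intros der)
      then show "((\<lambda>z. (v z)\<^sup>2) has_vector_derivative 2 * v z * v' z) (at z within {x..y})"
        by (simp add: has_real_derivative_iff_has_vector_derivative)
    qed
    then have "(v x)\<^sup>2 - (v y)\<^sup>2 = integral {x..y} (\<lambda>z. - (2 * v z * v' z))"
      by (simp add: has_integral_iff)
    also have "\<dots> \<le> integral {x..y} ?g"
    proof (rule integral_le)
      show "- (2 * v z * v' z) \<le> ?g z" for z
      proof -
        have "0 \<le> (v z + \<delta> * v' z)\<^sup>2 / \<delta>" using \<delta> by simp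
        also have "\<dots> = (v z)\<^sup>2 / \<delta> + 2 * v z * v' z + \<delta> * (v' z)\<^sup>2"
          using \<delta> by (simp add: power2_eq_square field_simps)
        finally show ?thesis by simp
      qed
      show "(\<lambda>z. - (2 * v z * v' z)) integrable_on {x..y}" by (intro ci continuous_intros vc v'c)
      show "?g integrable_on {x..y}" by (rule ci[OF gc])
    qed
    also have "\<dots> \<le> integral {x..x + \<delta>} ?g"
      by (rule integral_subset_le) (use y \<delta> in \<open>auto intro!: ci gc\<close>)
    also have "\<dots> = P / \<delta> + \<delta> * Q"
      unfolding P_def Q_def
      by (subst integral_add) (auto intro!: ci continuous_intros vc v'c simp: \<delta>[THEN less_imp_neq, symmetric])
    finally show ?thesis by simp
  qed
  have "\<delta> * (v x)\<^sup>2 = integral {x..x + \<delta>} (\<lambda>y. (v x)\<^sup>2)" using \<delta> by simp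
  also have "\<dots> \<le> integral {x..x + \<delta>} (\<lambda>y. (v y)\<^sup>2 + (P / \<delta> + \<delta> * Q))"
    by (rule integral_le) (use point in \<open>auto intro!: ci continuous_intros vc simp: add.assoc\<close>)
  also have "\<dots> = P + \<delta> * (P / \<delta> + \<delta> * Q)"
    unfolding P_def[symmetric] using \<delta>
    by (subst integral_add) (auto intro!: ci continuous_intros vc simp: P_def)
  also have "\<dots> = 2 * P + \<delta>\<^sup>2 * Q" using \<delta> by (simp add: field_simps power2_eq_square)
  finally show ?thesis by (simp add: P_def Q_def)
qed

text \<open>The intervals between neighbouring nodes tile the period, so the pointwise estimates add
  up to integrals. The derivative is weighted by the mesh size; this is the form in which
  interpolation is stable on \<open>H^1\<close>.\<close>

lemma hbound_interp_coeff_l2: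
  assumes v: "l2bound A v" and v': "l2bound B v'" and der: "\<And>x. (v has_real_derivative v' x) (at x)"
  shows "hbound 0 (2 * A + 2 * pi / real (2 * K + 1) * B) (interp_coeff K v)"
proof (rule discrete_bessel)
  define \<delta> where "\<delta> = 2 * pi / real (2 * K + 1)"
  have \<delta>: "0 < \<delta>" by (simp add: \<delta>_def)
  have A: "0 \<le> A" "continuous_on UNIV v" and B: "0 \<le> B" "continuous_on UNIV v'" using v v' by (auto simp: l2bound_def)
  have g: "grid_point K k = real k * \<delta>" for k by (simp add: grid_point_def \<delta>_def)
  have comb: "(\<Sum>k<n. integral {real k * \<delta>..real k * \<delta> + \<delta>} f) = integral {0..real n * \<delta>} f"
    if f: "continuous_on UNIV f" for f :: "real \<Rightarrow> real" and n
  proof (induction n)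
    case (Suc n)
    have "integral {0..real n * \<delta>} f + integral {real n * \<delta>..real (Suc n) * \<delta>} f = integral {0..real (Suc n) * \<delta>} f"
      by (rule Henstock_Kurzweil_Integration.integral_combine)
        (use \<delta> in \<open>auto intro!: integrable_continuous_real continuous_on_subset[OF f] mult_right_mono\<close>)
    then show ?case using Suc by (simp add: distrib_right add.commute)
  qed simp
  have I: "integral {0..2*pi} (\<lambda>y. (w y)\<^sup>2) \<le> 2 * pi * W\<^sup>2" if "l2bound W w" for W w
  proof -
    have "continuous_on UNIV w" using that by (simp add: l2bound_def)
    then have "set_integrable lborel {0..2*pi} (\<lambda>y. (w y)\<^sup>2)" by (intro set_integrable_continuous continuous_intros)
    from set_borel_integral_eq_integral(2)[OF this] that show ?thesis by (simp add: l2bound_def)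
  qed
  have N: "real (2 * K + 1) * \<delta> = 2 * pi" by (simp add: \<delta>_def)
  have "\<delta> * (\<Sum>k<2 * K + 1. (v (grid_point K k))\<^sup>2) \<le> (\<Sum>k<2 * K + 1. 2 * integral {real k * \<delta>..real k * \<delta> + \<delta>} (\<lambda>y. (v y)\<^sup>2)
      + \<delta>\<^sup>2 * integral {real k * \<delta>..real k * \<delta> + \<delta>} (\<lambda>y. (v' y)\<^sup>2))"
    unfolding sum_distrib_left g by (rule sum_mono) (rule point_value_le_integrals[OF \<delta> der B(2)])
  also have "\<dots> = 2 * integral {0..2*pi} (\<lambda>y. (v y)\<^sup>2) + \<delta>\<^sup>2 * integral {0..2*pi} (\<lambda>y. (v' y)\<^sup>2)"
    unfolding sum.distrib sum_distrib_left[symmetric] using A(2) B(2)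
    by (subst comb, force intro!: continuous_intros, subst comb, force intro!: continuous_intros, simp only: N)
  also have "\<dots> \<le> 2 * (2 * pi * A\<^sup>2) + \<delta>\<^sup>2 * (2 * pi * B\<^sup>2)"
    by (intro add_mono mult_left_mono I v v') auto
  also have "\<dots> = \<delta> * (real (2 * K + 1) * (2 * A\<^sup>2 + \<delta>\<^sup>2 * B\<^sup>2))"
    unfolding mult.assoc[symmetric] mult.commute[of \<delta> "real (2 * K + 1)"] N by (simp add: algebra_simps)
  also have "\<dots> \<le> \<delta> * (real (2 * K + 1) * (2 * A + \<delta> * B)\<^sup>2)"
  proof -
    have "2 * A\<^sup>2 + \<delta>\<^sup>2 * B\<^sup>2 \<le> (2 * A + \<delta> * B)\<^sup>2"
      using A(1) B(1) \<delta> by (simp add: power2_sum power_mult_distrib)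
    then show ?thesis using \<delta> by (intro mult_left_mono) auto
  qed
  finally have "(\<Sum>k<2 * K + 1. (v (grid_point K k))\<^sup>2) \<le> real (2 * K + 1) * (2 * A + \<delta> * B)\<^sup>2"
    using \<delta> by (simp only: mult_le_cancel_left_pos)
  then show "(\<Sum>k<2 * K + 1. (v (grid_point K k))\<^sup>2) \<le> real (2 * K + 1) * (2 * A + 2 * pi / real (2 * K + 1) * B)\<^sup>2"
    by (simp only: \<delta>_def)
  show "0 \<le> 2 * A + 2 * pi / real (2 * K + 1) * B" using A B by simp
qed

lemma jb_high: "\<not> low K j \<Longrightarrow> real K < \<bar>real_of_int j\<bar>"
proof -
  assume "\<not> low K j"
  then have "int K < \<bar>j\<bar>" by (auto simp: low_def)
  then show ?thesis by linarith
qed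

lemma tail_bounds:
  assumes K: "1 \<le> K" and q: "q \<le> r"
  shows "hbound r B x \<Longrightarrow> hbound q (real K powr (q - r) * B) (\<lambda>j. x j - cutoff (low K) x j)"
    and "wbound r B x \<Longrightarrow> wbound q (real K powr (q - r) * B) (\<lambda>j. x j - cutoff (low K) x j)"
proof -
  have *: "jb j powr q * cmod (x j - cutoff (low K) x j) \<le> real K powr (q - r) * (jb j powr r * cmod (x j))" for j
  proof (cases "low K j")
    case False
    have "jb j powr q = jb j powr (q - r) * jb j powr r" by (simp flip: powr_add)
    also have "\<dots> \<le> real K powr (q - r) * jb j powr r"
      using jb_high[OF False] abs_le_jb[of j] K q by (intro mult_right_mono powr_mono2') auto
    finally show ?thesis using False by (simp add: cutoff_def mult.assoc[symmetric] mult_right_mono)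
  qed (simp add: cutoff_def)
  show "hbound r B x \<Longrightarrow> hbound q (real K powr (q - r) * B) (\<lambda>j. x j - cutoff (low K) x j)"
    by (erule hbound_dominated) (simp, rule *)
  show "wbound r B x \<Longrightarrow> wbound q (real K powr (q - r) * B) (\<lambda>j. x j - cutoff (low K) x j)"
    by (erule wbound_dominated) (simp, rule *)
qed

lemma jb_low: "1 \<le> K \<Longrightarrow> low K j \<Longrightarrow> jb j \<le> 2 * real K"
  using jb_le_1_abs[of j] by (auto simp: low_def abs_le_iff)

text \<open>The inverse estimate for trigonometric polynomials; 2 comes from
  \<open>jb j \<le> 2 * K\<close> on the retained modes.\<close>

lemma hbound_low_gain:
  assumes "1 \<le> K" "supp (low K) x" "hbound 0 B x"
  shows "hbound 1 (2 * real K * B) x"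
proof (rule hbound_dominated[OF assms(3)])
  fix j
  show "jb j powr 1 * cmod (x j) \<le> 2 * real K * (jb j powr 0 * cmod (x j))"
    using assms(2) jb_low[OF assms(1), of j] by (cases "low K j") (auto simp: supp_def mult_right_mono)
qed simp

text \<open>Interpolation acts on the high modes only, which are small together with their derivative.\<close>

lemma interpolation_error:
  assumes K: "1 \<le> K" and k: "1 \<le> k" and w: "ck_bound 2 \<phi> w" and W: "hbound 0 W (\<lambda>j. (\<i> * of_int j) ^ k * fc w j)"
  shows "hbound 0 (7 * (W / real K ^ k)) (\<lambda>j. interp_coeff K w j - fc w j)"
proof -
  have h2: "hbound 2 (2\<^sup>2 * (\<phi> 0 + \<phi> 2)) (fc w)" using ck_bound_imp_hbound[OF w] by simp
  define A where "A = 3 * (2\<^sup>2 * (\<phi> 0 + \<phi> 2))"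
  have w1: "wbound 1 A (fc w)" unfolding A_def by (rule hbound_imp_wbound) (use h2 in simp)
  have w0: "wbound 0 A (fc w)" using w1 by (rule wbound_weaken) simp
  have ws: "synth (fc w) = w" by (rule synth_fc[OF ck_boundD(1,2)[OF w] w0])
  define lo where "lo = cutoff (low K) (fc w)"
  define hi where "hi j = fc w j - cutoff (low K) (fc w) j" for j
  have hl: "herm lo" unfolding lo_def by (rule herm_cutoff) auto
  have hh: "herm hi" using hl by (simp add: hi_def lo_def herm_def fourier_coeff_uminus)
  have lo0: "wbound 0 A lo" unfolding lo_def by (rule wbound_norm_le[OF w0]) (simp add: cutoff_def)
  have hi1: "wbound 1 A hi" by (rule wbound_norm_le[OF w1]) (simp add: hi_def cutoff_def)
  have hi0: "wbound 0 A hi" using hi1 by (rule wbound_weaken) simp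
  have K0: "0 < real K" using K by simp
  have a: "hbound 0 (1 / real K ^ k * W) hi"
  proof (rule hbound_dominated[OF W])
    fix j
    show "jb j powr 0 * cmod (hi j) \<le> 1 / real K ^ k * (jb j powr 0 * cmod ((\<i> * of_int j) ^ k * fc w j))"
    proof (cases "low K j")
      case False
      have "real K ^ k \<le> \<bar>real_of_int j\<bar> ^ k" using jb_high[OF False] by (intro power_mono) auto
      then have "real K ^ k * cmod (fc w j) \<le> \<bar>real_of_int j\<bar> ^ k * cmod (fc w j)" by (rule mult_right_mono) simp
      then show ?thesis using False K0 by (simp add: hi_def cutoff_def norm_mult norm_power field_simps)
    qed (simp add: hi_def cutoff_def)
  qed simp
  \<comment> \<open>On the high modes the derivative is worse by a factor \<open>K\<close> than the
    function, and the mesh size in the stability estimate compensates for it.\<close>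
  have b: "hbound 0 (real K / real K ^ k * W) (dcoeff hi)"
  proof (rule hbound_dominated[OF W])
    fix j
    show "jb j powr 0 * cmod (dcoeff hi j) \<le> real K / real K ^ k * (jb j powr 0 * cmod ((\<i> * of_int j) ^ k * fc w j))"
    proof (cases "low K j")
      case False
      have "real K ^ (k - 1) \<le> \<bar>real_of_int j\<bar> ^ (k - 1)" using jb_high[OF False] by (intro power_mono) auto
      then have "real K ^ (k - 1) * (\<bar>real_of_int j\<bar> * cmod (fc w j)) \<le> \<bar>real_of_int j\<bar> ^ (k - 1) * (\<bar>real_of_int j\<bar> * cmod (fc w j))"
        by (rule mult_right_mono) simp
      moreover have "\<bar>real_of_int j\<bar> ^ k = \<bar>real_of_int j\<bar> ^ (k - 1) * \<bar>real_of_int j\<bar>"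
        "real K ^ k = real K ^ (k - 1) * real K"
        using k by (simp_all flip: power_Suc2)
      ultimately show ?thesis using False K0
        by (simp add: hi_def cutoff_def dcoeff_def norm_mult norm_power field_simps)
    qed (simp add: hi_def cutoff_def dcoeff_def)
  qed simp
  have "hbound 0 (2 * (1 / real K ^ k * W) + 2 * pi / real (2 * K + 1) * (real K / real K ^ k * W)) (interp_coeff K (synth hi))"
  proof (rule hbound_interp_coeff_l2)
    show "l2bound (1 / real K ^ k * W) (synth hi)" by (rule parseval[OF hh hi0 a])
    show "l2bound (real K / real K ^ k * W) (synth (dcoeff hi))"
      by (rule parseval[OF herm_dcoeff[OF hh] _ b]) (use hi1 in \<open>auto intro: wbound_dcoeff\<close>)
    show "(synth hi has_real_derivative synth (dcoeff hi) x) (at x)" for x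
      using synth_DERIV[OF hi1] by (simp add: dcoeff_def[abs_def])
  qed
  \<comment> \<open>As \<pi> is below 4, the weighted derivative counts at most 4, in addition to
    the 2 of the function. Subtracting the high modes themselves raises the total from 6 to
    7.\<close>
  moreover have "2 * (1 / real K ^ k * W) + 2 * pi / real (2 * K + 1) * (real K / real K ^ k * W) \<le> 6 * (W / real K ^ k)"
  proof -
    have "pi * real K \<le> 4 * real K" using pi_less_4 K0 by (intro mult_right_mono) auto
    then have "2 * pi * real K \<le> 4 * real (2 * K + 1)" by simp
    then have "2 * pi / real (2 * K + 1) * real K \<le> 4" by (simp add: divide_le_eq del: of_nat_add of_nat_mult)
    then have "2 * pi / real (2 * K + 1) * real K * (W / real K ^ k) \<le> 4 * (W / real K ^ k)"
      using hbound_nonneg[OF W] by (intro mult_right_mono) auto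
    then show ?thesis by simp
  qed
  ultimately have c: "hbound 0 (6 * (W / real K ^ k)) (interp_coeff K (synth hi))" by (rule hbound_mono)
  have "w x - synth lo x = synth hi x" for x
    using synth_diff[OF w0 lo0, of x] by (simp add: ws hi_def[abs_def] lo_def)
  then have "interp_coeff K w j - interp_coeff K (synth lo) j = interp_coeff K (synth hi) j" for j
    using interp_coeff_diff[of K w "synth lo" j] by simp
  moreover have "interp_coeff K (synth lo) = lo" by (rule interp_coeff_trig_poly[OF hl]) (simp add: lo_def supp_cutoff)
  ultimately have "interp_coeff K w j - fc w j = interp_coeff K (synth hi) j - hi j" for j by (simp add: hi_def lo_def algebra_simps)
  with hbound_diff[OF c a] show ?thesis by simp
qed

section \<open>The discretized nonlinearity\<close>

definition pre_projection :: "(real \<Rightarrow> real) \<Rightarrow> (real \<times> real \<Rightarrow> real) \<Rightarrow> nat \<Rightarrow> (int \<Rightarrow> complex) \<Rightarrow> real \<Rightarrow> real" where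
  "pre_projection a g K x t = synth (interp_coeff K (\<lambda>y. a (synth x y))) t * synth (dcoeff (dcoeff x)) t
     + synth (interp_coeff K (\<lambda>y. g (synth x y, synth (dcoeff x) y))) t"

lemma trig_projection_synth:
  assumes "set_integrable lborel {0..2 * pi} v"
  shows "trig_projection K v = synth (cutoff (low K) (fc v))"
proof -
  have "synth (cutoff (low K) (fc v)) = (\<lambda>x. Re (\<Sum>j = - int K..int K. fc v j * cis (real_of_int j * x)))"
    unfolding synth_low[OF supp_cutoff] synth_upto_def[abs_def]
    by (rule ext, rule arg_cong[where f = Re], rule sum.cong) (auto simp: cutoff_def low_def)
  then show ?thesis
    unfolding trig_projection_def
    using theI'[OF trig_projection_unique[OF assms, of K]] trig_projection_exists[OF assms, of K] trig_projection_unique[OF assms, of K]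
    by auto
qed

lemma continuous_synth_low: "supp (low K) x \<Longrightarrow> continuous_on S (synth x)"
  by (simp add: synth_low continuous_synth_upto)

lemma supp_dcoeff: "supp S x \<Longrightarrow> supp S (dcoeff x)"
  by (simp add: supp_def dcoeff_def)

lemma fc_discrete_nonlinearity:
  assumes "herm x" "supp (low K) x"
  shows "continuous_on UNIV (pre_projection a g K x)"
    "fc (discrete_nonlinearity a g K (synth x)) = cutoff (low K) (fc (pre_projection a g K x))"
proof -
  show c: "continuous_on UNIV (pre_projection a g K x)"
    unfolding pre_projection_def[abs_def]
    by (intro continuous_intros continuous_synth_low[OF supp_interp_coeff] continuous_synth_low[OF supp_dcoeff[OF supp_dcoeff[OF assms(2)]]])
  obtain A where A: "wbound 2 A x" using finite_support_bounds[OF assms(2)] by blast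
  have "discrete_nonlinearity a g K (synth x) = trig_projection K (pre_projection a g K x)"
    unfolding discrete_nonlinearity_def trig_interpolation_synth pre_projection_def[abs_def]
    using deriv2_synth[OF A] deriv_synth[OF wbound_weaken[OF A, of 1]] by simp
  also have "\<dots> = synth (cutoff (low K) (fc (pre_projection a g K x)))"
    by (rule trig_projection_synth[OF set_integrable_continuous[OF c]])
  finally show "fc (discrete_nonlinearity a g K (synth x)) = cutoff (low K) (fc (pre_projection a g K x))"
    by (auto intro!: fc_low herm_cutoff supp_cutoff)
qed

text \<open>The truncated exact solution \<open>Z\<close> stands between the numerical
  \<open>x\<close> and the exact \<open>U\<close>. Passing from \<open>x\<close> to \<open>Z\<close>
  uses only grid values and the boundedness of interpolants and forms \<open>d1\<close>.
  Interpolation at \<open>Z\<close> and passing from \<open>Z\<close> to \<open>U\<close> form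
  \<open>d2\<close>: its \<open>L^2\<close> size is \<open>K\<close> to the power
  \<open>-s - 3\<close>, and the inverse estimate sacrifices one power to reach
  \<open>H^1\<close>.\<close>

lemma discrete_nonlinearity_error:
  assumes a: "smooth a" and g: "smooth g" and M: "0 \<le> M" and s: "0 \<le> s"
  obtains L \<rho> where "0 \<le> L" "0 \<le> \<rho>" "\<And>K U x e. 1 \<le> K \<Longrightarrow> herm U \<Longrightarrow> hbound (5 + s) M U \<Longrightarrow> herm x \<Longrightarrow> supp (low K) x \<Longrightarrow>
    hbound 2 e (\<lambda>j. x j - cutoff (low K) U j) \<Longrightarrow> e \<le> 1 \<Longrightarrow>
    \<exists>d1 d2. (\<forall>j. fc (discrete_nonlinearity a g K (synth x)) j - cutoff (low K) (nlcoeff a g U) j = d1 j + d2 j)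
      \<and> hbound 0 (L * e) d1 \<and> hbound 1 (\<rho> * real K powr (- s - 2)) d2"
proof -
  \<comment> \<open>The embedding constant 3 times a bound in \<open>H^2\<close> of the exact
    solution, enlarged by 1 for a numerical solution at distance at most 1.\<close>
  define B where "B = 3 * (M + 1)"
  have B: "0 \<le> B" using M by (simp add: B_def)
  \<comment> \<open>Interpolation errors are measured with an integer number of derivatives. For
    real \<open>s\<close> this number exceeds \<open>s + 3\<close> by at most 1, and the excess is
    paid for by growing bounds.\<close>
  define k where "k = nat \<lceil>s + 3\<rceil>"
  have k: "s + 3 \<le> real k" "real k \<le> s + 4" "2 \<le> k" using s unfolding k_def by linarith+
  note a' = smooth_comp_fst[OF a]
  obtain Ca where Ca: "0 \<le> Ca" "\<And>x y. \<bar>x\<bar> \<le> B \<Longrightarrow> \<bar>y\<bar> \<le> B \<Longrightarrow> \<bar>a (fst (x, y))\<bar> \<le> Ca"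
    using smooth_bounded[OF a'] by blast
  obtain La where La: "0 \<le> La" "\<And>x y x' y'. \<bar>x\<bar> \<le> B \<Longrightarrow> \<bar>y\<bar> \<le> B \<Longrightarrow> \<bar>x'\<bar> \<le> B \<Longrightarrow> \<bar>y'\<bar> \<le> B \<Longrightarrow>
     \<bar>a (fst (x', y')) - a (fst (x, y))\<bar> \<le> La * (\<bar>x' - x\<bar> + \<bar>y' - y\<bar>)"
    using smooth_lipschitz[OF a'] by blast
  obtain Lg where Lg: "0 \<le> Lg" "\<And>x y x' y'. \<bar>x\<bar> \<le> B \<Longrightarrow> \<bar>y\<bar> \<le> B \<Longrightarrow> \<bar>x'\<bar> \<le> B \<Longrightarrow> \<bar>y'\<bar> \<le> B \<Longrightarrow>
     \<bar>g (x', y') - g (x, y)\<bar> \<le> Lg * (\<bar>x' - x\<bar> + \<bar>y' - y\<bar>)"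
    using smooth_lipschitz[OF g] by blast
  obtain C1 where C1: "0 \<le> C1" "\<And>u v. ck_bound 1 (\<lambda>_. B) u \<Longrightarrow> ck_bound 1 (\<lambda>_. B) v \<Longrightarrow> ck_bound 1 (\<lambda>_. C1) (\<lambda>x. a (fst (u x, v x)))"
    using ck_bound_compose_const[OF a' B, of 1] by blast
  obtain Da where Da: "0 \<le> Da" "\<forall>\<Phi> u v. \<Phi> 0 = 1 \<and> (\<forall>i. 1 \<le> \<Phi> i) \<and> (\<forall>l m. \<Phi> l * \<Phi> m \<le> \<Phi> (l + m)) \<and>
     ck_bound k (\<lambda>i. B * \<Phi> i) u \<and> ck_bound k (\<lambda>i. B * \<Phi> i) v \<longrightarrow> ck_bound k (\<lambda>i. Da * \<Phi> i) (\<lambda>x. a (fst (u x, v x)))"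
    using ck_bound_compose[OF a' B, of k] by (elim exE conjE) (rule that)
  obtain Dg where Dg: "0 \<le> Dg" "\<forall>\<Phi> u v. \<Phi> 0 = 1 \<and> (\<forall>i. 1 \<le> \<Phi> i) \<and> (\<forall>l m. \<Phi> l * \<Phi> m \<le> \<Phi> (l + m)) \<and>
     ck_bound k (\<lambda>i. B * \<Phi> i) u \<and> ck_bound k (\<lambda>i. B * \<Phi> i) v \<longrightarrow> ck_bound k (\<lambda>i. Dg * \<Phi> i) (\<lambda>x. g (u x, v x))"
    using ck_bound_compose[OF g B, of k] by (elim exE conjE) (rule that)
  define Is where "Is = 3 * (14 * C1 + 4 * C1)"
  define L where "L = Is + B * (La * 3) + Lg * 6"
  define R where "R = B * (14 * Da) + 14 * Dg + La * B * B + Ca * M + Lg * (2 * B)"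
  have L0: "0 \<le> L" and R0: "0 \<le> R"
    using Ca La Lg C1 Da Dg B M by (auto simp: L_def R_def Is_def intro!: add_nonneg_nonneg mult_nonneg_nonneg)
  show ?thesis
  proof (rule that[OF L0, of "2 * R"])
    fix K U x e
    assume K: "1 \<le> K" and U: "herm U" "hbound (5 + s) M U" and x: "herm x" "supp (low K) x"
      and e: "hbound 2 e (\<lambda>j. x j - cutoff (low K) U j)" "e \<le> 1"

    \<comment> \<open>Bounds for the numerical, the truncated and the exact solution and for their
      differences\<close>
    define Z where "Z = cutoff (low K) U"
    define D where "D j = x j - Z j" for j
    have e0: "0 \<le> e" by (rule hbound_nonneg[OF e(1)])
    have K0: "1 \<le> real K" using K by simp
    have hZ: "herm Z" unfolding Z_def by (rule herm_cutoff) (use U in auto)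
    have sZ: "supp (low K) Z" unfolding Z_def by (rule supp_cutoff)
    have sD: "supp (low K) D" using x(2) sZ by (simp add: supp_def D_def)
    have hD: "herm D" using x(1) hZ by (simp add: herm_def D_def)
    have U2: "hbound 2 M U" using U(2) by (rule hbound_weaken) (use s in simp)
    have Z2: "hbound 2 M Z" unfolding Z_def by (rule hbound_cutoff[OF U2])
    have Uw: "wbound (s + 4) (3 * M) U" by (rule hbound_imp_wbound) (use U(2) in \<open>simp add: add.commute add.left_commute\<close>)
    have Zw: "wbound (s + 4) (3 * M) Z" unfolding Z_def by (rule wbound_norm_le[OF Uw]) (simp add: cutoff_def)
    have MB: "3 * M \<le> B" by (simp add: B_def)
    have Uw2: "wbound 2 B U" by (rule wbound_mono[OF wbound_weaken[OF Uw] MB]) (use s in simp)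
    have Zw2: "wbound 2 B Z" by (rule wbound_mono[OF wbound_weaken[OF Zw] MB]) (use s in simp)
    have D2: "hbound 2 e D" using e(1) by (simp add: D_def[abs_def] Z_def)
    have Dw1: "wbound 1 (3 * e) D" by (rule hbound_imp_wbound) (use D2 in simp)
    have "hbound 2 (M + e) (\<lambda>j. Z j + D j)" by (rule hbound_add[OF Z2 D2])
    then have "hbound 2 (M + 1) x" by (rule hbound_mono[OF hbound_norm_le]) (use e in \<open>simp_all add: D_def\<close>)
    then have xw1: "wbound 1 B x" unfolding B_def by (intro hbound_imp_wbound) simp
    obtain A where A: "wbound 3 A x" using finite_support_bounds[OF x(2)] by blast
    have xw2: "wbound 2 A x" by (rule wbound_weaken[OF A]) simp
    let ?y = "synth x" and ?y1 = "synth (dcoeff x)" and ?y2 = "synth (dcoeff (dcoeff x))"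
    let ?z = "synth Z" and ?z1 = "synth (dcoeff Z)" and ?z2 = "synth (dcoeff (dcoeff Z))"
    let ?u = "synth U" and ?u1 = "synth (dcoeff U)" and ?u2 = "synth (dcoeff (dcoeff U))"
    note zb = synth_continuous_bounds[OF Zw2] and ub = synth_continuous_bounds[OF Uw2] and yc = synth_continuous_bounds(1-3)[OF xw2]
    have w01: "wbound 0 C v" "wbound 0 C (dcoeff v)" if "wbound 1 C v" for C v
      using wbound_weaken[OF that, of 0] wbound_dcoeff[of 0 C v] that by auto
    have yb: "\<bar>?y t\<bar> \<le> B" "\<bar>?y1 t\<bar> \<le> B" for t
      using synth_bound[OF w01(1)[OF xw1]] synth_bound[OF w01(2)[OF xw1]] by auto
    have dD: "dcoeff D = (\<lambda>j. dcoeff x j - dcoeff Z j)" "dcoeff (\<lambda>j. dcoeff x j - dcoeff Z j) = (\<lambda>j. dcoeff (dcoeff x) j - dcoeff (dcoeff Z) j)"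
      by (auto simp: dcoeff_def D_def algebra_simps)
    have w2: "wbound 0 C (dcoeff (dcoeff v))" if "wbound 2 C v" for C v using that by (intro wbound_dcoeff2) simp
    have Zw1: "wbound 1 B Z" and Uw1: "wbound 1 B U" using wbound_weaken[OF Zw2] wbound_weaken[OF Uw2] by auto
    have Dy: "synth D t = ?y t - ?z t" "synth (dcoeff D) t = ?y1 t - ?z1 t" "synth (dcoeff (dcoeff D)) t = ?y2 t - ?z2 t" for t
      unfolding dD synth_diff[OF w01(2)[OF xw1] w01(2)[OF Zw1]] synth_diff[OF w2[OF xw2] w2[OF Zw2]]
      using synth_diff[OF w01(1)[OF xw1] w01(1)[OF Zw1], of t] by (simp_all add: D_def[abs_def])
    have yz: "\<bar>?y t - ?z t\<bar> \<le> 3 * e" "\<bar>?y1 t - ?z1 t\<bar> \<le> 3 * e" for t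
      using synth_bound[OF w01(1)[OF Dw1], of t] synth_bound[OF w01(2)[OF Dw1], of t] by (simp_all add: Dy)
    define \<tau> where "\<tau> = real K powr (- s - 3)"
    have \<tau>0: "0 \<le> \<tau>" by (simp add: \<tau>_def)
    define H where "H j = U j - Z j" for j
    have exps: "- 3 - s = - s - 3" "1 - (s + 4) = - s - 3" by simp_all
    have H2: "hbound 2 (\<tau> * M) H"
      using tail_bounds(1)[OF K _ U(2), of 2] s by (simp add: H_def[abs_def] Z_def \<tau>_def exps(1))
    have H1: "wbound 1 (\<tau> * (3 * M)) H"
      using tail_bounds(2)[OF K _ Uw, of 1] s by (simp add: H_def[abs_def] Z_def \<tau>_def exps(2))
    have hH: "herm H" using U(1) hZ by (simp add: herm_def H_def)
    have Hw2: "wbound 2 (B + B) H" using wbound_diff[OF Uw2 Zw2] by (simp add: H_def[abs_def])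
    have dH: "dcoeff H = (\<lambda>j. dcoeff U j - dcoeff Z j)" "dcoeff (\<lambda>j. dcoeff U j - dcoeff Z j) = (\<lambda>j. dcoeff (dcoeff U) j - dcoeff (dcoeff Z) j)"
      by (auto simp: dcoeff_def H_def algebra_simps)
    have Hy: "synth H t = ?u t - ?z t" "synth (dcoeff H) t = ?u1 t - ?z1 t" "synth (dcoeff (dcoeff H)) t = ?u2 t - ?z2 t" for t
      unfolding dH synth_diff[OF w01(2)[OF Uw1] w01(2)[OF Zw1]] synth_diff[OF w2[OF Uw2] w2[OF Zw2]]
      using synth_diff[OF w01(1)[OF Uw1] w01(1)[OF Zw1], of t] by (simp_all add: H_def[abs_def])
    have MB\<tau>: "\<tau> * (3 * M) \<le> \<tau> * B" using MB \<tau>0 by (rule mult_left_mono)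
    have uz: "\<bar>?u t - ?z t\<bar> \<le> \<tau> * B" "\<bar>?u1 t - ?z1 t\<bar> \<le> \<tau> * B" for t
      using order_trans[OF synth_bound[OF w01(1)[OF H1], of t] MB\<tau>] order_trans[OF synth_bound[OF w01(2)[OF H1], of t] MB\<tau>]
      by (simp_all add: Hy)
    have uz': "\<bar>?z t - ?u t\<bar> \<le> \<tau> * B" "\<bar>?z1 t - ?u1 t\<bar> \<le> \<tau> * B" for t
      using uz[of t] by (simp_all add: abs_minus_commute)
    define ay where "ay t = a (?y t)" for t
    define az where "az t = a (?z t)" for t
    define gy where "gy t = g (?y t, ?y1 t)" for t
    define gz where "gz t = g (?z t, ?z1 t)" for t
    have azc: "continuous_on UNIV az" unfolding az_def by (intro smooth_comp_continuous1[OF a] zb)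
    have gzc: "continuous_on UNIV gz" unfolding gz_def by (intro smooth_comp_continuous[OF g] zb)
    have ayz: "\<bar>ay t - az t\<bar> \<le> La * (3 * e)" for t
      using La(2)[of "?z t" 0 "?y t" 0] yb(1)[of t] zb(4)[of t] B yz(1)[of t] La(1)
      unfolding ay_def az_def by (auto intro: order_trans mult_left_mono)
    have gyz: "\<bar>gy t - gz t\<bar> \<le> Lg * (3 * e + 3 * e)" for t
      unfolding gy_def gz_def
      by (rule order_trans[OF Lg(2)[OF zb(4,5) yb] mult_left_mono[OF add_mono[OF yz] Lg(1)]])
    have l2_low: "l2bound C (synth v)" if "herm v" "supp (low K) v" "hbound 0 C v" for C v
      using finite_support_bounds[OF that(2), of 0] parseval[OF that(1) _ that(3)] by blast
    text \<open>The interpolant of \<open>a (?y)\<close> is bounded in the supremum norm because interpolation is bounded on \<open>H\<^sup>1\<close>.\<close>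
    have icb: "\<bar>synth (interp_coeff K ay) t\<bar> \<le> Is" for t
    proof -
      have y1: "ck_bound 1 (\<lambda>_. B) ?y"
        by (rule ck_bound_synth) (rule wbound_weaken[OF xw1], simp)
      have c1: "ck_bound 1 (\<lambda>_. C1) ay" using C1(2)[OF y1 y1] by (simp add: ay_def[abs_def])
      have A0: "0 \<le> A" by (rule wbound_nonneg[OF A])
      \<comment> \<open>\<open>A\<close>, and with it \<open>C2\<close>, may depend on
        \<open>K\<close>. It serves only to admit the interpolation estimate, whose bound involves
        the first derivative through \<open>C1\<close>.\<close>
      obtain C2 where C2: "\<And>u v. ck_bound 2 (\<lambda>_. A) u \<Longrightarrow> ck_bound 2 (\<lambda>_. A) v \<Longrightarrow> ck_bound 2 (\<lambda>_. C2) (\<lambda>x. a (fst (u x, v x)))"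
        by (rule ck_bound_compose_const[OF a' A0, of 2]) (rule that)
      have y2: "ck_bound 2 (\<lambda>_. A) ?y"
        by (rule ck_bound_synth) (rule wbound_weaken[OF xw2], simp)
      have c2: "ck_bound 2 (\<lambda>_. C2) ay" using C2[OF y2 y2] by (simp add: ay_def[abs_def])
      have "hbound 0 (7 * (C1 / real K ^ 1)) (\<lambda>j. interp_coeff K ay j - fc ay j)"
        by (rule interpolation_error[OF K _ c2]) (use ck_bound_fc[OF c1, of 1] in auto)
      then have "hbound 0 (7 * (C1 / real K)) (cutoff (low K) (\<lambda>j. interp_coeff K ay j - fc ay j))" by (simp add: hbound_cutoff)
      from hbound_low_gain[OF K supp_cutoff this]
      have "hbound 1 (14 * C1) (cutoff (low K) (\<lambda>j. interp_coeff K ay j - fc ay j))" using K0 by simp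
      moreover have "hbound 1 (4 * C1) (cutoff (low K) (fc ay))"
        by (rule hbound_cutoff) (use ck_bound_imp_hbound[OF c1] in simp)
      ultimately have "hbound 1 (14 * C1 + 4 * C1) (\<lambda>j. cutoff (low K) (\<lambda>j. interp_coeff K ay j - fc ay j) j + cutoff (low K) (fc ay) j)"
        by (rule hbound_add)
      also have "(\<lambda>j. cutoff (low K) (\<lambda>j. interp_coeff K ay j - fc ay j) j + cutoff (low K) (fc ay) j) = interp_coeff K ay"
        using supp_interp_coeff[of K ay] by (auto simp: cutoff_def supp_def)
      finally have "wbound 0 Is (interp_coeff K ay)" unfolding Is_def by (intro hbound_imp_wbound) simp
      then show ?thesis by (rule synth_bound)
    qed
    \<comment> \<open>\<open>Z\<close> has \<open>s + 4\<close> orders in the Wiener algebra, so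
      \<open>Z\<close> and its derivative are bounded up to order \<open>s + 3\<close>; every
      further derivative costs a factor \<open>jb (int K)\<close>. The positive part of
      \<open>i - (s + 3)\<close> is superadditive in \<open>i\<close>, which is the condition on the
      weights for compositions.\<close>
    define \<Phi> where "\<Phi> i = jb (int K) powr max 0 (real i - (s + 3))" for i
    have J1: "1 \<le> jb (int K)" by (rule jb_ge_1)
    have \<Phi>: "\<Phi> 0 = 1" "\<forall>i. 1 \<le> \<Phi> i" "\<forall>l m. \<Phi> l * \<Phi> m \<le> \<Phi> (l + m)"
    proof -
      show "\<Phi> 0 = 1" using s by (simp add: \<Phi>_def)
      show "\<forall>i. 1 \<le> \<Phi> i" by (simp add: \<Phi>_def jb_powr_ge_1)
      show "\<forall>l m. \<Phi> l * \<Phi> m \<le> \<Phi> (l + m)"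
        unfolding \<Phi>_def powr_add[symmetric] using s J1 by (auto intro!: powr_mono)
    qed
    have grow: "jb j powr (real i + 1) * cmod (Z j) \<le> \<Phi> i * (jb j powr (s + 4) * cmod (Z j))" for i j
    proof (cases "low K j")
      case True
      then have jK: "jb j \<le> jb (int K)" by (intro jb_mono) (auto simp: low_def)
      have "jb j powr (real i + 1) \<le> jb j powr (max 0 (real i - (s + 3)) + (s + 4))"
        by (intro powr_mono jb_ge_1) simp
      also have "\<dots> = jb j powr max 0 (real i - (s + 3)) * jb j powr (s + 4)" by (rule powr_add)
      also have "\<dots> \<le> \<Phi> i * jb j powr (s + 4)"
        unfolding \<Phi>_def using jK by (intro mult_right_mono powr_mono2) auto
      finally show ?thesis by (simp add: mult.assoc[symmetric] mult_right_mono)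
    qed (use sZ in \<open>simp add: supp_def\<close>)
    have \<Phi>0: "0 \<le> \<Phi> i" for i by (simp add: \<Phi>_def)
    have zz: "wbound (real i + 1) (B * \<Phi> i) Z" for i
    proof -
      have "wbound (real i + 1) (\<Phi> i * (3 * M)) Z" by (rule wbound_dominated[OF Zw \<Phi>0 grow])
      then show ?thesis by (rule wbound_mono) (rule order_trans[OF mult_left_mono[OF MB \<Phi>0]], simp)
    qed
    have cz: "ck_bound k (\<lambda>i. B * \<Phi> i) ?z" "ck_bound k (\<lambda>i. B * \<Phi> i) ?z1"
    proof -
      show "ck_bound k (\<lambda>i. B * \<Phi> i) ?z" by (rule ck_bound_synth) (rule wbound_weaken[OF zz], simp)
      show "ck_bound k (\<lambda>i. B * \<Phi> i) ?z1" by (rule ck_bound_synth) (rule wbound_dcoeff[OF zz])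
    qed
    have ca: "ck_bound k (\<lambda>i. Da * \<Phi> i) az"
      using Da(2)[THEN spec, THEN spec, THEN spec, THEN mp, OF conjI[OF \<Phi>(1) conjI[OF \<Phi>(2) conjI[OF \<Phi>(3) conjI[OF cz(1) cz(1)]]]]]
      by (simp add: az_def[abs_def])
    have cg: "ck_bound k (\<lambda>i. Dg * \<Phi> i) gz"
      using Dg(2)[THEN spec, THEN spec, THEN spec, THEN mp, OF conjI[OF \<Phi>(1) conjI[OF \<Phi>(2) conjI[OF \<Phi>(3) conjI[OF cz(1) cz(2)]]]]]
      by (simp add: gz_def[abs_def])
    \<comment> \<open>The growth of \<Phi> at order \<open>k\<close> cancels exactly the excess of
      \<open>K ^ k\<close> over \<open>K\<close> to the power \<open>s + 3\<close>. The factor 2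
      remains because \<open>jb (int K)\<close> is bounded by \<open>2 * K\<close> and the excess
      exponent by 1.\<close>
    have rate: "\<Phi> k / real K ^ k \<le> 2 * \<tau>"
    proof -
      have "\<Phi> k = jb (int K) powr (real k - (s + 3))" using k by (simp add: \<Phi>_def max_def)
      also have "\<dots> \<le> (2 * real K) powr (real k - (s + 3))"
        using jb_low[OF K, of "int K"] k by (intro powr_mono2) (auto simp: low_def)
      also have "\<dots> = 2 powr (real k - (s + 3)) * real K powr (real k - (s + 3))" using K0 by (simp add: powr_mult)
      also have "\<dots> \<le> 2 powr 1 * real K powr (real k - (s + 3))"
        using k by (intro mult_right_mono powr_mono) auto
      also have "real K powr (real k - (s + 3)) = real K ^ k * \<tau>"
      proof -
        have "real K powr (real k - (s + 3)) = real K powr real k * real K powr (- s - 3)"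
          by (simp only: powr_add[symmetric]) (simp add: algebra_simps)
        then show ?thesis using K0 by (simp add: \<tau>_def powr_realpow)
      qed
      finally show ?thesis using K0 by (simp add: divide_le_eq mult_ac)
    qed
    have ierr: "hbound 0 (14 * Dw * \<tau>) (\<lambda>j. interp_coeff K w j - fc w j)" if w: "ck_bound k (\<lambda>i. Dw * \<Phi> i) w" and "0 \<le> Dw" for w Dw
    proof -
      have "hbound 0 (7 * (Dw * \<Phi> k / real K ^ k)) (\<lambda>j. interp_coeff K w j - fc w j)"
        by (rule interpolation_error[OF K _ ck_bound_le[OF w k(3)] ck_bound_fc[OF w order_refl]]) (use k in simp)
      moreover have "7 * (Dw * \<Phi> k / real K ^ k) \<le> 14 * Dw * \<tau>"
        using mult_left_mono[OF rate \<open>0 \<le> Dw\<close>] by simp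
      ultimately show ?thesis by (rule hbound_mono)
    qed
    have w_eq: "synth (interp_coeff K w) t - w t = synth (\<lambda>j. interp_coeff K w j - fc w j) t" "\<exists>A. wbound 0 A (\<lambda>j. interp_coeff K w j - fc w j)"
      if w: "ck_bound k (\<lambda>i. Dw * \<Phi> i) w" for w Dw t
    proof -
      obtain A1 where A1: "wbound 0 A1 (interp_coeff K w)" using finite_support_bounds[OF supp_interp_coeff] by blast
      have "hbound 2 (2\<^sup>2 * (Dw * \<Phi> 0 + Dw * \<Phi> 2)) (fc w)" using ck_bound_imp_hbound[OF ck_bound_le[OF w k(3)]] by simp
      then have A2: "wbound 0 (3 * (2\<^sup>2 * (Dw * \<Phi> 0 + Dw * \<Phi> 2))) (fc w)"
        by (intro wbound_weaken[OF hbound_imp_wbound[of 1]]) simp_all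
      show "synth (interp_coeff K w) t - w t = synth (\<lambda>j. interp_coeff K w j - fc w j) t"
        using synth_diff[OF A1 A2, of t] synth_fc[OF ck_boundD(1,2)[OF w] A2] by simp
      show "\<exists>A. wbound 0 A (\<lambda>j. interp_coeff K w j - fc w j)" using wbound_diff[OF A1 A2] by blast
    qed
    have l2err: "l2bound (14 * Dw * \<tau>) (\<lambda>t. synth (interp_coeff K w) t - w t)" if w: "ck_bound k (\<lambda>i. Dw * \<Phi> i) w" and "0 \<le> Dw" for w Dw
    proof -
      have "herm (\<lambda>j. interp_coeff K w j - fc w j)" using herm_interp_coeff[of K w] by (simp add: herm_def fourier_coeff_uminus)
      then show ?thesis unfolding w_eq(1)[OF w] using w_eq(2)[OF w] parseval[OF _ _ ierr[OF that]] by blast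
    qed
    \<comment> \<open>Telescoping from \<open>x\<close> over \<open>Z\<close> to \<open>U\<close>,
      one factor at a time: \<open>Y1\<close> to \<open>Y3\<close> are proportional to the deviation
      of \<open>x\<close> from \<open>Z\<close>; \<open>Y4\<close> and \<open>Y7\<close> are pure
      interpolation errors; \<open>Y5\<close>, \<open>Y6\<close> and \<open>Y8\<close> come from
      truncating \<open>U\<close>.\<close>
    define Y1 where "Y1 t = synth (interp_coeff K ay) t * synth (dcoeff (dcoeff D)) t" for t
    define Y2 where "Y2 t = ?z2 t * synth (interp_coeff K (\<lambda>t. ay t - az t)) t" for t
    define Y3 where "Y3 = synth (interp_coeff K (\<lambda>t. gy t - gz t))"
    define Y4 where "Y4 t = ?z2 t * (synth (interp_coeff K az) t - az t)" for t
    define Y5 where "Y5 t = (az t - a (?u t)) * ?z2 t" for t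
    define Y6 where "Y6 t = - a (?u t) * synth (dcoeff (dcoeff H)) t" for t
    define Y7 where "Y7 t = synth (interp_coeff K gz) t - gz t" for t
    define Y8 where "Y8 t = gz t - g (?u t, ?u1 t)" for t
    have icd: "synth (interp_coeff K (\<lambda>t. v t - w t)) t = synth (interp_coeff K v) t - synth (interp_coeff K w) t" for v w t
    proof -
      obtain A1 where A1: "wbound 0 A1 (interp_coeff K v)" using finite_support_bounds[OF supp_interp_coeff] by blast
      obtain A2 where A2: "wbound 0 A2 (interp_coeff K w)" using finite_support_bounds[OF supp_interp_coeff] by blast
      show ?thesis using synth_diff[OF A1 A2, of t] by (simp add: interp_coeff_diff[abs_def])
    qed
    have sum_eq: "pre_projection a g K x t - nonlinearity a g ?u t = (Y1 t + Y2 t + Y3 t) + (Y4 t + Y5 t + Y6 t + Y7 t + Y8 t)" for t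
      unfolding pre_projection_def nonlinearity_synth[OF Uw2] Y1_def Y2_def Y3_def Y4_def Y5_def Y6_def Y7_def Y8_def icd Dy Hy
      by (simp add: ay_def[abs_def] gy_def[abs_def] az_def[abs_def] gz_def[abs_def] algebra_simps)
    have b1: "l2bound (Is * e) Y1"
      unfolding Y1_def
      by (rule l2bound_mult[OF continuous_synth_low[OF supp_interp_coeff] icb l2_low])
        (use D2 in \<open>auto intro!: herm_dcoeff hD supp_dcoeff sD hbound_dcoeff2\<close>)
    have b2: "l2bound (B * (La * (3 * e))) Y2"
      unfolding Y2_def by (rule l2bound_mult[OF zb(3) zb(6) l2_low[OF herm_interp_coeff supp_interp_coeff discrete_bessel_sup[OF ayz]]])
    have b3: "l2bound (Lg * (3 * e + 3 * e)) Y3"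
      unfolding Y3_def by (rule l2_low[OF herm_interp_coeff supp_interp_coeff discrete_bessel_sup[OF gyz]])
    have b4: "l2bound (B * (14 * Da * \<tau>)) Y4"
      unfolding Y4_def by (rule l2bound_mult[OF zb(3) zb(6) l2err[OF ca Da(1)]])
    have uc: "continuous_on UNIV (\<lambda>t. a (?u t))" by (intro smooth_comp_continuous1[OF a] ub)
    have b5: "l2bound (La * (\<tau> * B) * B) Y5"
    proof (rule l2bound_sup)
      show "continuous_on UNIV Y5" unfolding Y5_def by (intro continuous_intros azc uc zb)
      fix t
      have "\<bar>az t - a (?u t)\<bar> \<le> La * (\<tau> * B)"
        using La(2)[of "?u t" 0 "?z t" 0] ub(4)[of t] zb(4)[of t] B uz(1)[of t] La(1)
        unfolding az_def by (auto simp: abs_minus_commute intro: order_trans mult_left_mono)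
      then show "\<bar>Y5 t\<bar> \<le> La * (\<tau> * B) * B"
        unfolding Y5_def abs_mult by (rule mult_mono) (use zb(6) La B \<tau>0 in auto)
    qed
    have b6: "l2bound (Ca * (\<tau> * M)) Y6"
      unfolding Y6_def
    proof (rule l2bound_mult)
      show "continuous_on UNIV (\<lambda>t. - a (?u t))" by (intro continuous_intros uc)
      show "\<bar>- a (?u t)\<bar> \<le> Ca" for t using Ca(2)[of "?u t" 0] ub(4)[of t] B by simp
      show "l2bound (\<tau> * M) (synth (dcoeff (dcoeff H)))"
        by (rule parseval[OF herm_dcoeff[OF herm_dcoeff[OF hH]] w2[OF Hw2]]) (use H2 in \<open>auto intro!: hbound_dcoeff2\<close>)
    qed
    have b7: "l2bound (14 * Dg * \<tau>) Y7" unfolding Y7_def by (rule l2err[OF cg Dg(1)])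
    have b8: "l2bound (Lg * (\<tau> * B + \<tau> * B)) Y8"
    proof (rule l2bound_sup)
      show "continuous_on UNIV Y8" unfolding Y8_def by (intro continuous_intros gzc smooth_comp_continuous[OF g] ub)
      show "\<bar>Y8 t\<bar> \<le> Lg * (\<tau> * B + \<tau> * B)" for t
        unfolding Y8_def gz_def
        by (rule order_trans[OF Lg(2)[OF ub(4,5) zb(4,5)] mult_left_mono[OF add_mono[OF uz'] Lg(1)]])
    qed
    note cont = b1 b2 b3 b4 b5 b6 b7 b8
    have cs: "continuous_on UNIV Y1" "continuous_on UNIV Y2" "continuous_on UNIV Y3" "continuous_on UNIV Y4"
      "continuous_on UNIV Y5" "continuous_on UNIV Y6" "continuous_on UNIV Y7" "continuous_on UNIV Y8"
      using cont by (auto simp: l2bound_def)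
    define d1 where "d1 j = fc Y1 j + fc Y2 j + fc Y3 j" for j
    define d2 where "d2 j = fc Y4 j + fc Y5 j + fc Y6 j + fc Y7 j + fc Y8 j" for j
    have "hbound 0 (L * e) d1"
      unfolding d1_def
      by (rule hbound_mono[OF hbound_add[OF hbound_add[OF bessel[OF b1] bessel[OF b2]] bessel[OF b3]]])
        (simp add: L_def algebra_simps)
    then have h1: "hbound 0 (L * e) (cutoff (low K) d1)" by (rule hbound_cutoff)
    have "hbound 0 (R * \<tau>) d2"
      unfolding d2_def
      by (rule hbound_mono[OF hbound_add[OF hbound_add[OF hbound_add[OF hbound_add[OF bessel[OF b4] bessel[OF b5]] bessel[OF b6]] bessel[OF b7]] bessel[OF b8]]])
        (simp add: R_def algebra_simps)
    then have "hbound 0 (R * \<tau>) (cutoff (low K) d2)" by (rule hbound_cutoff)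
    from hbound_low_gain[OF K supp_cutoff this]
    have "hbound 1 (2 * real K * (R * \<tau>)) (cutoff (low K) d2)" .
    \<comment> \<open>The power of \<open>K\<close> spent on the inverse estimate turns the exponent
      \<open>-s - 3\<close> of \<tau> into the final \<open>-s - 2\<close>.\<close>
    moreover have "2 * real K * (R * \<tau>) = 2 * R * real K powr (- s - 2)"
    proof -
      have "real K * \<tau> = real K powr 1 * real K powr (- s - 3)" using K0 by (simp add: \<tau>_def)
      also have "\<dots> = real K powr (1 + (- s - 3))" by (rule powr_add[symmetric])
      also have "1 + (- s - 3) = - s - 2" by simp
      finally have "real K * \<tau> = real K powr (- s - 2)" .
      then show ?thesis by (metis mult.assoc mult.left_commute)
    qed
    ultimately have h2: "hbound 1 (2 * R * real K powr (- s - 2)) (cutoff (low K) d2)" by simp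
    have "fc (discrete_nonlinearity a g K ?y) j - cutoff (low K) (fc (nonlinearity a g ?u)) j
        = cutoff (low K) d1 j + cutoff (low K) d2 j" for j
    proof -
      have "fc (\<lambda>t. pre_projection a g K x t - nonlinearity a g ?u t) j = fc (pre_projection a g K x) j - fc (nonlinearity a g ?u) j"
        by (rule fc_diff[OF fc_discrete_nonlinearity(1)[OF x] continuous_nonlinearity[OF a g Uw2]])
      moreover have "fc (\<lambda>t. pre_projection a g K x t - nonlinearity a g ?u t) j = d1 j + d2 j"
        unfolding sum_eq d1_def d2_def
        by (simp add: fc_add cs continuous_on_add)
      ultimately show ?thesis by (simp add: fc_discrete_nonlinearity(2)[OF x] cutoff_def)
    qed
    then show "\<exists>d1 d2. (\<forall>j. fc (discrete_nonlinearity a g K ?y) j - cutoff (low K) (fc (nonlinearity a g ?u)) j = d1 j + d2 j)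
      \<and> hbound 0 (L * e) d1 \<and> hbound 1 (2 * R * real K powr (- s - 2)) d2"
      using h1 h2 by blast
  qed (use R0 in simp)
qed

section \<open>Convergence\<close>

text \<open>The part of membership in \<open>sobolev\<close> that does not concern the weights. It
  is stable under differences and covers the exact velocity, for which continuity in space is not
  assumed.\<close>

definition square_integrable :: "(real \<Rightarrow> real) \<Rightarrow> bool" where
  "square_integrable v \<longleftrightarrow> periodic v \<and> v \<in> borel_measurable lborel \<and> set_integrable lborel {0..2 * pi} (\<lambda>x. (v x)\<^sup>2)"

lemma sobolev_square_integrable: "v \<in> sobolev r \<Longrightarrow> square_integrable v"
  by (simp add: sobolev_def square_integrable_def)

lemma square_integrable_continuous:
  assumes "periodic v" "continuous_on UNIV v"
  shows "square_integrable v"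
proof -
  have "continuous_on UNIV (\<lambda>x. (v x)\<^sup>2)" by (intro continuous_intros assms(2))
  then show ?thesis using assms
    by (auto simp: square_integrable_def intro!: set_integrable_continuous borel_measurable_continuous_onI)
qed

lemma square_integrable_diff:
  assumes v: "square_integrable v" and w: "square_integrable w"
  shows "square_integrable (v - w)" "fc (v - w) j = fc v j - fc w j"
proof -
  have i: "set_integrable lborel {0..2 * pi} v" "set_integrable lborel {0..2 * pi} w"
    using v w by (auto simp: square_integrable_def intro: set_integrable_square_imp)
  show "fc (v - w) j = fc v j - fc w j"
    using fourier_coeff_diff[OF i] by (simp add: fun_diff_def)
  have "set_integrable lborel {0..2*pi} (\<lambda>x. (v x - w x)\<^sup>2)"
  proof (rule set_integrable_bound[of lborel "{0..2*pi}" "\<lambda>x. 2 * (v x)\<^sup>2 + 2 * (w x)\<^sup>2"])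
    show "set_integrable lborel {0..2*pi} (\<lambda>x. 2 * (v x)\<^sup>2 + 2 * (w x)\<^sup>2)"
      by (intro set_integral_add(1) set_integrable_mult_right) (use v w in \<open>auto simp: square_integrable_def\<close>)
    have "v \<in> borel_measurable borel" "w \<in> borel_measurable borel" using v w by (auto simp: square_integrable_def)
    then show "set_borel_measurable lborel {0..2*pi} (\<lambda>x. (v x - w x)\<^sup>2)"
      unfolding set_borel_measurable_def by measurable
    have "(x - y)\<^sup>2 \<le> 2 * x\<^sup>2 + 2 * y\<^sup>2" for x y :: real
      using zero_le_power2[of "x + y"] by (simp add: power2_sum power2_diff)
    then show "AE x in lborel. x \<in> {0..2*pi} \<longrightarrow> norm ((v x - w x)\<^sup>2) \<le> norm (2 * (v x)\<^sup>2 + 2 * (w x)\<^sup>2)"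
      by (intro AE_I2) simp
  qed
  then show "square_integrable (v - w)"
    using v w by (auto simp: square_integrable_def periodic_def fun_diff_def)
qed

lemma energy_error:
  assumes "square_integrable p" "square_integrable q" "square_integrable v" "square_integrable w"
    and "hbound 2 \<delta> (\<lambda>j. fc p j - fc v j)" "hbound 1 \<delta> (\<lambda>j. fc q j - fc w j)"
  shows "(p, q) - (v, w) \<in> energy_space 1 \<and> energy_norm 1 ((p, q) - (v, w)) \<le> 2 * \<delta>"
proof -
  have h: "hbound 2 \<delta> (fc (p - v))" "hbound 1 \<delta> (fc (q - w))"
    using assms(5,6) by (simp_all add: square_integrable_diff(2)[OF assms(1,3), abs_def] square_integrable_diff(2)[OF assms(2,4), abs_def])
  have sq: "square_integrable (p - v)" "square_integrable (q - w)"
    using square_integrable_diff(1) assms(1-4) by auto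
  note n = hbound_sobolev[OF h(1)] hbound_sobolev[OF h(2)]
  have \<delta>: "0 \<le> \<delta>" by (rule hbound_nonneg[OF h(1)])
  have nn: "0 \<le> sobolev_norm r x" for r x by (simp add: sobolev_norm_def infsum_nonneg)
  have "(sobolev_norm 2 (p - v))\<^sup>2 + (sobolev_norm 1 (q - w))\<^sup>2 \<le> \<delta>\<^sup>2 + \<delta>\<^sup>2"
    by (intro add_mono power_mono n nn)
  also have "\<dots> \<le> (2 * \<delta>)\<^sup>2" by (simp add: power_mult_distrib)
  finally have "sqrt ((sobolev_norm 2 (p - v))\<^sup>2 + (sobolev_norm 1 (q - w))\<^sup>2) \<le> 2 * \<delta>"
    using \<delta> by (intro real_le_lsqrt) auto
  then show ?thesis
    using sq n by (simp add: energy_space_def energy_norm_def sobolev_def square_integrable_def)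
qed

text \<open>Each term is to count at most a quarter of \<open>h^2\<close> or of \<open>q\<close>. In
  the terms of \<open>L\<close> and \<open>E\<close>, the bound \<open>\<kappa> \<le> c * h\<close>
  leaves a spare factor \<open>h\<close> or \<open>h powr (1 / 3)\<close>; in those of
  \<open>C\<close> and \<rho> it is \<kappa> itself that is small. No constant remains in front of
  \<open>h^2 + q\<close>, so the factor \<open>X\<close>, which contains the final time, is
  absorbed. The thresholds are chosen before \<open>q\<close>, hence uniformly in
  \<open>K\<close>.\<close>

lemma step_size_choice:
  fixes X L C c E \<rho> :: real
  assumes nn: "0 \<le> X" "0 \<le> L" "0 \<le> C" "0 \<le> c" "0 \<le> E" "0 \<le> \<rho>"
  obtains h0 \<kappa>0 where "0 < h0" "h0 \<le> 1" "0 < \<kappa>0" "\<kappa>0 \<le> 1"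
    "\<And>\<kappa> h q. 0 \<le> \<kappa> \<Longrightarrow> \<kappa> < \<kappa>0 \<Longrightarrow> 0 < h \<Longrightarrow> h < h0 \<Longrightarrow> \<kappa> \<le> c * h \<Longrightarrow> 0 \<le> q \<Longrightarrow> q \<le> 1 \<Longrightarrow>
      X * (\<kappa> * (L * C * \<kappa> * h + E * h powr (4 / 3) + C * h\<^sup>2 + \<rho> * q)) \<le> h\<^sup>2 + q \<and>
      X * (\<kappa> * (L * C * \<kappa> * h + E * h powr (4 / 3) + C * h\<^sup>2 + \<rho> * q)) + \<kappa> * C * h\<^sup>2 \<le> 1"
proof -
  define Y where "Y = X * (L * C * c\<^sup>2) + X * (c * E) + X * C + X * \<rho> + C + 1"
  have p: "0 \<le> X * (L * C * c\<^sup>2)" "0 \<le> X * (c * E)" "0 \<le> X * C" "0 \<le> X * \<rho>" using nn by auto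
  then have Y: "1 \<le> Y" "X * (L * C * c\<^sup>2) \<le> Y" "X * (c * E) \<le> Y" "X * C \<le> Y" "X * \<rho> \<le> Y" "C \<le> Y"
    using nn by (auto simp: Y_def)
  \<comment> \<open>The cube is there because the smallest spare factor is
    \<open>h powr (1 / 3)\<close>.\<close>
  define h0 where "h0 = (1 / (4 * Y)) ^ 3"
  have hY: "0 < 1 / (4 * Y)" "1 / (4 * Y) \<le> 1 / 4" using Y(1) by (auto simp: field_simps)
  have h0: "0 < h0" "h0 \<le> 1 / 4"
  proof -
    show "0 < h0" unfolding h0_def using hY(1) by (rule zero_less_power)
    have "h0 \<le> (1 / 4) ^ 3" unfolding h0_def using hY by (intro power_mono) auto
    then show "h0 \<le> 1 / 4" by (simp add: power3_eq_cube)
  qed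
  show ?thesis
  proof (rule that[of h0 "1 / (4 * Y)"])
    fix \<kappa> h q :: real
    assume \<kappa>: "0 \<le> \<kappa>" "\<kappa> < 1 / (4 * Y)" and h: "0 < h" "h < h0" and \<kappa>h: "\<kappa> \<le> c * h" and q: "0 \<le> q" "q \<le> 1"
    have quarter: "b * z \<le> 1 / 4" if "b \<le> Y" "0 \<le> z" "z \<le> 1 / (4 * Y)" for b z
    proof -
      have "b * z \<le> Y * (1 / (4 * Y))" using that Y(1) by (intro mult_mono) auto
      then show ?thesis using Y(1) by simp
    qed
    have h3: "h powr (1 / 3) \<le> 1 / (4 * Y)"
    proof -
      have "h powr (1 / 3) \<le> ((1 / (4 * Y)) ^ 3) powr (1 / 3)"
        using h unfolding h0_def by (intro powr_mono2) auto
      also have "\<dots> = ((1 / (4 * Y)) powr 3) powr (1 / 3)" using hY by simp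
      also have "\<dots> = 1 / (4 * Y)" using hY by (subst powr_powr) simp
      finally show ?thesis .
    qed
    have h1: "h \<le> 1 / (4 * Y)"
    proof -
      have "h = h powr 1" using h by simp
      also have "\<dots> \<le> h powr (1 / 3)" using h h0 by (intro powr_mono') auto
      finally show ?thesis using h3 by simp
    qed
    have hh: "h powr (4 / 3) = h powr (1 / 3) * h" using h powr_add[of h "1 / 3" 1] by simp
    have 1: "X * (\<kappa> * (L * C * \<kappa> * h)) \<le> 1 / 4 * h\<^sup>2"
    proof -
      have "\<kappa> * \<kappa> \<le> (c * h) * (c * h)" using \<kappa> \<kappa>h by (intro mult_mono) auto
      then have "X * (L * C) * h * (\<kappa> * \<kappa>) \<le> X * (L * C) * h * ((c * h) * (c * h))"
        using nn h by (intro mult_left_mono) auto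
      also have "\<dots> = (X * (L * C * c\<^sup>2) * h) * h\<^sup>2" by (simp add: power2_eq_square mult_ac)
      also have "\<dots> \<le> 1 / 4 * h\<^sup>2" using quarter[OF Y(2) _ h1] h by (intro mult_right_mono) auto
      finally show ?thesis by (simp add: mult_ac)
    qed
    have 2: "X * (\<kappa> * (E * h powr (4 / 3))) \<le> 1 / 4 * h\<^sup>2"
    proof -
      have "X * E * h powr (4 / 3) * \<kappa> \<le> X * E * h powr (4 / 3) * (c * h)"
        using nn \<kappa>h by (intro mult_left_mono) auto
      also have "\<dots> = (X * (c * E) * h powr (1 / 3)) * h\<^sup>2" unfolding hh by (simp add: power2_eq_square mult_ac)
      also have "\<dots> \<le> 1 / 4 * h\<^sup>2" using quarter[OF Y(3) _ h3] by (intro mult_right_mono) auto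
      finally show ?thesis by (simp add: mult_ac)
    qed
    have 3: "X * (\<kappa> * (C * h\<^sup>2)) \<le> 1 / 4 * h\<^sup>2"
    proof -
      have "(X * C * \<kappa>) * h\<^sup>2 \<le> 1 / 4 * h\<^sup>2" using quarter[OF Y(4), of \<kappa>] \<kappa> by (intro mult_right_mono) auto
      then show ?thesis by (simp add: mult_ac)
    qed
    have 4: "X * (\<kappa> * (\<rho> * q)) \<le> 1 / 4 * q"
    proof -
      have "(X * \<rho> * \<kappa>) * q \<le> 1 / 4 * q" using quarter[OF Y(5), of \<kappa>] \<kappa> q by (intro mult_right_mono) auto
      then show ?thesis by (simp add: mult_ac)
    qed
    have 5: "\<kappa> * C * h\<^sup>2 \<le> 1 / 4 * h\<^sup>2"
      using quarter[OF Y(6), of \<kappa>] \<kappa> by (intro mult_right_mono) (auto simp: mult.commute)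
    have 6: "h\<^sup>2 \<le> 1 / 4"
    proof -
      have "h\<^sup>2 \<le> 1 * (1 / 4)" unfolding power2_eq_square using h h0 by (intro mult_mono) auto
      then show ?thesis by simp
    qed
    have "X * (\<kappa> * (L * C * \<kappa> * h + E * h powr (4 / 3) + C * h\<^sup>2 + \<rho> * q)) \<le> 3 / 4 * h\<^sup>2 + 1 / 4 * q"
      using 1 2 3 4 by (simp add: distrib_left)
    then show "X * (\<kappa> * (L * C * \<kappa> * h + E * h powr (4 / 3) + C * h\<^sup>2 + \<rho> * q)) \<le> h\<^sup>2 + q \<and>
      X * (\<kappa> * (L * C * \<kappa> * h + E * h powr (4 / 3) + C * h\<^sup>2 + \<rho> * q)) + \<kappa> * C * h\<^sup>2 \<le> 1"
      using 5 6 q zero_le_power2[of h] by linarith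
  qed (use h0 hY in auto)
qed

text \<open>Joins the equation and the propagation of errors for both methods: \<delta> measures the
  distance to the exact solution truncated to \<open>S\<close>, \<tau> the discarded modes. The
  factor 2 passes from bounds of the two components to the energy norm.\<close>

lemma integrator_error:
  fixes z :: "nat \<Rightarrow> (real \<Rightarrow> real) \<times> (real \<Rightarrow> real)"
  assumes a: "smooth a" and g: "smooth g" and T: "0 < T" and r4: "4 \<le> r4"
    and sol: "wave_solution a g \<kappa> T u0 v0 u ut"
    and M: "\<And>t. t \<in> {0..T} \<Longrightarrow> (u t, ut t) \<in> energy_space r4" "\<And>t. t \<in> {0..T} \<Longrightarrow> energy_norm r4 (u t, ut t) \<le> M"
    and \<kappa>: "0 \<le> \<kappa>" "\<kappa> \<le> 1" and h: "0 < h" "h \<le> 1" "\<kappa> \<le> c * h"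
    and C: "0 \<le> C" "\<And>x. herm x \<Longrightarrow> hbound 5 M x \<Longrightarrow> hbound 3 C (nlcoeff a g x)"
    and E: "0 \<le> E" "\<And>\<kappa> T U V. exact_coeffs a g \<kappa> T M U V \<Longrightarrow> 0 \<le> \<kappa> \<Longrightarrow> \<kappa> \<le> 1 \<Longrightarrow> midpoint_error a g \<kappa> T E U V"
    and S: "\<And>j. S (- j) = S j"
    and F: "\<And>x. herm x \<Longrightarrow> supp S x \<Longrightarrow> (\<exists>B. hbound 5 B x) \<Longrightarrow> supp S (fc (F (synth x))) \<and> (\<exists>B. hbound 3 B (fc (F (synth x))))"
    and A: "\<And>t x e. t \<in> {0..T} \<Longrightarrow> herm x \<Longrightarrow> supp S x \<Longrightarrow> (\<exists>B. hbound 5 B x) \<Longrightarrow>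
        hbound 2 e (\<lambda>j. x j - cutoff S (fc (u t)) j) \<Longrightarrow> e \<le> 1 \<Longrightarrow>
        \<exists>d1 d2. (\<forall>j. fc (F (synth x)) j - cutoff S (fc (nonlinearity a g (u t))) j = d1 j + d2 j)
          \<and> hbound 0 (L * e) d1 \<and> hbound 1 \<rho> d2"
    and L: "0 \<le> L" and \<rho>: "0 \<le> \<rho>"
    and small: "T * exp (c * L * T) * (\<kappa> * (L * C * \<kappa> * h + E * h powr (4 / 3) + C * h\<^sup>2 + \<rho>)) \<le> \<delta>"
      "T * exp (c * L * T) * (\<kappa> * (L * C * \<kappa> * h + E * h powr (4 / 3) + C * h\<^sup>2 + \<rho>)) + \<kappa> * C * h\<^sup>2 \<le> 1"
    and tail: "\<And>t. t \<in> {0..T} \<Longrightarrow> hbound 1 \<tau> (\<lambda>j. diag (fc (u t)) (fc (ut t)) j - cutoff S (diag (fc (u t)) (fc (ut t))) j)"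
    and z0: "fc (fst (z 0)) = cutoff S (fc u0)" "fc (snd (z 0)) = cutoff S (fc v0)"
      "square_integrable (fst (z 0))" "square_integrable (snd (z 0))"
    and z: "\<And>n. z (Suc n) = ti_step TI2_b1 TI2_bb1 F \<kappa> h (z n)"
    and n: "real n * h \<le> T"
  shows "z n - (u (real n * h), ut (real n * h)) \<in> energy_space 1 \<and>
    energy_norm 1 (z n - (u (real n * h), ut (real n * h))) \<le> 2 * (\<delta> + \<tau>)"
proof -
  define U where "U t = fc (u t)" for t
  define V where "V t = fc (ut t)" for t
  note W = wave_solution_coefficients[OF a g T r4 sol M]
  have init: "u 0 = u0" "ut 0 = v0" using sol by (auto simp: wave_solution_def)
  have su: "synth (U t) = u t" if "t \<in> {0..T}" for t using W(3)[OF _ _ that] by (simp add: U_def)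
  have ex: "exact_coeffs a g \<kappa> T M U V"
    unfolding exact_coeffs_def
  proof (intro ballI conjI allI)
    fix t j assume t: "t \<in> {0..T}"
    show "herm (U t)" by (simp add: U_def)
    show "hbound 5 M (U t)" "hbound 4 M (V t)"
      using hbound_weaken[OF W(1)[OF _ _ t], of 5] hbound_weaken[OF W(2)[OF _ _ t], of 4] r4 by (auto simp: U_def V_def)
    show "((\<lambda>\<tau>. U \<tau> j) has_vector_derivative V t j) (at t within {0..T})"
      using W(4)[OF _ _ t] by (simp add: U_def V_def)
    show "((\<lambda>\<tau>. V \<tau> j) has_vector_derivative - of_real ((jb j)\<^sup>2) * U t j
             + of_real \<kappa> * nlcoeff a g (U t) j) (at t within {0..T})"
      using W(5)[OF _ _ t, of j] su[OF t] by (simp add: U_def V_def)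
  qed
  define R where "R = L * C * \<kappa> * h + E * h powr (4 / 3) + C * h\<^sup>2 + \<rho>"
  have e: "T * \<kappa> * R * exp (c * L * T) = T * exp (c * L * T) * (\<kappa> * (L * C * \<kappa> * h + E * h powr (4 / 3) + C * h\<^sup>2 + \<rho>))"
    by (simp add: R_def mult_ac)
  have P: "(\<exists>B. hbound 5 B (fc (fst (z n))) \<and> hbound 4 B (fc (snd (z n)))) \<and>
    supp S (fc (fst (z n))) \<and> supp S (fc (snd (z n))) \<and>
    (0 < n \<longrightarrow> (\<exists>X Y B. z n = (synth X, synth Y) \<and> wbound 0 B X \<and> wbound 0 B Y)) \<and>
    hbound 1 (T * \<kappa> * R * exp (c * L * T))
      (\<lambda>j. cis (- (jb j * (real n * h))) * diag (fc (fst (z n))) (fc (snd (z n))) j - cutoff S (twisted U V (real n * h)) j)"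
  proof (rule error_propagation[where a = a and g = g and \<kappa> = \<kappa> and T = T and M = M and U = U and V = V and h = h
        and c = c and C = C and E = E and S = S and F = F and L = L and \<rho> = \<rho> and r = R and s = z and n = n])
    show "exact_coeffs a g \<kappa> T M U V" by (rule ex)
    show "midpoint_error a g \<kappa> T E U V" by (rule E(2)[OF ex \<kappa>])
    show "supp S (fc (F (synth x))) \<and> (\<exists>B. hbound 3 B (fc (F (synth x))))"
      if "herm x" "supp S x" "\<exists>B. hbound 5 B x" for x
      by (rule F[OF that])
    show "hbound 3 C (nlcoeff a g (U t))" if "t \<in> {0..T}" for t
      using C(2) exact_coeffsD(1,2)[OF ex that] by blast
    show "\<exists>d1 d2. (\<forall>j. fc (F (synth x)) j - cutoff S (nlcoeff a g (U t)) j = d1 j + d2 j)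
          \<and> hbound 0 (L * e) d1 \<and> hbound 1 \<rho> d2"
      if "t \<in> {0..T}" "herm x" "supp S x" "\<exists>B. hbound 5 B x" "hbound 2 e (\<lambda>j. x j - cutoff S (U t) j)" "e \<le> 1" for t x e
      using A[OF that(1-4) _ that(6)] that(5) su[OF that(1)] by (simp add: U_def)
    show "T * \<kappa> * R * exp (c * L * T) + \<kappa> * C * h\<^sup>2 \<le> 1" unfolding e by (rule small(2))
    show "fc (fst (z 0)) = cutoff S (U 0)" "fc (snd (z 0)) = cutoff S (V 0)"
      using z0(1,2) by (simp_all add: U_def V_def init)
    show "R = L * C * \<kappa> * h + E * h powr (4 / 3) + C * h\<^sup>2 + \<rho>" by (rule R_def)
  qed (fact \<kappa> h C(1) E(1) S L \<rho> z n)+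
  define t where "t = real n * h"
  have t: "t \<in> {0..T}" using n h by (simp add: t_def)
  have d: "hbound 1 \<delta> (\<lambda>j. cis (- (jb j * t)) * diag (fc (fst (z n))) (fc (snd (z n))) j - cutoff S (twisted U V t) j)"
    using P small(1) unfolding e[symmetric] t_def by (blast intro: hbound_mono)
  \<comment> \<open>Rotations commute with truncation and have modulus 1, so the tail hypothesis
    carries over to the rotated variable.\<close>
  have "hbound 1 \<tau> (\<lambda>j. twisted U V t j - cutoff S (twisted U V t) j)"
    by (rule hbound_norm_le[OF tail[OF t]]) (simp add: twisted_def cutoff_def norm_mult U_def V_def)
  from hbound_diff[OF d this]
  have "hbound 1 (\<delta> + \<tau>) (diag (\<lambda>j. fc (fst (z n)) j - U t j) (\<lambda>j. fc (snd (z n)) j - V t j))"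
  proof (rule hbound_norm_le)
    fix j
    have "(cis (- (jb j * t)) * diag (fc (fst (z n))) (fc (snd (z n))) j - cutoff S (twisted U V t) j)
        - (twisted U V t j - cutoff S (twisted U V t) j)
      = cis (- (jb j * t)) * diag (\<lambda>j. fc (fst (z n)) j - U t j) (\<lambda>j. fc (snd (z n)) j - V t j) j"
      by (simp add: twisted_def diag_def algebra_simps)
    then show "cmod (diag (\<lambda>j. fc (fst (z n)) j - U t j) (\<lambda>j. fc (snd (z n)) j - V t j) j)
      \<le> cmod ((cis (- (jb j * t)) * diag (fc (fst (z n))) (fc (snd (z n))) j - cutoff S (twisted U V t) j)
        - (twisted U V t j - cutoff S (twisted U V t) j))"
      by (simp add: norm_mult)
  qed
  moreover have "herm (\<lambda>j. fc (fst (z n)) j - U t j)" "herm (\<lambda>j. fc (snd (z n)) j - V t j)"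
    by (simp_all add: herm_def U_def V_def fourier_coeff_uminus)
  ultimately have hb: "hbound (1 + 1) (\<delta> + \<tau>) (\<lambda>j. fc (fst (z n)) j - U t j)" "hbound 1 (\<delta> + \<tau>) (\<lambda>j. fc (snd (z n)) j - V t j)"
    using diag_components by blast+
  have sq: "square_integrable (fst (z n))" "square_integrable (snd (z n))"
  proof -
    \<comment> \<open>Later iterates are convergent series and hence continuous, whereas at
      \<open>n = 0\<close> the prescribed functions themselves appear, for which the hypothesis is
      used.\<close>
    have "square_integrable (fst (z n)) \<and> square_integrable (snd (z n))"
    proof (cases "n = 0")
      case False
      then obtain X Y B where "z n = (synth X, synth Y)" "wbound 0 B X" "wbound 0 B Y" using P by blast
      then show ?thesis by (auto intro!: square_integrable_continuous continuous_synth)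
    qed (use z0 in simp)
    then show "square_integrable (fst (z n))" "square_integrable (snd (z n))" by auto
  qed
  have "square_integrable (u t)" "square_integrable (ut t)"
    using M(1)[OF t] by (auto simp: energy_space_def intro: sobolev_square_integrable)
  from energy_error[OF sq this, of "\<delta> + \<tau>"] hb show ?thesis by (simp add: U_def V_def t_def)
qed

text \<open>Where \<open>sinc\<close> does not vanish it cancels and leaves
  \<open>\<xi> * cos (\<xi> / 2)\<close>. At \<xi> equal to \<pi> / 2 plus a multiple of 4 \<pi> the
  cosine is the same positive number, while \<xi> is unbounded.\<close>

lemma TI2_coefficient_unbounded:
  "\<not> (\<exists>c. \<forall>\<xi>\<ge>0. sinc \<xi> \<noteq> 0 \<longrightarrow> \<bar>\<xi> * inverse (sinc \<xi>) * TI2_b1 (\<xi>\<^sup>2)\<bar> \<le> c)"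
proof
  assume "\<exists>c. \<forall>\<xi>\<ge>0. sinc \<xi> \<noteq> 0 \<longrightarrow> \<bar>\<xi> * inverse (sinc \<xi>) * TI2_b1 (\<xi>\<^sup>2)\<bar> \<le> c"
  then obtain c where c: "\<And>\<xi>. \<xi> \<ge> 0 \<Longrightarrow> sinc \<xi> \<noteq> 0 \<Longrightarrow> \<bar>\<xi> * inverse (sinc \<xi>) * TI2_b1 (\<xi>\<^sup>2)\<bar> \<le> c" by blast
  obtain n :: nat where n: "c < real n" using reals_Archimedean2 by blast
  define \<xi> where "\<xi> = pi / 2 + 2 * real (2 * n) * pi"
  have \<xi>: "0 < \<xi>" unfolding \<xi>_def by (intro add_pos_nonneg) auto
  have "sin \<xi> = sin (pi / 2)" unfolding \<xi>_def sin_add cos_2npi sin_2npi by simp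
  then have sin: "sin \<xi> = 1" by simp
  have "\<xi> / 2 = pi / 4 + 2 * real n * pi" by (simp add: \<xi>_def)
  then have cos: "cos (\<xi> / 2) = sqrt 2 / 2" by (simp only: cos_add cos_2npi sin_2npi cos_45)
  have sc: "sinc \<xi> \<noteq> 0" using \<xi> sin by simp
  have e: "\<xi> * inverse (sinc \<xi>) * TI2_b1 (\<xi>\<^sup>2) = \<xi> * (sqrt 2 / 2)"
    using \<xi> sin cos by (simp add: TI2_b1_def)
  have "\<xi> * (sqrt 2 / 2) \<le> c" using c[OF less_imp_le[OF \<xi>] sc] unfolding e by (rule abs_le_D1)
  moreover have "1 / 2 \<le> sqrt 2 / 2" by simp
  then have "\<xi> * (1 / 2) \<le> \<xi> * (sqrt 2 / 2)" using \<xi> by (intro mult_left_mono) auto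
  ultimately have "\<xi> / 2 \<le> c" by linarith
  moreover have "real n \<le> \<xi> / 2"
  proof -
    have "1 * real n \<le> pi * real n" using pi_gt3 by (intro mult_right_mono) auto
    moreover have "\<xi> / 2 = pi / 4 + 2 * (pi * real n)" by (simp add: \<xi>_def)
    moreover have "0 \<le> pi * real n" by simp
    ultimately show ?thesis using pi_gt_zero by linarith
  qed
  ultimately show False using n by simp
qed

theorem theorem3p5:
  fixes a :: "real \<Rightarrow> real" and g :: "real \<times> real \<Rightarrow> real" and s M :: real
  assumes "smooth a" and "smooth g" and "a 0 = 0" and "g (0, 0) = 0"
    and "0 \<le> s" and "0 < M"
  shows
    "\<not> (\<exists>c. \<forall>\<xi>\<ge>0. sinc \<xi> \<noteq> 0 \<longrightarrow> \<bar>\<xi> * inverse (sinc \<xi>) * TI2_b1 (\<xi>\<^sup>2)\<bar> \<le> c) \<and>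
     (\<exists>C>0. \<forall>T>0. \<forall>\<delta> A\<^sub>0 c u\<^sub>0 v\<^sub>0. 0 < \<delta> \<and> \<delta> < 1 \<and> 0 \<le> A\<^sub>0 \<and> 0 < c \<longrightarrow>
       (\<exists>h\<^sub>0>0. \<exists>\<kappa>\<^sub>0>0. \<forall>\<kappa> u ut.
          0 < \<kappa> \<and> \<kappa> < \<kappa>\<^sub>0 \<and> wave_solution a g \<kappa> T u\<^sub>0 v\<^sub>0 u ut \<and>
          (\<forall>t\<in>{0..T}. (u t, ut t) \<in> energy_space (4 + s) \<and> energy_norm (4 + s) (u t, ut t) \<le> M \<and>
             (\<forall>x. 1 + \<kappa> * a (u t x) \<ge> \<delta> \<and> \<kappa> * a (u t x) \<le> A\<^sub>0))
          \<longrightarrow> (\<forall>h. \<kappa> \<le> c * h \<and> h < h\<^sub>0 \<longrightarrow>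
             (s = 0 \<longrightarrow> (\<forall>n. real n * h \<le> T \<longrightarrow>
                (let e = TI2_time_discrete a g \<kappa> h u\<^sub>0 v\<^sub>0 n - (u (real n * h), ut (real n * h))
                 in e \<in> energy_space 1 \<and> energy_norm 1 e \<le> C * h\<^sup>2))) \<and>
             (\<forall>K\<ge>1. \<forall>n. real n * h \<le> T \<longrightarrow>
                (let e = TI2_fully_discrete a g K \<kappa> h u\<^sub>0 v\<^sub>0 n - (u (real n * h), ut (real n * h))
                 in e \<in> energy_space 1 \<and>
                    energy_norm 1 e \<le> C * h\<^sup>2 + C * real K powr (- s - 2))))))"
proof -
  note a = assms(1) and g = assms(2)
  have M0: "0 \<le> M" and M1: "0 \<le> M + 1" using assms(6) by auto
  obtain C where C: "0 \<le> C" "\<And>x. herm x \<Longrightarrow> hbound 5 M x \<Longrightarrow> hbound 3 C (nlcoeff a g x)"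
    using nonlinearity_regular[OF a g M0] by blast
  obtain E where E: "0 \<le> E" "\<And>\<kappa> T U V. exact_coeffs a g \<kappa> T M U V \<Longrightarrow> 0 \<le> \<kappa> \<Longrightarrow> \<kappa> \<le> 1 \<Longrightarrow> midpoint_error a g \<kappa> T E U V"
    by (rule exact_local_error[OF a g M0]) (rule that)
  \<comment> \<open>The radius \<open>M + 1\<close> leaves room for a numerical solution at distance
    at most 1 from the exact one.\<close>
  obtain L1 where L1: "0 \<le> L1" "\<And>x y e A. herm x \<Longrightarrow> herm y \<Longrightarrow> hbound 2 (M + 1) x \<Longrightarrow> wbound 2 A x \<Longrightarrow> hbound 3 (M + 1) y \<Longrightarrow>
    hbound 2 e (\<lambda>j. x j - y j) \<Longrightarrow>
    hbound 0 (L1 * e) (\<lambda>j. nlcoeff a g x j - nlcoeff a g y j)"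
    by (rule nonlinearity_lipschitz[OF a g M1]) (rule that)
  obtain L2 \<rho> where L2: "0 \<le> L2" and \<rho>: "0 \<le> \<rho>" and A2: "\<And>K U x e. 1 \<le> K \<Longrightarrow> herm U \<Longrightarrow> hbound (5 + s) M U \<Longrightarrow> herm x \<Longrightarrow> supp (low K) x \<Longrightarrow>
    hbound 2 e (\<lambda>j. x j - cutoff (low K) U j) \<Longrightarrow> e \<le> 1 \<Longrightarrow>
    \<exists>d1 d2. (\<forall>j. fc (discrete_nonlinearity a g K (synth x)) j - cutoff (low K) (nlcoeff a g U) j = d1 j + d2 j)
      \<and> hbound 0 (L2 * e) d1 \<and> hbound 1 (\<rho> * real K powr (- s - 2)) d2"
    by (rule discrete_nonlinearity_error[OF a g M0 assms(5)]) (rule that)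
  \<comment> \<open>A common constant lets one pair of thresholds serve both methods.\<close>
  define L where "L = L1 + L2"
  have L: "0 \<le> L" "L1 \<le> L" "L2 \<le> L" using L1(1) L2 by (auto simp: L_def)
  \<comment> \<open>The error is at most \<open>2 * (h^2 + q)\<close> plus \<open>4 * M * q\<close>
    from the truncated modes, with \<open>q\<close> the power of \<open>K\<close>. All other
    constants, including those depending on \<open>c\<close> and \<open>T\<close>, have gone into
    the thresholds.\<close>
  let ?C = "2 + 4 * M"
  have C0: "0 < ?C" using assms(6) by simp
  show ?thesis
  proof (rule conjI[OF TI2_coefficient_unbounded], rule exI[of _ ?C], intro conjI C0 allI impI, goal_cases)
    case (1 T \<delta> A\<^sub>0 c u\<^sub>0 v\<^sub>0)
    then have T: "0 < T" and c: "0 < c" by auto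
    have X: "0 \<le> T * exp (c * L * T)" using T by simp
    obtain h0 \<kappa>0 where h0: "0 < h0" "h0 \<le> 1" and \<kappa>0: "0 < \<kappa>0" "\<kappa>0 \<le> 1" and small:
      "\<And>\<kappa> h q. 0 \<le> \<kappa> \<Longrightarrow> \<kappa> < \<kappa>0 \<Longrightarrow> 0 < h \<Longrightarrow> h < h0 \<Longrightarrow> \<kappa> \<le> c * h \<Longrightarrow> 0 \<le> q \<Longrightarrow> q \<le> 1 \<Longrightarrow>
      T * exp (c * L * T) * (\<kappa> * (L * C * \<kappa> * h + E * h powr (4 / 3) + C * h\<^sup>2 + \<rho> * q)) \<le> h\<^sup>2 + q \<and>
      T * exp (c * L * T) * (\<kappa> * (L * C * \<kappa> * h + E * h powr (4 / 3) + C * h\<^sup>2 + \<rho> * q)) + \<kappa> * C * h\<^sup>2 \<le> 1"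
      using step_size_choice[OF X L(1) C(1) less_imp_le[OF c] E(1) \<rho>] by metis
    show ?case
    proof (rule exI[of _ h0], rule conjI[OF h0(1)], rule exI[of _ \<kappa>0], rule conjI[OF \<kappa>0(1)], intro allI impI, goal_cases)
      case (1 \<kappa> u ut h)
      then have \<kappa>: "0 < \<kappa>" "\<kappa> < \<kappa>0" and sol: "wave_solution a g \<kappa> T u\<^sub>0 v\<^sub>0 u ut"
        and ball: "\<forall>t\<in>{0..T}. (u t, ut t) \<in> energy_space (4 + s) \<and> energy_norm (4 + s) (u t, ut t) \<le> M"
        and h: "\<kappa> \<le> c * h" "h < h0" by auto
      have es: "(u t, ut t) \<in> energy_space (4 + s)" and en: "energy_norm (4 + s) (u t, ut t) \<le> M" if "t \<in> {0..T}" for t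
        using ball that by auto
      have hpos: "0 < h" using \<kappa>(1) h(1) c by (smt (verit) mult_nonneg_nonpos)
      have \<kappa>1: "0 \<le> \<kappa>" "\<kappa> \<le> 1" using \<kappa> \<kappa>0 by auto
      have h1: "h \<le> 1" using h h0 by simp
      have s4: "4 \<le> 4 + s" using assms(5) by simp
      have T0: "0 \<in> {0..T}" using T by simp
      have init: "u 0 = u\<^sub>0" "ut 0 = v\<^sub>0" using sol by (auto simp: wave_solution_def)
      have sq: "square_integrable u\<^sub>0" "square_integrable v\<^sub>0"
        using es[OF T0] init by (auto simp: energy_space_def intro: sobolev_square_integrable)
      have U5: "hbound (5 + s) M (fc (u t))" and V4: "hbound (4 + s) M (fc (ut t))" if "t \<in> {0..T}" for t
        using energy_space_hbound[OF es[OF that] en[OF that]] by (simp_all add: add.commute add.left_commute)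
      have U5': "hbound 5 M (fc (u t))" if "t \<in> {0..T}" for t
        using U5[OF that] by (rule hbound_weaken) (use assms(5) in simp)
      have su: "synth (fc (u t)) = u t" if "t \<in> {0..T}" for t
        by (rule wave_solution_coefficients(3)[OF a g T s4 sol es en that])
      show ?case
      proof (intro conjI impI allI, goal_cases)
        case (1 n)
        then have n: "real n * h \<le> T" by simp
        let ?e = "TI2_time_discrete a g \<kappa> h u\<^sub>0 v\<^sub>0 n - (u (real n * h), ut (real n * h))"
        note sm = small[OF \<kappa>1(1) \<kappa>(2) hpos h(2,1), of 0]
        \<comment> \<open>Without spatial discretization all modes are kept, and both the spatial
          defect and the tail are zero.\<close>
        have "?e \<in> energy_space 1 \<and> energy_norm 1 ?e \<le> 2 * (h\<^sup>2 + 0)"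
        proof (rule integrator_error[OF a g T s4 sol es en \<kappa>1 hpos h1 h(1) C E, where S = "\<lambda>_. True" and L = L and \<rho> = 0 and F = "nonlinearity a g"])
          fix x assume x: "herm x" "\<exists>B. hbound 5 B x"
          then obtain B where B: "hbound 5 B x" by blast
          from nonlinearity_regular[OF a g hbound_nonneg[OF B]] x(1) B
          have "\<exists>B. hbound 3 B (nlcoeff a g x)" by metis
          then show "supp (\<lambda>_. True) (nlcoeff a g x) \<and> (\<exists>B. hbound 3 B (nlcoeff a g x))"
            by (simp add: supp_def)
        next
          fix t x e assume t: "t \<in> {0..T}" and x: "herm x" "\<exists>B. hbound 5 B x"
            and e: "hbound 2 e (\<lambda>j. x j - cutoff (\<lambda>_. True) (fc (u t)) j)" "e \<le> 1"
          obtain B where B: "hbound 5 B x" using x(2) by blast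
          have w: "wbound 2 (3 * B) x" by (rule wbound_weaken[OF hbound_imp_wbound[of 4 B x]]) (use B in simp_all)
          have e': "hbound 2 e (\<lambda>j. x j - fc (u t) j)" using e(1) by (simp add: cutoff_def)
          have "hbound 2 (M + e) (\<lambda>j. fc (u t) j + (x j - fc (u t) j))"
            by (rule hbound_add[OF hbound_weaken[OF U5'[OF t]] e']) simp
          then have x2: "hbound 2 (M + 1) x" using e(2) by (simp add: hbound_mono)
          have "hbound 3 (M + 1) (fc (u t))" by (rule hbound_mono[OF hbound_weaken[OF U5'[OF t]]]) simp_all
          from L1(2)[OF x(1) herm_fc x2 w this e']
          have "hbound 0 (L1 * e) (\<lambda>j. nlcoeff a g x j - fc (nonlinearity a g (u t)) j)"
            by (simp add: su[OF t])
          then have "hbound 0 (L * e) (\<lambda>j. nlcoeff a g x j - fc (nonlinearity a g (u t)) j)"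
            by (rule hbound_mono) (use L(2) hbound_nonneg[OF e(1)] in \<open>simp add: mult_right_mono\<close>)
          then show "\<exists>d1 d2. (\<forall>j. nlcoeff a g x j - cutoff (\<lambda>_. True) (fc (nonlinearity a g (u t))) j = d1 j + d2 j)
              \<and> hbound 0 (L * e) d1 \<and> hbound 1 0 d2"
            by (intro exI[of _ "\<lambda>j. nlcoeff a g x j - fc (nonlinearity a g (u t)) j"] exI[of _ "\<lambda>_. 0"])
              (simp add: cutoff_def hbound_def L2_set_def)
        next
          show "T * exp (c * L * T) * (\<kappa> * (L * C * \<kappa> * h + E * h powr (4 / 3) + C * h\<^sup>2 + 0)) \<le> h\<^sup>2"
            "T * exp (c * L * T) * (\<kappa> * (L * C * \<kappa> * h + E * h powr (4 / 3) + C * h\<^sup>2 + 0)) + \<kappa> * C * h\<^sup>2 \<le> 1"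
            using sm by simp_all
          show "hbound 1 0 (\<lambda>j. diag (fc (u t)) (fc (ut t)) j - cutoff (\<lambda>_. True) (diag (fc (u t)) (fc (ut t))) j)" for t
            by (simp add: cutoff_def hbound_def L2_set_def)
        qed (use n sq L in \<open>simp_all add: TI2_time_discrete_def cutoff_def[abs_def]\<close>)
        moreover have "2 * (h\<^sup>2 + 0) \<le> ?C * h\<^sup>2" using assms(6) by (simp add: mult_right_mono)
        ultimately show ?case unfolding Let_def by linarith
      next
        case (2 K n)
        then have K: "1 \<le> K" and n: "real n * h \<le> T" by simp_all
        let ?e = "TI2_fully_discrete a g K \<kappa> h u\<^sub>0 v\<^sub>0 n - (u (real n * h), ut (real n * h))"
        define q where "q = real K powr (- s - 2)"
        have K0: "1 \<le> real K" using K by simp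
        have q: "0 \<le> q" "q \<le> 1"
        proof -
          have "real K powr (- s - 2) \<le> real K powr 0" using K0 assms(5) by (intro powr_mono) auto
          then show "0 \<le> q" "q \<le> 1" using K0 by (auto simp: q_def)
        qed
        note sm = small[OF \<kappa>1(1) \<kappa>(2) hpos h(2,1) q]
        have proj: "trig_projection K w = synth (cutoff (low K) (fc w))" "fc (trig_projection K w) = cutoff (low K) (fc w)"
          "square_integrable (trig_projection K w)" if "square_integrable w" for w
        proof -
          have "set_integrable lborel {0..2 * pi} w"
            using that by (auto simp: square_integrable_def intro: set_integrable_square_imp)
          then show e: "trig_projection K w = synth (cutoff (low K) (fc w))" by (rule trig_projection_synth)
          show "fc (trig_projection K w) = cutoff (low K) (fc w)"
            unfolding e by (rule ext, rule fc_low) (auto intro!: herm_cutoff supp_cutoff)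
          show "square_integrable (trig_projection K w)"
            unfolding e by (intro square_integrable_continuous periodic_synth continuous_synth_low[OF supp_cutoff])
        qed
        \<comment> \<open>The tail is \<open>2 * M * q\<close> because \<open>diag\<close> is
          bounded by \<open>M + M\<close> in \<open>H^(4 + s)\<close>: measured in
          \<open>H^1\<close> it even decays with the exponent \<open>-s - 3\<close>.\<close>
        have "?e \<in> energy_space 1 \<and> energy_norm 1 ?e \<le> 2 * ((h\<^sup>2 + q) + 2 * M * q)"
        proof (rule integrator_error[OF a g T s4 sol es en \<kappa>1 hpos h1 h(1) C E, where S = "low K" and L = L and \<rho> = "\<rho> * q" and F = "discrete_nonlinearity a g K"])
          fix x assume x: "herm x" "supp (low K) x"
          have sp: "supp (low K) (fc (discrete_nonlinearity a g K (synth x)))"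
            unfolding fc_discrete_nonlinearity(2)[OF x] by (rule supp_cutoff)
          from finite_support_bounds[OF this, of 3] sp
          show "supp (low K) (fc (discrete_nonlinearity a g K (synth x))) \<and> (\<exists>B. hbound 3 B (fc (discrete_nonlinearity a g K (synth x))))"
            by metis
        next
          fix t x e assume t: "t \<in> {0..T}" and x: "herm x" "supp (low K) x"
            and e: "hbound 2 e (\<lambda>j. x j - cutoff (low K) (fc (u t)) j)" "e \<le> 1"
          from A2[OF K herm_fc U5[OF t] x e]
          obtain d1 d2 where d: "\<forall>j. fc (discrete_nonlinearity a g K (synth x)) j - cutoff (low K) (fc (nonlinearity a g (u t))) j = d1 j + d2 j"
            "hbound 0 (L2 * e) d1" "hbound 1 (\<rho> * q) d2"
            unfolding su[OF t] q_def by blast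
          have "hbound 0 (L * e) d1"
            by (rule hbound_mono[OF d(2)]) (use L(3) hbound_nonneg[OF e(1)] in \<open>simp add: mult_right_mono\<close>)
          then show "\<exists>d1 d2. (\<forall>j. fc (discrete_nonlinearity a g K (synth x)) j - cutoff (low K) (fc (nonlinearity a g (u t))) j = d1 j + d2 j)
              \<and> hbound 0 (L * e) d1 \<and> hbound 1 (\<rho> * q) d2"
            using d by blast
        next
          show "T * exp (c * L * T) * (\<kappa> * (L * C * \<kappa> * h + E * h powr (4 / 3) + C * h\<^sup>2 + \<rho> * q)) \<le> h\<^sup>2 + q"
            "T * exp (c * L * T) * (\<kappa> * (L * C * \<kappa> * h + E * h powr (4 / 3) + C * h\<^sup>2 + \<rho> * q)) + \<kappa> * C * h\<^sup>2 \<le> 1"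
            using sm by simp_all
        next
          fix t assume t: "t \<in> {0..T}"
          have "hbound (4 + s) (M + M) (diag (fc (u t)) (fc (ut t)))"
            by (rule hbound_diag[OF _ V4[OF t]]) (use U5[OF t] in \<open>simp add: add.commute add.left_commute\<close>)
          from tail_bounds(1)[OF K _ this, of 1]
          have "hbound 1 (real K powr (1 - (4 + s)) * (M + M)) (\<lambda>j. diag (fc (u t)) (fc (ut t)) j - cutoff (low K) (diag (fc (u t)) (fc (ut t))) j)"
            using assms(5) by simp
          then show "hbound 1 (2 * M * q) (\<lambda>j. diag (fc (u t)) (fc (ut t)) j - cutoff (low K) (diag (fc (u t)) (fc (ut t))) j)"
          proof (rule hbound_mono)
            have "real K powr (1 - (4 + s)) \<le> q" unfolding q_def using K0 by (intro powr_mono) auto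
            from mult_right_mono[OF this, of "2 * M"] M0
            show "real K powr (1 - (4 + s)) * (M + M) \<le> 2 * M * q" by (simp add: mult.commute)
          qed
        qed (use n sq L \<rho> q proj in \<open>simp_all add: TI2_fully_discrete_def\<close>)
        moreover have "2 * ((h\<^sup>2 + q) + 2 * M * q) \<le> ?C * h\<^sup>2 + ?C * q"
          using M0 by (simp add: algebra_simps)
        ultimately show ?case
          unfolding Let_def q_def[symmetric] by linarith
      qed
    qed
  qed
qed

end
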